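(* Let $m\in\mathbb{N}$, $\alpha\in[0,1]$, $V\in H_{+}^{-m\alpha}[0,1]$ and $R>0$. (1) Let $\alpha=1$. (a) There exists $\varepsilon>0$ such that for any $W\in H_{+}^{-m}[0,1]$ with $\|W-V\|_{H_{+}^{-m}[0,1]}\leq\varepsilon$ the eigenvalues of the operator $L_{m}(W)$ satisfy $$\lambda_{2n-1}(m,W),\ \lambda_{2n}(m,W)=(2n-1)^{2m}\pi^{2m}+O(n^{m}),\quad n\to\infty,$$ uniformly in $W$. (b) For any $W\in H_{+}^{-m}[0,1]$ with $\|W-V\|_{H_{+}^{m}[0,1]}\leq R$ the eigenvalues of the operator $L_{m}(W)$ satisfy $$\lambda_{2n-1}(m,W),\ \lambda_{2n}(m,W)=(2n-1)^{2m}\pi^{2m}+o(n^{m}),\quad n\to\infty,$$ uniformly in $W$. (2) Let $\alpha\in[1/2,1)$ and let $\varepsilon>0$ be arbitrary. For any $V\in H_{+}^{-m\alpha}[0,1]$ with $\|V\|_{H_{+}^{-m\alpha}[0,1]}\leq R$ the eigenvalues of the operator $L_{m}(V)$ satisfy $$\lambda_{2n-1}(m,V),\ \lambda_{2n}(m,V)=(2n-1)^{2m}\pi^{2m}+\widehat{V}(0)\pm\sqrt{\widehat{V}(-2(2n-1))\,\widehat{V}(2(2n-1))}+h^{m(1-2\alpha)-\varepsilon}(n),$$ uniformly in $V$. (3) Let $\alpha\in[0,1/2)$. For any $V\in H_{+}^{-m\alpha}[0,1]$ with $\|V\|_{H_{+}^{-m\alpha}[0,1]}\leq R$ the eigenvalues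 of the operator $L_{m}(V)$ satisfy $$\lambda_{2n-1}(m,V),\ \lambda_{2n}(m,V)=(2n-1)^{2m}\pi^{2m}+\widehat{V}(0)\pm\sqrt{\widehat{V}(-2(2n-1))\,\widehat{V}(2(2n-1))}+h^{m(1/2-\alpha)}(n),$$ uniformly in $V$.
   Context: Notation: $\langle k\rangle:=1+|k|$. For $s\in\mathbb{R}$, $H_{+}^{s}[0,1]$ is the complex Sobolev space of 1-periodic functions/distributions $f=\sum_{k\in\mathbb{Z}}\widehat{f}(2k)e^{i2k\pi x}$ with $\|f\|_{H_{+}^{s}[0,1]}:=\left(\sum_{k\in\mathbb{Z}}\langle 2k\rangle^{2s}|\widehat{f}(2k)|^{2}\right)^{1/2}<\infty$, and $H_{-}^{s}[0,1]$ is the space of semi-periodic functions/distributions $f=\sum_{k\in\mathbb{Z}}\widehat{f}(2k+1)e^{i(2k+1)\pi x}$ with $\|f\|_{H_{-}^{s}[0,1]}:=\left(\sum_{k\in\mathbb{Z}}\langle 2k+1\rangle^{2s}|\widehat{f}(2k+1)|^{2}\right)^{1/2}<\infty$. Operator: for $V\in H_{+}^{-m}[0,1]$ (in particular for $V\in H_{+}^{-m\alpha}[0,1]$, $\alpha\in[0,1]$), $L_{m}(V)$ is the unbounded operator $u\mapsto D^{2m}u+Vu$, $D=-i\,d/dx$, in the Hilbert space $H_{-}^{-m}[0,1]$ with domain $H_{-}^{m}[0,1]$; that is, for odd $k$, $\widehat{(L_m(V)u)}(k)=k^{2m}\pi^{2m}\widehat{u}(k)+\sum_{j\ \mathrm{odd}}\widehat{V}(k-j)\widehat{u}(j)$.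 Its spectrum is discrete and consists of a sequence of eigenvalues $(\lambda_{k}(m,V))_{k\geq1}$, counted with algebraic multiplicity and ordered lexicographically: $\mathrm{Re}\,\lambda_{k}<\mathrm{Re}\,\lambda_{k+1}$, or $\mathrm{Re}\,\lambda_{k}=\mathrm{Re}\,\lambda_{k+1}$ and $\mathrm{Im}\,\lambda_{k}\leq\mathrm{Im}\,\lambda_{k+1}$. Error notation: $h^{s}$ is the Hilbert space of complex sequences $(a(k))_{k\in\mathbb{Z}}$ with norm $\|a\|_{h^{s}}=\left(\sum_{k}\langle k\rangle^{2s}|a(k)|^{2}\right)^{1/2}$, and $h^{s}(n)$ stands for the $n$-th element of some sequence in $h^{s}$ (sequences indexed by $n\geq1$ are extended by $0$). The formulae with $\pm$ mean that for each $n$, for a suitable choice of the square root, $\lambda_{2n-1}$ is given by the formula with the sign $-$ and $\lambda_{2n}$ by the formula with the sign $+$, each with its own error sequence. "Uniformly" means: in (1), that the constant (resp. rate) in $O$ (resp. $o$) is the same for all the $W$ considered; in (2) and (3), that the $h^{s}$-norm of the error sequences is bounded by a constant independent of $V$ in the ball of radius $R$. *)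

theory Defs
  imports "HOL-Analysis.Analysis" "HOL-Library.Function_Algebras"
begin

text \<open>
  A periodic or semi-periodic distribution on [0,1] is represented by its family of Fourier
  coefficients with respect to the exponentials \<open>exp (i k \<pi> x)\<close>, where k is an integer: the
  1-periodic ones are supported on the even k, the semi-periodic ones on the odd k.
  Sums and differences of families are pointwise (\<^theory>\<open>HOL-Library.Function_Algebras\<close>).
\<close>

definition bracket :: "int \<Rightarrow> real" where
  "bracket k = 1 + \<bar>real_of_int k\<bar>"

definition hs :: "real \<Rightarrow> (int \<Rightarrow> complex) set" where
  "hs s = {a. (\<lambda>k. bracket k powr (2 * s) * (cmod (a k))\<^sup>2) summable_on UNIV}"

definition hs_norm :: "real \<Rightarrow> (int \<Rightarrow> complex) \<Rightarrow> real" where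
  "hs_norm s a = sqrt (\<Sum>\<^sub>\<infinity>k. bracket k powr (2 * s) * (cmod (a k))\<^sup>2)"

text \<open>
  On families supported on the even (odd) integers, \<^const>\<open>hs_norm\<close> is the Sobolev norm of
  \<open>H_plus\<close> (\<open>H_minus\<close>). Outside \<open>hs s\<close> it has the junk value 0, so bounds on it are only
  meaningful together with membership.
\<close>

definition H_plus :: "real \<Rightarrow> (int \<Rightarrow> complex) set" where
  "H_plus s = {f \<in> hs s. \<forall>k. odd k \<longrightarrow> f k = 0}"

definition H_minus :: "real \<Rightarrow> (int \<Rightarrow> complex) set" where
  "H_minus s = {f \<in> hs s. \<forall>k. even k \<longrightarrow> f k = 0}"

text \<open>
  The action of \<open>D^(2m) + V\<close> on Fourier coefficients. As an unbounded operator in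
  \<open>H_minus (- m)\<close> it has domain \<open>H_minus m\<close>; the domain is imposed in \<open>ker_pow\<close> below.
\<close>

definition L_op :: "nat \<Rightarrow> (int \<Rightarrow> complex) \<Rightarrow> (int \<Rightarrow> complex) \<Rightarrow> (int \<Rightarrow> complex)" where
  "L_op m V u = (\<lambda>k. if odd k
     then of_int k ^ (2 * m) * of_real pi ^ (2 * m) * u k
          + (\<Sum>\<^sub>\<infinity>j\<in>{j. odd j}. V (k - j) * u j)
     else 0)"

interpretation coeffs: vector_space "\<lambda>(c::complex) (f::int \<Rightarrow> complex) k. c * f k"
  by unfold_locales (auto simp: fun_eq_iff algebra_simps)

text \<open>
  \<open>ker_pow m V \<mu> n\<close> is the kernel of the n-th power of \<open>L_op m V - \<mu>\<close>, on the natural domain of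
  that power.
\<close>

primrec ker_pow :: "nat \<Rightarrow> (int \<Rightarrow> complex) \<Rightarrow> complex \<Rightarrow> nat \<Rightarrow> (int \<Rightarrow> complex) set" where
  "ker_pow m V \<mu> 0 = {0}"
| "ker_pow m V \<mu> (Suc n) =
     {u \<in> H_minus (real m). (\<lambda>k. L_op m V u k - \<mu> * u k) \<in> ker_pow m V \<mu> n}"

definition root_space :: "nat \<Rightarrow> (int \<Rightarrow> complex) \<Rightarrow> complex \<Rightarrow> (int \<Rightarrow> complex) set" where
  "root_space m V \<mu> = (\<Union>n. ker_pow m V \<mu> n)"

definition lex_le :: "complex \<Rightarrow> complex \<Rightarrow> bool" where
  "lex_le z w \<longleftrightarrow> Re z < Re w \<or> (Re z = Re w \<and> Im z \<le> Im w)"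

text \<open>
  \<open>lam 1, lam 2, \<dots>\<close> lists the eigenvalues in lexicographic order, each repeated according to its
  algebraic multiplicity, the complex dimension of the root space. Finiteness is stated
  separately because \<open>card\<close> and \<open>dim\<close> are 0 in the infinite case. The value \<open>lam 0\<close> is irrelevant.
\<close>

definition eigenvalue_sequence :: "nat \<Rightarrow> (int \<Rightarrow> complex) \<Rightarrow> (nat \<Rightarrow> complex) \<Rightarrow> bool" where
  "eigenvalue_sequence m V lam \<longleftrightarrow>
     (\<forall>k\<ge>1. lex_le (lam k) (lam (Suc k))) \<and>
     (\<forall>\<mu>. (\<exists>B. finite B \<and> root_space m V \<mu> \<subseteq> coeffs.span B) \<and>
          finite {k. k \<ge> 1 \<and> lam k = \<mu>} \<and>
          card {k. k \<ge> 1 \<and> lam k = \<mu>} = coeffs.dim (root_space m V \<mu>))"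

text \<open>
  An eigenvalue sequence is determined at all indices \<open>k \<ge> 1\<close>, so the choice is immaterial there;
  its existence is implicit in any non-trivial assertion about \<open>eigval\<close>.
\<close>

definition eigval :: "nat \<Rightarrow> (int \<Rightarrow> complex) \<Rightarrow> nat \<Rightarrow> complex" where
  "eigval m V = (SOME lam. eigenvalue_sequence m V lam)"

definition unperturbed :: "nat \<Rightarrow> nat \<Rightarrow> complex" where
  "unperturbed m n = of_real ((2 * real n - 1) ^ (2 * m) * pi ^ (2 * m))"

text \<open>
  The asymptotic formula with \<open>\<plusminus>\<close> and errors of \<open>hs s\<close>-norm at most C: \<open>r n\<close> is the chosen square
  root, \<open>a\<close> and \<open>b\<close> are the error sequences for the signs \<open>-\<close> and \<open>+\<close>, extended by 0 to the
  nonpositive integers.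
\<close>

definition pm_formula :: "nat \<Rightarrow> (int \<Rightarrow> complex) \<Rightarrow> real \<Rightarrow> real \<Rightarrow> bool" where
  "pm_formula m V s C \<longleftrightarrow>
     (\<exists>(r :: nat \<Rightarrow> complex) a b.
        a \<in> hs s \<and> hs_norm s a \<le> C \<and> (\<forall>k\<le>0. a k = 0) \<and>
        b \<in> hs s \<and> hs_norm s b \<le> C \<and> (\<forall>k\<le>0. b k = 0) \<and>
        (\<forall>n\<ge>1.
           (r n)\<^sup>2 = V (- 2 * (2 * int n - 1)) * V (2 * (2 * int n - 1)) \<and>
           eigval m V (2 * n - 1) = unperturbed m n + V 0 - r n + a (int n) \<and>
           eigval m V (2 * n) = unperturbed m n + V 0 + r n + b (int n)))"

end

theory Submission
  imports Defs "Jordan_Normal_Form.Jordan_Normal_Form_Existence" "Jordan_Normal_Form.Jordan_Normal_Form_Uniqueness"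
begin

text \<open>
  On Fourier coefficients the operator is the diagonal \<open>k\<^sup>2\<^sup>m \<pi>\<^sup>2\<^sup>m\<close> plus the matrix \<open>V (k - j)\<close>. After
  scaling with weights comparable to the gaps of the diagonal, this matrix has a small
  Hilbert-Schmidt norm when the weights are centred at a high frequency. A contraction argument for
  a Riccati equation then shows that the span of the low frequencies, and that of each pair
  \<open>{k, - k}\<close> of high odd frequencies, deforms to an invariant subspace, the graph of an operator on that
  span. All root vectors with eigenvalues near the block lie in the graph, so the Jordan normal form
  of the finite compressed matrix gives their multiplicities, and comparing real parts shows that the
  n-th pair of eigenvalues comes from the block \<open>{k, - k}\<close> with \<open>k = 2 n - 1\<close>. For this 2x2 block the
  diagonal entries are \<open>k\<^sup>2\<^sup>m \<pi>\<^sup>2\<^sup>m + V 0\<close> and the off-diagonal ones \<open>V (\<plusminus>2 k)\<close>, up to an explicit second order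
  sum and a third order remainder; the quadratic formula turns bounds on these into the asymptotics.
\<close>

text \<open>A potential in \<open>H_plus (- m)\<close> need not map \<open>H_minus m\<close> into
  the square summable sequences; it is controlled only as a form. This forces the division by square
  roots of the weights on both sides. The frequencies \<open>k\<close> and \<open>- k\<close> have
  the same unperturbed eigenvalue, so no gap separates them and a pair is the smallest block that
  can be split off. Its eigenvalues contain a square root, which is not Lipschitz: an error
  \<open>b\<close> in the off-diagonal entries enters the square of the eigenvalue error multiplied
  by the possibly large \<open>V (2 k)\<close> and \<open>V (- 2 k)\<close>. Therefore the
  off-diagonal second-order sums receive a bound of their own, and errors are estimated through
  their squares. For the most singular potentials the scaled matrix is of order
  \<open>t powr (1 - m)\<close>, which is no decay for \<open>m = 1\<close>; smallness then has to
  come from the tail of the coefficients, and the uniformity in (1) rests on controlling that tail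
  for all \<open>W\<close> at once. Multiplicities are obtained algebraically, without resolvents or
  contour integrals.\<close>

unbundle no vec_syntax
hide_const (open) Determinants.det Coset.order

section \<open>Square summable families\<close>

text \<open>A bound in place of a norm: it asserts membership and size at once, has no default value
  for families that are not square summable, and passes to limits. With pairs as indices it is a
  Hilbert-Schmidt bound.\<close>

definition l2_bounded :: "real \<Rightarrow> ('a \<Rightarrow> complex) \<Rightarrow> bool" where
  "l2_bounded C f \<longleftrightarrow> 0 \<le> C \<and> (\<forall>F. finite F \<longrightarrow> L2_set (\<lambda>x. cmod (f x)) F \<le> C)"

lemma l2_boundedI:
  "0 \<le> C \<Longrightarrow> (\<And>F. finite F \<Longrightarrow> (\<Sum>x\<in>F. (cmod (f x))\<^sup>2) \<le> C\<^sup>2) \<Longrightarrow> l2_bounded C f"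
  unfolding l2_bounded_def L2_set_def by (auto intro: real_le_lsqrt sum_nonneg)

lemma l2_boundedD:
  "l2_bounded C f \<Longrightarrow> finite F \<Longrightarrow> (\<Sum>x\<in>F. (cmod (f x))\<^sup>2) \<le> C\<^sup>2"
  unfolding l2_bounded_def L2_set_def
  by (metis real_sqrt_le_iff real_sqrt_unique)

lemma l2_bounded_nonneg: "l2_bounded C f \<Longrightarrow> 0 \<le> C"
  by (simp add: l2_bounded_def)

lemma l2_bounded_le: "l2_bounded C f \<Longrightarrow> C \<le> D \<Longrightarrow> l2_bounded D f"
  unfolding l2_bounded_def by force

lemma l2_bounded_mono:
  assumes "l2_bounded C g" "\<And>x. cmod (f x) \<le> cmod (g x)"
  shows "l2_bounded C f"
proof -
  have "L2_set (\<lambda>x. cmod (f x)) F \<le> C" if "finite F" for F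
    by (rule order_trans[OF L2_set_mono[of F _ "\<lambda>x. cmod (g x)"]]) (use assms that in \<open>auto simp: l2_bounded_def\<close>)
  thus ?thesis using assms by (auto simp: l2_bounded_def)
qed

lemma l2_bounded_pointwise: "l2_bounded C f \<Longrightarrow> cmod (f x) \<le> C"
  using member_le_L2_set[of "{x}" x "\<lambda>x. cmod (f x)"] unfolding l2_bounded_def
  by (meson finite.emptyI finite_insert insertI1 order_trans)

lemma l2_bounded_0 [simp]: "0 \<le> C \<Longrightarrow> l2_bounded C (\<lambda>x. 0)"
  by (rule l2_boundedI) auto

lemma l2_bounded_add:
  assumes "l2_bounded A f" "l2_bounded B g"
  shows "l2_bounded (A + B) (\<lambda>x. f x + g x)"
proof -
  have "L2_set (\<lambda>x. cmod (f x + g x)) F \<le> A + B" if "finite F" for F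
  proof -
    have "L2_set (\<lambda>x. cmod (f x + g x)) F \<le> L2_set (\<lambda>x. cmod (f x) + cmod (g x)) F"
      by (rule L2_set_mono) (auto simp: norm_triangle_ineq)
    also have "\<dots> \<le> L2_set (\<lambda>x. cmod (f x)) F + L2_set (\<lambda>x. cmod (g x)) F"
      by (rule L2_set_triangle_ineq)
    also have "\<dots> \<le> A + B" using assms that by (auto simp: l2_bounded_def intro: add_mono)
    finally show ?thesis .
  qed
  thus ?thesis using assms by (auto simp: l2_bounded_def)
qed

lemma l2_bounded_minus: "l2_bounded A f \<Longrightarrow> l2_bounded A (\<lambda>x. - f x)"
  by (erule l2_bounded_mono) simp

lemma l2_bounded_diff:
  "l2_bounded A f \<Longrightarrow> l2_bounded B g \<Longrightarrow> l2_bounded (A + B) (\<lambda>x. f x - g x)"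
  using l2_bounded_add[OF _ l2_bounded_minus, of A f B g] by simp

lemma l2_bounded_cmult:
  assumes "l2_bounded A f"
  shows "l2_bounded (cmod c * A) (\<lambda>x. c * f x)"
  using assms unfolding l2_bounded_def
  by (auto simp: norm_mult L2_set_right_distrib[symmetric] intro: mult_left_mono)

lemma l2_bounded_reindex:
  assumes "l2_bounded A f" "inj h"
  shows "l2_bounded A (\<lambda>x. f (h x))"
proof (rule l2_boundedI)
  fix F :: "'b set" assume F: "finite F"
  have "(\<Sum>x\<in>F. (cmod (f (h x)))\<^sup>2) = (\<Sum>x\<in>h`F. (cmod (f x))\<^sup>2)"
    by (rule sum.reindex_cong[symmetric, of h]) (use assms(2) in \<open>auto intro: inj_on_subset\<close>)
  thus "(\<Sum>x\<in>F. (cmod (f (h x)))\<^sup>2) \<le> A\<^sup>2" using l2_boundedD[OF assms(1), of "h`F"] F by simp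
qed (use assms in \<open>auto simp: l2_bounded_def\<close>)

text \<open>Iterating \<open>step\<close> from one finite bound gives the bounds
  \<open>\<rho> ^ n * B\<close>, which tend to 0. The uniqueness arguments below know only that some
  bound exists, and this is the form they can use.\<close>

lemma l2_bounded_contract_zero:
  assumes "l2_bounded B f" and step: "\<And>C. l2_bounded C f \<Longrightarrow> l2_bounded (\<rho> * C) f"
    and "0 \<le> \<rho>" "\<rho> < 1"
  shows "f x = 0"
proof -
  have *: "l2_bounded (\<rho> ^ n * B) f" for n
    by (induction n) (use assms(1) step in \<open>auto simp: mult.assoc\<close>)
  have "(\<lambda>n. \<rho> ^ n * B) \<longlonglongrightarrow> 0 * B"
    by (intro tendsto_mult LIMSEQ_realpow_zero tendsto_const assms)
  from tendsto_lowerbound[OF this, of "cmod (f x)"] l2_bounded_pointwise[OF *]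
  show ?thesis by simp
qed

section \<open>Products: Cauchy-Schwarz and Hilbert-Schmidt matrices\<close>

lemma l2_bounded_cauchy_schwarz:
  assumes "l2_bounded A f" "l2_bounded B g"
  shows "(\<lambda>x. cmod (f x * g x)) summable_on UNIV"
    and "(\<Sum>\<^sub>\<infinity>x. cmod (f x * g x)) \<le> A * B"
    and "cmod (\<Sum>\<^sub>\<infinity>x. f x * g x) \<le> A * B"
proof -
  have *: "(\<Sum>x\<in>F. cmod (f x * g x)) \<le> A * B" if "finite F" for F
  proof -
    have "(\<Sum>x\<in>F. cmod (f x * g x)) = (\<Sum>x\<in>F. \<bar>cmod (f x)\<bar> * \<bar>cmod (g x)\<bar>)"
      by (simp add: norm_mult)
    also have "\<dots> \<le> L2_set (\<lambda>x. cmod (f x)) F * L2_set (\<lambda>x. cmod (g x)) F"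
      by (rule L2_set_mult_ineq)
    also have "\<dots> \<le> A * B" using assms that by (intro mult_mono) (auto simp: l2_bounded_def)
    finally show ?thesis .
  qed
  show 1: "(\<lambda>x. cmod (f x * g x)) summable_on UNIV"
    by (rule nonneg_bdd_above_summable_on) (auto intro!: bdd_aboveI[of _ "A * B"] *)
  show 2: "(\<Sum>\<^sub>\<infinity>x. cmod (f x * g x)) \<le> A * B"
    by (rule infsum_le_finite_sums[OF 1]) (use * in auto)
  show "cmod (\<Sum>\<^sub>\<infinity>x. f x * g x) \<le> A * B"
    using norm_infsum_bound[OF 1] 2 by simp
qed

text \<open>Every finite partial sum is continuous under pointwise convergence. The filter is
  arbitrary because limits are taken along sequences and also along the finite subsets of an index
  set.\<close>

lemma l2_bounded_limit:
  fixes g :: "'a \<Rightarrow> complex"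
  assumes "\<And>x. ((\<lambda>n. f n x) \<longlongrightarrow> g x) net" "net \<noteq> bot" "0 \<le> C"
    and "\<forall>\<^sub>F n in net. l2_bounded C (f n)"
  shows "l2_bounded C g"
proof (rule l2_boundedI)
  fix F :: "'a set" assume F: "finite F"
  have "((\<lambda>n. \<Sum>x\<in>F. (cmod (f n x))\<^sup>2) \<longlongrightarrow> (\<Sum>x\<in>F. (cmod (g x))\<^sup>2)) net"
    by (intro tendsto_sum tendsto_power tendsto_norm assms)
  moreover have "\<forall>\<^sub>F n in net. (\<Sum>x\<in>F. (cmod (f n x))\<^sup>2) \<le> C\<^sup>2"
    using assms(4) by eventually_elim (rule l2_boundedD[OF _ F])
  ultimately show "(\<Sum>x\<in>F. (cmod (g x))\<^sup>2) \<le> C\<^sup>2"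
    using tendsto_upperbound assms(2) by blast
qed fact

lemma l2_bounded_section:
  assumes "l2_bounded A (\<lambda>(i, j). K i j)"
  shows "l2_bounded A (\<lambda>j. K i j)" "l2_bounded A (\<lambda>i. K i j)"
  using l2_bounded_reindex[OF assms, of "\<lambda>j. (i, j)"] l2_bounded_reindex[OF assms, of "\<lambda>i. (i, j)"]
  by (auto simp: inj_on_def)

text \<open>Cauchy-Schwarz bounds each entry by a row norm times a column norm, and the squares
  factor when summed over rows and columns. The middle index is kept in a finite set, which
  \<open>l2_bounded_limit\<close> then exhausts.\<close>

lemma l2_bounded_matmul:
  fixes K :: "'a \<Rightarrow> 'b \<Rightarrow> complex" and Y :: "'b \<Rightarrow> 'c \<Rightarrow> complex"
  assumes K: "l2_bounded A (\<lambda>(i, j). K i j)" and Y: "l2_bounded B (\<lambda>(j, k). Y j k)"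
  shows "l2_bounded (A * B) (\<lambda>(i, k). \<Sum>\<^sub>\<infinity>j. K i j * Y j k)"
proof (rule l2_bounded_limit[where net = "finite_subsets_at_top UNIV"
      and f = "\<lambda>G (i, k). \<Sum>j\<in>G. K i j * Y j k"])
  have nn: "0 \<le> A" "0 \<le> B" using K Y by (auto simp: l2_bounded_def)
  show "0 \<le> A * B" using nn by simp
  show "finite_subsets_at_top (UNIV :: 'b set) \<noteq> bot" by simp
  fix p :: "'a \<times> 'c"
  obtain i k where p: "p = (i, k)" by fastforce
  have "(\<lambda>j. cmod (K i j * Y j k)) summable_on UNIV"
    using l2_bounded_cauchy_schwarz(1)[OF l2_bounded_section(1)[OF K] l2_bounded_section(2)[OF Y]] .
  hence "(\<lambda>j. K i j * Y j k) summable_on UNIV" by (rule abs_summable_summable)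
  thus "((\<lambda>G. case p of (i, k) \<Rightarrow> \<Sum>j\<in>G. K i j * Y j k) \<longlongrightarrow>
      (case p of (i, k) \<Rightarrow> \<Sum>\<^sub>\<infinity>j. K i j * Y j k)) (finite_subsets_at_top UNIV)"
    unfolding p by (simp add: infsum_tendsto)
next
  have nn: "0 \<le> A" "0 \<le> B" using K Y by (auto simp: l2_bounded_def)
  have fin: "l2_bounded (A * B) (\<lambda>(i, k). \<Sum>j\<in>G. K i j * Y j k)" if G: "finite G" for G
  proof (rule l2_boundedI)
    fix F :: "('a \<times> 'c) set" assume F: "finite F"
    define F1 F3 where "F1 = fst ` F" and "F3 = snd ` F"
    have sub: "F \<subseteq> F1 \<times> F3" and fin: "finite F1" "finite F3"
      using F by (force simp: F1_def F3_def)+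
    have cs: "(cmod (\<Sum>j\<in>G. K i j * Y j k))\<^sup>2
        \<le> (\<Sum>j\<in>G. (cmod (K i j))\<^sup>2) * (\<Sum>j\<in>G. (cmod (Y j k))\<^sup>2)" for i k
    proof -
      have "cmod (\<Sum>j\<in>G. K i j * Y j k) \<le> (\<Sum>j\<in>G. \<bar>cmod (K i j)\<bar> * \<bar>cmod (Y j k)\<bar>)"
        by (rule order_trans[OF norm_sum]) (simp add: norm_mult)
      also have "\<dots> \<le> L2_set (\<lambda>j. cmod (K i j)) G * L2_set (\<lambda>j. cmod (Y j k)) G"
        by (rule L2_set_mult_ineq)
      finally have "(cmod (\<Sum>j\<in>G. K i j * Y j k))\<^sup>2
          \<le> (L2_set (\<lambda>j. cmod (K i j)) G * L2_set (\<lambda>j. cmod (Y j k)) G)\<^sup>2"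
        by (rule power_mono) simp
      thus ?thesis by (simp add: power_mult_distrib L2_set_def sum_nonneg)
    qed
    have "(\<Sum>x\<in>F. (cmod (case x of (i, k) \<Rightarrow> \<Sum>j\<in>G. K i j * Y j k))\<^sup>2)
        \<le> (\<Sum>x\<in>F1 \<times> F3. (cmod (case x of (i, k) \<Rightarrow> \<Sum>j\<in>G. K i j * Y j k))\<^sup>2)"
      by (rule sum_mono2) (use sub fin in auto)
    also have "\<dots> = (\<Sum>i\<in>F1. \<Sum>k\<in>F3. (cmod (\<Sum>j\<in>G. K i j * Y j k))\<^sup>2)"
      by (simp add: sum.cartesian_product case_prod_unfold)
    also have "\<dots> \<le> (\<Sum>i\<in>F1. \<Sum>k\<in>F3. (\<Sum>j\<in>G. (cmod (K i j))\<^sup>2) * (\<Sum>j\<in>G. (cmod (Y j k))\<^sup>2))"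
      by (intro sum_mono cs)
    also have "\<dots> = (\<Sum>i\<in>F1. \<Sum>j\<in>G. (cmod (K i j))\<^sup>2) * (\<Sum>k\<in>F3. \<Sum>j\<in>G. (cmod (Y j k))\<^sup>2)"
      by (simp add: sum_product)
    also have "(\<Sum>k\<in>F3. \<Sum>j\<in>G. (cmod (Y j k))\<^sup>2) = (\<Sum>j\<in>G. \<Sum>k\<in>F3. (cmod (Y j k))\<^sup>2)"
      by (rule sum.swap)
    also have "(\<Sum>i\<in>F1. \<Sum>j\<in>G. (cmod (K i j))\<^sup>2) * (\<Sum>j\<in>G. \<Sum>k\<in>F3. (cmod (Y j k))\<^sup>2) \<le> A\<^sup>2 * B\<^sup>2"
      using l2_boundedD[OF K, of "F1 \<times> G"] l2_boundedD[OF Y, of "G \<times> F3"] fin G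
      by (intro mult_mono) (auto simp: sum.cartesian_product case_prod_unfold sum_nonneg)
    finally show "(\<Sum>x\<in>F. (cmod (case x of (i, k) \<Rightarrow> \<Sum>j\<in>G. K i j * Y j k))\<^sup>2) \<le> (A * B)\<^sup>2"
      by (simp add: power_mult_distrib)
  qed (use nn in simp)
  show "\<forall>\<^sub>F G in finite_subsets_at_top UNIV. l2_bounded (A * B) (\<lambda>(i, k). \<Sum>j\<in>G. K i j * Y j k)"
    by (rule eventually_finite_subsets_at_top_weakI) (rule fin)
qed

text \<open>A vector is a matrix with a single column, indexed by \<open>unit\<close>.\<close>

lemma l2_bounded_matvec:
  fixes K :: "'a \<Rightarrow> 'b \<Rightarrow> complex"
  assumes K: "l2_bounded A (\<lambda>(i, j). K i j)" and u: "l2_bounded B u"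
  shows "l2_bounded (A * B) (\<lambda>i. \<Sum>\<^sub>\<infinity>j. K i j * u j)"
proof -
  have "l2_bounded B (\<lambda>(j, k::unit). u j)"
    using l2_bounded_reindex[OF u, of "fst :: 'b \<times> unit \<Rightarrow> 'b"] by (simp add: case_prod_unfold inj_on_def)
  from l2_bounded_reindex[OF l2_bounded_matmul[OF K this], of "\<lambda>i. (i, ())"] show ?thesis
    by (simp add: inj_on_def)
qed

section \<open>Completeness and fixed points\<close>

lemma l2_bounded_tail_limit:
  assumes "\<And>n. l2_bounded (D * (1/2) ^ n) (\<lambda>x. f (Suc n) x - f n x)"
  obtains g where "\<And>x. (\<lambda>n. f n x) \<longlonglongrightarrow> g x"
    and "\<And>n. l2_bounded (2 * D * (1/2) ^ n) (\<lambda>x. g x - f n x)"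
proof -
  have D: "0 \<le> D" using l2_bounded_nonneg[OF assms[of 0]] by simp
  have tail: "l2_bounded (2 * D * (1/2) ^ n) (\<lambda>x. f (n + j) x - f n x)" for n j
  proof -
    have "l2_bounded (2 * D * (1/2) ^ n * (1 - (1/2) ^ j)) (\<lambda>x. f (n + j) x - f n x)"
    proof (induction j)
      case (Suc j)
      have "D * (1/2) ^ (n + j) + 2 * D * (1/2) ^ n * (1 - (1/2) ^ j)
          = 2 * D * (1/2) ^ n * (1 - (1/2) ^ Suc j)"
        by (simp add: power_add algebra_simps)
      with l2_bounded_add[OF assms[of "n + j"] Suc] show ?case by simp
    qed simp
    thus ?thesis
      by (rule l2_bounded_le[OF _ mult_left_le]) (use D in auto)
  qed
  have "\<exists>l. (\<lambda>n. f n x) \<longlonglongrightarrow> l" for x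
  proof -
    have "summable (\<lambda>n. f (Suc n) x - f n x)"
      by (rule summable_comparison_test[of _ "\<lambda>n. D * (1/2) ^ n"])
        (use l2_bounded_pointwise[OF assms] in \<open>auto intro!: summable_mult summable_geometric\<close>)
    from summable_LIMSEQ[OF this] have "(\<lambda>n. f n x - f 0 x) \<longlonglongrightarrow> (\<Sum>n. f (Suc n) x - f n x)"
      by (simp add: sum_lessThan_telescope[of "\<lambda>n. f n x"])
    from tendsto_add[OF this tendsto_const[of "f 0 x"]] show ?thesis by auto
  qed
  then obtain g where g: "\<And>x. (\<lambda>n. f n x) \<longlonglongrightarrow> g x" by metis
  have "l2_bounded (2 * D * (1/2) ^ n) (\<lambda>x. g x - f n x)" for n
  proof (rule l2_bounded_limit[where net = sequentially and f = "\<lambda>j x. f (n + j) x - f n x"])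
    show "(\<lambda>j. f (n + j) x - f n x) \<longlonglongrightarrow> g x - f n x" for x
      using LIMSEQ_ignore_initial_segment[OF g[of x], of n] by (intro tendsto_diff tendsto_const) (simp add: add.commute)
  qed (use D tail in auto)
  with g show ?thesis by (rule that)
qed

text \<open>Picard iteration from 0 in a closed ball. Quantifying over every bound \<open>d\<close>
  of the difference replaces a metric; the first increment has bound \<open>B\<close> because it
  equals the first iterate.\<close>

lemma l2_bounded_fixed_point:
  fixes \<Phi> :: "('a \<Rightarrow> complex) \<Rightarrow> 'a \<Rightarrow> complex"
  assumes "0 \<le> B" and ball: "\<And>Z. l2_bounded B Z \<Longrightarrow> l2_bounded B (\<Phi> Z)"
    and lip: "\<And>Z Z' d. l2_bounded B Z \<Longrightarrow> l2_bounded B Z' \<Longrightarrow> l2_bounded d (\<lambda>x. Z x - Z' x)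
      \<Longrightarrow> l2_bounded (d / 2) (\<lambda>x. \<Phi> Z x - \<Phi> Z' x)"
  obtains Z where "l2_bounded B Z" "\<Phi> Z = Z"
proof -
  define f where "f n = (\<Phi> ^^ n) (\<lambda>x. 0)" for n
  have fS: "f (Suc n) = \<Phi> (f n)" for n by (simp add: f_def)
  have fB: "l2_bounded B (f n)" for n
    by (induction n) (use assms(1) ball in \<open>auto simp: f_def\<close>)
  have "l2_bounded (B * (1/2) ^ n) (\<lambda>x. f (Suc n) x - f n x)" for n
  proof (induction n)
    case 0
    show ?case using fB[of 1] by (simp add: f_def)
  next
    case (Suc n)
    from lip[OF fB fB this] show ?case by (simp add: fS)
  qed
  then obtain g where g: "\<And>x. (\<lambda>n. f n x) \<longlonglongrightarrow> g x"
    and tail: "\<And>n. l2_bounded (2 * B * (1/2) ^ n) (\<lambda>x. g x - f n x)"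
    by (rule l2_bounded_tail_limit) auto
  have gB: "l2_bounded B g"
    by (rule l2_bounded_limit[OF g]) (use assms fB in auto)
  have "\<Phi> g x = g x" for x
  proof -
    have "l2_bounded (2 * B * (1/2) ^ n / 2) (\<lambda>x. \<Phi> g x - f (Suc n) x)" for n
      using lip[OF gB fB tail[of n]] by (simp add: fS)
    from l2_bounded_pointwise[OF this]
    have *: "cmod (\<Phi> g x - f (Suc n) x) \<le> 2 * B * (1/2) ^ n / 2" for n .
    have "(\<lambda>n. \<Phi> g x - f (Suc n) x) \<longlonglongrightarrow> 0"
    proof (rule Lim_null_comparison)
      show "(\<lambda>n. 2 * B * (1/2) ^ n / 2) \<longlonglongrightarrow> 0"
        by (auto intro!: tendsto_eq_intros LIMSEQ_realpow_zero)
    qed (use * in auto)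
    moreover have "(\<lambda>n. \<Phi> g x - f (Suc n) x) \<longlonglongrightarrow> \<Phi> g x - g x"
      by (intro tendsto_diff tendsto_const LIMSEQ_Suc g)
    ultimately show ?thesis using LIMSEQ_unique by fastforce
  qed
  with gB show ?thesis by (intro that[of g]) auto
qed

section \<open>Invariant graphs of block operators\<close>

lemma infsum_diff_l2:
  assumes "l2_bounded A f" "l2_bounded B g" "l2_bounded C h"
  shows "(\<Sum>\<^sub>\<infinity>x. f x * g x) - (\<Sum>\<^sub>\<infinity>x. f x * h x) = (\<Sum>\<^sub>\<infinity>x. f x * (g x - h x))"
proof -
  have "(\<lambda>x. f x * g x) summable_on UNIV" "(\<lambda>x. f x * h x) summable_on UNIV"
    using l2_bounded_cauchy_schwarz(1)[OF assms(1,2)] l2_bounded_cauchy_schwarz(1)[OF assms(1,3)]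
    by (auto intro: abs_summable_summable)
  thus ?thesis
    using infsum_add[of "\<lambda>x. f x * g x" UNIV "\<lambda>x. - (f x * h x)"]
    by (simp add: infsum_uminus summable_on_uminus algebra_simps)
qed

text \<open>
  \<open>K\<close> is the perturbation of the diagonal operator \<open>lam\<close> after division by the weights \<open>w\<close> on both
  sides. The graph of \<open>X\<close> over the coordinates in \<open>J\<close> is invariant if and only if \<open>X\<close> solves a Riccati
  equation, and \<open>riccati\<close> is that equation for \<open>Z (i, j) = X i j * (lam i - lam j) / (w i * w j)\<close>, where the
  gap hypothesis makes the multipliers \<open>c1\<close> and \<open>c2\<close> bounded by 1.
\<close>

locale block_splitting =
  fixes I J :: "'a set" and lam :: "'a \<Rightarrow> complex" and w :: "'a \<Rightarrow> real"
    and K :: "'a \<Rightarrow> 'a \<Rightarrow> complex" and \<delta> \<tau> :: real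
  assumes fin_J: "finite J" and J_sub: "J \<subseteq> I" and w_pos: "\<And>i. 0 < w i"
    and K_supp: "\<And>i j. i \<notin> I \<or> j \<notin> I \<Longrightarrow> K i j = 0"
    and K_bound: "l2_bounded \<delta> (\<lambda>(i, j). K i j)" and \<delta>_small: "\<delta> \<le> 1 / 8"
    and gap: "\<And>i j. i \<in> I - J \<Longrightarrow> j \<in> J \<Longrightarrow>
      (w i)\<^sup>2 \<le> cmod (lam i - lam j) \<and> (w j)\<^sup>2 \<le> cmod (lam i - lam j)"
    and K_out_in: "l2_bounded \<tau> (\<lambda>(i, j). if i \<in> I - J \<and> j \<in> J then K i j else 0)"
    and K_in_out: "l2_bounded \<tau> (\<lambda>(i, j). if i \<in> J \<and> j \<in> I - J then K i j else 0)"
    and \<tau>_le: "\<tau> \<le> \<delta>"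
begin

section \<open>The Riccati equation as a contraction\<close>

definition c1 :: "'a \<Rightarrow> 'a \<Rightarrow> complex" where
  "c1 i j = (if i \<in> I - J \<and> j \<in> J then of_real ((w i)\<^sup>2) / (lam i - lam j) else 0)"

definition c2 :: "'a \<Rightarrow> 'a \<Rightarrow> complex" where
  "c2 i j = (if i \<in> I - J \<and> j \<in> J then of_real ((w j)\<^sup>2) / (lam i - lam j) else 0)"

text \<open>The perturbation applied to the graph vector over \<open>j\<close> has the value
  \<open>w i * w j * N Z i j\<close> in the coordinate \<open>i\<close> (see
  \<open>op_U_sum\<close>); \<open>N\<close> is the perturbation along the graph with the weights
  divided out.\<close>

definition N :: "('a \<times> 'a \<Rightarrow> complex) \<Rightarrow> 'a \<Rightarrow> 'a \<Rightarrow> complex" where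
  "N Z i j = K i j + (\<Sum>\<^sub>\<infinity>k. K i k * (c1 k j * Z (k, j)))"

definition riccati :: "('a \<times> 'a \<Rightarrow> complex) \<Rightarrow> 'a \<times> 'a \<Rightarrow> complex" where
  "riccati Z = (\<lambda>(i, j). if i \<in> I - J \<and> j \<in> J
     then - N Z i j + (\<Sum>\<^sub>\<infinity>k. (c2 i k * Z (i, k)) * N Z k j) else 0)"

lemma \<tau>_nonneg: "0 \<le> \<tau>" and \<delta>_nonneg: "0 \<le> \<delta>"
  using K_out_in K_bound by (auto simp: l2_bounded_def)

lemma lam_diff_pos: "i \<in> I - J \<Longrightarrow> j \<in> J \<Longrightarrow> 0 < cmod (lam i - lam j)"
  by (rule less_le_trans[OF _ conjunct1[OF gap]]) (use w_pos[of i] in auto)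

lemma c1_le: "cmod (c1 i j) \<le> 1" and c2_le: "cmod (c2 i j) \<le> 1"
  using gap[of i j] lam_diff_pos[of i j]
  by (auto simp: c1_def c2_def norm_divide norm_power divide_le_eq_1)

lemma c_mult_bound:
  assumes "l2_bounded B Z"
  shows "l2_bounded B (\<lambda>(i, j). c1 i j * Z (i, j))" "l2_bounded B (\<lambda>(i, j). c2 i j * Z (i, j))"
  by (rule l2_bounded_mono[OF assms]; auto simp: norm_mult intro!: mult_left_le_one_le c1_le c2_le)+

lemma KX_bound:
  "l2_bounded B Z \<Longrightarrow> l2_bounded (\<delta> * B) (\<lambda>(i, j). \<Sum>\<^sub>\<infinity>k. K i k * (c1 k j * Z (k, j)))"
  by (rule l2_bounded_matmul[OF K_bound c_mult_bound(1)])

lemma N_bound: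
  assumes "l2_bounded B Z"
  shows "l2_bounded (\<delta> + \<delta> * B) (\<lambda>(i, j). N Z i j)"
  using l2_bounded_add[OF K_bound KX_bound[OF assms]] by (simp add: N_def case_prod_unfold)

lemma N_diff_bound:
  assumes "l2_bounded B Z" "l2_bounded B' Z'" "l2_bounded d (\<lambda>x. Z x - Z' x)"
  shows "l2_bounded (\<delta> * d) (\<lambda>(i, j). N Z i j - N Z' i j)"
proof -
  have "N Z i j - N Z' i j = (\<Sum>\<^sub>\<infinity>k. K i k * (c1 k j * (Z (k, j) - Z' (k, j))))" for i j
    using infsum_diff_l2[OF l2_bounded_section(1)[OF K_bound]
        l2_bounded_section(2)[OF c_mult_bound(1)[OF assms(1)]]
        l2_bounded_section(2)[OF c_mult_bound(1)[OF assms(2)]], of i j]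
    by (simp add: N_def algebra_simps)
  thus ?thesis using KX_bound[OF assms(3)] by simp
qed

lemma XN_bound:
  assumes "l2_bounded B Z" "l2_bounded D (\<lambda>(i, j). P i j)"
  shows "l2_bounded (B * D) (\<lambda>(i, j). \<Sum>\<^sub>\<infinity>k. (c2 i k * Z (i, k)) * P k j)"
  by (rule l2_bounded_matmul[OF c_mult_bound(2)[OF assms(1)] assms(2)])

text \<open>On the coordinates that matter the Riccati equation reads
  \<open>Z = - K + remainder Z\<close>. Isolating the first-order term \<open>- K\<close> is what
  later exposes the second-order sum of perturbation theory.\<close>

definition remainder :: "('a \<times> 'a \<Rightarrow> complex) \<Rightarrow> 'a \<times> 'a \<Rightarrow> complex" where
  "remainder Z = (\<lambda>(i, j). - (\<Sum>\<^sub>\<infinity>k. K i k * (c1 k j * Z (k, j)))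
     + (\<Sum>\<^sub>\<infinity>k. (c2 i k * Z (i, k)) * N Z k j))"

lemma \<tau>_small: "\<tau> \<le> 1 / 8"
  using \<tau>_le \<delta>_small by simp

lemma remainder_bound:
  assumes "l2_bounded (2 * \<tau>) Z"
  shows "l2_bounded (5 * \<delta> * \<tau>) (remainder Z)"
proof (rule l2_bounded_le)
  show "l2_bounded (\<delta> * (2 * \<tau>) + 2 * \<tau> * (\<delta> + \<delta> * (2 * \<tau>))) (remainder Z)"
    using l2_bounded_add[OF l2_bounded_minus[OF KX_bound[OF assms]] XN_bound[OF assms N_bound[OF assms]]]
    by (simp add: remainder_def case_prod_unfold)
  \<comment> \<open>This makes the total at most \<open>(4 + 1/2) * \<delta> * \<tau>\<close>,
    rounded up to the constant 5.\<close>
  have "\<delta> * \<tau> * \<tau> \<le> \<delta> * \<tau> * (1 / 8)"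
    using \<tau>_nonneg \<delta>_nonneg \<tau>_small by (intro mult_left_mono) auto
  thus "\<delta> * (2 * \<tau>) + 2 * \<tau> * (\<delta> + \<delta> * (2 * \<tau>)) \<le> 5 * \<delta> * \<tau>"
    using mult_nonneg_nonneg[OF \<delta>_nonneg \<tau>_nonneg] by (simp add: algebra_simps)
qed

lemma riccati_eq:
  "riccati Z (i, j) = (if i \<in> I - J \<and> j \<in> J then - K i j + remainder Z (i, j) else 0)"
  by (simp add: riccati_def remainder_def N_def)

text \<open>The inhomogeneous term is only the coupling block of \<open>K\<close>, and everything
  else costs at most \<open>5/8 * \<tau>\<close>. The radius is thus a multiple of the coupling
  bound \<open>\<tau>\<close> and not of \<open>\<delta>\<close>; later estimates inherit their
  factor \<open>\<tau>\<^sup>2\<close> from this.\<close>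

lemma riccati_ball:
  assumes "l2_bounded (2 * \<tau>) Z"
  shows "l2_bounded (2 * \<tau>) (riccati Z)"
proof (rule l2_bounded_le)
  have "l2_bounded (5 * \<delta> * \<tau>) (\<lambda>(i, j). if i \<in> I - J \<and> j \<in> J then remainder Z (i, j) else 0)"
    by (rule l2_bounded_mono[OF remainder_bound[OF assms]]) auto
  from l2_bounded_add[OF l2_bounded_minus[OF K_out_in] this]
  show "l2_bounded (\<tau> + 5 * \<delta> * \<tau>) (riccati Z)"
    by (rule l2_bounded_mono) (auto simp: riccati_eq)
  show "\<tau> + 5 * \<delta> * \<tau> \<le> 2 * \<tau>"
    using mult_right_mono[OF \<delta>_small \<tau>_nonneg] \<tau>_nonneg by (simp add: algebra_simps)
qed

lemma riccati_lipschitz: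
  assumes Z: "l2_bounded (2 * \<tau>) Z" and Z': "l2_bounded (2 * \<tau>) Z'"
    and d: "l2_bounded d (\<lambda>x. Z x - Z' x)"
  shows "l2_bounded (d / 2) (\<lambda>x. riccati Z x - riccati Z' x)"
proof -
  let ?A = "\<lambda>(i, j). N Z i j - N Z' i j"
  let ?B = "\<lambda>(i, j). \<Sum>\<^sub>\<infinity>k. (c2 i k * (Z (i, k) - Z' (i, k))) * N Z k j"
  let ?C = "\<lambda>(i, j). \<Sum>\<^sub>\<infinity>k. (c2 i k * Z' (i, k)) * (N Z k j - N Z' k j)"
  have A: "l2_bounded (\<delta> * d) ?A" by (rule N_diff_bound[OF Z Z' d])
  have B: "l2_bounded (d * (\<delta> + \<delta> * (2 * \<tau>))) ?B" by (rule XN_bound[OF d N_bound[OF Z]])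
  have C: "l2_bounded (2 * \<tau> * (\<delta> * d)) ?C" by (rule XN_bound[OF Z' A])
  \<comment> \<open>The quadratic term is telescoped as
    \<open>(Z - Z') * N Z + Z' * (N Z - N Z')\<close>, so that each piece is linear in a
    difference.\<close>
  have split: "riccati Z (i, j) - riccati Z' (i, j)
      = (if i \<in> I - J \<and> j \<in> J then - ?A (i, j) + (?B (i, j) + ?C (i, j)) else 0)" for i j
  proof -
    note s = l2_bounded_section[OF c_mult_bound(2)[OF Z]] l2_bounded_section[OF c_mult_bound(2)[OF Z']]
      and n = l2_bounded_section[OF N_bound[OF Z]] l2_bounded_section[OF N_bound[OF Z']]
    have B': "(\<Sum>\<^sub>\<infinity>k. (c2 i k * Z (i, k)) * N Z k j) - (\<Sum>\<^sub>\<infinity>k. (c2 i k * Z' (i, k)) * N Z k j) = ?B (i, j)"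
      using infsum_diff_l2[OF n(2) s(1) s(3), of j i i] by (simp add: algebra_simps)
    have C': "(\<Sum>\<^sub>\<infinity>k. (c2 i k * Z' (i, k)) * N Z k j) - (\<Sum>\<^sub>\<infinity>k. (c2 i k * Z' (i, k)) * N Z' k j) = ?C (i, j)"
      using infsum_diff_l2[OF s(3) n(2) n(4), of i j j] by simp
    show ?thesis unfolding riccati_def using B' C' by (simp add: algebra_simps)
  qed
  have "l2_bounded (\<delta> * d + (d * (\<delta> + \<delta> * (2 * \<tau>)) + 2 * \<tau> * (\<delta> * d))) (\<lambda>x. riccati Z x - riccati Z' x)"
  proof (rule l2_bounded_mono[OF l2_bounded_add[OF l2_bounded_minus[OF A] l2_bounded_add[OF B C]]])
    fix x :: "'a \<times> 'a"
    obtain i j where x: "x = (i, j)" by fastforce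
    show "cmod (riccati Z x - riccati Z' x) \<le> cmod (- ?A x + (?B x + ?C x))"
      unfolding x split by (simp del: minus_diff_eq)
  qed
  moreover have "\<delta> * d + (d * (\<delta> + \<delta> * (2 * \<tau>)) + 2 * \<tau> * (\<delta> * d)) \<le> d / 2"
  proof -
    have "0 \<le> d" by (rule l2_bounded_nonneg[OF d])
    have 1: "\<delta> * d \<le> 1/8 * d" by (rule mult_right_mono) (use \<delta>_small \<open>0 \<le> d\<close> in auto)
    have 2: "\<tau> * (\<delta> * d) \<le> 1/8 * (1/8 * d)"
      by (rule mult_mono) (use 1 \<tau>_small \<delta>_nonneg \<open>0 \<le> d\<close> in auto)
    show ?thesis using 1 2 \<open>0 \<le> d\<close> by (simp add: algebra_simps)
  qed
  ultimately show ?thesis by (rule l2_bounded_le)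
qed

definition Z :: "'a \<times> 'a \<Rightarrow> complex" where
  "Z = (SOME Z. l2_bounded (2 * \<tau>) Z \<and> riccati Z = Z)"

lemma Z_bound: "l2_bounded (2 * \<tau>) Z" and Z_riccati: "riccati Z = Z"
proof -
  have "\<exists>Z. l2_bounded (2 * \<tau>) Z \<and> riccati Z = Z"
    by (rule l2_bounded_fixed_point[of "2 * \<tau>" riccati])
      (use \<tau>_nonneg riccati_ball riccati_lipschitz in auto)
  from someI_ex[OF this] show "l2_bounded (2 * \<tau>) Z" "riccati Z = Z" by (auto simp: Z_def)
qed

lemma Z_eq: "Z (i, j) = (if i \<in> I - J \<and> j \<in> J then - K i j + remainder Z (i, j) else 0)"
  using riccati_eq[of Z i j] by (simp add: Z_riccati)

section \<open>The invariant graph\<close>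

definition X :: "'a \<Rightarrow> 'a \<Rightarrow> complex" where
  "X i j = (if i \<in> I - J \<and> j \<in> J then of_real (w i * w j) / (lam i - lam j) * Z (i, j) else 0)"

definition U :: "'a \<Rightarrow> 'a \<Rightarrow> complex" where
  "U j i = (if i = j then 1 else 0) + X i j"

text \<open>The matrix of the operator on the graph in the basis \<open>U j\<close>. Since
  \<open>U j\<close> is a unit vector on \<open>J\<close>, its entries are the
  \<open>J\<close>-coordinates of the operator applied to these vectors.\<close>

definition M :: "'a \<Rightarrow> 'a \<Rightarrow> complex" where
  "M i j = (if i = j then lam j else 0) + of_real (w i * w j) * N Z i j"

definition op :: "('a \<Rightarrow> complex) \<Rightarrow> 'a \<Rightarrow> complex" where
  "op u i = lam i * u i + of_real (w i) * (\<Sum>\<^sub>\<infinity>j. K i j * (of_real (w j) * u j))"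

definition dom :: "('a \<Rightarrow> complex) set" where
  "dom = {u. (\<forall>i. i \<notin> I \<longrightarrow> u i = 0) \<and> (\<exists>B. l2_bounded B (\<lambda>i. of_real (w i) * u i))}"

text \<open>No coefficients are quantified: the \<open>J\<close>-coordinates of \<open>U j\<close>
  form a unit vector, so the coefficient of \<open>U j\<close> in a graph vector \<open>g\<close>
  can only be \<open>g j\<close>.\<close>

definition in_graph :: "('a \<Rightarrow> complex) \<Rightarrow> bool" where
  "in_graph g \<longleftrightarrow> (\<forall>i. g i = (\<Sum>j\<in>J. g j * U j i))"

text \<open>The identities for which the two multipliers are made: a weight on one side of
  \<open>X\<close> turns into the weight of the other index times a bounded multiple of
  \<open>Z\<close>. Thus \<open>X\<close> itself never needs a norm estimate.\<close>

lemma wX: "of_real (w i) * X i j = of_real (w j) * (c1 i j * Z (i, j))"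
  and Xw: "X i j * of_real (w j) = of_real (w i) * (c2 i j * Z (i, j))"
  by (auto simp: X_def c1_def c2_def power2_eq_square)

lemma wU: "of_real (w i) * U j i = of_real (w j) * ((if i = j then 1 else 0) + c1 i j * Z (i, j))"
  using wX[of i j] by (auto simp: U_def distrib_left)

lemma U_J: "i \<in> J \<Longrightarrow> U j i = (if i = j then 1 else 0)"
  by (simp add: U_def X_def)

lemma U_outside: "i \<notin> I \<Longrightarrow> j \<in> J \<Longrightarrow> U j i = 0"
  using J_sub by (auto simp: U_def X_def)

lemma delta_bound: "l2_bounded 1 (\<lambda>i::'a. if i = j then 1 else 0)"
proof (rule l2_boundedI)
  fix F :: "'a set" assume "finite F"
  have "(\<Sum>i\<in>F. (cmod (if i = j then 1 else 0))\<^sup>2) = (\<Sum>i\<in>F. if i = j then 1 else 0)"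
    by (intro sum.cong) auto
  thus "(\<Sum>i\<in>F. (cmod (if i = j then 1 else 0))\<^sup>2) \<le> 1\<^sup>2" using \<open>finite F\<close> by simp
qed simp

lemma dom_bound_summable:
  assumes "u \<in> dom"
  shows "(\<lambda>j. K i j * (of_real (w j) * u j)) summable_on UNIV"
  using assms l2_bounded_cauchy_schwarz(1)[OF l2_bounded_section(1)[OF K_bound]]
  unfolding dom_def by (blast intro: abs_summable_summable)

lemma dom_lin: "u \<in> dom \<Longrightarrow> v \<in> dom \<Longrightarrow> (\<lambda>i. a * u i + b * v i) \<in> dom"
proof -
  assume u: "u \<in> dom" and v: "v \<in> dom"
  then obtain A B where AB: "l2_bounded A (\<lambda>i. of_real (w i) * u i)" "l2_bounded B (\<lambda>i. of_real (w i) * v i)"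
    by (auto simp: dom_def)
  show ?thesis using l2_bounded_add[OF l2_bounded_cmult[OF AB(1), of a] l2_bounded_cmult[OF AB(2), of b]] u v
    by (auto simp: dom_def algebra_simps)
qed

lemma op_lin:
  assumes "u \<in> dom" "v \<in> dom"
  shows "op (\<lambda>i. a * u i + b * v i) i = a * op u i + b * op v i"
proof -
  note s = dom_bound_summable[OF assms(1), of i] dom_bound_summable[OF assms(2), of i]
  have "(\<Sum>\<^sub>\<infinity>j. K i j * (of_real (w j) * (a * u j + b * v j)))
      = (\<Sum>\<^sub>\<infinity>j. a * (K i j * (of_real (w j) * u j)) + b * (K i j * (of_real (w j) * v j)))"
    by (simp add: algebra_simps)
  also have "\<dots> = a * (\<Sum>\<^sub>\<infinity>j. K i j * (of_real (w j) * u j)) + b * (\<Sum>\<^sub>\<infinity>j. K i j * (of_real (w j) * v j))"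
    using s by (subst infsum_add) (auto intro: summable_on_cmult_right simp: infsum_cmult_right)
  finally show ?thesis by (simp add: op_def algebra_simps)
qed

lemma zero_dom: "(\<lambda>i. 0) \<in> dom"
  by (auto simp: dom_def intro: exI[of _ 0])

lemma U_dom: "j \<in> J \<Longrightarrow> U j \<in> dom"
proof -
  assume j: "j \<in> J"
  have "l2_bounded (cmod (of_real (w j)) * (1 + 2 * \<tau>)) (\<lambda>i. of_real (w j) * ((if i = j then 1 else 0) + c1 i j * Z (i, j)))"
    by (intro l2_bounded_cmult l2_bounded_add delta_bound l2_bounded_section(2)[OF c_mult_bound(1)[OF Z_bound]])
  thus ?thesis using U_outside[OF _ j] unfolding dom_def wU[symmetric] by blast
qed

lemma op_U_sum: "(\<Sum>\<^sub>\<infinity>k. K i k * (of_real (w k) * U j k)) = of_real (w j) * N Z i j"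
proof -
  let ?f = "\<lambda>k. K i k * (if k = j then 1 else 0)" and ?g = "\<lambda>k. K i k * (c1 k j * Z (k, j))"
  have g: "?g summable_on UNIV"
    using l2_bounded_cauchy_schwarz(1)[OF l2_bounded_section(1)[OF K_bound]
        l2_bounded_section(2)[OF c_mult_bound(1)[OF Z_bound]]] by (rule abs_summable_summable)
  have f: "(?f has_sum K i j) UNIV"
    by (rule has_sum_finite_neutralI[of "{j}"]) auto
  have "(\<Sum>\<^sub>\<infinity>k. K i k * (of_real (w k) * U j k)) = (\<Sum>\<^sub>\<infinity>k. of_real (w j) * (?f k + ?g k))"
    unfolding wU by (simp add: algebra_simps)
  also have "\<dots> = of_real (w j) * (\<Sum>\<^sub>\<infinity>k. ?f k + ?g k)" by (simp add: infsum_cmult_right')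
  also have "(\<Sum>\<^sub>\<infinity>k. ?f k + ?g k) = N Z i j"
    using f g infsumI[OF f] by (subst infsum_add) (auto simp: N_def has_sum_imp_summable)
  finally show ?thesis .
qed

lemma N_outside: "i \<notin> I \<Longrightarrow> N Z i j = 0"
  by (simp add: N_def K_supp)

lemma infsum_eq_sum_J:
  fixes f :: "'a \<Rightarrow> complex"
  assumes "\<And>k. k \<notin> J \<Longrightarrow> f k = 0"
  shows "(\<Sum>\<^sub>\<infinity>k. f k) = (\<Sum>k\<in>J. f k)"
  by (rule infsumI, rule has_sum_finite_neutralI[of J]) (use fin_J assms in auto)

text \<open>Invariance of the graph. In the coordinates of \<open>J\<close> it is the definition of
  \<open>M\<close>; in the remaining ones it is the Riccati equation multiplied by
  \<open>w i * w j\<close>.\<close>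

lemma op_U:
  assumes j: "j \<in> J"
  shows "op (U j) i = (\<Sum>k\<in>J. M k j * U k i)"
proof -
  have op: "op (U j) i = lam i * U j i + of_real (w i * w j) * N Z i j"
    by (simp add: op_def op_U_sum)
  consider "i \<in> J" | "i \<in> I - J" | "i \<notin> I" by blast
  thus ?thesis
  proof cases
    case 1
    thus ?thesis using op fin_J by (simp add: U_J M_def if_distrib cong: if_cong)
  next
    case 2
    have "Z (i, j) = - N Z i j + (\<Sum>\<^sub>\<infinity>k. (c2 i k * Z (i, k)) * N Z k j)"
      using fun_cong[OF Z_riccati, of "(i, j)"] 2 j by (simp add: riccati_def)
    also have "(\<Sum>\<^sub>\<infinity>k. (c2 i k * Z (i, k)) * N Z k j) = (\<Sum>k\<in>J. (c2 i k * Z (i, k)) * N Z k j)"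
      by (rule infsum_eq_sum_J) (simp add: c2_def)
    finally have Z: "Z (i, j) = - N Z i j + (\<Sum>k\<in>J. (c2 i k * Z (i, k)) * N Z k j)" .
    have "(\<Sum>k\<in>J. M k j * U k i) = (\<Sum>k\<in>J. M k j * X i k)"
      using 2 by (intro sum.cong) (auto simp: U_def)
    also have "\<dots> = (\<Sum>k\<in>J. (if k = j then lam j * X i j else 0)
        + of_real (w i * w j) * ((c2 i k * Z (i, k)) * N Z k j))"
    proof (rule sum.cong)
      fix k assume "k \<in> J"
      have "M k j * X i k = (if k = j then lam j * X i j else 0)
          + of_real (w j) * N Z k j * (X i k * of_real (w k))"
        by (auto simp: M_def algebra_simps)
      thus "M k j * X i k = (if k = j then lam j * X i j else 0)
        + of_real (w i * w j) * ((c2 i k * Z (i, k)) * N Z k j)"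
        unfolding Xw by simp
    qed simp
    also have "\<dots> = lam j * X i j + of_real (w i * w j) * (\<Sum>k\<in>J. (c2 i k * Z (i, k)) * N Z k j)"
      using fin_J j by (simp add: sum.distrib sum_distrib_left)
    also have "\<dots> = lam j * X i j + of_real (w i * w j) * (Z (i, j) + N Z i j)"
      by (simp add: Z)
    also have "\<dots> = lam i * X i j + of_real (w i * w j) * N Z i j"
    proof -
      have "(lam i - lam j) * X i j = of_real (w i * w j) * Z (i, j)"
        using lam_diff_pos[OF 2 j] 2 j by (simp add: X_def)
      thus ?thesis by (simp add: algebra_simps)
    qed
    also have "\<dots> = op (U j) i" using 2 j by (auto simp: op U_def)
    finally show ?thesis ..
  next
    case 3
    thus ?thesis using j by (simp add: op U_outside N_outside)
  qed
qed

lemma graph_lin: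
  assumes "in_graph f" "in_graph g"
  shows "in_graph (\<lambda>i. a * f i + b * g i)"
  unfolding in_graph_def
proof
  fix i
  have "f i = (\<Sum>j\<in>J. f j * U j i)" "g i = (\<Sum>j\<in>J. g j * U j i)"
    using assms unfolding in_graph_def by blast+
  thus "a * f i + b * g i = (\<Sum>j\<in>J. (a * f j + b * g j) * U j i)"
    by (simp add: sum_distrib_left sum.distrib algebra_simps)
qed

lemma graph_comb: "in_graph (\<lambda>i. \<Sum>j\<in>J. c j * U j i)"
  unfolding in_graph_def using fin_J by (auto simp: U_J if_distrib cong: if_cong intro!: sum.cong)

lemma comb_dom_op:
  assumes "finite S" "S \<subseteq> J"
  shows "(\<lambda>i. \<Sum>j\<in>S. c j * U j i) \<in> dom \<and>
    (\<forall>i. op (\<lambda>i. \<Sum>j\<in>S. c j * U j i) i = (\<Sum>j\<in>S. c j * op (U j) i))"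
  using assms
proof (induction S rule: finite_induct)
  case empty
  show ?case by (simp add: zero_dom op_def)
next
  case (insert s S)
  hence IH: "(\<lambda>i. \<Sum>j\<in>S. c j * U j i) \<in> dom" 
    "\<And>i. op (\<lambda>i. \<Sum>j\<in>S. c j * U j i) i = (\<Sum>j\<in>S. c j * op (U j) i)" and s: "U s \<in> dom"
    using U_dom by auto
  show ?case using insert(1,2) dom_lin[OF s IH(1), of "c s" 1] op_lin[OF s IH(1), of "c s" 1] IH(2)
    by simp
qed

lemma graph_dom: "in_graph g \<Longrightarrow> g \<in> dom"
proof -
  assume "in_graph g"
  hence "g = (\<lambda>i. \<Sum>j\<in>J. g j * U j i)" unfolding in_graph_def by (intro ext) blast
  thus ?thesis using comb_dom_op[OF fin_J order_refl, of g] by simp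
qed

lemma op_comb:
  "op (\<lambda>i. \<Sum>j\<in>J. c j * U j i) i = (\<Sum>k\<in>J. (\<Sum>j\<in>J. M k j * c j) * U k i)"
proof -
  have "op (\<lambda>i. \<Sum>j\<in>J. c j * U j i) i = (\<Sum>j\<in>J. c j * (\<Sum>k\<in>J. M k j * U k i))"
    using comb_dom_op[OF fin_J order_refl, of c] op_U by simp
  also have "\<dots> = (\<Sum>k\<in>J. (\<Sum>j\<in>J. M k j * c j) * U k i)"
    by (simp add: sum_distrib_left sum_distrib_right mult_ac) (rule sum.swap)
  finally show ?thesis .
qed

lemma graph_op: "in_graph g \<Longrightarrow> in_graph (op g)"
proof -
  assume g: "in_graph g"
  hence "g = (\<lambda>i. \<Sum>j\<in>J. g j * U j i)" unfolding in_graph_def by (intro ext) blast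
  hence "op g = op (\<lambda>i. \<Sum>j\<in>J. g j * U j i)" by simp
  also have "\<dots> = (\<lambda>i. \<Sum>k\<in>J. (\<Sum>j\<in>J. M k j * g j) * U k i)" by (intro ext op_comb)
  finally show ?thesis using graph_comb by simp
qed

text \<open>
  Modulo the graph, the operator acts on the complementary coordinates as a small perturbation
  of the diagonal, which is why no second Riccati equation is needed.
\<close>

lemma graph_absorbs:
  assumes u: "u \<in> dom" and g: "in_graph (\<lambda>i. op u i - \<mu> * u i)"
    and \<mu>: "\<And>i. i \<in> I - J \<Longrightarrow> (w i)\<^sup>2 \<le> cmod (lam i - \<mu>)"
  shows "in_graph u"
proof -
  \<comment> \<open>\<open>p\<close> is the graph vector with the same \<open>J\<close>-coordinates
    as \<open>u\<close>, so \<open>y = u - p\<close> lives on the complement, and the claim becomes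
    \<open>y = 0\<close>.\<close>
  define p where "p = (\<lambda>i. \<Sum>j\<in>J. u j * U j i)"
  define y where "y = (\<lambda>i. 1 * u i + (-1) * p i)"
  define T where "T = (\<lambda>i. \<Sum>\<^sub>\<infinity>k. K i k * (of_real (w k) * y k))"
  have p: "in_graph p" "p \<in> dom" using graph_comb graph_dom by (auto simp: p_def)
  have y: "y \<in> dom" unfolding y_def by (rule dom_lin[OF u p(2)])
  have yJ: "y j = 0" if "j \<in> J" for j
    using that fin_J by (simp add: y_def p_def U_J if_distrib cong: if_cong)
  have "in_graph (\<lambda>i. 1 * (op u i - \<mu> * u i) + (-1) * (1 * op p i + (-\<mu>) * p i))"
    by (intro graph_lin g p graph_op)
  also have "(\<lambda>i. 1 * (op u i - \<mu> * u i) + (-1) * (1 * op p i + (-\<mu>) * p i)) = (\<lambda>i. op y i - \<mu> * y i)"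
    using op_lin[OF u p(2), of 1 "-1"] by (auto simp: y_def algebra_simps)
  finally have gy: "in_graph (\<lambda>i. op y i - \<mu> * y i)" .
  have opy: "op y i = lam i * y i + of_real (w i) * T i" for i by (simp add: op_def T_def)
  \<comment> \<open>\<open>op y - \<mu> * y\<close> is the graph vector determined by its
    \<open>J\<close>-coordinates, and these are \<open>w j * T j\<close> because \<open>y\<close>
    vanishes on \<open>J\<close>.\<close>
  have eq: "(lam i - \<mu>) * y i = of_real (w i) * (- T i + (\<Sum>j\<in>J. (c2 i j * Z (i, j)) * T j))" 
    if i: "i \<in> I - J" for i
  proof -
    have "op y i - \<mu> * y i = (\<Sum>j\<in>J. (op y j - \<mu> * y j) * U j i)"
      using gy unfolding in_graph_def by blast
    also have "\<dots> = (\<Sum>j\<in>J. T j * (X i j * of_real (w j)))"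
      using i by (intro sum.cong) (auto simp: opy yJ U_def)
    also have "\<dots> = of_real (w i) * (\<Sum>j\<in>J. (c2 i j * Z (i, j)) * T j)"
      unfolding Xw by (simp add: sum_distrib_left mult_ac)
    finally show ?thesis by (simp add: opy algebra_simps)
  qed
  obtain B where B: "l2_bounded B (\<lambda>i. of_real (w i) * y i)" using y by (auto simp: dom_def)
  have wy0: "of_real (w i) * y i = 0" for i
  proof (rule l2_bounded_contract_zero[OF B, of "1/2"])
    fix C assume C: "l2_bounded C (\<lambda>i. of_real (w i) * y i)"
    have T: "l2_bounded (\<delta> * C) T" unfolding T_def by (rule l2_bounded_matvec[OF K_bound C])
    have T2: "l2_bounded (2 * \<tau> * (\<delta> * C)) (\<lambda>i. \<Sum>\<^sub>\<infinity>j. (c2 i j * Z (i, j)) * T j)"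
      by (rule l2_bounded_matvec[OF c_mult_bound(2)[OF Z_bound] T])
    have "l2_bounded (\<delta> * C + 2 * \<tau> * (\<delta> * C)) (\<lambda>i. of_real (w i) * y i)"
    proof (rule l2_bounded_mono[OF l2_bounded_add[OF l2_bounded_minus[OF T] T2]])
      fix i
      let ?R = "- T i + (\<Sum>\<^sub>\<infinity>j. (c2 i j * Z (i, j)) * T j)"
      show "cmod (of_real (w i) * y i) \<le> cmod ?R"
      proof (cases "i \<in> I - J")
        case True
        have R: "?R = - T i + (\<Sum>j\<in>J. (c2 i j * Z (i, j)) * T j)"
          by (subst infsum_eq_sum_J) (auto simp: c2_def)
        have "w i * cmod (of_real (w i) * y i) = (w i)\<^sup>2 * cmod (y i)"
          using w_pos[of i] by (simp add: norm_mult power2_eq_square)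
        also have "\<dots> \<le> cmod (lam i - \<mu>) * cmod (y i)" by (rule mult_right_mono[OF \<mu>[OF True]]) simp
        also have "\<dots> = w i * cmod ?R"
          using arg_cong[OF eq[OF True], of cmod] w_pos[of i] by (simp only: R norm_mult) simp
        finally show ?thesis using w_pos[of i] by simp
      next
        case False
        hence "y i = 0" using yJ y by (cases "i \<in> J") (auto simp: dom_def)
        thus ?thesis by simp
      qed
    qed
    moreover have "\<delta> * C + 2 * \<tau> * (\<delta> * C) \<le> 1/2 * C"
    proof -
      have "0 \<le> C" by (rule l2_bounded_nonneg[OF C])
      have 1: "\<delta> * C \<le> 1/8 * C" by (rule mult_right_mono) (use \<delta>_small \<open>0 \<le> C\<close> in auto)
      have 2: "\<tau> * (\<delta> * C) \<le> 1/8 * (1/8 * C)"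
        by (rule mult_mono) (use 1 \<tau>_small \<delta>_nonneg \<open>0 \<le> C\<close> in auto)
      show ?thesis using 1 2 \<open>0 \<le> C\<close> by simp
    qed
    ultimately show "l2_bounded (1/2 * C) (\<lambda>i. of_real (w i) * y i)" by (rule l2_bounded_le)
  qed auto
  have "y i = 0" for i using wy0[of i] w_pos[of i] by auto
  hence "u = p" by (auto simp: y_def)
  thus ?thesis using p by simp
qed

text \<open>A Gershgorin argument. If \<mu> is at distance at least \<open>(w j)\<^sup>2 / 4\<close>
  from the diagonal entries of the block, the eigenvalue equation on \<open>J\<close> bounds the
  weighted \<open>J\<close>-part by four times the perturbation, hence by
  \<open>4 * \<delta> * (1 + 2 * \<tau>) \<le> 5/8\<close> times itself. So it vanishes, and with it
  the graph vector.\<close>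

lemma graph_eigenvalue_near:
  assumes u: "in_graph u" and ev: "\<And>i. op u i = \<mu> * u i" and nz: "u i0 \<noteq> 0"
  shows "\<exists>j\<in>J. cmod (lam j - \<mu>) < (w j)\<^sup>2 / 4"
proof (rule ccontr)
  assume "\<not> ?thesis"
  hence far: "(w j)\<^sup>2 / 4 \<le> cmod (lam j - \<mu>)" if "j \<in> J" for j using that by force
  define y where "y i = (if i \<in> J then of_real (w i) * u i else 0)" for i
  have u_sum: "u i = (\<Sum>j\<in>J. u j * U j i)" for i using u unfolding in_graph_def by blast
  have wu: "of_real (w i) * u i = y i + (\<Sum>\<^sub>\<infinity>j. (c1 i j * Z (i, j)) * y j)" for i
  proof -
    have "of_real (w i) * u i = (\<Sum>j\<in>J. u j * (of_real (w i) * U j i))"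
      by (subst u_sum) (simp add: sum_distrib_left mult_ac)
    also have "\<dots> = (\<Sum>j\<in>J. (if j = i then y i else 0) + (c1 i j * Z (i, j)) * y j)"
      unfolding wU by (intro sum.cong) (auto simp: y_def algebra_simps)
    also have "\<dots> = (if i \<in> J then y i else 0) + (\<Sum>j\<in>J. (c1 i j * Z (i, j)) * y j)"
      using fin_J by (simp add: sum.distrib)
    also have "\<dots> = y i + (\<Sum>\<^sub>\<infinity>j. (c1 i j * Z (i, j)) * y j)"
      by (subst infsum_eq_sum_J) (auto simp: c1_def y_def)
    finally show ?thesis .
  qed
  obtain B where "l2_bounded B (\<lambda>i. of_real (w i) * u i)" using graph_dom[OF u] by (auto simp: dom_def)
  hence B: "l2_bounded B y" by (rule l2_bounded_mono) (auto simp: y_def)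
  have y0: "y i = 0" for i
  proof (rule l2_bounded_contract_zero[OF B, of "5/8"])
    fix C assume C: "l2_bounded C y"
    have "l2_bounded (C + 2 * \<tau> * C) (\<lambda>i. of_real (w i) * u i)"
      unfolding wu by (rule l2_bounded_add[OF C l2_bounded_matvec[OF c_mult_bound(1)[OF Z_bound] C]])
    from l2_bounded_cmult[OF l2_bounded_matvec[OF K_bound this], of 4]
    have "l2_bounded (4 * (\<delta> * (C + 2 * \<tau> * C))) (\<lambda>i. 4 * (\<Sum>\<^sub>\<infinity>j. K i j * (of_real (w j) * u j)))"
      by simp
    hence "l2_bounded (4 * (\<delta> * (C + 2 * \<tau> * C))) y"
    proof (rule l2_bounded_mono)
      fix i
      let ?S = "\<Sum>\<^sub>\<infinity>j. K i j * (of_real (w j) * u j)"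
      show "cmod (y i) \<le> cmod (4 * ?S)"
      proof (cases "i \<in> J")
        case True
        have "(lam i - \<mu>) * u i = - (of_real (w i) * ?S)"
          using ev[of i] by (simp add: op_def algebra_simps add_eq_0_iff)
        from arg_cong[OF this, of cmod] have e: "cmod (lam i - \<mu>) * cmod (u i) = w i * cmod ?S"
          using w_pos[of i] by (simp only: norm_mult norm_minus_cancel) simp
        have "w i / 4 * cmod (y i) = (w i)\<^sup>2 / 4 * cmod (u i)"
          using w_pos[of i] True by (simp add: y_def norm_mult power2_eq_square)
        also have "\<dots> \<le> cmod (lam i - \<mu>) * cmod (u i)" by (rule mult_right_mono[OF far[OF True]]) simp
        finally show ?thesis using w_pos[of i] unfolding e by (simp add: norm_mult field_simps)
      qed (simp add: y_def)
    qed
    moreover have "4 * (\<delta> * (C + 2 * \<tau> * C)) \<le> 5/8 * C"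
    proof -
      have "0 \<le> C" by (rule l2_bounded_nonneg[OF C])
      have "\<tau> * C \<le> 1/8 * C" by (rule mult_right_mono) (use \<tau>_small \<open>0 \<le> C\<close> in auto)
      hence "\<delta> * (C + 2 * \<tau> * C) \<le> 1/8 * (C + 2 * (1/8 * C))"
        by (intro mult_mono) (use \<delta>_small \<open>0 \<le> C\<close> \<tau>_nonneg in auto)
      thus ?thesis by simp
    qed
    ultimately show "l2_bounded (5/8 * C) y" by (rule l2_bounded_le)
  qed auto
  hence "u i0 = 0" using wu[of i0] w_pos[of i0] by simp
  with nz show False ..
qed

text \<open>The crude bound pairs the coupling block, of norm \<open>\<tau>\<close>, with
  \<open>Z\<close>, of norm \<open>2 * \<tau>\<close>. In the refined one \<open>Z\<close> is
  replaced by \<open>- K + remainder Z\<close>: the term \<open>- K\<close> yields the second-order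
  sum, and the remainder carries a further factor \<open>\<delta>\<close>.\<close>

lemma N_error:
  assumes i: "i \<in> J" and j: "j \<in> J"
  shows "cmod (N Z i j - K i j) \<le> 2 * \<tau>\<^sup>2"
    and "cmod (N Z i j - K i j + (\<Sum>\<^sub>\<infinity>k. K i k * (c1 k j * K k j))) \<le> 5 * \<delta> * \<tau>\<^sup>2"
proof -
  \<comment> \<open>Since \<open>c1 k j\<close> vanishes unless \<open>k\<close> lies in
    \<open>I - J\<close>, \<open>K\<close> may be cut down to the coupling block, whose bound is
    \<open>\<tau>\<close> and not \<open>\<delta>\<close>.\<close>
  let ?K = "\<lambda>k. if i \<in> J \<and> k \<in> I - J then K i k else 0"
  have Kr: "l2_bounded \<tau> ?K" using l2_bounded_section(1)[OF K_in_out, of i] by simp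
  have eq: "N Z i j - K i j = (\<Sum>\<^sub>\<infinity>k. ?K k * (c1 k j * Z (k, j)))"
    using i by (auto simp: N_def c1_def intro!: infsum_cong)
  have Zc: "l2_bounded (2 * \<tau>) (\<lambda>k. c1 k j * Z (k, j))"
    using l2_bounded_section(2)[OF c_mult_bound(1)[OF Z_bound]] .
  show "cmod (N Z i j - K i j) \<le> 2 * \<tau>\<^sup>2"
    unfolding eq using l2_bounded_cauchy_schwarz(3)[OF Kr Zc] by (simp add: power2_eq_square)
  have Kc: "l2_bounded \<tau> (\<lambda>k. - (c1 k j * K k j))"
    by (rule l2_bounded_mono[OF l2_bounded_section(2)[OF K_out_in, of j]])
      (use c1_le in \<open>auto simp: norm_mult intro!: mult_left_le_one_le, auto simp: c1_def\<close>)
  have "N Z i j - K i j + (\<Sum>\<^sub>\<infinity>k. K i k * (c1 k j * K k j))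
      = (\<Sum>\<^sub>\<infinity>k. ?K k * (c1 k j * Z (k, j))) - (\<Sum>\<^sub>\<infinity>k. ?K k * (- (c1 k j * K k j)))"
    unfolding eq using i by (auto simp: c1_def infsum_uminus intro!: infsum_cong)
  also have "\<dots> = (\<Sum>\<^sub>\<infinity>k. ?K k * (c1 k j * Z (k, j) - - (c1 k j * K k j)))"
    by (rule infsum_diff_l2[OF Kr Zc Kc])
  also have "\<dots> = (\<Sum>\<^sub>\<infinity>k. ?K k * (c1 k j * remainder Z (k, j)))"
    using j by (intro infsum_cong) (auto simp: Z_eq algebra_simps)
  finally have e2: "N Z i j - K i j + (\<Sum>\<^sub>\<infinity>k. K i k * (c1 k j * K k j))
      = (\<Sum>\<^sub>\<infinity>k. ?K k * (c1 k j * remainder Z (k, j)))" .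
  have "l2_bounded (5 * \<delta> * \<tau>) (\<lambda>k. c1 k j * remainder Z (k, j))"
    using l2_bounded_section(2)[OF c_mult_bound(1)[OF remainder_bound[OF Z_bound]]] .
  from l2_bounded_cauchy_schwarz(3)[OF Kr this]
  show "cmod (N Z i j - K i j + (\<Sum>\<^sub>\<infinity>k. K i k * (c1 k j * K k j))) \<le> 5 * \<delta> * \<tau>\<^sup>2"
    unfolding e2 by (simp add: power2_eq_square algebra_simps)
qed

end

section \<open>Root spaces of finite blocks\<close>

text \<open>Spells out a basis of a matrix kernel in coordinates, the form in which it can be
  carried over to the vector space \<open>coeffs\<close>.\<close>

lemma kernel_basis_explicit:
  fixes A :: "complex mat"
  assumes A: "A \<in> carrier_mat n n"
  obtains B where "finite B" "card B = kernel_dim A" "B \<subseteq> mat_kernel A"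
    "\<forall>v\<in>mat_kernel A. \<exists>a. \<forall>i<n. v $ i = (\<Sum>x\<in>B. a x * x $ i)"
    "\<forall>a. (\<forall>i<n. (\<Sum>x\<in>B. a x * x $ i) = 0) \<longrightarrow> (\<forall>x\<in>B. a x = 0)"
proof -
  interpret kernel n n A by unfold_locales (rule A)
  obtain B where fin: "finite B" and bas: "basis B" using kernel_basis_exists[OF A] by blast
  have sub: "B \<subseteq> mat_kernel A" and gen: "span B = mat_kernel A" and li: "\<not> lin_dep B"
    using bas by (auto simp: Ker.basis_def)
  have rep: "\<exists>a. \<forall>i<n. v $ i = (\<Sum>x\<in>B. a x * x $ i)" if "v \<in> mat_kernel A" for v
  proof -
    have "v \<in> span B" using that gen by simp
    then obtain a where "v = lincomb a B"
      using Ker.finite_span[OF fin] sub by auto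
    thus ?thesis using lincomb_index[OF _ sub] by auto
  qed
  have zero: "\<forall>x\<in>B. a x = 0" if z: "\<forall>i<n. (\<Sum>x\<in>B. a x * x $ i) = 0" for a
  proof (rule ccontr)
    assume "\<not> ?thesis"
    then obtain x where x: "x \<in> B" "a x \<noteq> 0" by blast
    have cl: "lincomb a B \<in> mat_kernel A"
      using Ker.lincomb_closed[of B a] sub by (auto simp: class_field_def)
    have "lincomb a B = 0\<^sub>v n"
    proof (rule eq_vecI)
      show "dim_vec (lincomb a B) = dim_vec (0\<^sub>v n)" using mat_kernelD(1)[OF A cl] by auto
    qed (use z lincomb_index[OF _ sub] in auto)
    hence "lin_dep B" unfolding Ker.lin_dep_def
      using fin x by (intro exI[of _ B] exI[of _ a] exI[of _ x]) (auto simp: class_field_def)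
    with li show False ..
  qed
  have card: "card B = kernel_dim A"
    using Ker.dim_basis[OF fin bas] by simp
  show ?thesis by (rule that[OF fin card sub]) (use rep zero in auto)
qed

lemma fun_sum_apply: "(\<Sum>x\<in>S. f x) k = (\<Sum>x\<in>S. f x k)"
  for f :: "'a \<Rightarrow> 'b \<Rightarrow> 'c::comm_monoid_add"
  by (induction S rule: infinite_finite_induct) auto

text \<open>In Jordan form the kernel of the \<open>k\<close>-th power has as dimension the sum of
  \<open>min k m\<close> over the blocks of size \<open>m\<close> belonging to \<mu>. As soon as
  \<open>k\<close> exceeds all sizes this is the total size of these blocks, the order of the root
  \<mu>.\<close>

lemma gen_eigenspace_dim_eventually:
  fixes A :: "complex mat"
  assumes A: "A \<in> carrier_mat n n"
  shows "\<exists>k0. \<forall>k\<ge>k0. kernel_dim (char_matrix A \<mu> ^\<^sub>m k) = order \<mu> (char_poly A)"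
proof -
  obtain as where "char_poly A = (\<Prod>a\<leftarrow>as. [:- a, 1:])" using char_poly_factorized[OF A] by blast
  from jordan_nf_exists[OF A this] obtain nas where jnf: "jordan_nf A nas" by blast
  have "kernel_dim (char_matrix A \<mu> ^\<^sub>m k) = order \<mu> (char_poly A)"
    if k: "sum_list (map fst nas) \<le> k" for k
  proof -
    have le: "m \<le> k" if "(m, e) \<in> set nas" for m e
      using member_le_sum_list[of m "map fst nas"] that k by force
    have "kernel_dim (char_matrix A \<mu> ^\<^sub>m k)
        = (\<Sum>m \<leftarrow> map fst [(m, e)\<leftarrow>nas . e = \<mu>]. min k m)"
      using dim_gen_eigenspace[OF jnf, of \<mu> k] by (simp add: dim_gen_eigenspace_def)
    also have "\<dots> = (\<Sum>m \<leftarrow> map fst [(m, e)\<leftarrow>nas . e = \<mu>]. m)"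
      by (rule arg_cong[where f = sum_list], rule map_cong) (auto simp: min_def dest!: le)
    also have "\<dots> = order \<mu> (char_poly A)"
      unfolding jordan_nf_order[OF jnf] by (simp add: case_prod_unfold)
    finally show ?thesis .
  qed
  thus ?thesis by blast
qed

lemma order_prod_linear:
  "order \<mu> (\<Prod>a\<leftarrow>as. [:- a, 1:]) = count (mset as) (\<mu> :: complex)"
proof -
  have "order \<mu> (\<Prod>a\<leftarrow>as. [:- a, 1:]) = sum_list (map (\<lambda>a. order \<mu> [:- a, 1:]) as)"
    by (subst order_prod_list) (auto simp: o_def)
  also have "\<dots> = count (mset as) \<mu>"
    by (induction as) (auto simp: order_linear')
  finally show ?thesis .
qed

lemma det_2x2:
  fixes A :: "'a :: comm_ring_1 mat"
  assumes A: "A \<in> carrier_mat 2 2"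
  shows "det A = A $$ (0, 0) * A $$ (1, 1) - A $$ (0, 1) * A $$ (1, 0)"
proof -
  have d: "det (mat_delete A i 0) = A $$ (1 - i, 1)" if "i < 2" for i
    using A that by (subst det_single) (auto simp: mat_delete_def less_2_cases_iff)
  have "det A = (\<Sum>i<2. A $$ (i, 0) * cofactor A i 0)"
    by (rule laplace_expansion_column[OF A]) simp
  thus ?thesis using d[of 0] d[of 1] by (simp add: numeral_2_eq_2 cofactor_def algebra_simps)
qed

text \<open>Two monic quadratics agree at all points; comparing them at 0 gives the product of the
  roots, and at 1 the sum.\<close>

lemma char_poly_roots_2x2:
  fixes A :: "complex mat"
  assumes A: "A \<in> carrier_mat 2 2" and cp: "char_poly A = (\<Prod>a\<leftarrow>[d, e]. [:- a, 1:])"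
  shows "d + e = A $$ (0, 0) + A $$ (1, 1)"
    and "d * e = A $$ (0, 0) * A $$ (1, 1) - A $$ (0, 1) * A $$ (1, 0)"
proof -
  have *: "(x - d) * (x - e) = (x - A $$ (0,0)) * (x - A $$ (1,1)) - A $$ (0, 1) * A $$ (1, 0)" for x
  proof -
    have "(x - d) * (x - e) = poly (char_poly A) x" by (simp add: cp algebra_simps)
    also have "\<dots> = det (- char_matrix A x)" by (rule char_poly_matrix[OF A])
    also have "\<dots> = (x - A $$ (0,0)) * (x - A $$ (1,1)) - A $$ (0, 1) * A $$ (1, 0)"
      using A by (subst det_2x2) (auto simp: char_matrix_def algebra_simps)
    finally show ?thesis .
  qed
  show p: "d * e = A $$ (0, 0) * A $$ (1, 1) - A $$ (0, 1) * A $$ (1, 0)"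
    using *[of 0] by simp
  show "d + e = A $$ (0, 0) + A $$ (1, 1)"
    using *[of 1] p by (simp add: algebra_simps)
qed

section \<open>Transfer from matrices to families of Fourier coefficients\<close>

lemma ker_pow_mono: "ker_pow m V \<mu> s \<subseteq> ker_pow m V \<mu> (s + j)"
proof -
  have "ker_pow m V \<mu> s \<subseteq> ker_pow m V \<mu> (Suc s)" for s
  proof (induction s)
    case 0
    show ?case by (auto simp: H_minus_def hs_def L_op_def zero_fun_def)
  qed auto
  thus ?thesis by (induction j) (auto simp del: ker_pow.simps)
qed

text \<open>The span of the vectors \<open>b a\<close> is invariant with matrix \<open>A\<close>,
  its coordinates can be read at the frequencies \<open>e a\<close>, and it absorbs: whatever
  \<open>L - \<mu>\<close> maps into it already lies in it. Absorption concerns one fixed \<mu>; it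
  confines the whole root space of this \<mu> to the span.\<close>

locale root_space_matrix =
  fixes m :: nat and V :: "int \<Rightarrow> complex" and n :: nat
    and b :: "nat \<Rightarrow> int \<Rightarrow> complex" and e :: "nat \<Rightarrow> int" and A :: "complex mat" and \<mu> :: complex
  assumes A: "A \<in> carrier_mat n n"
    and b_e: "\<And>a c. a < n \<Longrightarrow> c < n \<Longrightarrow> b a (e c) = (if a = c then 1 else 0)"
    and comb_dom: "\<And>v. v \<in> carrier_vec n \<Longrightarrow> (\<lambda>i. \<Sum>a<n. v $ a * b a i) \<in> H_minus (real m)"
    and comb_op: "\<And>v. v \<in> carrier_vec n \<Longrightarrow>
      L_op m V (\<lambda>i. \<Sum>a<n. v $ a * b a i) = (\<lambda>i. \<Sum>a<n. (A *\<^sub>v v) $ a * b a i)"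
    and absorbs: "\<And>u v. u \<in> H_minus (real m) \<Longrightarrow> v \<in> carrier_vec n \<Longrightarrow>
      (\<lambda>i. L_op m V u i - \<mu> * u i) = (\<lambda>i. \<Sum>a<n. v $ a * b a i) \<Longrightarrow>
      \<exists>v'\<in>carrier_vec n. u = (\<lambda>i. \<Sum>a<n. v' $ a * b a i)"
begin

definition comb :: "complex vec \<Rightarrow> int \<Rightarrow> complex" where
  "comb v = (\<lambda>i. \<Sum>a<n. v $ a * b a i)"

lemma comb_e: "c < n \<Longrightarrow> comb v (e c) = v $ c"
  by (simp add: comb_def b_e if_distrib cong: if_cong)

lemma comb_inj: "inj_on comb (carrier_vec n)"
proof (rule inj_onI)
  fix v v' assume "v \<in> carrier_vec n" "v' \<in> carrier_vec n" "comb v = comb v'"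
  thus "v = v'" by (intro eq_vecI) (use comb_e[of _ v] comb_e[of _ v'] in auto)
qed

lemma comb_0: "comb (0\<^sub>v n) = 0"
  by (simp add: comb_def zero_fun_def)

lemma comb_char_matrix:
  assumes v: "v \<in> carrier_vec n"
  shows "(\<lambda>i. L_op m V (comb v) i - \<mu> * comb v i) = comb (char_matrix A \<mu> *\<^sub>v v)"
proof
  fix i
  have "(char_matrix A \<mu> *\<^sub>v v) $ a = (A *\<^sub>v v) $ a - \<mu> * v $ a" if a: "a < n" for a
  proof -
    have "char_matrix A \<mu> *\<^sub>v v = A *\<^sub>v v + (- \<mu>) \<cdot>\<^sub>v v"
      using A v unfolding char_matrix_def by (subst add_mult_distrib_mat_vec[of _ n n]) auto
    thus ?thesis using A v a by simp
  qed
  thus "L_op m V (comb v) i - \<mu> * comb v i = comb (char_matrix A \<mu> *\<^sub>v v) i"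
  proof -
    assume d: "\<And>a. a < n \<Longrightarrow> (char_matrix A \<mu> *\<^sub>v v) $ a = (A *\<^sub>v v) $ a - \<mu> * v $ a"
    have "(\<Sum>a<n. (A *\<^sub>v v) $ a * b a i) - \<mu> * (\<Sum>a<n. v $ a * b a i)
        = (\<Sum>a<n. ((A *\<^sub>v v) $ a - \<mu> * v $ a) * b a i)"
      by (simp add: sum_distrib_left sum_subtractf left_diff_distrib mult.assoc)
    thus ?thesis unfolding comb_def comb_op[OF v] by (simp add: d)
  qed
qed

text \<open>Absorption gives the inclusion from left to right: a vector sent by
  \<open>L - \<mu>\<close> into the previous kernel must itself be a combination, and injectivity of
  \<open>comb\<close> turns the equation into one between coordinate vectors.\<close>

lemma ker_pow_eq: "ker_pow m V \<mu> s = comb ` mat_kernel (char_matrix A \<mu> ^\<^sub>m s)"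
proof (induction s)
  case 0
  have "mat_kernel (char_matrix A \<mu> ^\<^sub>m 0) = {0\<^sub>v n}"
    using A by (auto simp: mat_kernel_def char_matrix_def)
  thus ?case by (simp only: ker_pow.simps image_insert image_empty comb_0)
next
  case (Suc s)
  let ?B = "char_matrix A \<mu>"
  have B: "?B \<in> carrier_mat n n" "?B ^\<^sub>m k \<in> carrier_mat n n" for k using A by auto
  show ?case
  proof (intro equalityI subsetI)
    fix u assume "u \<in> ker_pow m V \<mu> (Suc s)"
    then obtain v where u: "u \<in> H_minus (real m)" and v: "v \<in> mat_kernel (?B ^\<^sub>m s)"
      and eq: "(\<lambda>i. L_op m V u i - \<mu> * u i) = comb v"
      using Suc by auto
    have vc: "v \<in> carrier_vec n" using v mat_kernelD(1)[OF B(2)] by blast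
    then obtain v' where v': "v' \<in> carrier_vec n" "u = comb v'"
      using absorbs[OF u vc] eq by (auto simp: comb_def)
    have "comb (?B *\<^sub>v v') = comb v" using comb_char_matrix[OF v'(1)] eq v'(2) by simp
    hence "?B *\<^sub>v v' = v"
      using comb_inj vc v'(1) B(1) by (auto dest!: inj_onD)
    hence "(?B ^\<^sub>m Suc s) *\<^sub>v v' = 0\<^sub>v n"
      using v mat_kernelD(2)[OF B(2)] B v'(1) by (simp add: assoc_mult_mat_vec[of _ n n _ n])
    hence "v' \<in> mat_kernel (?B ^\<^sub>m Suc s)" by (intro mat_kernelI[OF B(2) v'(1)])
    thus "u \<in> comb ` mat_kernel (?B ^\<^sub>m Suc s)" using v'(2) by blast
  next
    fix u assume "u \<in> comb ` mat_kernel (?B ^\<^sub>m Suc s)"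
    then obtain v where v: "v \<in> mat_kernel (?B ^\<^sub>m Suc s)" and u: "u = comb v" by blast
    have vc: "v \<in> carrier_vec n" using v mat_kernelD(1)[OF B(2)] by blast
    have "(?B ^\<^sub>m s) *\<^sub>v (?B *\<^sub>v v) = 0\<^sub>v n"
      using mat_kernelD(2)[OF B(2) v] B vc by (simp add: assoc_mult_mat_vec[of _ n n _ n])
    hence "?B *\<^sub>v v \<in> mat_kernel (?B ^\<^sub>m s)" using B(1) vc by (intro mat_kernelI[OF B(2)]) auto
    thus "u \<in> ker_pow m V \<mu> (Suc s)"
      using Suc comb_dom[OF vc] comb_char_matrix[OF vc] by (auto simp: u comb_def)
  qed
qed

text \<open>Linear independence survives the transfer because evaluation at the frequencies
  \<open>e c\<close> recovers the coordinates.\<close>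

lemma comb_kernel_basis:
  assumes C: "C \<in> carrier_mat n n"
  obtains B where "finite B" "card B = kernel_dim C" "B \<subseteq> comb ` mat_kernel C"
    "comb ` mat_kernel C \<subseteq> coeffs.span B" "coeffs.independent B"
proof -
  obtain B where B: "finite B" "card B = kernel_dim C" "B \<subseteq> mat_kernel C"
    and gen: "\<forall>v\<in>mat_kernel C. \<exists>a. \<forall>i<n. v $ i = (\<Sum>x\<in>B. a x * x $ i)"
    and li: "\<forall>a. (\<forall>i<n. (\<Sum>x\<in>B. a x * x $ i) = 0) \<longrightarrow> (\<forall>x\<in>B. a x = 0)"
    by (rule kernel_basis_explicit[OF C])
  have Bc: "B \<subseteq> carrier_vec n" using B(3) mat_kernel_carrier[OF C] by blast
  have inj: "inj_on comb B" using comb_inj Bc by (rule inj_on_subset)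
  have "comb ` mat_kernel C \<subseteq> coeffs.span (comb ` B)"
  proof (rule image_subsetI)
    fix v assume "v \<in> mat_kernel C"
    then obtain a where a: "\<forall>i<n. v $ i = (\<Sum>x\<in>B. a x * x $ i)" using gen by blast
    have "comb v = (\<Sum>x\<in>B. (\<lambda>k. a x * comb x k))"
    proof
      fix i
      have "comb v i = (\<Sum>c<n. \<Sum>x\<in>B. a x * x $ c * b c i)"
        unfolding comb_def by (intro sum.cong) (use a in \<open>auto simp: sum_distrib_right\<close>)
      also have "\<dots> = (\<Sum>x\<in>B. \<Sum>c<n. a x * x $ c * b c i)" by (rule sum.swap)
      finally show "comb v i = (\<Sum>x\<in>B. (\<lambda>k. a x * comb x k)) i"
        by (simp add: fun_sum_apply comb_def sum_distrib_left mult.assoc)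
    qed
    also have "\<dots> \<in> coeffs.span (comb ` B)"
      by (intro coeffs.span_sum coeffs.span_scale coeffs.span_base) auto
    finally show "comb v \<in> coeffs.span (comb ` B)" .
  qed
  moreover have "coeffs.independent (comb ` B)"
    unfolding coeffs.independent_explicit_finite_subsets
  proof (intro allI impI ballI)
    fix S u v assume S: "S \<subseteq> comb ` B" "finite S" and z: "(\<Sum>v\<in>S. (\<lambda>k. u v * v k)) = 0" and v: "v \<in> S"
    obtain B' where B': "B' \<subseteq> B" "S = comb ` B'" using S(1) by (auto simp: subset_image_iff)
    define a where "a x = (if x \<in> B' then u (comb x) else 0)" for x
    have "(\<Sum>x\<in>B. a x * x $ c) = 0" if "c < n" for c
    proof -
      have "(\<Sum>x\<in>B. a x * x $ c) = (\<Sum>x\<in>B'. u (comb x) * comb x (e c))"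
        using B' B(1) that by (intro sum.mono_neutral_cong_right) (auto simp: a_def comb_e)
      also have "\<dots> = (\<Sum>v\<in>S. u v * v (e c))"
        unfolding B'(2) by (subst sum.reindex) (use inj B'(1) in \<open>auto intro: inj_on_subset\<close>)
      also have "\<dots> = 0" using fun_cong[OF z, of "e c"] by (simp add: fun_sum_apply)
      finally show ?thesis .
    qed
    hence z: "\<forall>x\<in>B. a x = 0" using li by blast
    obtain x where "x \<in> B'" "v = comb x" using v B'(2) by blast
    thus "u v = 0" using bspec[OF z, of x] B'(1) by (auto simp: a_def)
  qed
  ultimately show ?thesis
    using B inj by (intro that[of "comb ` B"]) (auto simp: card_image)
qed

text \<open>From the power \<open>s0\<close> on the nested kernels have constant dimension, so they
  coincide and the root space is one of them.\<close>

lemma root_space_dim: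
  "(\<exists>B. finite B \<and> root_space m V \<mu> \<subseteq> coeffs.span B)
    \<and> coeffs.dim (root_space m V \<mu>) = order \<mu> (char_poly A)"
proof -
  let ?C = "\<lambda>s. char_matrix A \<mu> ^\<^sub>m s"
  have C: "?C s \<in> carrier_mat n n" for s using A by auto
  obtain s0 where s0: "\<And>s. s0 \<le> s \<Longrightarrow> kernel_dim (?C s) = order \<mu> (char_poly A)"
    using gen_eigenspace_dim_eventually[OF A] by blast
  obtain B where B: "finite B" "card B = kernel_dim (?C s0)" "B \<subseteq> ker_pow m V \<mu> s0"
     "ker_pow m V \<mu> s0 \<subseteq> coeffs.span B" "coeffs.independent B"
    unfolding ker_pow_eq by (rule comb_kernel_basis[OF C[of s0]])
  have big: "ker_pow m V \<mu> (s0 + j) \<subseteq> coeffs.span B" for j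
  proof -
    obtain B' where B': "finite B'" "card B' = kernel_dim (?C (s0 + j))"
      "B' \<subseteq> ker_pow m V \<mu> (s0 + j)" "ker_pow m V \<mu> (s0 + j) \<subseteq> coeffs.span B'" "coeffs.independent B'"
      unfolding ker_pow_eq by (rule comb_kernel_basis[OF C[of "s0 + j"]])
    have "B \<subseteq> ker_pow m V \<mu> (s0 + j)" using B(3) ker_pow_mono by blast
    \<comment> \<open>A basis of the smaller kernel, extended inside the larger one, gains no
      element: both kernels have the dimension \<open>order \<mu> (char_poly A)\<close>.\<close>
    then obtain B'' where B'': "B \<subseteq> B''" "B'' \<subseteq> ker_pow m V \<mu> (s0 + j)" "coeffs.independent B''"
      "ker_pow m V \<mu> (s0 + j) \<subseteq> coeffs.span B''"
      by (rule coeffs.maximal_independent_subset_extend[OF _ B(5)])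
    have "finite B'' \<and> card B'' \<le> card B'"
      by (rule coeffs.independent_span_bound[OF B'(1) B''(3)]) (use B'' B' in blast)
    moreover have "card B' = card B" using B'(2) B(2) s0 by simp
    ultimately have "B = B''" using B''(1) card_seteq[of B'' B] by simp
    thus ?thesis using B'' by blast
  qed
  have "root_space m V \<mu> \<subseteq> coeffs.span B"
  proof
    fix u assume "u \<in> root_space m V \<mu>"
    then obtain s where "u \<in> ker_pow m V \<mu> s" by (auto simp: root_space_def)
    hence "u \<in> ker_pow m V \<mu> (s0 + s)" using ker_pow_mono[of m V \<mu> s s0] by (auto simp: add.commute)
    thus "u \<in> coeffs.span B" using big by blast
  qed
  moreover have "B \<subseteq> root_space m V \<mu>" using B(3) by (auto simp: root_space_def)
  ultimately have "coeffs.dim (root_space m V \<mu>) = card B"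
    using coeffs.basis_card_eq_dim[of B "root_space m V \<mu>"] B(5) by simp
  thus ?thesis using \<open>root_space m V \<mu> \<subseteq> coeffs.span B\<close> B(1,2) s0 by auto
qed

end

section \<open>The weighted operator\<close>

lemma bracket_powr_square: "(bracket k powr s)\<^sup>2 = bracket k powr (2 * s)"
  by (simp add: power2_eq_square flip: powr_add)

text \<open>Together with \<open>l2_bounded_hs\<close> this trades \<open>hs_norm\<close> for
  \<open>l2_bounded\<close>, after which the default value of \<open>hs_norm\<close> outside
  \<open>hs s\<close> can no longer interfere.\<close>

lemma hs_l2_bounded:
  assumes "a \<in> hs s"
  shows "l2_bounded (hs_norm s a) (\<lambda>k. of_real (bracket k powr s) * a k)"
proof (rule l2_boundedI)
  have eq: "(cmod (of_real (bracket k powr s) * a k))\<^sup>2 = bracket k powr (2 * s) * (cmod (a k))\<^sup>2" for k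
    by (simp add: norm_mult power_mult_distrib bracket_powr_square)
  have nn: "0 \<le> (\<Sum>\<^sub>\<infinity>k. bracket k powr (2 * s) * (cmod (a k))\<^sup>2)"
    by (rule infsum_nonneg) simp
  thus "0 \<le> hs_norm s a" by (simp add: hs_norm_def)
  fix F :: "int set" assume "finite F"
  hence "(\<Sum>k\<in>F. bracket k powr (2 * s) * (cmod (a k))\<^sup>2) \<le> (\<Sum>\<^sub>\<infinity>k. bracket k powr (2 * s) * (cmod (a k))\<^sup>2)"
    using assms by (intro finite_sum_le_infsum) (auto simp: hs_def)
  thus "(\<Sum>k\<in>F. (cmod (of_real (bracket k powr s) * a k))\<^sup>2) \<le> (hs_norm s a)\<^sup>2"
    using nn by (simp add: eq hs_norm_def)
qed

lemma l2_bounded_hs: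
  assumes "l2_bounded C (\<lambda>k. of_real (bracket k powr s) * a k)"
  shows "a \<in> hs s" "hs_norm s a \<le> C"
proof -
  have eq: "(cmod (of_real (bracket k powr s) * a k))\<^sup>2 = bracket k powr (2 * s) * (cmod (a k))\<^sup>2" for k
    by (simp add: norm_mult power_mult_distrib bracket_powr_square)
  have *: "(\<Sum>k\<in>F. bracket k powr (2 * s) * (cmod (a k))\<^sup>2) \<le> C\<^sup>2" if "finite F" for F
    using l2_boundedD[OF assms that] by (simp add: eq)
  have sm: "(\<lambda>k. bracket k powr (2 * s) * (cmod (a k))\<^sup>2) summable_on UNIV"
    by (rule nonneg_bdd_above_summable_on) (auto intro!: bdd_aboveI[of _ "C\<^sup>2"] *)
  thus "a \<in> hs s" by (simp add: hs_def)
  have "(\<Sum>\<^sub>\<infinity>k. bracket k powr (2 * s) * (cmod (a k))\<^sup>2) \<le> C\<^sup>2"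
    by (rule infsum_le_finite_sums[OF sm]) (use * in auto)
  thus "hs_norm s a \<le> C" unfolding hs_norm_def
    using l2_bounded_nonneg[OF assms] by (intro real_le_lsqrt) (auto intro: infsum_nonneg)
qed

text \<open>
  The weight at \<open>j\<close> is a lower bound for the distance between the diagonal entries at \<open>j\<close> and \<open>t\<close> when
  \<open>\<bar>j\<bar>\<close> and \<open>t\<close> are at least 1 apart.
\<close>

definition weight :: "nat \<Rightarrow> int \<Rightarrow> int \<Rightarrow> real" where
  "weight m t j = max 1 \<bar>\<bar>real_of_int j\<bar> - real_of_int t\<bar> * max \<bar>real_of_int j\<bar> (real_of_int t) ^ (2 * m - 1)"

text \<open>The centre \<open>t\<close> is a parameter: it will be the odd frequency
  \<open>k\<close> for a pair and an even number for the low block.\<close>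

definition kmat :: "nat \<Rightarrow> (int \<Rightarrow> complex) \<Rightarrow> int \<Rightarrow> int \<Rightarrow> int \<Rightarrow> complex" where
  "kmat m V t i j = (if odd i \<and> odd j then V (i - j) / of_real (sqrt (weight m t i) * sqrt (weight m t j)) else 0)"

definition lam0 :: "nat \<Rightarrow> int \<Rightarrow> complex" where
  "lam0 m j = of_int j ^ (2 * m) * of_real pi ^ (2 * m)"

lemma weight_pos: "1 \<le> t \<Longrightarrow> 0 < weight m t j"
  by (simp add: weight_def less_max_iff_disj)

lemma weight_upper:
  assumes "1 \<le> m" "1 \<le> t"
  shows "weight m t j \<le> (real_of_int t * bracket j) ^ (2 * m)"
proof -
  have 1: "max 1 \<bar>\<bar>real_of_int j\<bar> - real_of_int t\<bar> \<le> \<bar>real_of_int j\<bar> + real_of_int t"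
    using assms(2) by linarith
  have 2: "max \<bar>real_of_int j\<bar> (real_of_int t) \<le> \<bar>real_of_int j\<bar> + real_of_int t"
    using assms(2) by linarith
  have "weight m t j \<le> (\<bar>real_of_int j\<bar> + real_of_int t) * (\<bar>real_of_int j\<bar> + real_of_int t) ^ (2 * m - 1)"
    unfolding weight_def using 1 2 assms(2) by (intro mult_mono power_mono) auto
  also have "\<dots> = (\<bar>real_of_int j\<bar> + real_of_int t) ^ (2 * m)"
    using assms(1) by (simp flip: power_Suc)
  also have "\<dots> \<le> (real_of_int t * bracket j) ^ (2 * m)"
  proof (rule power_mono)
    have "\<bar>real_of_int j\<bar> * 1 \<le> \<bar>real_of_int j\<bar> * real_of_int t"
      using assms(2) by (intro mult_left_mono) auto
    thus "\<bar>real_of_int j\<bar> + real_of_int t \<le> real_of_int t * bracket j"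
      by (simp add: bracket_def algebra_simps)
  qed (use assms in auto)
  finally show ?thesis .
qed

lemma weight_lower:
  assumes "1 \<le> m" "1 \<le> t"
  shows "bracket j ^ (2 * m) \<le> (real_of_int t + 2) * 2 ^ (2 * m - 1) * weight m t j"
proof -
  let ?d = "max 1 \<bar>\<bar>real_of_int j\<bar> - real_of_int t\<bar>" and ?M = "max \<bar>real_of_int j\<bar> (real_of_int t)"
  have 1: "bracket j \<le> (real_of_int t + 2) * d" if d: "1 \<le> d" "\<bar>\<bar>real_of_int j\<bar> - real_of_int t\<bar> \<le> d" for d
  proof -
    have "real_of_int t * 1 \<le> real_of_int t * d" using assms(2) d by (intro mult_left_mono) auto
    thus ?thesis unfolding bracket_def distrib_right using d by linarith
  qed
  have 2: "bracket j \<le> 2 * ?M" unfolding bracket_def using assms(2) by linarith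
  have "bracket j ^ (2 * m) = bracket j * bracket j ^ (2 * m - 1)"
    using assms(1) by (simp flip: power_Suc)
  also have "\<dots> \<le> ((real_of_int t + 2) * ?d) * (2 * ?M) ^ (2 * m - 1)"
    using 2 by (intro mult_mono power_mono 1) (use assms in \<open>auto simp: bracket_def le_max_iff_disj intro!: mult_nonneg_nonneg\<close>)
  finally show ?thesis by (simp add: weight_def power_mult_distrib mult_ac)
qed

lemma bracket_pos [simp]: "0 < bracket k" and bracket_ge_1 [simp]: "1 \<le> bracket k"
  by (auto simp: bracket_def)

text \<open>For a fixed centre the weight is comparable to \<open>bracket i ^ (2 * m)\<close>. The
  constants depend on \<open>t\<close>, which is harmless because only an equality of domains is
  extracted, for one \<open>t\<close> at a time.\<close>

lemma H_minus_weight: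
  assumes "1 \<le> m" "1 \<le> t"
  shows "H_minus (real m) = {u. (\<forall>i. even i \<longrightarrow> u i = 0) \<and>
     (\<exists>B. l2_bounded B (\<lambda>i. of_real (sqrt (weight m t i)) * u i))}"
proof -
  have br: "bracket i powr real m = sqrt (bracket i ^ (2 * m))" for i
    by (simp add: powr_realpow power_even_eq less_imp_le)
  have "u \<in> hs (real m) \<longleftrightarrow> (\<exists>B. l2_bounded B (\<lambda>i. of_real (sqrt (weight m t i)) * u i))" for u
  proof
    assume "u \<in> hs (real m)"
    note b = l2_bounded_cmult[OF hs_l2_bounded[OF this], of "of_real (sqrt (real_of_int t ^ (2 * m)))"]
    have "l2_bounded (cmod (of_real (sqrt (real_of_int t ^ (2 * m)))) * hs_norm (real m) u)
        (\<lambda>i. of_real (sqrt (weight m t i)) * u i)"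
    proof (rule l2_bounded_mono[OF b])
      fix i
      have "sqrt (weight m t i) \<le> sqrt (real_of_int t ^ (2 * m)) * sqrt (bracket i ^ (2 * m))"
        using weight_upper[OF assms, of i] by (simp add: power_mult_distrib flip: real_sqrt_mult)
      from mult_right_mono[OF this norm_ge_zero[of "u i"]]
      show "cmod (of_real (sqrt (weight m t i)) * u i)
        \<le> cmod (of_real (sqrt (real_of_int t ^ (2 * m))) * (of_real (bracket i powr real m) * u i))"
        using weight_pos[OF assms(2), of m i] assms(2) by (simp add: norm_mult br mult.assoc less_imp_le)
    qed
    thus "\<exists>B. l2_bounded B (\<lambda>i. of_real (sqrt (weight m t i)) * u i)" by blast
  next
    assume "\<exists>B. l2_bounded B (\<lambda>i. of_real (sqrt (weight m t i)) * u i)"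
    then obtain B where B: "l2_bounded B (\<lambda>i. of_real (sqrt (weight m t i)) * u i)" by blast
    define c where "c = (real_of_int t + 2) * 2 ^ (2 * m - 1)"
    have "l2_bounded (cmod (of_real (sqrt c)) * B) (\<lambda>i. of_real (bracket i powr real m) * u i)"
    proof (rule l2_bounded_mono[OF l2_bounded_cmult[OF B]])
      fix i
      have "sqrt (bracket i ^ (2 * m)) \<le> sqrt c * sqrt (weight m t i)"
        using weight_lower[OF assms, of i] by (simp add: c_def flip: real_sqrt_mult)
      from mult_right_mono[OF this norm_ge_zero[of "u i"]]
      show "cmod (of_real (bracket i powr real m) * u i) \<le> cmod (of_real (sqrt c) * (of_real (sqrt (weight m t i)) * u i))"
        using weight_pos[OF assms(2), of m i] assms(2) by (simp add: norm_mult br mult.assoc less_imp_le c_def)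
    qed
    thus "u \<in> hs (real m)" by (rule l2_bounded_hs)
  qed
  thus ?thesis by (auto simp: H_minus_def)
qed

lemma L_op_eq:
  assumes "1 \<le> t" "\<And>i. even i \<Longrightarrow> u i = 0"
    and bs: "block_splitting {i. odd i} J (lam0 m) (\<lambda>j. sqrt (weight m t j)) (kmat m V t) \<delta> \<tau>"
  shows "L_op m V u i = block_splitting.op (lam0 m) (\<lambda>j. sqrt (weight m t j)) (kmat m V t) u i"
proof -
  interpret block_splitting "{i. odd i}" J "lam0 m" "\<lambda>j. sqrt (weight m t j)" "kmat m V t" \<delta> \<tau> by fact
  have w: "weight m t j > 0" for j by (rule weight_pos[OF assms(1)])
  show ?thesis
  proof (cases "odd i")
    case True
    have "(\<Sum>\<^sub>\<infinity>j\<in>{j. odd j}. V (i - j) * u j)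
        = (\<Sum>\<^sub>\<infinity>j. of_real (sqrt (weight m t i)) * (kmat m V t i j * (of_real (sqrt (weight m t j)) * u j)))"
      by (rule infsum_cong_neutral) (use True assms(2) in \<open>auto simp: kmat_def less_imp_neq[OF w, symmetric]\<close>)
    thus ?thesis using True by (simp add: L_op_def op_def lam0_def infsum_cmult_right')
  next
    case False
    thus ?thesis using assms(2) by (simp add: L_op_def op_def kmat_def)
  qed
qed

text \<open>The abstract splitting applied to \<open>L_op\<close>; \<open>ds\<close> lists the
  eigenvalues of the compressed matrix. The multiplicity formula covers every \<mu> that keeps its
  distance from the diagonal entries outside \<open>J\<close>, so it also shows that such a \<mu>
  not occurring in \<open>ds\<close> has multiplicity 0.\<close>

theorem block_spectrum:
  fixes m :: nat and t :: int and J :: "int set" and V :: "int \<Rightarrow> complex"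
  assumes m: "1 \<le> m" and t: "1 \<le> t" and J: "finite J" "J \<subseteq> {i. odd i}"
    and K: "l2_bounded \<delta> (\<lambda>(i, j). kmat m V t i j)" and \<delta>: "\<delta> \<le> 1 / 8"
    and gap: "\<And>i j. odd i \<Longrightarrow> i \<notin> J \<Longrightarrow> j \<in> J \<Longrightarrow>
      weight m t i \<le> cmod (lam0 m i - lam0 m j) \<and> weight m t j \<le> cmod (lam0 m i - lam0 m j)"
    and out_in: "l2_bounded \<tau> (\<lambda>(i, j). if i \<in> {i. odd i} - J \<and> j \<in> J then kmat m V t i j else 0)"
    and in_out: "l2_bounded \<tau> (\<lambda>(i, j). if i \<in> J \<and> j \<in> {i. odd i} - J then kmat m V t i j else 0)"
    and \<tau>: "\<tau> \<le> \<delta>"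
  obtains ds :: "complex list" and M :: "int \<Rightarrow> int \<Rightarrow> complex" where
    "length ds = card J"
    "\<And>\<mu>. (\<And>i. odd i \<Longrightarrow> i \<notin> J \<Longrightarrow> weight m t i \<le> cmod (lam0 m i - \<mu>)) \<Longrightarrow>
       (\<exists>B. finite B \<and> root_space m V \<mu> \<subseteq> coeffs.span B) \<and>
       coeffs.dim (root_space m V \<mu>) = count (mset ds) \<mu>"
    "\<And>d. d \<in> set ds \<Longrightarrow> \<exists>j\<in>J. cmod (lam0 m j - d) < weight m t j / 4"
    "\<And>i j. i \<in> J \<Longrightarrow> j \<in> J \<Longrightarrow> cmod (M i j - (if i = j then lam0 m j else 0) - V (i - j))
       \<le> sqrt (weight m t i * weight m t j) * (2 * \<tau>\<^sup>2)"
    "\<And>i j. i \<in> J \<Longrightarrow> j \<in> J \<Longrightarrow> cmod (M i j - (if i = j then lam0 m j else 0) - V (i - j)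
         + (\<Sum>\<^sub>\<infinity>l\<in>{l. odd l} - J. V (i - l) * V (l - j) / (lam0 m l - lam0 m j)))
       \<le> sqrt (weight m t i * weight m t j) * (5 * \<delta> * \<tau>\<^sup>2)"
    "\<And>k. J = {k, - k} \<Longrightarrow> k \<noteq> - k \<Longrightarrow> \<exists>d e. ds = [d, e] \<and> d + e = M k k + M (- k) (- k)
       \<and> d * e = M k k * M (- k) (- k) - M k (- k) * M (- k) k"
proof -
  let ?w = "\<lambda>j. sqrt (weight m t j)"
  have W: "weight m t j > 0" for j by (rule weight_pos[OF t])
  have bs: "block_splitting {i. odd i} J (lam0 m) ?w (kmat m V t) \<delta> \<tau>"
    by unfold_locales (use assms W in \<open>auto simp: kmat_def less_imp_le\<close>)
  interpret block_splitting "{i. odd i}" J "lam0 m" ?w "kmat m V t" \<delta> \<tau> by fact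
  have dom: "H_minus (real m) = dom"
    unfolding H_minus_weight[OF m t] dom_def by auto
  have Lop: "L_op m V u = op u" if "u \<in> dom" for u
    using L_op_eq[OF t _ bs, of u] that by (auto simp: dom_def)
  \<comment> \<open>The matrix needs an enumeration of \<open>J\<close>. For a pair it is taken as
    \<open>[k', - k']\<close>, so that the entries in the trace and the determinant can be named;
    the set determines \<open>k\<close> only up to sign, and both quantities are symmetric under the
    exchange.\<close>
  obtain xs where xs: "set xs = J" "distinct xs"
    and xs2: "\<And>k. J = {k, - k} \<Longrightarrow> k \<noteq> - k \<Longrightarrow> (\<exists>k'. (k' = k \<or> k' = - k) \<and> xs = [k', - k'])"
  proof (cases "\<exists>k. J = {k, - k} \<and> k \<noteq> - k")
    case True
    then obtain k where k: "J = {k, - k}" "k \<noteq> - k" by blast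
    show ?thesis by (rule that[of "[k, - k]"]) (use k in \<open>auto simp: doubleton_eq_iff\<close>)
  next
    case False
    obtain xs where "set xs = J" "distinct xs" using finite_distinct_list[OF J(1)] by blast
    thus ?thesis using that False by blast
  qed
  define n where "n = length xs"
  have n: "n = card J" using xs distinct_card by (force simp: n_def)
  have bij: "bij_betw (nth xs) {..<n} J" using bij_betw_nth[OF xs(2), of "{..<n}" J] xs by (simp add: n_def)
  have nth_J: "xs ! a \<in> J" if "a < n" for a using that xs by (auto simp: n_def)
  have nth_eq: "xs ! a = xs ! c \<longleftrightarrow> a = c" if "a < n" "c < n" for a c
    using that xs by (simp add: n_def nth_eq_iff_index_eq)
  define A where "A = Matrix.mat n n (\<lambda>(a, c). M (xs ! a) (xs ! c))"
  have A: "A \<in> carrier_mat n n" by (simp add: A_def)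
  have reindex: "(\<Sum>a<n. f (xs ! a)) = (\<Sum>j\<in>J. f j)" for f :: "int \<Rightarrow> complex"
    by (rule sum.reindex_bij_betw[OF bij])
  \<comment> \<open>Coefficient vectors are indexed by positions in \<open>xs\<close>, graph
    combinations by the elements of \<open>J\<close>; \<open>cf\<close> passes from the former to
    the latter.\<close>
  define cf where "cf v j = vec_index v (inv_into {..<n} (nth xs) j)" for v :: "complex vec" and j
  have cf: "cf v (xs ! a) = vec_index v a" if "a < n" for v a
    unfolding cf_def using that bij by (simp add: bij_betw_def inv_into_f_f)
  have comb: "(\<lambda>i. \<Sum>a<n. vec_index v a * U (xs ! a) i) = (\<lambda>i. \<Sum>j\<in>J. cf v j * U j i)" for v
    by (subst reindex[symmetric]) (auto simp: cf intro!: sum.cong)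
  have comb_dom: "(\<lambda>i. \<Sum>j\<in>J. c j * U j i) \<in> dom" for c
    using comb_dom_op[OF fin_J order_refl] by blast
  have comb_op: "L_op m V (\<lambda>i. \<Sum>a<n. vec_index v a * U (xs ! a) i)
      = (\<lambda>i. \<Sum>a<n. vec_index (A *\<^sub>v v) a * U (xs ! a) i)" if v: "v \<in> carrier_vec n" for v
  proof
    fix i
    have "cf (A *\<^sub>v v) j = (\<Sum>l\<in>J. M j l * cf v l)" if "j \<in> J" for j
    proof -
      have "j \<in> nth xs ` {..<n}" using that bij by (simp add: bij_betw_def)
      then obtain a where a: "a < n" "j = xs ! a" by blast
      have "cf (A *\<^sub>v v) j = (\<Sum>c<n. M (xs ! a) (xs ! c) * vec_index v c)"
        using a v by (auto simp: cf A_def scalar_prod_def lessThan_atLeast0 intro!: sum.cong)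
      also have "\<dots> = (\<Sum>c<n. M (xs ! a) (xs ! c) * cf v (xs ! c))" by (simp add: cf)
      finally show ?thesis using reindex[of "\<lambda>l. M j l * cf v l"] a(2) by simp
    qed
    thus "L_op m V (\<lambda>i. \<Sum>a<n. vec_index v a * U (xs ! a) i) i
        = (\<Sum>a<n. vec_index (A *\<^sub>v v) a * U (xs ! a) i)"
      unfolding comb Lop[OF comb_dom] op_comb fun_cong[OF comb, of _ i] by simp
  qed
  have rsm: "root_space_matrix m V n (\<lambda>a. U (xs ! a)) (nth xs) A \<mu>"
    if good: "\<And>i. odd i \<Longrightarrow> i \<notin> J \<Longrightarrow> weight m t i \<le> cmod (lam0 m i - \<mu>)" for \<mu>
  proof (unfold_locales, rule A)
    show "U (xs ! a) (xs ! c) = (if a = c then 1 else 0)" if "a < n" "c < n" for a c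
      using that nth_eq[of c a] by (auto simp: U_J nth_J)
    show "(\<lambda>i. \<Sum>a<n. vec_index v a * U (xs ! a) i) \<in> H_minus (real m)" for v
      unfolding comb dom by (rule comb_dom)
    show "L_op m V (\<lambda>i. \<Sum>a<n. vec_index v a * U (xs ! a) i)
      = (\<lambda>i. \<Sum>a<n. vec_index (A *\<^sub>v v) a * U (xs ! a) i)" if "v \<in> carrier_vec n" for v
      by (rule comb_op[OF that])
    fix u v assume u: "u \<in> H_minus (real m)"
      and eq: "(\<lambda>i. L_op m V u i - \<mu> * u i) = (\<lambda>i. \<Sum>a<n. vec_index v a * U (xs ! a) i)"
    have "L_op m V u = op u" using u Lop[of u] by (simp only: dom)
    hence "(\<lambda>i. op u i - \<mu> * u i) = (\<lambda>i. \<Sum>j\<in>J. cf v j * U j i)" using eq by (simp only: comb)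
    hence gr: "in_graph (\<lambda>i. op u i - \<mu> * u i)" using graph_comb[of "cf v"] by simp
    have ud: "u \<in> dom" using u by (simp only: dom)
    have "in_graph u"
    proof (rule graph_absorbs[OF ud gr])
      fix i assume "i \<in> {i. odd i} - J"
      thus "(sqrt (weight m t i))\<^sup>2 \<le> cmod (lam0 m i - \<mu>)" using good[of i] W[of i] by simp
    qed
    hence ur: "u i = (\<Sum>a<n. u (xs ! a) * U (xs ! a) i)" for i
      unfolding in_graph_def reindex[of "\<lambda>j. u j * U j i"] by blast
    have "u = (\<lambda>i. \<Sum>a<n. vec_index (Matrix.vec n (\<lambda>a. u (xs ! a))) a * U (xs ! a) i)"
    proof
      fix i
      have "(\<Sum>a<n. vec_index (Matrix.vec n (\<lambda>a. u (xs ! a))) a * U (xs ! a) i) = (\<Sum>a<n. u (xs ! a) * U (xs ! a) i)"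
        by (intro sum.cong) auto
      also have "\<dots> = u i" by (rule ur[symmetric])
      finally show "u i = (\<Sum>a<n. vec_index (Matrix.vec n (\<lambda>a. u (xs ! a))) a * U (xs ! a) i)" ..
    qed
    thus "\<exists>v'\<in>carrier_vec n. u = (\<lambda>i. \<Sum>a<n. vec_index v' a * U (xs ! a) i)"
      by (metis vec_carrier)
  qed
  obtain ds where cp: "char_poly A = (\<Prod>a\<leftarrow>ds. [:- a, 1:])" and len: "length ds = n"
    using char_poly_factorized[OF A] by blast
  show ?thesis
  proof (rule that[of ds M])
    show "length ds = card J" using len n by simp
    show "(\<exists>B. finite B \<and> root_space m V \<mu> \<subseteq> coeffs.span B) \<and>
       coeffs.dim (root_space m V \<mu>) = count (mset ds) \<mu>"
      if "\<And>i. odd i \<Longrightarrow> i \<notin> J \<Longrightarrow> weight m t i \<le> cmod (lam0 m i - \<mu>)" for \<mu>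
      using root_space_matrix.root_space_dim[OF rsm[OF that]] order_prod_linear[of \<mu> ds] cp by simp
    show "\<exists>j\<in>J. cmod (lam0 m j - d) < weight m t j / 4" if d: "d \<in> set ds" for d
    proof -
      have "poly (char_poly A) d = 0" unfolding cp using d by (simp add: poly_prod_list prod_list_zero_iff)
      then obtain v where v: "v \<in> carrier_vec n" "v \<noteq> 0\<^sub>v n" "A *\<^sub>v v = d \<cdot>\<^sub>v v"
        using eigenvalue_root_char_poly[OF A] A by (auto simp: eigenvalue_def eigenvector_def)
      define u where "u = (\<lambda>i. \<Sum>a<n. vec_index v a * U (xs ! a) i)"
      have ug: "in_graph u" unfolding u_def comb by (rule graph_comb)
      have "op u = (\<lambda>i. \<Sum>a<n. vec_index (A *\<^sub>v v) a * U (xs ! a) i)"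
        using comb_op[OF v(1)] Lop[OF graph_dom[OF ug]] by (simp add: u_def)
      hence ev: "op u i = d * u i" for i
        using v by (simp add: u_def sum_distrib_left mult.assoc)
      obtain a where a: "a < n" "vec_index v a \<noteq> 0" using v(1,2) by (metis eq_vecI carrier_vecD index_zero_vec)
      have "u (xs ! a) = (\<Sum>c<n. if c = a then vec_index v a else 0)"
        unfolding u_def by (rule sum.cong) (use a nth_eq[of a] in \<open>auto simp: U_J nth_J\<close>)
      hence "u (xs ! a) \<noteq> 0" using a by simp
      from graph_eigenvalue_near[OF ug ev this] show ?thesis using W by (simp add: less_imp_le)
    qed
    fix i j assume ij: "i \<in> J" "j \<in> J"
    have odd: "odd i" "odd j" using ij J by auto
    have nz: "sqrt (weight m t l) \<noteq> 0" for l using W[of l] by simp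
    define ww :: complex where "ww = of_real (?w i * ?w j)"
    have Kij: "V (i - j) = ww * kmat m V t i j" using odd nz by (simp add: kmat_def ww_def)
    have Mij: "M i j - (if i = j then lam0 m j else 0) - V (i - j) = ww * (N Z i j - kmat m V t i j)"
      unfolding Kij by (simp add: M_def ww_def algebra_simps)
    have nw: "cmod ww = sqrt (weight m t i * weight m t j)"
      using W[of i] W[of j] by (simp add: ww_def norm_mult real_sqrt_mult)
    show "cmod (M i j - (if i = j then lam0 m j else 0) - V (i - j))
       \<le> sqrt (weight m t i * weight m t j) * (2 * \<tau>\<^sup>2)"
      unfolding Mij norm_mult nw using N_error(1)[OF ij] W[of i] W[of j]
      by (intro mult_left_mono) (auto simp: less_imp_le)
    have "(\<Sum>\<^sub>\<infinity>l\<in>{l. odd l} - J. V (i - l) * V (l - j) / (lam0 m l - lam0 m j))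
        = (\<Sum>\<^sub>\<infinity>l. ww * (kmat m V t i l * (c1 l j * kmat m V t l j)))"
    proof (rule infsum_cong_neutral)
      fix l assume "l \<in> ({l. odd l} - J) \<inter> UNIV"
      hence l: "odd l" "l \<notin> J" by auto
      \<comment> \<open>Stated for an arbitrary denominator \<open>D\<close>; if it is 0, both sides
        are 0.\<close>
      have gen: "x * y / D = of_real (a * b) * (x / of_real (a * c) * (of_real (c\<^sup>2) / D * (y / of_real (c * b))))"
        if "a \<noteq> 0" "b \<noteq> 0" "c \<noteq> 0" for a b c :: real and x y D :: complex
        using that by (cases "D = 0") (simp_all add: field_simps power2_eq_square)
      have e: "kmat m V t i l = V (i - l) / of_real (?w i * ?w l)"
        "kmat m V t l j = V (l - j) / of_real (?w l * ?w j)"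
        "c1 l j = of_real ((?w l)\<^sup>2) / (lam0 m l - lam0 m j)"
        using l odd ij by (simp_all add: kmat_def c1_def)
      show "V (i - l) * V (l - j) / (lam0 m l - lam0 m j) = ww * (kmat m V t i l * (c1 l j * kmat m V t l j))"
        unfolding e ww_def by (rule gen) (rule nz)+
    qed (auto simp: c1_def)
    also have "\<dots> = ww * (\<Sum>\<^sub>\<infinity>l. kmat m V t i l * (c1 l j * kmat m V t l j))"
      by (rule infsum_cmult_right')
    finally have "M i j - (if i = j then lam0 m j else 0) - V (i - j)
         + (\<Sum>\<^sub>\<infinity>l\<in>{l. odd l} - J. V (i - l) * V (l - j) / (lam0 m l - lam0 m j))
      = ww * (N Z i j - kmat m V t i j + (\<Sum>\<^sub>\<infinity>l. kmat m V t i l * (c1 l j * kmat m V t l j)))"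
      unfolding Mij by (simp add: distrib_left)
    thus "cmod (M i j - (if i = j then lam0 m j else 0) - V (i - j)
         + (\<Sum>\<^sub>\<infinity>l\<in>{l. odd l} - J. V (i - l) * V (l - j) / (lam0 m l - lam0 m j)))
       \<le> sqrt (weight m t i * weight m t j) * (5 * \<delta> * \<tau>\<^sup>2)"
      using N_error(2)[OF ij] W[of i] W[of j]
      by (simp only: norm_mult nw) (intro mult_left_mono, auto simp: less_imp_le)
  next
    fix k assume k: "J = {k, - k}" "k \<noteq> - k"
    from xs2[OF this] obtain k' where k': "k' = k \<or> k' = - k" "xs = [k', - k']" by blast
    have n2: "n = 2" using k' by (simp add: n_def)
    obtain d e where de: "ds = [d, e]" using len n2 by (auto simp: length_Suc_conv numeral_2_eq_2)
    have "A \<in> carrier_mat 2 2" using A n2 by simp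
    from char_poly_roots_2x2[OF this, of d e] cp de
    have "d + e = M k' k' + M (- k') (- k')" "d * e = M k' k' * M (- k') (- k') - M k' (- k') * M (- k') k'"
      using k' n2 by (simp_all add: A_def)
    thus "\<exists>d e. ds = [d, e] \<and> d + e = M k k + M (- k) (- k)
       \<and> d * e = M k k * M (- k) (- k) - M k (- k) * M (- k) k"
      using de k'(1) by (auto simp: algebra_simps)
  qed
qed

section \<open>Enumeration of the eigenvalues\<close>

lemma lex_le_total: "lex_le z w \<or> lex_le w z"
  and lex_le_trans: "lex_le z w \<Longrightarrow> lex_le w v \<Longrightarrow> lex_le z v"
  by (auto simp: lex_le_def)

lemma lex_sort_exists: "\<exists>ys. mset ys = mset xs \<and> sorted_wrt lex_le ys"
proof (induction xs)
  case (Cons x xs)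
  then obtain ys where ys: "mset ys = mset xs" "sorted_wrt lex_le ys" by blast
  let ?A = "filter (\<lambda>y. \<not> lex_le x y) ys" and ?B = "filter (lex_le x) ys"
  have A: "lex_le y x" if "y \<in> set ?A" for y using lex_le_total[of x y] that by auto
  have B: "lex_le x y" if "y \<in> set ?B" for y using that by auto
  have "sorted_wrt lex_le ?A" "sorted_wrt lex_le ?B" using ys(2) by (auto intro: sorted_wrt_filter)
  hence "sorted_wrt lex_le (?A @ x # ?B)"
    using A B lex_le_trans by (simp only: sorted_wrt_append sorted_wrt.simps set_simps) blast
  moreover have "mset (?A @ x # ?B) = mset (x # xs)"
    using ys(1) multiset_partition[of "mset ys" "lex_le x", symmetric] by (simp add: add.commute)
  ultimately show ?case by (intro exI[of _ "?A @ x # ?B"] conjI)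
qed simp

lemma card_positive_initial_segment:
  fixes A :: "nat set"
  assumes "finite A" "\<And>k. k \<in> A \<Longrightarrow> 1 \<le> k" "\<And>k j. k \<in> A \<Longrightarrow> 1 \<le> j \<Longrightarrow> j \<le> k \<Longrightarrow> j \<in> A"
  shows "A = {1..card A}"
proof (cases "A = {}")
  case False
  have eq: "A = {1..Max A}"
  proof (intro equalityI subsetI)
    fix k assume "k \<in> A"
    thus "k \<in> {1..Max A}" using assms(2)[of k] Max_ge[OF assms(1), of k] by simp
  next
    fix k assume "k \<in> {1..Max A}"
    thus "k \<in> A" using assms(3)[OF Max_in[OF assms(1) False], of k] by simp
  qed
  have "card A = Max A" using arg_cong[OF eq, of card] by (simp only: card_atLeastAtMost)
  thus ?thesis using eq by simp
qed simp

text \<open>The vertical lines \<open>Re \<mu> = x n\<close> separate the blocks. The lists lie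
  strictly between the lines while the multiplicity formulas hold on closed strips, so no eigenvalue
  sits on a line and neighbouring formulas agree there. With \<open>2 * N\<close> values in the low
  block and two in every later one, block \<open>n\<close> has to occupy the positions
  \<open>2 * n - 1\<close> and \<open>2 * n\<close>.\<close>

locale spectral_blocks =
  fixes m :: nat and V :: "int \<Rightarrow> complex" and N :: nat and x :: "nat \<Rightarrow> real"
    and D0 :: "complex list" and P :: "nat \<Rightarrow> complex list"
  assumes x_step: "\<And>n. N \<le> n \<Longrightarrow> x n < x (Suc n)" and x_unbounded: "\<And>c. \<exists>n\<ge>N. c < x n"
    and D0_length: "length D0 = 2 * N" and P_length: "\<And>n. N < n \<Longrightarrow> length (P n) = 2"
    and D0_Re: "\<And>d. d \<in> set D0 \<Longrightarrow> Re d < x N"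
    and P_Re: "\<And>n d. N < n \<Longrightarrow> d \<in> set (P n) \<Longrightarrow> x (n - 1) < Re d \<and> Re d < x n"
    and D0_mult: "\<And>\<mu>. Re \<mu> \<le> x N \<Longrightarrow> (\<exists>B. finite B \<and> root_space m V \<mu> \<subseteq> coeffs.span B)
      \<and> coeffs.dim (root_space m V \<mu>) = count (mset D0) \<mu>"
    and P_mult: "\<And>n \<mu>. N < n \<Longrightarrow> x (n - 1) \<le> Re \<mu> \<Longrightarrow> Re \<mu> \<le> x n \<Longrightarrow>
      (\<exists>B. finite B \<and> root_space m V \<mu> \<subseteq> coeffs.span B)
      \<and> coeffs.dim (root_space m V \<mu>) = count (mset (P n)) \<mu>"
begin

lemma x_mono:
  assumes "N \<le> n" "n \<le> n'"
  shows "x n \<le> x n'"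
  using assms(2,1) by (induction n' rule: dec_induct) (use x_step in \<open>auto intro: order_trans less_imp_le\<close>)

definition D0s :: "complex list" where
  "D0s = (SOME ys. mset ys = mset D0 \<and> sorted_wrt lex_le ys)"

definition Ps :: "nat \<Rightarrow> complex list" where
  "Ps n = (SOME ys. mset ys = mset (P n) \<and> sorted_wrt lex_le ys)"

lemma D0s: "mset D0s = mset D0" "sorted_wrt lex_le D0s"
  and Ps: "mset (Ps n) = mset (P n)" "sorted_wrt lex_le (Ps n)"
  using someI_ex[OF lex_sort_exists[of D0]] someI_ex[OF lex_sort_exists[of "P n"]]
  by (auto simp: D0s_def Ps_def)

primrec Dn :: "nat \<Rightarrow> complex list" where
  "Dn 0 = D0s"
| "Dn (Suc n) = Dn n @ Ps (N + Suc n)"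

lemma Dn_length: "length (Dn n) = 2 * (N + n)"
  by (induction n) (use mset_eq_length[OF D0s(1)] mset_eq_length[OF Ps(1)] D0_length P_length in auto)

lemma set_D0s: "set D0s = set D0" and set_Ps: "set (Ps n) = set (P n)"
  using D0s(1) Ps(1) by (metis set_mset_mset)+

lemma Dn_Re: "d \<in> set (Dn n) \<Longrightarrow> Re d < x (N + n)"
proof (induction n)
  case (Suc n)
  thus ?case using x_step[of "N + n"] P_Re[of "N + Suc n" d] by (auto simp: set_Ps)
qed (use D0_Re in \<open>auto simp: set_D0s\<close>)

lemma Dn_sorted: "sorted_wrt lex_le (Dn n)"
proof (induction n)
  case (Suc n)
  have "lex_le a b" if "a \<in> set (Dn n)" "b \<in> set (Ps (N + Suc n))" for a b
    using Dn_Re[OF that(1)] P_Re[of "N + Suc n" b] that(2) by (auto simp: set_Ps lex_le_def)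
  thus ?case using Suc Ps(2) by (auto simp: sorted_wrt_append)
qed (use D0s in auto)

lemma Dn_mult:
  "Re \<mu> < x (N + n) \<Longrightarrow> (\<exists>B. finite B \<and> root_space m V \<mu> \<subseteq> coeffs.span B)
      \<and> coeffs.dim (root_space m V \<mu>) = count (mset (Dn n)) \<mu>"
proof (induction n)
  case 0
  thus ?case using D0_mult[of \<mu>] D0s by simp
next
  case (Suc n)
  show ?case
  proof (cases "Re \<mu> < x (N + n)")
    case True
    hence "\<mu> \<notin> set (P (N + Suc n))" using P_Re[of "N + Suc n" \<mu>] by auto
    hence "count (mset (Ps (N + Suc n))) \<mu> = 0" using Ps(1) by (simp add: count_eq_zero_iff)
    thus ?thesis using Suc.IH[OF True] by simp
  next
    case False
    hence "count (mset (Dn n)) \<mu> = 0" using Dn_Re[of \<mu> n] by (auto simp: count_eq_zero_iff)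
    thus ?thesis using P_mult[of "N + Suc n" \<mu>] Suc.prems False Ps(1) by simp
  qed
qed

lemma Dn_nth:
  assumes "i < 2 * (N + n)" "n \<le> n'"
  shows "Dn n' ! i = Dn n ! i"
  using assms(2,1)
proof (induction n' rule: dec_induct)
  case (step k)
  thus ?case using Dn_length[of k] by (simp add: nth_append)
qed simp

lemma Dn_later: "2 * (N + n) \<le> i \<Longrightarrow> i < 2 * (N + n') \<Longrightarrow> x (N + n) < Re (Dn n' ! i)"
proof (induction n')
  case (Suc k)
  show ?case
  proof (cases "i < 2 * (N + k)")
    case True
    thus ?thesis using Suc Dn_length[of k] by (simp add: nth_append)
  next
    case False
    have len: "length (Ps (N + Suc k)) = 2" using mset_eq_length[OF Ps(1)] P_length by simp
    have "Dn (Suc k) ! i \<in> set (P (N + Suc k))"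
      using False Suc.prems Dn_length[of k] len nth_mem[of "i - 2 * (N + k)" "Ps (N + Suc k)"]
      by (simp add: nth_append set_Ps)
    hence "x (N + k) < Re (Dn (Suc k) ! i)" using P_Re[of "N + Suc k"] by auto
    moreover have "x (N + n) \<le> x (N + k)" using Suc.prems False by (intro x_mono) auto
    ultimately show ?thesis by simp
  qed
qed simp

text \<open>\<open>eigval\<close> is defined by choice, so nothing can be concluded about it before
  some eigenvalue sequence is exhibited; the concatenated sorted blocks provide one.\<close>

lemma eigenvalue_sequence_exists: "\<exists>lam. eigenvalue_sequence m V lam"
proof
  \<comment> \<open>\<open>Dn k\<close> is long enough to contain the position \<open>k - 1\<close>,
    and later stages only append, so every later stage gives the same value. List positions start at
    0, eigenvalues at 1.\<close>
  define lam where "lam k = Dn k ! (k - 1)" for k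
  have lam: "lam k = Dn n ! (k - 1)" if "1 \<le> k" "k - 1 < 2 * (N + n)" for k n
    using Dn_nth[of "k - 1" n k] Dn_nth[of "k - 1" k n] that by (cases "n \<le> k") (auto simp: lam_def)
  show "eigenvalue_sequence m V lam"
    unfolding eigenvalue_sequence_def
  proof (intro conjI allI impI)
    fix k :: nat assume k: "1 \<le> k"
    have "lex_le (Dn (Suc k) ! (k - 1)) (Dn (Suc k) ! k)"
      using sorted_wrt_nth_less[OF Dn_sorted, of "k - 1" k "Suc k"] k Dn_length by simp
    thus "lex_le (lam k) (lam (Suc k))" using lam[of k "Suc k"] lam[of "Suc k" "Suc k"] k by simp
  next
    fix \<mu>
    obtain n' where n': "N \<le> n'" "Re \<mu> < x n'" using x_unbounded by blast
    define n where "n = n' - N"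
    have n: "Re \<mu> < x (N + n)" using n' by (simp add: n_def)
    show "\<exists>B. finite B \<and> root_space m V \<mu> \<subseteq> coeffs.span B" using Dn_mult[OF n] by blast
    have eq: "{k. 1 \<le> k \<and> lam k = \<mu>} = Suc ` {i. i < length (Dn n) \<and> Dn n ! i = \<mu>}"
    proof (intro equalityI subsetI)
      fix k assume "k \<in> {k. 1 \<le> k \<and> lam k = \<mu>}"
      hence k: "1 \<le> k" "lam k = \<mu>" by auto
      have "k - 1 < 2 * (N + n)"
      proof (rule ccontr)
        assume "\<not> ?thesis"
        hence "x (N + n) < Re (Dn k ! (k - 1))" using k by (intro Dn_later) auto
        thus False using n k by (simp add: lam_def)
      qed
      thus "k \<in> Suc ` {i. i < length (Dn n) \<and> Dn n ! i = \<mu>}"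
        using lam[of k n] k Dn_length[of n] by (intro image_eqI[of _ _ "k - 1"]) auto
    next
      fix k assume "k \<in> Suc ` {i. i < length (Dn n) \<and> Dn n ! i = \<mu>}"
      thus "k \<in> {k. 1 \<le> k \<and> lam k = \<mu>}" using lam[of k n] Dn_length[of n] by auto
    qed
    show "finite {k. 1 \<le> k \<and> lam k = \<mu>}" unfolding eq by simp
    have "card {k. 1 \<le> k \<and> lam k = \<mu>} = length (filter (\<lambda>y. y = \<mu>) (Dn n))"
      unfolding eq length_filter_conv_card by (simp add: card_image)
    also have "length (filter (\<lambda>y. y = \<mu>) ys) = count (mset ys) \<mu>" for ys
      by (induction ys) auto
    finally show "card {k. 1 \<le> k \<and> lam k = \<mu>} = coeffs.dim (root_space m V \<mu>)"
      using Dn_mult[OF n] by simp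
  qed
qed

context
  fixes lam :: "nat \<Rightarrow> complex"
  assumes seq: "eigenvalue_sequence m V lam"
begin

lemma lam_Re_mono:
  assumes "1 \<le> j" "j \<le> k"
  shows "Re (lam j) \<le> Re (lam k)"
  using assms(2,1)
proof (induction k rule: dec_induct)
  case (step k)
  moreover have "lex_le (lam k) (lam (Suc k))" using seq step by (auto simp: eigenvalue_sequence_def)
  ultimately show ?case by (auto simp: lex_le_def)
qed simp

lemma lam_fiber: "finite {k. 1 \<le> k \<and> lam k = \<mu>}"
  "card {k. 1 \<le> k \<and> lam k = \<mu>} = coeffs.dim (root_space m V \<mu>)"
  using seq by (auto simp: eigenvalue_sequence_def)

text \<open>Concerns an arbitrary eigenvalue sequence, because the one selected by choice is
  unknown. The multiplicities to the left of a line add up to \<open>2 * (N + n)\<close>, and as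
  real parts increase weakly, the indices involved form an initial segment.\<close>

lemma lam_initial: "{k. 1 \<le> k \<and> Re (lam k) < x (N + n)} = {1..2 * (N + n)}"
proof -
  let ?A = "{k. 1 \<le> k \<and> Re (lam k) < x (N + n)}" and ?D = "Dn n"
  have A: "?A = (\<Union>\<mu>\<in>set ?D. {k. 1 \<le> k \<and> lam k = \<mu>})"
  proof (intro equalityI subsetI)
    fix k assume k: "k \<in> ?A"
    hence "0 < card {j. 1 \<le> j \<and> lam j = lam k}" using lam_fiber(1)[of "lam k"] by (auto simp: card_gt_0_iff)
    hence "0 < count (mset ?D) (lam k)" using k lam_fiber(2)[of "lam k"] Dn_mult[of "lam k" n] by simp
    thus "k \<in> (\<Union>\<mu>\<in>set ?D. {k. 1 \<le> k \<and> lam k = \<mu>})" using k by auto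
  qed (use Dn_Re in auto)
  have fin: "finite ?A" unfolding A using lam_fiber(1) by blast
  have "card ?A = (\<Sum>\<mu>\<in>set ?D. card {k. 1 \<le> k \<and> lam k = \<mu>})"
    unfolding A by (rule card_UN_disjoint) (use lam_fiber(1) in auto)
  also have "\<dots> = (\<Sum>\<mu>\<in>set ?D. count (mset ?D) \<mu>)"
    by (intro sum.cong) (use Dn_mult Dn_Re lam_fiber(2) in auto)
  also have "\<dots> = 2 * (N + n)"
    using size_multiset_overloaded_eq[of "mset ?D"] Dn_length[of n] by simp
  finally have card: "card ?A = 2 * (N + n)" .
  have "?A = {1..card ?A}"
  proof (rule card_positive_initial_segment[OF fin])
    fix k j assume "k \<in> ?A" "1 \<le> j" "j \<le> k"
    thus "j \<in> ?A" using lam_Re_mono[of j k] by simp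
  qed simp
  thus ?thesis unfolding card .
qed

lemma lam_low: "1 \<le> k \<Longrightarrow> k \<le> 2 * N \<Longrightarrow> lam k \<in> set D0"
proof -
  assume k: "1 \<le> k" "k \<le> 2 * N"
  hence "k \<in> {1..2 * (N + 0)}" by simp
  hence "k \<in> {k. 1 \<le> k \<and> Re (lam k) < x (N + 0)}" by (simp only: lam_initial)
  hence "Re (lam k) < x N" by simp
  hence "card {j. 1 \<le> j \<and> lam j = lam k} = count (mset D0) (lam k)"
    using lam_fiber(2)[of "lam k"] D0_mult[of "lam k"] by simp
  moreover have "0 < card {j. 1 \<le> j \<and> lam j = lam k}"
    using lam_fiber(1)[of "lam k"] k by (auto simp: card_gt_0_iff)
  ultimately have "0 < count (mset D0) (lam k)" by (simp only:)
  thus ?thesis by simp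
qed

text \<open>Consecutive initial segments differ by the indices \<open>2 * n - 1\<close> and
  \<open>2 * n\<close>, which must therefore carry all multiplicities of the strip.\<close>

lemma lam_pair: "N < n \<Longrightarrow> mset [lam (2 * n - 1), lam (2 * n)] = mset (P n)"
proof (rule multiset_eqI)
  fix \<mu>
  assume n: "N < n"
  have strip: "1 \<le> k \<and> x (n - 1) \<le> Re (lam k) \<and> Re (lam k) < x n \<longleftrightarrow> k = 2 * n - 1 \<or> k = 2 * n" for k
  proof -
    have a: "1 \<le> k \<and> Re (lam k) < x n \<longleftrightarrow> 1 \<le> k \<and> k \<le> 2 * n"
      using lam_initial[of "n - N"] n by (auto simp: set_eq_iff)
    have b: "1 \<le> k \<and> Re (lam k) < x (n - 1) \<longleftrightarrow> 1 \<le> k \<and> k \<le> 2 * (n - 1)"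
      using lam_initial[of "n - 1 - N"] n by (auto simp: set_eq_iff)
    have c: "x (n - 1) \<le> Re (lam k) \<longleftrightarrow> \<not> Re (lam k) < x (n - 1)" by auto
    have d: "1 \<le> k \<and> k \<le> 2 * n \<and> \<not> k \<le> 2 * (n - 1) \<longleftrightarrow> k = 2 * n - 1 \<or> k = 2 * n"
      using n by arith
    show ?thesis using a b c d by blast
  qed
  show "count (mset [lam (2 * n - 1), lam (2 * n)]) \<mu> = count (mset (P n)) \<mu>"
  proof (cases "x (n - 1) \<le> Re \<mu> \<and> Re \<mu> < x n")
    case True
    have "{k. 1 \<le> k \<and> lam k = \<mu>} = {k \<in> {2 * n - 1, 2 * n}. lam k = \<mu>}"
      using strip True by auto
    hence "count (mset (P n)) \<mu> = card {k \<in> {2 * n - 1, 2 * n}. lam k = \<mu>}"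
      using lam_fiber(2)[of \<mu>] P_mult[OF n, of \<mu>] True by simp
    also have "\<dots> = (\<Sum>k\<in>{2 * n - 1, 2 * n}. if lam k = \<mu> then 1 else 0)"
      unfolding card_eq_sum by (rule sum.inter_filter) simp
    also have "\<dots> = count (mset [lam (2 * n - 1), lam (2 * n)]) \<mu>"
      using n by auto
    finally show ?thesis ..
  next
    case False
    have "\<mu> \<noteq> lam (2 * n - 1)" "\<mu> \<noteq> lam (2 * n)"
      using strip[of "2 * n - 1"] strip[of "2 * n"] False by auto
    moreover have "\<mu> \<notin> set (P n)" using P_Re[OF n, of \<mu>] False by auto
    ultimately show ?thesis by (simp add: count_eq_zero_iff)
  qed
qed

end

lemma eigval_blocks:
  "N < n \<Longrightarrow> mset [eigval m V (2 * n - 1), eigval m V (2 * n)] = mset (P n)"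
  "1 \<le> k \<Longrightarrow> k \<le> 2 * N \<Longrightarrow> eigval m V k \<in> set D0"
proof -
  have seq: "eigenvalue_sequence m V (eigval m V)"
    unfolding eigval_def by (rule someI_ex[OF eigenvalue_sequence_exists])
  show "N < n \<Longrightarrow> mset [eigval m V (2 * n - 1), eigval m V (2 * n)] = mset (P n)"
    by (rule lam_pair[OF seq])
  show "1 \<le> k \<Longrightarrow> k \<le> 2 * N \<Longrightarrow> eigval m V k \<in> set D0"
    by (rule lam_low[OF seq])
qed

end

section \<open>Localization of the spectrum\<close>

lemma power_gap:
  fixes a b :: real
  assumes "0 \<le> b" "b \<le> a" "1 \<le> p"
  shows "(a - b) * a ^ (p - 1) \<le> a ^ p - b ^ p"
proof -
  obtain q where p: "p = Suc q" using assms(3) by (metis Suc_diff_1 less_eq_Suc_le One_nat_def)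
  have "b * b ^ q \<le> b * a ^ q" using assms by (intro mult_left_mono power_mono) auto
  thus ?thesis by (simp add: p algebra_simps)
qed

lemma lam0_real: "lam0 m j = of_real (pi ^ (2 * m) * \<bar>real_of_int j\<bar> ^ (2 * m))"
  by (simp add: lam0_def power_even_abs mult.commute)

lemma lam0_minus [simp]: "lam0 m (- j) = lam0 m j"
  by (simp add: lam0_def)

lemma pi_power_ge:
  assumes "1 \<le> m"
  shows "2 ^ (2 * m) \<le> pi ^ (2 * m)" "4 \<le> pi ^ (2 * m)"
proof -
  show 1: "2 ^ (2 * m) \<le> pi ^ (2 * m)" using pi_ge_two by (intro power_mono) auto
  have "(2::real) ^ 2 \<le> 2 ^ (2 * m)" using assms by (intro power_increasing) auto
  thus "4 \<le> pi ^ (2 * m)" using 1 by simp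
qed

text \<open>The factor 4 gained from \<open>pi ^ (2 * m)\<close> is the slack that pays for disks of
  a quarter of the weight around diagonal entries and for moving from such an entry to a separating
  line.\<close>

lemma pi_power_gap:
  assumes "1 \<le> m" "0 \<le> b" "b \<le> a"
  shows "4 * ((a - b) * a ^ (2 * m - 1)) \<le> pi ^ (2 * m) * a ^ (2 * m) - pi ^ (2 * m) * b ^ (2 * m)"
proof -
  have "4 * ((a - b) * a ^ (2 * m - 1)) \<le> pi ^ (2 * m) * (a ^ (2 * m) - b ^ (2 * m))"
    using power_gap[OF assms(2,3), of "2 * m"] pi_power_ge(2)[OF assms(1)] assms by (intro mult_mono) auto
  thus ?thesis by (simp add: right_diff_distrib)
qed

lemma lam0_gap:
  assumes "1 \<le> m" "\<bar>j\<bar> \<le> \<bar>i\<bar>"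
  shows "(\<bar>real_of_int i\<bar> - \<bar>real_of_int j\<bar>) * \<bar>real_of_int i\<bar> ^ (2 * m - 1) \<le> cmod (lam0 m i - lam0 m j)"
proof -
  have ij: "\<bar>real_of_int j\<bar> \<le> \<bar>real_of_int i\<bar>" using assms(2) by linarith
  have "0 \<le> (\<bar>real_of_int i\<bar> - \<bar>real_of_int j\<bar>) * \<bar>real_of_int i\<bar> ^ (2 * m - 1)" using ij by simp
  hence "(\<bar>real_of_int i\<bar> - \<bar>real_of_int j\<bar>) * \<bar>real_of_int i\<bar> ^ (2 * m - 1)
      \<le> \<bar>pi ^ (2 * m) * \<bar>real_of_int i\<bar> ^ (2 * m) - pi ^ (2 * m) * \<bar>real_of_int j\<bar> ^ (2 * m)\<bar>"
    using pi_power_gap[OF assms(1) abs_ge_zero ij] by linarith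
  thus ?thesis unfolding lam0_real by (simp only: norm_of_real flip: of_real_diff)
qed

lemma weight_ge_t:
  assumes "t \<le> \<bar>i\<bar>"
  shows "weight m t i = max 1 (\<bar>real_of_int i\<bar> - real_of_int t) * \<bar>real_of_int i\<bar> ^ (2 * m - 1)"
proof -
  have "real_of_int t \<le> \<bar>real_of_int i\<bar>" using assms by linarith
  thus ?thesis by (simp add: weight_def max_absorb1)
qed

lemma weight_le_t:
  assumes "\<bar>i\<bar> \<le> t"
  shows "weight m t i = max 1 (real_of_int t - \<bar>real_of_int i\<bar>) * real_of_int t ^ (2 * m - 1)"
proof -
  have "\<bar>real_of_int i\<bar> \<le> real_of_int t" using assms by linarith
  thus ?thesis by (simp add: weight_def max_absorb2)
qed

lemma weight_diag: "weight m k k = \<bar>real_of_int k\<bar> ^ (2 * m - 1)" "weight m k (- k) = \<bar>real_of_int k\<bar> ^ (2 * m - 1)"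
  if "1 \<le> k"
  using that by (simp_all add: weight_def)

text \<open>The diagonal entry that the even frequency \<open>2 * n\<close> would have; it separates
  the odd frequencies \<open>2 * n - 1\<close> and \<open>2 * n + 1\<close>.\<close>

definition cut :: "nat \<Rightarrow> nat \<Rightarrow> real" where
  "cut m n = pi ^ (2 * m) * (2 * real n) ^ (2 * m)"

lemma cut_step: "1 \<le> m \<Longrightarrow> cut m n < cut m (Suc n)"
  unfolding cut_def by (intro mult_strict_left_mono power_strict_mono) auto

lemma cut_unbounded:
  assumes "1 \<le> m"
  shows "\<exists>n\<ge>N. c < cut m n"
proof -
  obtain n0 where n0: "c < real n0" using reals_Archimedean2 by blast
  define n where "n = max N (max 1 n0)"
  have n: "N \<le> n" "1 \<le> n" "c < real n" using n0 by (auto simp: n_def)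
  have "real n \<le> 2 * real n" by simp
  also have "\<dots> = (2 * real n) ^ 1" by simp
  also have "\<dots> \<le> (2 * real n) ^ (2 * m)" using n(2) assms by (intro power_increasing) auto
  also have "\<dots> \<le> cut m n"
    unfolding cut_def using pi_power_ge(2)[OF assms] mult_right_mono[of 1 "pi ^ (2 * m)" "(2 * real n) ^ (2 * m)"] by simp
  finally show ?thesis using n by force
qed

lemma Re_gap: "\<bar>Re (lam0 m i) - Re \<mu>\<bar> \<le> cmod (lam0 m i - \<mu>)"
  using abs_Re_le_cmod[of "lam0 m i - \<mu>"] by simp

lemma Re_lam0: "Re (lam0 m i) = pi ^ (2 * m) * \<bar>real_of_int i\<bar> ^ (2 * m)"
  by (simp only: lam0_real Re_complex_of_real)

text \<open>The even centre \<open>2 * N\<close> has distance at least 1 from every odd frequency.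
  So the \<open>max 1\<close> in the weight is inactive, and the centre lies between the moduli of
  the two groups of indices.\<close>

lemma low_block_gap:
  assumes m: "1 \<le> m" and N: "1 \<le> N" and i: "odd i" "\<not> \<bar>i\<bar> < 2 * int N" and j: "odd j" "\<bar>j\<bar> < 2 * int N"
  shows "weight m (2 * int N) i \<le> cmod (lam0 m i - lam0 m j)"
    and "weight m (2 * int N) j \<le> cmod (lam0 m i - lam0 m j)"
proof -
  define a b t where "a = \<bar>real_of_int i\<bar>" and "b = \<bar>real_of_int j\<bar>" and "t = real_of_int (2 * int N)"
  have "\<bar>i\<bar> \<noteq> 2 * int N" "\<bar>j\<bar> \<noteq> 2 * int N" using i(1) j(1) by (metis dvd_abs_iff dvd_triv_left)+
  hence it: "2 * int N + 1 \<le> \<bar>i\<bar>" and jt: "\<bar>j\<bar> + 1 \<le> 2 * int N" using i j by auto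
  hence ab: "t + 1 \<le> a" "b + 1 \<le> t" "0 \<le> b" unfolding a_def b_def t_def by linarith+
  have g: "(a - b) * a ^ (2 * m - 1) \<le> cmod (lam0 m i - lam0 m j)"
    unfolding a_def b_def by (rule lam0_gap[OF m]) (use it jt in auto)
  have "weight m (2 * int N) i = (a - t) * a ^ (2 * m - 1)"
    using weight_ge_t[of "2 * int N" i m] it ab by (simp add: a_def t_def)
  also have "\<dots> \<le> (a - b) * a ^ (2 * m - 1)" using ab by (intro mult_right_mono) auto
  finally show "weight m (2 * int N) i \<le> cmod (lam0 m i - lam0 m j)" using g by simp
  have "weight m (2 * int N) j = (t - b) * t ^ (2 * m - 1)"
    using weight_le_t[of j "2 * int N" m] jt ab by (simp add: b_def t_def)
  also have "\<dots> \<le> (a - b) * a ^ (2 * m - 1)" using ab by (intro mult_mono power_mono) auto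
  finally show "weight m (2 * int N) j \<le> cmod (lam0 m i - lam0 m j)" using g by simp
qed

lemma low_block_good:
  assumes m: "1 \<le> m" and N: "1 \<le> N" and i: "odd i" "\<not> \<bar>i\<bar> < 2 * int N" and \<mu>: "Re \<mu> \<le> cut m N"
  shows "weight m (2 * int N) i \<le> cmod (lam0 m i - \<mu>)"
proof -
  define a t where "a = \<bar>real_of_int i\<bar>" and "t = real_of_int (2 * int N)"
  have "\<bar>i\<bar> \<noteq> 2 * int N" using i(1) by (metis dvd_abs_iff dvd_triv_left)
  hence it: "2 * int N + 1 \<le> \<bar>i\<bar>" using i by auto
  hence ab: "t + 1 \<le> a" "0 \<le> t" unfolding a_def t_def by linarith+
  have g: "4 * ((a - t) * a ^ (2 * m - 1)) \<le> pi ^ (2 * m) * a ^ (2 * m) - pi ^ (2 * m) * t ^ (2 * m)"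
    by (rule pi_power_gap[OF m]) (use ab in auto)
  have w: "weight m (2 * int N) i = (a - t) * a ^ (2 * m - 1)"
    using weight_ge_t[of "2 * int N" i m] it ab by (simp add: a_def t_def)
  have "0 \<le> (a - t) * a ^ (2 * m - 1)" using ab by simp
  thus ?thesis using g w Re_gap[of m i \<mu>] \<mu> unfolding Re_lam0 cut_def a_def t_def by simp
qed

lemma low_block_Re:
  assumes m: "1 \<le> m" and j: "odd j" "\<bar>j\<bar> < 2 * int N" and d: "cmod (lam0 m j - d) < weight m (2 * int N) j / 4"
  shows "Re d < cut m N"
proof -
  define b t where "b = \<bar>real_of_int j\<bar>" and "t = real_of_int (2 * int N)"
  have bt: "b + 1 \<le> t" "0 \<le> b" using j unfolding b_def t_def by linarith+
  have g: "4 * ((t - b) * t ^ (2 * m - 1)) \<le> pi ^ (2 * m) * t ^ (2 * m) - pi ^ (2 * m) * b ^ (2 * m)"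
    by (rule pi_power_gap[OF m]) (use bt in auto)
  have w: "weight m (2 * int N) j = (t - b) * t ^ (2 * m - 1)"
    using weight_le_t[of j "2 * int N" m] j bt by (simp add: b_def t_def)
  have w0: "0 \<le> (t - b) * t ^ (2 * m - 1)" using bt by simp
  have tN: "2 * real N = t" by (simp add: t_def)
  show ?thesis using g w w0 Re_gap[of m j d] d unfolding Re_lam0 cut_def b_def[symmetric] tN by linarith
qed

lemma odd_abs_neq_gap:
  fixes i k :: int
  assumes "odd i" "odd k" "1 \<le> k" "i \<noteq> k" "i \<noteq> - k"
  shows "k + 2 \<le> \<bar>i\<bar> \<or> \<bar>i\<bar> + 2 \<le> k"
proof -
  have "\<bar>i\<bar> \<noteq> k + 1" "\<bar>i\<bar> + 1 \<noteq> k" "\<bar>i\<bar> \<noteq> k"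
    using assms by (auto simp: abs_if split: if_splits) presburger+
  thus ?thesis by arith
qed

lemma pair_gap:
  assumes m: "1 \<le> m" and k: "odd k" "1 \<le> k" and i: "odd i" "i \<noteq> k" "i \<noteq> - k"
  shows "weight m k i \<le> cmod (lam0 m i - lam0 m k)" "weight m k k \<le> cmod (lam0 m i - lam0 m k)"
proof -
  define a t where "a = \<bar>real_of_int i\<bar>" and "t = real_of_int k"
  have t: "1 \<le> t" "\<bar>real_of_int k\<bar> = t" using k(2) by (auto simp: t_def)
  have wd: "weight m k k = t ^ (2 * m - 1)" using weight_diag(1)[OF k(2), of m] t by simp
  from odd_abs_neq_gap[OF i(1) k(1,2) i(2,3)]
  have "weight m k i \<le> cmod (lam0 m i - lam0 m k) \<and> weight m k k \<le> cmod (lam0 m i - lam0 m k)"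
  proof
    assume h: "k + 2 \<le> \<bar>i\<bar>"
    hence ab: "t + 2 \<le> a" unfolding a_def t_def by linarith
    have g: "(a - t) * a ^ (2 * m - 1) \<le> cmod (lam0 m i - lam0 m k)"
      using lam0_gap[OF m, of k i] h k t by (simp add: a_def)
    have "weight m k i = (a - t) * a ^ (2 * m - 1)"
      using weight_ge_t[of k i m] h ab by (simp add: a_def t_def)
    moreover have "1 * t ^ (2 * m - 1) \<le> (a - t) * a ^ (2 * m - 1)"
      using ab t by (intro mult_mono power_mono) auto
    ultimately show ?thesis using g wd by linarith
  next
    assume h: "\<bar>i\<bar> + 2 \<le> k"
    hence ab: "a + 2 \<le> t" unfolding a_def t_def by linarith
    have g: "(t - a) * t ^ (2 * m - 1) \<le> cmod (lam0 m i - lam0 m k)"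
      using lam0_gap[OF m, of i k] h k t by (simp add: a_def norm_minus_commute)
    have "weight m k i = (t - a) * t ^ (2 * m - 1)"
      using weight_le_t[of i k m] h ab by (simp add: a_def t_def)
    moreover have "1 * t ^ (2 * m - 1) \<le> (t - a) * t ^ (2 * m - 1)"
      using ab t by (intro mult_right_mono) auto
    ultimately show ?thesis using g wd by linarith
  qed
  thus "weight m k i \<le> cmod (lam0 m i - lam0 m k)" "weight m k k \<le> cmod (lam0 m i - lam0 m k)" by auto
qed

text \<open>Outside, the slack 4 absorbs the shift from \<open>k\<close> to the line at
  \<open>k + 1\<close>, since \<open>a - t \<le> 4 * (a - (t + 1))\<close> for
  \<open>a \<ge> t + 2\<close>. Inside, passing from \<open>t\<close> to \<open>t - 1\<close> costs
  at most a factor 2 in the distance and in each factor of the power, which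
  \<open>pi ^ (2 * m) \<ge> 2 ^ (2 * m)\<close> absorbs; this uses \<open>t \<ge> 3\<close>, hence
  \<open>2 \<le> n\<close>.\<close>

lemma pair_good:
  assumes m: "1 \<le> m" and n: "2 \<le> n" and k: "k = 2 * int n - 1" and i: "odd i" "i \<noteq> k" "i \<noteq> - k"
    and \<mu>: "cut m (n - 1) \<le> Re \<mu>" "Re \<mu> \<le> cut m n"
  shows "weight m k i \<le> cmod (lam0 m i - \<mu>)"
proof -
  define a t where "a = \<bar>real_of_int i\<bar>" and "t = real_of_int k"
  have k': "odd k" "1 \<le> k" using n by (auto simp: k)
  have t: "3 \<le> t" using n by (simp add: t_def k)
  have tn: "2 * real n = t + 1" "2 * real (n - 1) = t - 1" using n by (auto simp: t_def k of_nat_diff)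
  from odd_abs_neq_gap[OF i(1) k' i(2,3)] show ?thesis
  proof
    assume h: "k + 2 \<le> \<bar>i\<bar>"
    hence ab: "t + 2 \<le> a" unfolding a_def t_def by linarith
    have "4 * ((a - (t + 1)) * a ^ (2 * m - 1)) \<le> pi ^ (2 * m) * a ^ (2 * m) - pi ^ (2 * m) * (t + 1) ^ (2 * m)"
      by (rule pi_power_gap[OF m]) (use ab t in auto)
    moreover have "(a - t) * a ^ (2 * m - 1) \<le> (4 * (a - (t + 1))) * a ^ (2 * m - 1)"
      using ab t by (intro mult_right_mono) auto
    moreover have "weight m k i = (a - t) * a ^ (2 * m - 1)"
      using weight_ge_t[of k i m] h ab by (simp add: a_def t_def)
    moreover have "Re \<mu> \<le> pi ^ (2 * m) * (t + 1) ^ (2 * m)" using \<mu>(2) unfolding cut_def tn .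
    ultimately show ?thesis using Re_gap[of m i \<mu>] unfolding Re_lam0 a_def by linarith
  next
    assume h: "\<bar>i\<bar> + 2 \<le> k"
    hence ab: "a + 2 \<le> t" unfolding a_def t_def by linarith
    have a0: "0 \<le> a" by (simp add: a_def)
    have "(t - a) * t ^ (2 * m - 1) \<le> (2 * (t - 1 - a)) * (2 * (t - 1)) ^ (2 * m - 1)"
      using ab t by (intro mult_mono power_mono) auto
    also have "\<dots> = (2 * 2 ^ (2 * m - 1)) * ((t - 1 - a) * (t - 1) ^ (2 * m - 1))"
      by (simp only: power_mult_distrib mult_ac)
    also have "2 * 2 ^ (2 * m - 1) = (2::real) ^ (2 * m)" using m by (simp flip: power_Suc)
    also have "2 ^ (2 * m) * ((t - 1 - a) * (t - 1) ^ (2 * m - 1)) \<le> pi ^ (2 * m) * ((t - 1) ^ (2 * m) - a ^ (2 * m))"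
      using ab t a0 m by (intro mult_mono pi_power_ge power_gap) auto
    finally have "(t - a) * t ^ (2 * m - 1) \<le> pi ^ (2 * m) * (t - 1) ^ (2 * m) - pi ^ (2 * m) * a ^ (2 * m)"
      by (simp add: right_diff_distrib)
    moreover have "weight m k i = (t - a) * t ^ (2 * m - 1)"
      using weight_le_t[of i k m] h ab by (simp add: a_def t_def)
    moreover have "pi ^ (2 * m) * (t - 1) ^ (2 * m) \<le> Re \<mu>" using \<mu>(1) unfolding cut_def tn .
    ultimately show ?thesis using Re_gap[of m i \<mu>] unfolding Re_lam0 a_def by linarith
  qed
qed

lemma pair_Re:
  assumes m: "1 \<le> m" and n: "1 \<le> n" and k: "k = 2 * int n - 1" and d: "cmod (lam0 m k - d) < weight m k k / 4"
  shows "cut m (n - 1) < Re d" "Re d < cut m n"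
proof -
  define t where "t = real_of_int k"
  have t: "1 \<le> t" "\<bar>real_of_int k\<bar> = t" using n by (auto simp: t_def k)
  have tn: "2 * real n = t + 1" "2 * real (n - 1) = t - 1" using n by (auto simp: t_def k of_nat_diff)
  have w: "weight m k k = t ^ (2 * m - 1)" using weight_diag(1)[of k m] t by (simp add: t_def)
  have t0: "0 < t ^ (2 * m - 1)" using t by simp
  have 1: "4 * (((t + 1) - t) * (t + 1) ^ (2 * m - 1)) \<le> pi ^ (2 * m) * (t + 1) ^ (2 * m) - pi ^ (2 * m) * t ^ (2 * m)"
    by (rule pi_power_gap[OF m]) (use t in auto)
  have 2: "4 * ((t - (t - 1)) * t ^ (2 * m - 1)) \<le> pi ^ (2 * m) * t ^ (2 * m) - pi ^ (2 * m) * (t - 1) ^ (2 * m)"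
    by (rule pi_power_gap[OF m]) (use t in auto)
  have 3: "t ^ (2 * m - 1) \<le> (t + 1) ^ (2 * m - 1)" using t by (intro power_mono) auto
  show "cut m (n - 1) < Re d"
    using 2 Re_gap[of m k d] d t0 unfolding Re_lam0 w t(2) cut_def tn by simp
  show "Re d < cut m n"
    using 1 3 Re_gap[of m k d] d t0 unfolding Re_lam0 w t(2) cut_def tn by simp
qed

section \<open>Second-order sums and the effective matrix of a pair\<close>

definition second_order :: "nat \<Rightarrow> (int \<Rightarrow> complex) \<Rightarrow> int \<Rightarrow> int \<Rightarrow> int \<Rightarrow> complex" where
  "second_order m V k i j =
     (\<Sum>\<^sub>\<infinity>l\<in>{l. odd l} - {k, - k}. V (i - l) * V (l - j) / (lam0 m l - lam0 m k))"

text \<open>The deviations of the diagonal entries from \<open>lam0 m k + V 0\<close> and of the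
  others from \<open>V (2 k)\<close> and \<open>V (- 2 k)\<close>, bounded twice: as they stand, and
  after the second-order sum is added. The factor \<open>k ^ (2 * m - 1)\<close> is the weight at
  \<open>k\<close> and at \<open>- k\<close>.\<close>

definition effective_entries ::
  "nat \<Rightarrow> (int \<Rightarrow> complex) \<Rightarrow> real \<Rightarrow> real \<Rightarrow> int \<Rightarrow> complex \<Rightarrow> complex \<Rightarrow> complex \<Rightarrow> complex \<Rightarrow> bool" where
  "effective_entries m V \<delta> \<tau> k a1 a2 b1 b2 \<longleftrightarrow>
     (\<forall>c\<in>{a1, a2, b1, b2}. cmod c \<le> real_of_int k ^ (2 * m - 1) * (2 * \<tau>\<^sup>2)) \<and>
     cmod (a1 + second_order m V k k k) \<le> real_of_int k ^ (2 * m - 1) * (5 * \<delta> * \<tau>\<^sup>2) \<and>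
     cmod (a2 + second_order m V k (- k) (- k)) \<le> real_of_int k ^ (2 * m - 1) * (5 * \<delta> * \<tau>\<^sup>2) \<and>
     cmod (b1 + second_order m V k k (- k)) \<le> real_of_int k ^ (2 * m - 1) * (5 * \<delta> * \<tau>\<^sup>2) \<and>
     cmod (b2 + second_order m V k (- k) k) \<le> real_of_int k ^ (2 * m - 1) * (5 * \<delta> * \<tau>\<^sup>2)"

text \<open>Bundles everything known about one pair, so that the lists and matrices can be chosen
  for all \<open>n\<close> at once.\<close>

definition pair_block ::
  "nat \<Rightarrow> (int \<Rightarrow> complex) \<Rightarrow> real \<Rightarrow> real \<Rightarrow> nat \<Rightarrow> int \<Rightarrow> complex list \<Rightarrow> (int \<Rightarrow> int \<Rightarrow> complex) \<Rightarrow> bool" where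
  "pair_block m V \<delta> \<tau> n k ds M \<longleftrightarrow> length ds = 2 \<and>
      (\<forall>\<mu>. cut m (n - 1) \<le> Re \<mu> \<longrightarrow> Re \<mu> \<le> cut m n \<longrightarrow> (\<exists>B. finite B \<and> root_space m V \<mu> \<subseteq> coeffs.span B) \<and>
         coeffs.dim (root_space m V \<mu>) = count (mset ds) \<mu>) \<and>
      (\<forall>d\<in>set ds. cut m (n - 1) < Re d \<and> Re d < cut m n) \<and>
      (\<forall>i\<in>{k, - k}. \<forall>j\<in>{k, - k}.
         cmod (M i j - (if i = j then lam0 m j else 0) - V (i - j)) \<le> real_of_int k ^ (2 * m - 1) * (2 * \<tau>\<^sup>2) \<and>
         cmod (M i j - (if i = j then lam0 m j else 0) - V (i - j) + second_order m V k i j)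
           \<le> real_of_int k ^ (2 * m - 1) * (5 * \<delta> * \<tau>\<^sup>2)) \<and>
      (\<exists>d e. ds = [d, e] \<and> d + e = M k k + M (- k) (- k)
         \<and> d * e = M k k * M (- k) (- k) - M k (- k) * M (- k) k)"

lemma card_low_block: "card {j. odd j \<and> \<bar>j\<bar> < 2 * int N} = 2 * N" and finite_low_block: "finite {j. odd j \<and> \<bar>j\<bar> < 2 * int N}"
proof -
  have eq: "{j. odd j \<and> \<bar>j\<bar> < 2 * int N} = (\<lambda>a. 2 * int a + 1 - 2 * int N) ` {..<2 * N}"
  proof (intro equalityI subsetI)
    fix j assume "j \<in> {j. odd j \<and> \<bar>j\<bar> < 2 * int N}"
    hence "odd j" "\<bar>j\<bar> < 2 * int N" by auto
    then obtain b where b: "j = 2 * b + 1" by (elim oddE)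
    show "j \<in> (\<lambda>a. 2 * int a + 1 - 2 * int N) ` {..<2 * N}"
      by (rule image_eqI[of _ _ "nat (b + int N)"]) (use b \<open>\<bar>j\<bar> < 2 * int N\<close> in auto)
  qed auto
  show "card {j. odd j \<and> \<bar>j\<bar> < 2 * int N} = 2 * N" unfolding eq by (subst card_image) (auto simp: inj_on_def)
  show "finite {j. odd j \<and> \<bar>j\<bar> < 2 * int N}" unfolding eq by simp
qed

text \<open>The low block uses the even centre \<open>2 * N\<close>, each pair its own odd centre.
  The shifts \<open>e\<close> and \<open>f\<close> are described by their sum and product only: the
  order within a pair is lexicographic and bears no relation to the order of the roots delivered by
  the matrix.\<close>

theorem spectral_structure:
  fixes m N :: nat and V :: "int \<Rightarrow> complex" and \<delta> \<tau> :: "nat \<Rightarrow> real"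
  assumes m: "1 \<le> m" and N: "1 \<le> N"
    and low: "l2_bounded (1 / 8) (\<lambda>(i, j). kmat m V (2 * int N) i j)"
    and K: "\<And>n. N < n \<Longrightarrow> l2_bounded (\<delta> n) (\<lambda>(i, j). kmat m V (2 * int n - 1) i j)"
    and \<delta>: "\<And>n. N < n \<Longrightarrow> \<delta> n \<le> 1 / 8"
    and out_in: "\<And>n k. N < n \<Longrightarrow> k = 2 * int n - 1 \<Longrightarrow>
      l2_bounded (\<tau> n) (\<lambda>(i, j). if i \<in> {i. odd i} - {k, - k} \<and> j \<in> {k, - k} then kmat m V k i j else 0)"
    and in_out: "\<And>n k. N < n \<Longrightarrow> k = 2 * int n - 1 \<Longrightarrow>
      l2_bounded (\<tau> n) (\<lambda>(i, j). if i \<in> {k, - k} \<and> j \<in> {i. odd i} - {k, - k} then kmat m V k i j else 0)"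
    and \<tau>: "\<And>n. N < n \<Longrightarrow> \<tau> n \<le> \<delta> n"
  shows "\<And>k. 1 \<le> k \<Longrightarrow> k \<le> 2 * N \<Longrightarrow>
      \<exists>j. odd j \<and> \<bar>j\<bar> < 2 * int N \<and> cmod (lam0 m j - eigval m V k) < weight m (2 * int N) j / 4"
    and "\<And>n k. N < n \<Longrightarrow> k = 2 * int n - 1 \<Longrightarrow> \<exists>a1 a2 b1 b2 e f.
      effective_entries m V (\<delta> n) (\<tau> n) k a1 a2 b1 b2 \<and>
      eigval m V (2 * n - 1) = lam0 m k + V 0 + e \<and> eigval m V (2 * n) = lam0 m k + V 0 + f \<and>
      e + f = a1 + a2 \<and> e * f = a1 * a2 - (V (2 * k) + b1) * (V (- 2 * k) + b2)"
proof -
  let ?J0 = "{j. odd j \<and> \<bar>j\<bar> < 2 * int N}"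
  \<comment> \<open>For the low block the coupling bound is simply the full bound 1/8, because its
    eigenvalues are merely located.\<close>
  have sub: "l2_bounded (1 / 8) (\<lambda>(i, j). if P i j then kmat m V (2 * int N) i j else 0)" for P
    by (rule l2_bounded_mono[OF low]) auto
  obtain D0 where D0: "length D0 = card ?J0"
    "\<And>\<mu>. (\<And>i. odd i \<Longrightarrow> i \<notin> ?J0 \<Longrightarrow> weight m (2 * int N) i \<le> cmod (lam0 m i - \<mu>)) \<Longrightarrow>
       (\<exists>B. finite B \<and> root_space m V \<mu> \<subseteq> coeffs.span B) \<and>
       coeffs.dim (root_space m V \<mu>) = count (mset D0) \<mu>"
    "\<And>d. d \<in> set D0 \<Longrightarrow> \<exists>j\<in>?J0. cmod (lam0 m j - d) < weight m (2 * int N) j / 4"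
  proof (rule block_spectrum[OF m _ finite_low_block _ low _ _ sub sub])
    fix i j :: int assume ij: "odd i" "i \<notin> ?J0" "j \<in> ?J0"
    show "weight m (2 * int N) i \<le> cmod (lam0 m i - lam0 m j) \<and> weight m (2 * int N) j \<le> cmod (lam0 m i - lam0 m j)"
      using low_block_gap[OF m N ij(1), of j] ij by auto
  qed (use N in auto)
  have ex: "\<exists>ds M. pair_block m V (\<delta> n) (\<tau> n) n k ds M"
    if n: "N < n" and k: "k = 2 * int n - 1" for n k
  proof -
    have k': "odd k" "1 \<le> k" "k \<noteq> - k" using n N by (auto simp: k)
    have n2: "2 \<le> n" using n N by simp
    have sq: "sqrt (weight m k i * weight m k j) = real_of_int k ^ (2 * m - 1)" if "i \<in> {k, - k}" "j \<in> {k, - k}" for i j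
      using that weight_diag[OF k'(2), of m] k'(2) by auto
    obtain ds M where ds: "length ds = card {k, - k}"
      "\<And>\<mu>. (\<And>i. odd i \<Longrightarrow> i \<notin> {k, - k} \<Longrightarrow> weight m k i \<le> cmod (lam0 m i - \<mu>)) \<Longrightarrow>
         (\<exists>B. finite B \<and> root_space m V \<mu> \<subseteq> coeffs.span B) \<and>
         coeffs.dim (root_space m V \<mu>) = count (mset ds) \<mu>"
      "\<And>d. d \<in> set ds \<Longrightarrow> \<exists>j\<in>{k, - k}. cmod (lam0 m j - d) < weight m k j / 4"
      "\<And>i j. i \<in> {k, - k} \<Longrightarrow> j \<in> {k, - k} \<Longrightarrow> cmod (M i j - (if i = j then lam0 m j else 0) - V (i - j))
         \<le> sqrt (weight m k i * weight m k j) * (2 * (\<tau> n)\<^sup>2)"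
      "\<And>i j. i \<in> {k, - k} \<Longrightarrow> j \<in> {k, - k} \<Longrightarrow> cmod (M i j - (if i = j then lam0 m j else 0) - V (i - j)
           + (\<Sum>\<^sub>\<infinity>l\<in>{l. odd l} - {k, - k}. V (i - l) * V (l - j) / (lam0 m l - lam0 m j)))
         \<le> sqrt (weight m k i * weight m k j) * (5 * \<delta> n * (\<tau> n)\<^sup>2)"
      "\<And>k'. {k, - k} = {k', - k'} \<Longrightarrow> k' \<noteq> - k' \<Longrightarrow> \<exists>d e. ds = [d, e] \<and> d + e = M k' k' + M (- k') (- k')
         \<and> d * e = M k' k' * M (- k') (- k') - M k' (- k') * M (- k') k'"
    proof (rule block_spectrum[where J = "{k, - k}", OF m k'(2) _ _ K[OF n, folded k] \<delta>[OF n] _ out_in[OF n k] in_out[OF n k] \<tau>[OF n]])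
      fix i j :: int assume ij: "odd i" "i \<notin> {k, - k}" "j \<in> {k, - k}"
      show "weight m k i \<le> cmod (lam0 m i - lam0 m j) \<and> weight m k j \<le> cmod (lam0 m i - lam0 m j)"
        using pair_gap[OF m k'(1,2) ij(1)] ij weight_diag[OF k'(2), of m] by auto
    qed (use k' in auto)
    have so: "(\<Sum>\<^sub>\<infinity>l\<in>{l. odd l} - {k, - k}. V (i - l) * V (l - j) / (lam0 m l - lam0 m j)) = second_order m V k i j"
      if "j \<in> {k, - k}" for i j
      using that by (auto simp: second_order_def)
    show ?thesis unfolding pair_block_def
    proof (intro exI[of _ ds] exI[of _ M] conjI)
      show "length ds = 2" using ds(1) k'(3) by simp
      show "\<forall>\<mu>. cut m (n - 1) \<le> Re \<mu> \<longrightarrow> Re \<mu> \<le> cut m n \<longrightarrow> (\<exists>B. finite B \<and> root_space m V \<mu> \<subseteq> coeffs.span B) \<and>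
         coeffs.dim (root_space m V \<mu>) = count (mset ds) \<mu>"
        by (intro allI impI ds(2) pair_good[OF m n2 k]) auto
      show "\<forall>d\<in>set ds. cut m (n - 1) < Re d \<and> Re d < cut m n"
      proof
        fix d assume "d \<in> set ds"
        from ds(3)[OF this] have "cmod (lam0 m k - d) < weight m k k / 4"
          using weight_diag[OF k'(2), of m] by auto
        from pair_Re[OF m _ k this] n2 show "cut m (n - 1) < Re d \<and> Re d < cut m n" by simp
      qed
      show "\<exists>d e. ds = [d, e] \<and> d + e = M k k + M (- k) (- k)
         \<and> d * e = M k k * M (- k) (- k) - M k (- k) * M (- k) k"
        by (rule ds(6)) (use k' in auto)
      show "\<forall>i\<in>{k, - k}. \<forall>j\<in>{k, - k}.
         cmod (M i j - (if i = j then lam0 m j else 0) - V (i - j)) \<le> real_of_int k ^ (2 * m - 1) * (2 * (\<tau> n)\<^sup>2) \<and>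
         cmod (M i j - (if i = j then lam0 m j else 0) - V (i - j) + second_order m V k i j)
           \<le> real_of_int k ^ (2 * m - 1) * (5 * \<delta> n * (\<tau> n)\<^sup>2)"
      proof (intro ballI conjI)
        fix i j assume ij: "i \<in> {k, - k}" "j \<in> {k, - k}"
        show "cmod (M i j - (if i = j then lam0 m j else 0) - V (i - j)) \<le> real_of_int k ^ (2 * m - 1) * (2 * (\<tau> n)\<^sup>2)"
          using ds(4)[OF ij] unfolding sq[OF ij] .
        show "cmod (M i j - (if i = j then lam0 m j else 0) - V (i - j) + second_order m V k i j)
           \<le> real_of_int k ^ (2 * m - 1) * (5 * \<delta> n * (\<tau> n)\<^sup>2)"
          using ds(5)[OF ij] unfolding sq[OF ij] so[OF ij(2)] .
      qed
    qed
  qed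
  have "\<forall>n. \<exists>ds M. N < n \<longrightarrow> pair_block m V (\<delta> n) (\<tau> n) n (2 * int n - 1) ds M"
    using ex by blast
  then obtain P M where PM: "\<And>n. N < n \<Longrightarrow> pair_block m V (\<delta> n) (\<tau> n) n (2 * int n - 1) (P n) (M n)"
    by metis
  interpret spectral_blocks m V N "cut m" D0 P
  proof
    show "cut m n < cut m (Suc n)" for n by (rule cut_step[OF m])
    show "\<exists>n\<ge>N. c < cut m n" for c by (rule cut_unbounded[OF m])
    show "length D0 = 2 * N" using D0(1) card_low_block by simp
    show "Re d < cut m N" if "d \<in> set D0" for d
      using D0(3)[OF that] low_block_Re[OF m] by blast
    show "(\<exists>B. finite B \<and> root_space m V \<mu> \<subseteq> coeffs.span B) \<and> coeffs.dim (root_space m V \<mu>) = count (mset D0) \<mu>"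
      if "Re \<mu> \<le> cut m N" for \<mu>
      by (rule D0(2), rule low_block_good[OF m N _ _ that]) auto
    show "length (P n) = 2" if "N < n" for n using PM[OF that] unfolding pair_block_def by blast
    show "cut m (n - 1) < Re d \<and> Re d < cut m n" if "N < n" "d \<in> set (P n)" for n d
      using PM[OF that(1)] that(2) unfolding pair_block_def by blast
    show "(\<exists>B. finite B \<and> root_space m V \<mu> \<subseteq> coeffs.span B) \<and> coeffs.dim (root_space m V \<mu>) = count (mset (P n)) \<mu>"
      if "N < n" "cut m (n - 1) \<le> Re \<mu>" "Re \<mu> \<le> cut m n" for n \<mu>
      using PM[OF that(1)] that(2,3) unfolding pair_block_def by blast
  qed
  show "\<exists>j. odd j \<and> \<bar>j\<bar> < 2 * int N \<and> cmod (lam0 m j - eigval m V k) < weight m (2 * int N) j / 4"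
    if "1 \<le> k" "k \<le> 2 * N" for k
    using D0(3)[OF eigval_blocks(2)[OF that]] by blast
  show "\<exists>a1 a2 b1 b2 e f.
      effective_entries m V (\<delta> n) (\<tau> n) k a1 a2 b1 b2 \<and>
      eigval m V (2 * n - 1) = lam0 m k + V 0 + e \<and> eigval m V (2 * n) = lam0 m k + V 0 + f \<and>
      e + f = a1 + a2 \<and> e * f = a1 * a2 - (V (2 * k) + b1) * (V (- 2 * k) + b2)"
    if n: "N < n" and k: "k = 2 * int n - 1" for n k
  proof -
    have kk: "k \<noteq> - k" using n N by (auto simp: k)
    define l where "l = lam0 m k"
    define a1 a2 b1 b2 where "a1 = M n k k - l - V 0" and "a2 = M n (- k) (- k) - l - V 0"
      and "b1 = M n k (- k) - V (2 * k)" and "b2 = M n (- k) k - V (- 2 * k)"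
    have est: "cmod (M n i j - (if i = j then lam0 m j else 0) - V (i - j)) \<le> real_of_int k ^ (2 * m - 1) * (2 * (\<tau> n)\<^sup>2)"
         "cmod (M n i j - (if i = j then lam0 m j else 0) - V (i - j) + second_order m V k i j)
           \<le> real_of_int k ^ (2 * m - 1) * (5 * \<delta> n * (\<tau> n)\<^sup>2)" if "i \<in> {k, - k}" "j \<in> {k, - k}" for i j
      using PM[OF n, folded k] that unfolding pair_block_def by blast+
    have ee: "effective_entries m V (\<delta> n) (\<tau> n) k a1 a2 b1 b2"
      unfolding effective_entries_def a1_def a2_def b1_def b2_def l_def
      using est[of k k] est[of "-k" "-k"] est[of k "-k"] est[of "-k" k] kk by (simp add: algebra_simps)
    obtain d e where de: "P n = [d, e]" "d + e = M n k k + M n (- k) (- k)"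
         "d * e = M n k k * M n (- k) (- k) - M n k (- k) * M n (- k) k"
      using PM[OF n, folded k] unfolding pair_block_def by blast
    define x y where "x = eigval m V (2 * n - 1)" and "y = eigval m V (2 * n)"
    have "mset [x, y] = mset [d, e]" using eigval_blocks(1)[OF n] de(1) by (simp add: x_def y_def)
    hence "x = d \<and> y = e \<or> x = e \<and> y = d" by (auto simp: add_eq_conv_ex)
    hence "x + y = d + e" "x * y = d * e" by auto
    hence s: "x + y = a1 + a2 + 2 * (l + V 0)"
      and p: "x * y = (a1 + (l + V 0)) * (a2 + (l + V 0)) - (V (2 * k) + b1) * (V (- 2 * k) + b2)"
      using de by (simp_all add: a1_def a2_def b1_def b2_def)
    have "(x - (l + V 0)) * (y - (l + V 0)) = x * y - (l + V 0) * (x + y) + (l + V 0) * (l + V 0)"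
      by (simp add: algebra_simps)
    also have "\<dots> = a1 * a2 - (V (2 * k) + b1) * (V (- 2 * k) + b2)"
      unfolding s p by (simp add: algebra_simps)
    finally have pr: "(x - (l + V 0)) * (y - (l + V 0)) = a1 * a2 - (V (2 * k) + b1) * (V (- 2 * k) + b2)" .
    have su: "(x - (l + V 0)) + (y - (l + V 0)) = a1 + a2" using s by (simp add: algebra_simps)
    have "x = l + V 0 + (x - (l + V 0))" "y = l + V 0 + (y - (l + V 0))" by simp_all
    with ee pr su show ?thesis unfolding l_def x_def y_def by blast
  qed
qed

section \<open>Hilbert-Schmidt bounds\<close>

lemma bracket_nonzero [simp]: "bracket k \<noteq> 0"
  by (rule less_imp_neq[OF bracket_pos, symmetric])

lemma bracket_powr_sum_bounded:
  assumes "1 < s"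
  shows "\<exists>H. \<forall>F. finite F \<longrightarrow> (\<Sum>k\<in>F. bracket k powr (- s)) \<le> H"
proof -
  define h where "h n = real (Suc n) powr (- s)" for n
  have sm: "summable h"
    unfolding h_def using assms by (subst summable_Suc_iff[of "\<lambda>n. real n powr (- s)"]) (simp add: summable_real_powr_iff)
  have nn: "0 \<le> h n" for n by (simp add: h_def)
  have part: "(\<Sum>k\<in>G. bracket k powr (- s)) \<le> suminf h" if G: "finite G" "inj_on (\<lambda>k. nat \<bar>k\<bar>) G" for G
  proof -
    have "(\<Sum>k\<in>G. bracket k powr (- s)) = (\<Sum>n\<in>(\<lambda>k. nat \<bar>k\<bar>) ` G. h n)"
      by (subst sum.reindex[OF G(2)]) (auto simp: h_def bracket_def intro!: sum.cong)
    also have "\<dots> \<le> suminf h" by (rule sum_le_suminf[OF sm]) (use G nn in auto)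
    finally show ?thesis .
  qed
  have "(\<Sum>k\<in>F. bracket k powr (- s)) \<le> 2 * suminf h" if F: "finite F" for F
  proof -
    have "(\<Sum>k\<in>F. bracket k powr (- s))
        = (\<Sum>k\<in>F \<inter> {0..}. bracket k powr (- s)) + (\<Sum>k\<in>F - {0..}. bracket k powr (- s))"
      by (subst sum.Int_Diff[OF F, of _ "{0..}"]) simp
    also have "\<dots> \<le> suminf h + suminf h"
      by (intro add_mono part) (use F in \<open>auto simp: inj_on_def\<close>)
    finally show ?thesis by simp
  qed
  thus ?thesis by blast
qed

definition dist1 :: "real \<Rightarrow> real" where
  "dist1 x = max 1 \<bar>x\<bar>"

lemma dist1_ge: "1 \<le> dist1 x" "\<bar>x\<bar> \<le> dist1 x" and dist1_pos: "0 < dist1 x"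
  by (auto simp: dist1_def)

lemma dist1_square_sum_bounded: "\<exists>H. \<forall>F. finite F \<longrightarrow> (\<Sum>k\<in>F. 1 / (dist1 (real_of_int k))\<^sup>2) \<le> H"
proof -
  obtain H where H: "\<And>F. finite F \<Longrightarrow> (\<Sum>k\<in>F. bracket k powr (- 2)) \<le> H"
    using bracket_powr_sum_bounded[of 2] by auto
  have le: "1 / (dist1 (real_of_int k))\<^sup>2 \<le> 4 * bracket k powr (- 2)" for k
  proof -
    have "bracket k \<le> 2 * dist1 (real_of_int k)" by (auto simp: bracket_def dist1_def)
    hence "(bracket k)\<^sup>2 \<le> (2 * dist1 (real_of_int k))\<^sup>2" by (intro power_mono) (auto simp: less_imp_le)
    hence "(bracket k)\<^sup>2 \<le> 4 * (dist1 (real_of_int k))\<^sup>2" by (simp add: power_mult_distrib)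
    moreover have "0 < (bracket k)\<^sup>2" "0 < (dist1 (real_of_int k))\<^sup>2"
      using dist1_pos[of "real_of_int k"] bracket_pos[of k] by (auto intro: zero_less_power)
    ultimately have "1 / (dist1 (real_of_int k))\<^sup>2 \<le> 4 / (bracket k)\<^sup>2"
      by (simp add: divide_le_eq le_divide_eq mult.commute)
    thus ?thesis by (simp add: powr_minus_divide less_imp_le)
  qed
  have "(\<Sum>k\<in>F. 1 / (dist1 (real_of_int k))\<^sup>2) \<le> 4 * H" if "finite F" for F
  proof -
    have "(\<Sum>k\<in>F. 1 / (dist1 (real_of_int k))\<^sup>2) \<le> (\<Sum>k\<in>F. 4 * bracket k powr (- 2))"
      by (intro sum_mono le)
    also have "\<dots> = 4 * (\<Sum>k\<in>F. bracket k powr (- 2))" by (rule sum_distrib_left[symmetric])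
    also have "\<dots> \<le> 4 * H" using H[OF that] by simp
    finally show ?thesis .
  qed
  thus ?thesis by blast
qed

lemma weight_eq: "weight m t j = dist1 (\<bar>real_of_int j\<bar> - real_of_int t) * max \<bar>real_of_int j\<bar> (real_of_int t) ^ (2 * m - 1)"
  by (simp add: weight_def dist1_def)

lemma weight_minus [simp]: "weight m t (- j) = weight m t j"
  by (simp add: weight_def)

lemma weight_ge_dist1:
  assumes "1 \<le> t"
  shows "dist1 (\<bar>real_of_int j\<bar> - real_of_int t) * real_of_int t ^ (2 * m - 1) \<le> weight m t j"
  unfolding weight_eq using assms dist1_pos by (intro mult_left_mono power_mono) (auto simp: less_imp_le)

text \<open>One large factor of the weight is traded for a second factor of the distance, which is
  at most \<open>max \<bar>j\<bar> t\<close>. With the square, the sum of the inverses over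
  \<open>j\<close> converges.\<close>

lemma weight_ge_dist1_square:
  assumes "1 \<le> t" "1 \<le> m"
  shows "(dist1 (\<bar>real_of_int j\<bar> - real_of_int t))\<^sup>2 * real_of_int t ^ (2 * m - 2) \<le> weight m t j"
proof -
  let ?d = "dist1 (\<bar>real_of_int j\<bar> - real_of_int t)" and ?M = "max \<bar>real_of_int j\<bar> (real_of_int t)"
  have "?d \<le> ?M" using assms by (auto simp: dist1_def)
  hence "?d * real_of_int t ^ (2 * m - 2) \<le> ?M * ?M ^ (2 * m - 2)"
    using assms dist1_pos by (intro mult_mono power_mono) (auto simp: less_imp_le)
  also have "\<dots> = ?M ^ Suc (2 * m - 2)" by simp
  also have "Suc (2 * m - 2) = 2 * m - 1" using assms(2) by simp
  finally have "?d * (?d * real_of_int t ^ (2 * m - 2)) \<le> ?d * ?M ^ (2 * m - 1)"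
    using dist1_pos by (intro mult_left_mono) (auto simp: less_imp_le)
  thus ?thesis unfolding weight_eq by (simp add: power2_eq_square mult.assoc)
qed

lemma weight_far:
  assumes "1 \<le> t" "1 \<le> m" "2 * real_of_int t \<le> \<bar>real_of_int j\<bar>"
  shows "\<bar>real_of_int j\<bar> ^ (2 * m) / 2 \<le> weight m t j"
proof -
  have d: "\<bar>real_of_int j\<bar> / 2 \<le> dist1 (\<bar>real_of_int j\<bar> - real_of_int t)"
    using assms by (auto simp: dist1_def)
  have M: "max \<bar>real_of_int j\<bar> (real_of_int t) = \<bar>real_of_int j\<bar>" using assms by auto
  have "\<bar>real_of_int j\<bar> ^ (2 * m) / 2 = \<bar>real_of_int j\<bar> / 2 * \<bar>real_of_int j\<bar> ^ (2 * m - 1)"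
    using assms(2) by (simp flip: power_Suc)
  also have "\<dots> \<le> weight m t j" unfolding weight_eq M using d by (intro mult_right_mono) auto
  finally show ?thesis .
qed

lemma power_eq_powr: "1 \<le> x \<Longrightarrow> x ^ n = x powr real n" for x :: real
  by (simp add: powr_realpow)

lemma powr_le_exponent_drop:
  fixes x t q r :: real
  assumes "1 \<le> t" "t \<le> x" "q \<le> r"
  shows "x powr q \<le> x powr r * t powr (q - r)"
proof -
  have "x powr q = x powr r * x powr (q - r)" using powr_add[of x r "q - r"] by simp
  also have "\<dots> \<le> x powr r * t powr (q - r)"
    using assms by (intro mult_left_mono powr_mono2') auto
  finally show ?thesis .
qed

text \<open>For \<open>\<bar>i\<bar> \<le> 2 * t\<close> the difference \<open>i - j\<close> is of
  order \<open>t\<close>, and the weights supply \<open>1 / (d i * d j)\<close>, which is split by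
  the arithmetic-geometric mean. For larger \<open>\<bar>i\<bar>\<close> the weight at
  \<open>i\<close> alone dominates \<open>\<bar>i - j\<bar> powr (2 * p)\<close>, as
  \<open>p \<le> m\<close>, and the weight at \<open>j\<close> supplies
  \<open>1 / (d j)\<^sup>2\<close>. The constant \<open>36 ^ m\<close> bounds the factor in
  \<open>(6 * t) powr (2 * p)\<close>.\<close>

lemma kernel_bound_aux:
  assumes m: "1 \<le> m" and p: "0 \<le> p" "p \<le> real m" and t: "1 \<le> t" and ij: "\<bar>j\<bar> \<le> \<bar>i\<bar>"
  defines "d \<equiv> \<lambda>j. dist1 (\<bar>real_of_int j\<bar> - real_of_int t)"
  shows "bracket (i - j) powr (2 * p)
    \<le> 2 * 36 ^ m * real_of_int t powr (2 * p - 4 * real m + 2) * (weight m t i * weight m t j) * (1 / (d i)\<^sup>2 + 1 / (d j)\<^sup>2)"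
proof -
  define a T where "a = \<bar>real_of_int i\<bar>" and "T = real_of_int t"
  have T: "1 \<le> T" using t by (simp add: T_def)
  have dp: "0 < d j" "0 < d i" by (auto simp: d_def dist1_pos)
  have b: "bracket (i - j) \<le> 1 + 2 * a" using ij by (simp add: bracket_def a_def)
  have c36: "(36::real) powr p \<le> 36 ^ m"
    using p powr_mono[of p "real m" "36::real"] by (simp add: powr_realpow)
  have wpos: "0 < weight m t i" "0 < weight m t j" using weight_pos[OF t] by auto
  have nat1: "real (2 * m - Suc 0) = 2 * real m - 1" "real (2 * m - 2) = 2 * real m - 2" using m by auto
  show ?thesis
  proof (cases "a \<le> 2 * T")
    case True
    have "bracket (i - j) powr (2 * p) \<le> (6 * T) powr (2 * p)"
      using b True T p by (intro powr_mono2) (auto simp: less_imp_le)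
    also have "\<dots> = 36 powr p * T powr (2 * p)"
      using T powr_powr[of "6::real" 2 p] by (simp add: powr_mult)
    also have "\<dots> \<le> 36 ^ m * T powr (2 * p)" using c36 by (intro mult_right_mono) auto
    also have "T powr (2 * p) = T powr (2 * p - 4 * real m + 2) * (T ^ (2 * m - 1) * T ^ (2 * m - 1))"
      using T by (simp add: power_eq_powr nat1 powr_add[symmetric])
    finally have 1: "bracket (i - j) powr (2 * p)
        \<le> 36 ^ m * (T powr (2 * p - 4 * real m + 2) * (T ^ (2 * m - 1) * T ^ (2 * m - 1)))" .
    have "(d i * T ^ (2 * m - 1)) * (d j * T ^ (2 * m - 1)) \<le> weight m t i * weight m t j"
      unfolding d_def T_def using weight_ge_dist1[OF t] t dist1_pos
      by (intro mult_mono) (auto simp: less_imp_le weight_pos)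
    hence 2: "T ^ (2 * m - 1) * T ^ (2 * m - 1) \<le> (weight m t i * weight m t j) * (1 / (d i * d j))"
      using dp by (simp add: field_simps)
    have 3: "1 / (d i * d j) \<le> 1 / (d i)\<^sup>2 + 1 / (d j)\<^sup>2"
    proof -
      have "2 * (1 / d i) * (1 / d j) \<le> (1 / d i)\<^sup>2 + (1 / d j)\<^sup>2" by (rule sum_squares_bound)
      moreover have "1 / (d i * d j) \<le> 2 / (d i * d j)" using dp by (intro divide_right_mono) auto
      ultimately show ?thesis by (simp add: power_divide)
    qed
    have "bracket (i - j) powr (2 * p) \<le> 36 ^ m * (T powr (2 * p - 4 * real m + 2) *
        ((weight m t i * weight m t j) * (1 / (d i)\<^sup>2 + 1 / (d j)\<^sup>2)))"
      by (rule order_trans[OF 1], intro mult_left_mono order_trans[OF 2] 3) (use wpos in auto)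
    moreover have "0 \<le> 36 ^ m * (T powr (2 * p - 4 * real m + 2) *
        ((weight m t i * weight m t j) * (1 / (d i)\<^sup>2 + 1 / (d j)\<^sup>2)))" using wpos by simp
    ultimately show ?thesis unfolding T_def by (simp add: mult.assoc)
  next
    case False
    hence a: "2 * T \<le> a" "1 \<le> a" "T \<le> a" using T by auto
    have "bracket (i - j) powr (2 * p) \<le> (3 * a) powr (2 * p)"
      using b a p by (intro powr_mono2) (auto simp: less_imp_le)
    also have "\<dots> = 9 powr p * a powr (2 * p)"
      using a powr_powr[of "3::real" 2 p] by (simp add: powr_mult)
    also have "\<dots> \<le> 36 ^ m * a powr (2 * p)"
      using c36 powr_mono2[of p 9 36] p by (intro mult_right_mono) auto
    also have "\<dots> \<le> 36 ^ m * (a powr (2 * real m) * T powr (2 * p - 2 * real m))"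
      using a T p by (intro mult_left_mono powr_le_exponent_drop) auto
    also have "T powr (2 * p - 2 * real m) = T powr (2 * p - 4 * real m + 2) * T ^ (2 * m - 2)"
      using T by (simp add: power_eq_powr nat1 powr_add[symmetric])
    also have "a powr (2 * real m) = a ^ (2 * m)" using a by (simp add: power_eq_powr)
    also have "36 ^ m * (a ^ (2 * m) * (T powr (2 * p - 4 * real m + 2) * T ^ (2 * m - 2)))
        = 2 * 36 ^ m * T powr (2 * p - 4 * real m + 2) * (a ^ (2 * m) / 2 * T ^ (2 * m - 2))"
      by simp
    finally have 1: "bracket (i - j) powr (2 * p)
        \<le> 2 * 36 ^ m * T powr (2 * p - 4 * real m + 2) * (a ^ (2 * m) / 2 * T ^ (2 * m - 2))" .
    have "a ^ (2 * m) / 2 * T ^ (2 * m - 2) \<le> weight m t i * (weight m t j * (1 / (d j)\<^sup>2))"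
    proof (rule mult_mono)
      show "a ^ (2 * m) / 2 \<le> weight m t i" using weight_far[OF t m, of i] a by (simp add: a_def T_def)
      show "T ^ (2 * m - 2) \<le> weight m t j * (1 / (d j)\<^sup>2)"
        using weight_ge_dist1_square[OF t m, of j] dp(1) by (simp add: field_simps T_def d_def)
    qed (use wpos T in auto)
    also have "\<dots> \<le> (weight m t i * weight m t j) * (1 / (d i)\<^sup>2 + 1 / (d j)\<^sup>2)"
      using wpos by (simp add: distrib_left)
    finally have 2: "a ^ (2 * m) / 2 * T ^ (2 * m - 2)
        \<le> (weight m t i * weight m t j) * (1 / (d i)\<^sup>2 + 1 / (d j)\<^sup>2)" .
    have "bracket (i - j) powr (2 * p) \<le> 2 * 36 ^ m * T powr (2 * p - 4 * real m + 2) *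
        ((weight m t i * weight m t j) * (1 / (d i)\<^sup>2 + 1 / (d j)\<^sup>2))"
      by (rule order_trans[OF 1], rule mult_left_mono[OF 2]) simp
    thus ?thesis unfolding T_def by (simp only: mult.assoc)
  qed
qed

lemma kernel_bound:
  assumes m: "1 \<le> m" and p: "0 \<le> p" "p \<le> real m" and t: "1 \<le> t"
  defines "d \<equiv> \<lambda>j. dist1 (\<bar>real_of_int j\<bar> - real_of_int t)"
  shows "bracket (i - j) powr (2 * p) / (weight m t i * weight m t j)
    \<le> 2 * 36 ^ m * real_of_int t powr (2 * p - 4 * real m + 2) * (1 / (d i)\<^sup>2 + 1 / (d j)\<^sup>2)"
proof -
  have sym: "bracket (i - j) = bracket (j - i)" by (simp add: bracket_def abs_minus_commute)
  have "bracket (i - j) powr (2 * p)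
    \<le> 2 * 36 ^ m * real_of_int t powr (2 * p - 4 * real m + 2) * (weight m t i * weight m t j) * (1 / (d i)\<^sup>2 + 1 / (d j)\<^sup>2)"
  proof (cases "\<bar>j\<bar> \<le> \<bar>i\<bar>")
    case True
    thus ?thesis using kernel_bound_aux[OF m p t True] by (simp add: d_def)
  next
    case False
    hence "\<bar>i\<bar> \<le> \<bar>j\<bar>" by simp
    from kernel_bound_aux[OF m p t this] show ?thesis
      by (simp only: sym d_def mult.commute[of "weight m t j"] add.commute[of "1 / (dist1 (\<bar>real_of_int j\<bar> - real_of_int t))\<^sup>2"])
  qed
  moreover have "0 < weight m t i * weight m t j" using weight_pos[OF t] by simp
  ultimately show ?thesis by (simp add: divide_le_eq mult_ac)
qed

text \<open>Up to sign \<open>\<bar>j\<bar> - t\<close> is one of the translates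
  \<open>j - t\<close> and \<open>j + t\<close>, and sums over all integers are invariant under
  translation; hence a bound uniform in \<open>t\<close>.\<close>

lemma dist1_abs_sum_bounded:
  "\<exists>H\<ge>0. \<forall>F (t::int). finite F \<longrightarrow> (\<Sum>j\<in>F. 1 / (dist1 (\<bar>real_of_int j\<bar> - real_of_int t))\<^sup>2) \<le> H"
proof -
  obtain H where H: "\<And>F. finite F \<Longrightarrow> (\<Sum>k\<in>F. 1 / (dist1 (real_of_int k))\<^sup>2) \<le> H"
    using dist1_square_sum_bounded by blast
  have shift: "(\<Sum>j\<in>F. 1 / (dist1 (real_of_int (j + c)))\<^sup>2) \<le> H" if "finite F" for F c
  proof -
    have "(\<Sum>j\<in>F. 1 / (dist1 (real_of_int (j + c)))\<^sup>2) = (\<Sum>k\<in>(\<lambda>j. j + c) ` F. 1 / (dist1 (real_of_int k))\<^sup>2)"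
      by (subst sum.reindex) (auto simp: inj_on_def)
    thus ?thesis using H[of "(\<lambda>j. j + c) ` F"] that by simp
  qed
  have "(\<Sum>j\<in>F. 1 / (dist1 (\<bar>real_of_int j\<bar> - real_of_int t))\<^sup>2) \<le> 2 * H" if F: "finite F" for F t
  proof -
    have "(\<Sum>j\<in>F. 1 / (dist1 (\<bar>real_of_int j\<bar> - real_of_int t))\<^sup>2)
        \<le> (\<Sum>j\<in>F. 1 / (dist1 (real_of_int (j + (- t))))\<^sup>2 + 1 / (dist1 (real_of_int (j + t)))\<^sup>2)"
    proof (rule sum_mono)
      fix j
      have "dist1 (\<bar>real_of_int j\<bar> - real_of_int t) = dist1 (real_of_int (j + (- t)))
          \<or> dist1 (\<bar>real_of_int j\<bar> - real_of_int t) = dist1 (real_of_int (j + t))"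
        by (auto simp: dist1_def abs_if)
      thus "1 / (dist1 (\<bar>real_of_int j\<bar> - real_of_int t))\<^sup>2
        \<le> 1 / (dist1 (real_of_int (j + (- t))))\<^sup>2 + 1 / (dist1 (real_of_int (j + t)))\<^sup>2"
        by (elim disjE) (simp_all only: le_add_same_cancel1 le_add_same_cancel2, simp_all)
    qed
    also have "\<dots> \<le> H + H" unfolding sum.distrib by (intro add_mono shift F)
    finally show ?thesis by simp
  qed
  moreover have "0 \<le> H" using H[of "{}"] by simp
  ultimately show ?thesis by (intro exI[of _ "2 * H"]) auto
qed

text \<open>In each of the two terms of \<open>kernel_bound\<close> one index enters only through
  \<open>V (i - j)\<close>. Summing over it first gives \<open>Y\<^sup>2\<close>, and the other sum
  is bounded uniformly in \<open>t\<close>. The exponent is negative for \<open>p < m\<close>, but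
  it is 0 for \<open>p = m = 1\<close>, where the bound yields no decay.\<close>

theorem kmat_bound:
  fixes m :: nat and p :: real
  assumes m: "1 \<le> m" and p: "0 \<le> p" "p \<le> real m"
  shows "\<exists>C\<ge>0. \<forall>V Y t. 1 \<le> t \<longrightarrow> l2_bounded Y (\<lambda>l. of_real (bracket l powr (- p)) * V l) \<longrightarrow>
    l2_bounded (C * Y * real_of_int t powr (p - 2 * real m + 1)) (\<lambda>(i, j). kmat m V t i j)"
proof -
  obtain H where H0: "0 \<le> H"
    and H: "\<And>F (t::int). finite F \<Longrightarrow> (\<Sum>j\<in>F. 1 / (dist1 (\<bar>real_of_int j\<bar> - real_of_int t))\<^sup>2) \<le> H"
    using dist1_abs_sum_bounded by blast
  define C where "C = sqrt (2 * 36 ^ m * (2 * H))"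
  have C: "0 \<le> C" "C\<^sup>2 = 2 * 36 ^ m * (2 * H)" using H0 by (auto simp: C_def)
  have "l2_bounded (C * Y * real_of_int t powr (p - 2 * real m + 1)) (\<lambda>(i, j). kmat m V t i j)"
    if t: "1 \<le> t" and Y: "l2_bounded Y (\<lambda>l. of_real (bracket l powr (- p)) * V l)" for V Y t
  proof (rule l2_boundedI)
    have Y0: "0 \<le> Y" by (rule l2_bounded_nonneg[OF Y])
    show "0 \<le> C * Y * real_of_int t powr (p - 2 * real m + 1)" using C Y0 by simp
    fix F :: "(int \<times> int) set" assume F: "finite F"
    define y where "y l = cmod (of_real (bracket l powr (- p)) * V l)" for l
    define T where "T = real_of_int t powr (2 * p - 4 * real m + 2)"
    have T: "T = (real_of_int t powr (p - 2 * real m + 1))\<^sup>2"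
      by (simp add: T_def power2_eq_square powr_add[symmetric] algebra_simps)
    have w: "0 < weight m t i" for i by (rule weight_pos[OF t])
    define d where "d j = 1 / (dist1 (\<bar>real_of_int j\<bar> - real_of_int t))\<^sup>2" for j
    have Vy: "(cmod (V l))\<^sup>2 = (y l)\<^sup>2 * bracket l powr (2 * p)" for l
    proof -
      have "(y l)\<^sup>2 * bracket l powr (2 * p) = (cmod (V l))\<^sup>2 * (bracket l powr (- 2 * p) * bracket l powr (2 * p))"
        by (simp add: y_def norm_mult power_mult_distrib bracket_powr_square)
      thus ?thesis by (simp add: powr_add[symmetric])
    qed
    have entry: "(cmod (kmat m V t i j))\<^sup>2 \<le> 2 * 36 ^ m * T * ((y (i - j))\<^sup>2 * (d i + d j))" for i j
    proof -
      have "(cmod (kmat m V t i j))\<^sup>2 \<le> (cmod (V (i - j)))\<^sup>2 / (weight m t i * weight m t j)"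
        using w[of i] w[of j] by (auto simp: kmat_def norm_divide norm_mult power_divide power_mult_distrib less_imp_le)
      also have "\<dots> = (y (i - j))\<^sup>2 * (bracket (i - j) powr (2 * p) / (weight m t i * weight m t j))"
        by (simp add: Vy)
      also have "\<dots> \<le> (y (i - j))\<^sup>2 * (2 * 36 ^ m * T * (d i + d j))"
        unfolding T_def d_def by (intro mult_left_mono kernel_bound[OF m p t]) auto
      finally show ?thesis by (simp add: mult_ac)
    qed
    define F1 F2 where "F1 = fst ` F" and "F2 = snd ` F"
    have sub: "F \<subseteq> F1 \<times> F2" and fin: "finite F1" "finite F2" using F by (force simp: F1_def F2_def)+
    have ysum: "(\<Sum>l\<in>G. (y l)\<^sup>2) \<le> Y\<^sup>2" if "finite G" for G
      using l2_boundedD[OF Y that] by (simp add: y_def)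
    have s1: "(\<Sum>j\<in>F2. (y (i - j))\<^sup>2) \<le> Y\<^sup>2" for i
    proof -
      have "(\<Sum>j\<in>F2. (y (i - j))\<^sup>2) = (\<Sum>l\<in>(\<lambda>j. i - j) ` F2. (y l)\<^sup>2)"
        by (subst sum.reindex) (auto simp: inj_on_def)
      thus ?thesis using ysum[of "(\<lambda>j. i - j) ` F2"] fin by simp
    qed
    have s2: "(\<Sum>i\<in>F1. (y (i - j))\<^sup>2) \<le> Y\<^sup>2" for j
    proof -
      have "(\<Sum>i\<in>F1. (y (i - j))\<^sup>2) = (\<Sum>l\<in>(\<lambda>i. i - j) ` F1. (y l)\<^sup>2)"
        by (subst sum.reindex) (auto simp: inj_on_def)
      thus ?thesis using ysum[of "(\<lambda>i. i - j) ` F1"] fin by simp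
    qed
    have d0: "0 \<le> d j" for j by (simp add: d_def)
    have HH: "(\<Sum>i\<in>G. d i) \<le> H" if "finite G" for G using H[OF that, of t] by (simp add: d_def)
    have "(\<Sum>x\<in>F. (cmod (case x of (i, j) \<Rightarrow> kmat m V t i j))\<^sup>2)
        \<le> (\<Sum>x\<in>F1 \<times> F2. (cmod (case x of (i, j) \<Rightarrow> kmat m V t i j))\<^sup>2)"
      by (rule sum_mono2) (use sub fin in auto)
    also have "\<dots> = (\<Sum>i\<in>F1. \<Sum>j\<in>F2. (cmod (kmat m V t i j))\<^sup>2)"
      by (simp add: sum.cartesian_product case_prod_unfold)
    also have "\<dots> \<le> (\<Sum>i\<in>F1. \<Sum>j\<in>F2. 2 * 36 ^ m * T * ((y (i - j))\<^sup>2 * (d i + d j)))"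
      by (intro sum_mono entry)
    also have "\<dots> = 2 * 36 ^ m * T * ((\<Sum>i\<in>F1. d i * (\<Sum>j\<in>F2. (y (i - j))\<^sup>2)) + (\<Sum>i\<in>F1. \<Sum>j\<in>F2. d j * (y (i - j))\<^sup>2))"
      by (simp add: sum_distrib_left sum.distrib distrib_left distrib_right mult_ac)
    also have "(\<Sum>i\<in>F1. \<Sum>j\<in>F2. d j * (y (i - j))\<^sup>2) = (\<Sum>j\<in>F2. d j * (\<Sum>i\<in>F1. (y (i - j))\<^sup>2))"
      by (subst sum.swap) (simp add: sum_distrib_left)
    also have "2 * 36 ^ m * T * ((\<Sum>i\<in>F1. d i * (\<Sum>j\<in>F2. (y (i - j))\<^sup>2)) + (\<Sum>j\<in>F2. d j * (\<Sum>i\<in>F1. (y (i - j))\<^sup>2)))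
        \<le> 2 * 36 ^ m * T * ((\<Sum>i\<in>F1. d i * Y\<^sup>2) + (\<Sum>j\<in>F2. d j * Y\<^sup>2))"
      using d0 s1 s2 by (intro mult_left_mono add_mono sum_mono) (auto simp: T_def)
    also have "\<dots> \<le> 2 * 36 ^ m * T * (H * Y\<^sup>2 + H * Y\<^sup>2)"
      unfolding sum_distrib_right[symmetric]
      by (intro mult_left_mono add_mono mult_right_mono HH fin) (auto simp: T_def)
    also have "\<dots> = (C * Y * real_of_int t powr (p - 2 * real m + 1))\<^sup>2"
      by (simp add: power_mult_distrib C(2) T)
    finally show "(\<Sum>x\<in>F. (cmod (case x of (i, j) \<Rightarrow> kmat m V t i j))\<^sup>2)
        \<le> (C * Y * real_of_int t powr (p - 2 * real m + 1))\<^sup>2" .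
  qed
  thus ?thesis using C(1) by blast
qed

section \<open>Bounds for the second order terms\<close>

lemma bracket_le_double: "l \<noteq> 0 \<Longrightarrow> bracket l \<le> 2 * \<bar>real_of_int l\<bar>"
  by (simp add: bracket_def)

lemma powr_double: "0 \<le> x \<Longrightarrow> 0 \<le> c \<Longrightarrow> (c * x) powr (2 * p) = (c\<^sup>2) powr p * x powr (2 * p)" for x c p :: real
  by (simp add: powr_mult powr_powr[symmetric] flip: powr_numeral)

lemma powr_le_power: "1 \<le> c \<Longrightarrow> p \<le> real m \<Longrightarrow> c powr p \<le> c ^ m" for c :: real
  using powr_mono[of p "real m" c] by (simp add: powr_realpow)

lemma weight_far_half:
  assumes m: "1 \<le> m" and k: "1 \<le> k" and far: "2 * k \<le> \<bar>i\<bar>" and l: "\<bar>l\<bar> \<le> 2 * \<bar>i\<bar>"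
  shows "\<bar>real_of_int l\<bar> ^ (2 * m) \<le> 2 * 4 ^ m * weight m k i"
proof -
  have "\<bar>real_of_int l\<bar> ^ (2 * m) \<le> (2 * \<bar>real_of_int i\<bar>) ^ (2 * m)"
    using l by (intro power_mono) auto
  also have "\<dots> = 2 * 4 ^ m * (\<bar>real_of_int i\<bar> ^ (2 * m) / 2)" by (simp add: power_mult_distrib power_mult)
  also have "\<dots> \<le> 2 * 4 ^ m * weight m k i"
    using weight_far[OF k m, of i] far by (intro mult_left_mono) auto
  finally show ?thesis .
qed

text \<open>\<open>l\<close> is the frequency that carries \<open>i\<close> to \<open>k\<close>. For
  \<open>\<bar>l\<bar> \<le> k\<close> the weight contains the factor \<open>\<bar>l\<bar>\<close>;
  for \<open>k < l \<le> 3 * k\<close> the frequency \<open>i\<close> may be near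
  \<open>- k\<close>, and the weight contains only the distance of \<open>l\<close> from
  \<open>2 * k\<close>; beyond that it has the full order \<open>\<bar>i\<bar> ^ (2 * m)\<close>.
  The \<open>max 1\<close> arises because \<open>\<bar>l\<bar> powr (2 * p - 1)\<close> decreases in
  \<open>\<bar>l\<bar>\<close> when \<open>p < 1/2\<close>.\<close>

lemma pair_kernel_diag:
  fixes m :: nat and p :: real and i k :: int
  assumes m: "1 \<le> m" and p: "0 \<le> p" "p \<le> real m" and k: "1 \<le> k" and i: "i \<noteq> k"
  defines "l \<equiv> k - i"
  shows "bracket l powr (2 * p) \<le> 2 * 16 ^ m * (real_of_int k powr (max 1 (2 * p) - 2 * real m)
    + (if k < \<bar>l\<bar> then real_of_int k powr (2 * p - 2 * real m + 1) / dist1 (real_of_int (2 * k - l)) else 0)) * weight m k i"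
proof -
  define a T W where "a = \<bar>real_of_int l\<bar>" and "T = real_of_int k" and "W = weight m k i"
  define e1 e2 where "e1 = max 1 (2 * p) - 2 * real m" and "e2 = 2 * p - 2 * real m + 1"
  have l0: "l \<noteq> 0" using i by (simp add: l_def)
  have a1: "1 \<le> a" using l0 by (simp add: a_def)
  have T: "1 \<le> T" using k by (simp add: T_def)
  have W: "0 < W" unfolding W_def by (rule weight_pos[OF k])
  have br: "bracket l powr (2 * p) \<le> 4 ^ m * a powr (2 * p)"
  proof -
    have "bracket l powr (2 * p) \<le> (2 * a) powr (2 * p)"
      using bracket_le_double[OF l0] p by (intro powr_mono2) (auto simp: a_def less_imp_le)
    also have "\<dots> = 4 powr p * a powr (2 * p)" using powr_double[of a 2 p] a1 by simp
    also have "\<dots> \<le> 4 ^ m * a powr (2 * p)" using powr_le_power[of 4 p m] p by (intro mult_right_mono) auto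
    finally show ?thesis .
  qed
  have Tp: "T ^ (2 * m - 1) = T powr (2 * real m - 1)" using power_eq_powr[OF T, of "2 * m - 1"] m by simp
  have c4: "(4::real) ^ m \<le> 2 * 16 ^ m"
  proof -
    have "(4::real) ^ m \<le> 16 ^ m" by (rule power_mono) auto
    thus ?thesis by (rule order_trans) simp
  qed
  have goal1: ?thesis if "bracket l powr (2 * p) \<le> 2 * 16 ^ m * T powr e1 * W"
  proof -
    have "bracket l powr (2 * p) \<le> 2 * 16 ^ m * (T powr e1 * W)" using that by (simp only: mult.assoc)
    also have "\<dots> \<le> 2 * 16 ^ m * ((T powr e1 + (if k < \<bar>l\<bar> then T powr e2 / dist1 (real_of_int (2 * k - l)) else 0)) * W)"
      using W dist1_pos by (intro mult_left_mono mult_right_mono) (auto simp: less_imp_le)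
    finally show ?thesis by (simp only: T_def W_def e1_def e2_def mult.assoc)
  qed
  consider "\<bar>l\<bar> \<le> k" | "k < l" "l \<le> 3 * k" | "3 * k < l \<or> l < - k" by linarith
  thus ?thesis
  proof cases
    case 1
    have d: "dist1 (\<bar>real_of_int i\<bar> - real_of_int k) = a"
    proof -
      have "\<bar>real_of_int i\<bar> - real_of_int k = - real_of_int l" using 1 by (simp add: l_def)
      thus ?thesis using a1 by (simp add: dist1_def a_def max_absorb2)
    qed
    have Wge: "a * T ^ (2 * m - 1) \<le> W"
      using weight_ge_dist1[OF k, of i m] unfolding d W_def T_def .
    have aT: "a \<le> T" using 1 by (simp add: a_def T_def)
    have "a powr (2 * p) = a * a powr (2 * p - 1)" using a1 by (simp add: powr_mult_base)
    also have "a powr (2 * p - 1) \<le> a powr (max 1 (2 * p) - 1)" using a1 by (intro powr_mono) auto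
    also have "\<dots> \<le> T powr (max 1 (2 * p) - 1)" using a1 aT by (intro powr_mono2) auto
    also have "\<dots> = T powr e1 * T ^ (2 * m - 1)"
      unfolding Tp e1_def by (simp add: powr_add[symmetric])
    finally have "a powr (2 * p) \<le> T powr e1 * (a * T ^ (2 * m - 1))" using a1 by (simp add: mult_ac)
    also have "\<dots> \<le> T powr e1 * W" using Wge by (intro mult_left_mono) auto
    finally have "4 ^ m * a powr (2 * p) \<le> 2 * 16 ^ m * (T powr e1 * W)"
      using c4 W by (intro mult_mono) auto
    thus ?thesis using br by (intro goal1) simp
  next
    case 2
    define d where "d = dist1 (real_of_int (2 * k - l))"
    have d: "dist1 (\<bar>real_of_int i\<bar> - real_of_int k) = d"
    proof -
      have "\<bar>real_of_int i\<bar> - real_of_int k = - real_of_int (2 * k - l)" using 2 by (simp add: l_def)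
      thus ?thesis by (simp add: d_def dist1_def)
    qed
    have d0: "0 < d" by (simp add: d_def dist1_pos)
    have Wge: "d * T ^ (2 * m - 1) \<le> W"
      using weight_ge_dist1[OF k, of i m] unfolding d W_def T_def .
    have "real_of_int l \<le> real_of_int (3 * k)" "0 < real_of_int l" "1 \<le> real_of_int k" using 2 k by linarith+
    hence "bracket l \<le> 4 * T" unfolding bracket_def T_def by linarith
    hence "bracket l powr (2 * p) \<le> (4 * T) powr (2 * p)" using p by (intro powr_mono2) (auto simp: less_imp_le)
    also have "\<dots> = 16 powr p * T powr (2 * p)" using powr_double[of T 4 p] T by simp
    also have "\<dots> \<le> (2 * 16 ^ m) * T powr (2 * p)"
      by (intro mult_right_mono order_trans[OF powr_le_power[of 16 p m]]) (use p in auto)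
    also have "T powr (2 * p) = T powr e2 * T ^ (2 * m - 1)"
      unfolding Tp e2_def by (simp add: powr_add[symmetric])
    also have "T powr e2 * T ^ (2 * m - 1) = (T powr e2 / d) * (d * T ^ (2 * m - 1))" using d0 by simp
    finally have 1: "bracket l powr (2 * p) \<le> 2 * 16 ^ m * ((T powr e2 / d) * (d * T ^ (2 * m - 1)))" .
    have "(T powr e2 / d) * (d * T ^ (2 * m - 1)) \<le> (T powr e1 + T powr e2 / d) * W"
      using Wge W d0 T by (intro mult_mono) (auto simp: less_imp_le)
    hence "bracket l powr (2 * p) \<le> 2 * 16 ^ m * ((T powr e1 + T powr e2 / d) * W)"
      using 1 by (intro order_trans[OF 1] mult_left_mono) auto
    moreover have "k < \<bar>l\<bar>" using 2 by linarith
    ultimately show ?thesis by (simp only: T_def W_def e1_def e2_def d_def mult.assoc if_True)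
  next
    case 3
    have far: "2 * k \<le> \<bar>i\<bar>" "\<bar>l\<bar> \<le> 2 * \<bar>i\<bar>" using 3 k by (auto simp: l_def)
    have Ta: "T \<le> a" using 3 k by (auto simp: T_def a_def)
    have "a powr (2 * p) \<le> a powr (2 * real m) * T powr (2 * p - 2 * real m)"
      using T Ta p by (intro powr_le_exponent_drop) auto
    also have "a powr (2 * real m) = a ^ (2 * m)" using a1 by (simp add: power_eq_powr)
    also have "a ^ (2 * m) * T powr (2 * p - 2 * real m) \<le> (2 * 4 ^ m * W) * T powr e1"
      using weight_far_half[OF m k far] T W
      by (intro mult_mono powr_mono) (auto simp: a_def W_def e1_def)
    finally have "4 ^ m * a powr (2 * p) \<le> 4 ^ m * ((2 * 4 ^ m * W) * T powr e1)"
      by (intro mult_left_mono) auto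
    also have "\<dots> = 2 * (4 ^ m * 4 ^ m) * T powr e1 * W" by simp
    also have "(4::real) ^ m * 4 ^ m = 16 ^ m" by (simp flip: power_mult_distrib)
    finally show ?thesis using br by (intro goal1) simp
  qed
qed

text \<open>For \<open>i \<ge> 0\<close> only the resonance at \<open>i = k\<close> matters. Near it
  the weight cancels one power of \<open>bracket l\<close>; of the remaining
  \<open>bracket l powr (p - 1)\<close> a factor \<open>bracket l powr (- h)\<close> is set aside,
  and the rest is at most of order \<open>k powr \<gamma>\<close>. Thus \<open>h\<close> trades
  decay in \<open>k\<close> for summability in \<open>l\<close>.\<close>

lemma pair_kernel_offdiag_aux:
  fixes m :: nat and p h :: real and i k :: int
  assumes m: "1 \<le> m" and p: "0 \<le> p" "p \<le> real m" and k: "1 \<le> k" and i: "i \<noteq> k" "0 \<le> i" and h: "0 \<le> h"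
  defines "l \<equiv> k - i" and "\<gamma> \<equiv> max 0 (p - 1 + h)"
  shows "bracket l powr p * bracket (2 * k - l) powr p \<le> 2 * 16 ^ m * 2 powr \<gamma> *
    (real_of_int k powr (p + 1 - 2 * real m + \<gamma>) * bracket l powr (- h) + real_of_int k powr (2 * p - 2 * real m)) * weight m k i"
proof -
  define a T W where "a = \<bar>real_of_int l\<bar>" and "T = real_of_int k" and "W = weight m k i"
  define \<beta> e2 where "\<beta> = p + 1 - 2 * real m + \<gamma>" and "e2 = 2 * p - 2 * real m"
  have l0: "l \<noteq> 0" using i by (simp add: l_def)
  have a1: "1 \<le> a" using l0 by (simp add: a_def)
  have T: "1 \<le> T" using k by (simp add: T_def)
  have W: "0 < W" unfolding W_def by (rule weight_pos[OF k])
  have Tp: "T ^ (2 * m - 1) = T powr (2 * real m - 1)" using power_eq_powr[OF T, of "2 * m - 1"] m by simp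
  have g0: "0 \<le> \<gamma>" by (simp add: \<gamma>_def)
  have g1: "1 \<le> 2 powr \<gamma>" using powr_mono[OF g0, of 2] by simp
  show ?thesis
  proof (cases "\<bar>l\<bar> \<le> k")
    case True
    have d: "dist1 (\<bar>real_of_int i\<bar> - real_of_int k) = a"
    proof -
      have "\<bar>real_of_int i\<bar> - real_of_int k = - real_of_int l" using True by (simp add: l_def)
      thus ?thesis using a1 by (simp add: dist1_def a_def max_absorb2)
    qed
    have Wge: "a * T ^ (2 * m - 1) \<le> W"
      using weight_ge_dist1[OF k, of i m] unfolding d W_def T_def .
    have b2: "bracket l \<le> 2 * a" using bracket_le_double[OF l0] by (simp add: a_def)
    have bT: "bracket l \<le> 2 * T" using True k by (simp add: bracket_def T_def)
    have 1: "bracket (2 * k - l) powr p \<le> 4 ^ m * T powr p"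
    proof -
      have "real_of_int \<bar>2 * k - l\<bar> \<le> real_of_int (3 * k)" "1 \<le> real_of_int k" using True k by linarith+
      hence "bracket (2 * k - l) \<le> 4 * T" unfolding bracket_def T_def by linarith
      hence "bracket (2 * k - l) powr p \<le> (4 * T) powr p" using p by (intro powr_mono2) (auto simp: less_imp_le)
      also have "\<dots> = 4 powr p * T powr p" using T by (simp add: powr_mult)
      also have "\<dots> \<le> 4 ^ m * T powr p" using powr_le_power[of 4 p m] p by (intro mult_right_mono) auto
      finally show ?thesis .
    qed
    have 2: "bracket l powr p \<le> bracket l * ((2 powr \<gamma> * T powr \<gamma>) * bracket l powr (- h))"
    proof -
      have "bracket l powr p = bracket l powr (1 + (p - 1 + h) + - h)" by simp
      also have "\<dots> = bracket l * bracket l powr (p - 1 + h) * bracket l powr (- h)"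
        unfolding powr_add by (simp add: less_imp_le)
      also have "\<dots> \<le> bracket l * (2 powr \<gamma> * T powr \<gamma>) * bracket l powr (- h)"
      proof (intro mult_right_mono mult_left_mono)
        have "bracket l powr (p - 1 + h) \<le> bracket l powr \<gamma>" by (intro powr_mono) (auto simp: \<gamma>_def)
        also have "\<dots> \<le> (2 * T) powr \<gamma>" using bT g0 by (intro powr_mono2) (auto simp: less_imp_le)
        finally show "bracket l powr (p - 1 + h) \<le> 2 powr \<gamma> * T powr \<gamma>" using T by (simp add: powr_mult)
      qed (auto simp: less_imp_le)
      finally show ?thesis by (simp only: mult.assoc)
    qed
    have "bracket l powr p * bracket (2 * k - l) powr p
        \<le> ((2 * a) * ((2 powr \<gamma> * T powr \<gamma>) * bracket l powr (- h))) * (4 ^ m * T powr p)"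
      by (intro mult_mono 1 order_trans[OF 2] mult_right_mono b2) (use a1 in auto)
    also have "\<dots> = 2 * 4 ^ m * 2 powr \<gamma> * bracket l powr (- h) * (a * (T powr \<gamma> * T powr p))" by simp
    also have "T powr \<gamma> * T powr p = T powr \<beta> * T ^ (2 * m - 1)"
      unfolding Tp \<beta>_def by (simp add: powr_add[symmetric] add.commute)
    also have "a * (T powr \<beta> * T ^ (2 * m - 1)) = T powr \<beta> * (a * T ^ (2 * m - 1))" by simp
    finally have 3: "bracket l powr p * bracket (2 * k - l) powr p
        \<le> 2 * 4 ^ m * 2 powr \<gamma> * bracket l powr (- h) * (T powr \<beta> * (a * T ^ (2 * m - 1)))" .
    also have "\<dots> \<le> 2 * 16 ^ m * 2 powr \<gamma> * bracket l powr (- h) * (T powr \<beta> * W)"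
      using Wge W a1 T by (intro mult_mono power_mono mult_right_mono) (auto simp: less_imp_le)
    also have "\<dots> = 2 * 16 ^ m * 2 powr \<gamma> * ((T powr \<beta> * bracket l powr (- h)) * W)" by simp
    also have "\<dots> \<le> 2 * 16 ^ m * 2 powr \<gamma> * ((T powr \<beta> * bracket l powr (- h) + T powr e2) * W)"
      using W by (intro mult_left_mono mult_right_mono) auto
    finally show ?thesis by (simp only: T_def W_def \<beta>_def e2_def mult.assoc)
  next
    case False
    hence l: "l < - k" using i by (simp add: l_def)
    have far: "2 * k \<le> \<bar>i\<bar>" using l by (simp add: l_def)
    have Ta: "T \<le> a" using l k by (auto simp: T_def a_def)
    have Wge: "a ^ (2 * m) / 2 \<le> W"
    proof -
      have "a ^ (2 * m) \<le> \<bar>real_of_int i\<bar> ^ (2 * m)" using l k by (intro power_mono) (auto simp: a_def l_def)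
      moreover have "2 * real_of_int k \<le> \<bar>real_of_int i\<bar>" using far by linarith
      ultimately show ?thesis using weight_far[OF k m, of i] by (simp add: W_def)
    qed
    have "real_of_int \<bar>2 * k - l\<bar> + 1 \<le> real_of_int (4 * \<bar>l\<bar>)" using l k by linarith
    hence "bracket (2 * k - l) \<le> 4 * a" unfolding bracket_def a_def by linarith
    moreover have "bracket l \<le> 2 * a" using bracket_le_double[OF l0] by (simp add: a_def)
    ultimately have "bracket l powr p * bracket (2 * k - l) powr p \<le> (2 * a) powr p * (4 * a) powr p"
      using p by (intro mult_mono powr_mono2) (auto simp: less_imp_le)
    also have "\<dots> = 8 powr p * a powr (2 * p)"
    proof -
      have "(2 * a) powr p * (4 * a) powr p = (2 * a * (4 * a)) powr p" using a1 by (simp only: powr_mult)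
      also have "2 * a * (4 * a) = 8 * a\<^sup>2" by (simp add: power2_eq_square)
      also have "(8 * a\<^sup>2) powr p = 8 powr p * (a powr 2) powr p" using a1 by (simp add: powr_mult)
      finally show ?thesis by (simp only: powr_powr)
    qed
    also have "\<dots> \<le> 16 ^ m * (a powr (2 * real m) * T powr e2)"
    proof (rule mult_mono)
      have "(8::real) powr p \<le> 16 powr p" using p by (intro powr_mono2) auto
      also have "\<dots> \<le> 16 ^ m" by (rule powr_le_power) (use p in auto)
      finally show "(8::real) powr p \<le> 16 ^ m" .
      show "a powr (2 * p) \<le> a powr (2 * real m) * T powr e2"
        unfolding e2_def using T Ta p by (intro powr_le_exponent_drop) auto
    qed auto
    also have "a powr (2 * real m) = a ^ (2 * m)" using a1 by (simp add: power_eq_powr)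
    also have "16 ^ m * (a ^ (2 * m) * T powr e2) \<le> 16 ^ m * ((2 * W) * T powr e2)"
      using Wge by (intro mult_left_mono mult_right_mono) auto
    also have "\<dots> = 2 * 16 ^ m * 1 * (T powr e2 * W)" by simp
    also have "\<dots> \<le> 2 * 16 ^ m * 2 powr \<gamma> * ((T powr \<beta> * bracket l powr (- h) + T powr e2) * W)"
      using g1 W by (intro mult_mono mult_right_mono) auto
    finally show ?thesis by (simp only: T_def W_def \<beta>_def e2_def mult.assoc)
  qed
qed

text \<open>Replacing \<open>i\<close> by \<open>- i\<close> exchanges the two factors and keeps the
  weight, which reduces negative \<open>i\<close> to the previous estimate.\<close>

lemma pair_kernel_offdiag:
  fixes m :: nat and p h :: real and i k :: int
  assumes m: "1 \<le> m" and p: "0 \<le> p" "p \<le> real m" and k: "1 \<le> k" and i: "i \<noteq> k" "i \<noteq> - k" and h: "0 \<le> h"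
  defines "\<gamma> \<equiv> max 0 (p - 1 + h)"
  shows "bracket (k - i) powr p * bracket (k + i) powr p \<le> 2 * 16 ^ m * 2 powr \<gamma> *
    (real_of_int k powr (p + 1 - 2 * real m + \<gamma>) * (bracket (k - i) powr (- h) + bracket (k + i) powr (- h))
      + real_of_int k powr (2 * p - 2 * real m)) * weight m k i"
proof -
  let ?B = "real_of_int k powr (p + 1 - 2 * real m + \<gamma>)" and ?E = "real_of_int k powr (2 * p - 2 * real m)"
  have W: "0 < weight m k i" by (rule weight_pos[OF k])
  have fin: "2 * 16 ^ m * 2 powr \<gamma> * (?B * x + ?E) * weight m k i
    \<le> 2 * 16 ^ m * 2 powr \<gamma> * (?B * (x + y) + ?E) * weight m k i" if "0 \<le> y" for x y
    using W that by (intro mult_right_mono mult_left_mono add_mono) auto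
  show ?thesis
  proof (cases "0 \<le> i")
    case True
    have e: "2 * k - (k - i) = k + i" by simp
    show ?thesis
      by (rule order_trans[OF pair_kernel_offdiag_aux[OF m p k i(1) True h, folded \<gamma>_def, unfolded e] fin]) simp
  next
    case False
    have e: "k - - i = k + i" "2 * k - (k + i) = k - i" by simp_all
    show ?thesis
      using pair_kernel_offdiag_aux[OF m p k _ _ h, of "- i", folded \<gamma>_def, unfolded e] i False
        fin[of "bracket (k - i) powr (- h)" "bracket (k + i) powr (- h)"] by (simp add: add.commute mult.commute)
  qed
qed

section \<open>Convolution bounds\<close>

lemma cmod_infsum_le:
  fixes f :: "'a \<Rightarrow> complex"
  assumes "0 \<le> B" "\<And>F. finite F \<Longrightarrow> F \<subseteq> A \<Longrightarrow> (\<Sum>x\<in>F. cmod (f x)) \<le> B"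
  shows "cmod (infsum f A) \<le> B"
proof -
  have sm: "(\<lambda>x. cmod (f x)) summable_on A"
    by (rule nonneg_bdd_above_summable_on) (use assms(2) in \<open>auto intro!: bdd_aboveI[of _ B]\<close>)
  have "cmod (infsum f A) \<le> (\<Sum>\<^sub>\<infinity>x\<in>A. cmod (f x))" by (rule norm_infsum_bound[OF sm])
  also have "\<dots> \<le> B" by (rule infsum_le_finite_sums[OF sm]) (use assms(2) in auto)
  finally show ?thesis .
qed

text \<open>The convolution is a superposition of translates of \<open>b\<close>.\<close>

lemma l2_bounded_convolution:
  fixes a b :: "int \<Rightarrow> real"
  assumes a: "\<And>l. 0 \<le> a l" "\<And>G. finite G \<Longrightarrow> (\<Sum>l\<in>G. a l) \<le> A" and b: "l2_bounded B (\<lambda>x. of_real (b x))"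
  shows "l2_bounded (A * B) (\<lambda>x. of_real (\<Sum>\<^sub>\<infinity>l. a l * b (x - l)))"
    and "(\<lambda>l. a l * b (x - l)) summable_on UNIV"
proof -
  have A0: "0 \<le> A" using a(2)[of "{}"] by simp
  have B0: "0 \<le> B" by (rule l2_bounded_nonneg[OF b])
  have as: "a summable_on UNIV"
    by (rule nonneg_bdd_above_summable_on) (use a in \<open>auto intro!: bdd_aboveI[of _ A]\<close>)
  have bB: "\<bar>b x\<bar> \<le> B" for x using l2_bounded_pointwise[OF b, of x] by simp
  have sm: "(\<lambda>l. a l * b (x - l)) summable_on UNIV" for x
  proof (rule abs_summable_summable)
    show "(\<lambda>l. norm (a l * b (x - l))) summable_on UNIV"
    proof (rule summable_on_comparison_test)
      show "(\<lambda>l. a l * B) summable_on UNIV" by (intro summable_on_cmult_left as)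
    qed (use a(1) bB in \<open>auto simp: abs_mult intro!: mult_left_mono\<close>)
  qed
  thus "(\<lambda>l. a l * b (x - l)) summable_on UNIV" .
  have fin: "l2_bounded ((\<Sum>l\<in>G. a l) * B) (\<lambda>x. of_real (\<Sum>l\<in>G. a l * b (x - l)))" if "finite G" for G
    using that
  proof (induction G rule: finite_induct)
    case (insert l G)
    have "l2_bounded B (\<lambda>x. of_real (b (x - l)))"
      by (rule l2_bounded_reindex[OF b, of "\<lambda>x. x - l"]) (simp add: inj_on_def)
    from l2_bounded_add[OF l2_bounded_cmult[OF this, of "of_real (a l)"] insert.IH] insert.hyps a(1)
    show ?case by (simp add: algebra_simps)
  qed simp
  show "l2_bounded (A * B) (\<lambda>x. of_real (\<Sum>\<^sub>\<infinity>l. a l * b (x - l)))"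
  proof (rule l2_bounded_limit[where net = "finite_subsets_at_top UNIV"
        and f = "\<lambda>G x. of_real (\<Sum>l\<in>G. a l * b (x - l))"])
    show "((\<lambda>G. complex_of_real (\<Sum>l\<in>G. a l * b (x - l))) \<longlongrightarrow> of_real (\<Sum>\<^sub>\<infinity>l. a l * b (x - l)))
        (finite_subsets_at_top UNIV)" for x
      by (intro tendsto_of_real infsum_tendsto sm)
    show "\<forall>\<^sub>F G in finite_subsets_at_top UNIV. l2_bounded (A * B) (\<lambda>x. complex_of_real (\<Sum>l\<in>G. a l * b (x - l)))"
    proof (rule eventually_finite_subsets_at_top_weakI)
      fix G :: "int set" assume "finite G"
      thus "l2_bounded (A * B) (\<lambda>x. complex_of_real (\<Sum>l\<in>G. a l * b (x - l)))"
        by (intro l2_bounded_le[OF fin] mult_right_mono a(2) B0)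
    qed
  qed (use A0 B0 in auto)
qed

lemma dist1_inverse_l2: "\<exists>B. l2_bounded B (\<lambda>x::int. of_real (1 / dist1 (real_of_int x)))"
proof -
  obtain H where H: "\<And>F. finite F \<Longrightarrow> (\<Sum>k\<in>F. 1 / (dist1 (real_of_int k))\<^sup>2) \<le> H"
    using dist1_square_sum_bounded by blast
  have H0: "0 \<le> H" using H[of "{}"] by simp
  have "l2_bounded (sqrt H) (\<lambda>x::int. of_real (1 / dist1 (real_of_int x)))"
  proof (rule l2_boundedI)
    fix F :: "int set" assume "finite F"
    thus "(\<Sum>x\<in>F. (cmod (complex_of_real (1 / dist1 (real_of_int x))))\<^sup>2) \<le> (sqrt H)\<^sup>2"
      using H[of F] H0 by (simp add: norm_divide power_divide)
  qed (use H0 in simp)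
  thus ?thesis by blast
qed

text \<open>Fixed once and for all, like \<open>bracket_l2\<close> below, so that bounds built from
  it cannot depend on the potential.\<close>

definition dist1_l2 :: real where
  "dist1_l2 = (SOME B. l2_bounded B (\<lambda>x::int. of_real (1 / dist1 (real_of_int x))))"

lemma dist1_l2: "l2_bounded dist1_l2 (\<lambda>x::int. of_real (1 / dist1 (real_of_int x)))"
  unfolding dist1_l2_def by (rule someI_ex[OF dist1_inverse_l2])

lemma bracket_powr_l2:
  assumes "1 / 2 < h"
  shows "\<exists>B. l2_bounded B (\<lambda>x. of_real (bracket x powr (- h)))"
proof -
  obtain H where H: "\<And>F. finite F \<Longrightarrow> (\<Sum>k\<in>F. bracket k powr (- (2 * h))) \<le> H"
    using bracket_powr_sum_bounded[of "2 * h"] assms by auto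
  have H0: "0 \<le> H" using H[of "{}"] by simp
  have "l2_bounded (sqrt H) (\<lambda>x. of_real (bracket x powr (- h)))"
  proof (rule l2_boundedI)
    fix F :: "int set" assume "finite F"
    thus "(\<Sum>x\<in>F. (cmod (complex_of_real (bracket x powr (- h))))\<^sup>2) \<le> (sqrt H)\<^sup>2"
      using H[of F] H0 by (simp add: bracket_powr_square)
  qed (use H0 in simp)
  thus ?thesis by blast
qed

definition bracket_l2 :: "real \<Rightarrow> real" where
  "bracket_l2 h = (SOME B. l2_bounded B (\<lambda>x. of_real (bracket x powr (- h))))"

lemma bracket_l2: "1 / 2 < h \<Longrightarrow> l2_bounded (bracket_l2 h) (\<lambda>x. of_real (bracket x powr (- h)))"
  unfolding bracket_l2_def by (rule someI_ex[OF bracket_powr_l2])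

text \<open>\<open>y\<close> stands for the coefficients with the growth
  \<open>bracket l powr p\<close> removed. It is even, so that \<open>V l\<close> and
  \<open>V (- l)\<close>, which occur together in the second-order sums, share one majorant.\<close>

locale coeff_majorant =
  fixes m :: nat and p :: real and V :: "int \<Rightarrow> complex" and y :: "int \<Rightarrow> real" and Y :: real
  assumes m: "1 \<le> m" and p: "0 \<le> p" "p \<le> real m"
    and y_nonneg: "\<And>l. 0 \<le> y l" and y_even: "\<And>l. y (- l) = y l"
    and V_le: "\<And>l. cmod (V l) \<le> bracket l powr p * y l"
    and y_l2: "l2_bounded Y (\<lambda>l. of_real (y l))"
begin

lemma y_sum: "finite F \<Longrightarrow> (\<Sum>l\<in>F. (y l)\<^sup>2) \<le> Y\<^sup>2"
  using l2_boundedD[OF y_l2] by simp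

lemma y_sum_reindex:
  assumes "finite F" "inj h"
  shows "(\<Sum>i\<in>F. (y (h i))\<^sup>2) \<le> Y\<^sup>2"
proof -
  have "(\<Sum>i\<in>F. (y (h i))\<^sup>2) = (\<Sum>l\<in>h ` F. (y l)\<^sup>2)"
    by (rule sum.reindex_cong[symmetric, of h]) (use assms(2) in \<open>auto intro: inj_on_subset\<close>)
  thus ?thesis using y_sum[of "h ` F"] assms(1) by simp
qed

definition ftail :: "int \<Rightarrow> real" where
  "ftail k = (\<Sum>\<^sub>\<infinity>l. (if k < \<bar>l\<bar> then (y l)\<^sup>2 else 0) * (1 / dist1 (real_of_int (2 * k - l))))"

text \<open>\<open>y\<^sup>2\<close> is summable and \<open>1 / dist1\<close> is square summable, so
  this convolution, sampled at the even points \<open>2 * k\<close>, is square summable in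
  \<open>k\<close>.\<close>

definition ffull :: "int \<Rightarrow> real" where
  "ffull k = (\<Sum>\<^sub>\<infinity>l. (y l)\<^sup>2 * (1 / dist1 (real_of_int (2 * k - l))))"

lemma ftail_summable: "(\<lambda>l. (if k < \<bar>l\<bar> then (y l)\<^sup>2 else 0) * (1 / dist1 (real_of_int (2 * k - l)))) summable_on UNIV"
proof (rule l2_bounded_convolution(2)[where b = "\<lambda>x. 1 / dist1 (real_of_int x)" and A = "Y\<^sup>2", OF _ _ dist1_l2])
  fix G :: "int set" assume "finite G"
  have "(\<Sum>l\<in>G. if k < \<bar>l\<bar> then (y l)\<^sup>2 else 0) \<le> (\<Sum>l\<in>G. (y l)\<^sup>2)" by (intro sum_mono) auto
  also have "\<dots> \<le> Y\<^sup>2" by (rule y_sum) fact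
  finally show "(\<Sum>l\<in>G. if k < \<bar>l\<bar> then (y l)\<^sup>2 else 0) \<le> Y\<^sup>2" .
qed auto

lemma ffull_summable: "(\<lambda>l. (y l)\<^sup>2 * (1 / dist1 (real_of_int (2 * k - l)))) summable_on UNIV"
  by (rule l2_bounded_convolution(2)[where b = "\<lambda>x. 1 / dist1 (real_of_int x)" and A = "Y\<^sup>2", OF _ y_sum dist1_l2]) auto

lemma ffull_l2: "l2_bounded (Y\<^sup>2 * dist1_l2) (\<lambda>k. of_real (ffull k))"
proof -
  have "l2_bounded (Y\<^sup>2 * dist1_l2) (\<lambda>x. of_real (\<Sum>\<^sub>\<infinity>l. (y l)\<^sup>2 * (1 / dist1 (real_of_int (x - l)))))"
    by (rule l2_bounded_convolution(1)[where b = "\<lambda>x. 1 / dist1 (real_of_int x)" and A = "Y\<^sup>2", OF _ y_sum dist1_l2]) auto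
  from l2_bounded_reindex[OF this, of "\<lambda>k. 2 * k"] show ?thesis by (simp add: ffull_def inj_on_def)
qed

lemma ftail_nonneg: "0 \<le> ftail k" and ftail_le_ffull: "ftail k \<le> ffull k"
proof -
  have d: "0 \<le> 1 / dist1 x" for x using dist1_pos[of x] by simp
  show "0 \<le> ftail k" unfolding ftail_def by (rule infsum_nonneg) (use d in auto)
  show "ftail k \<le> ffull k" unfolding ftail_def ffull_def
    by (rule infsum_mono[OF ftail_summable ffull_summable]) (use d in auto)
qed

lemma ftail_le:
  assumes "\<And>F. finite F \<Longrightarrow> (\<Sum>l\<in>F. if k < \<bar>l\<bar> then (y l)\<^sup>2 else 0) \<le> \<eta>"
  shows "ftail k \<le> \<eta>"
  unfolding ftail_def
proof (rule infsum_le_finite_sums[OF ftail_summable])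
  fix F :: "int set" assume "finite F"
  have "(if k < \<bar>l\<bar> then (y l)\<^sup>2 else 0) * (1 / dist1 (real_of_int (2 * k - l))) \<le> (if k < \<bar>l\<bar> then (y l)\<^sup>2 else 0)" for l
    by (rule mult_right_le_one_le) (use dist1_ge(1)[of "real_of_int (2 * k - l)"] in auto)
  hence "(\<Sum>l\<in>F. (if k < \<bar>l\<bar> then (y l)\<^sup>2 else 0) * (1 / dist1 (real_of_int (2 * k - l))))
      \<le> (\<Sum>l\<in>F. if k < \<bar>l\<bar> then (y l)\<^sup>2 else 0)" by (rule sum_mono)
  thus "(\<Sum>l\<in>F. (if k < \<bar>l\<bar> then (y l)\<^sup>2 else 0) * (1 / dist1 (real_of_int (2 * k - l)))) \<le> \<eta>"
    using assms[OF \<open>finite F\<close>] by (rule order_trans)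
qed

text \<open>
  \<open>Q k\<close> and \<open>B h k\<close> bound the diagonal and off-diagonal entries of \<open>second_order m V k\<close>. In \<open>Q\<close> the
  coefficients of index at most \<open>k\<close> enter through their norm, and the others through \<open>ftail\<close>, whose
  kernel is peaked at the index \<open>2 k\<close> connecting \<open>k\<close> with the resonant frequency \<open>- k\<close>.
\<close>

definition Q :: "int \<Rightarrow> real" where
  "Q k = 2 * 16 ^ m * (real_of_int k powr (max 1 (2 * p) - 2 * real m) * Y\<^sup>2
    + real_of_int k powr (2 * p - 2 * real m + 1) * ftail k)"

lemma Q_nonneg: "0 \<le> Q k"
  unfolding Q_def using ftail_nonneg by simp

definition diag_term :: "int \<Rightarrow> int \<Rightarrow> real" where
  "diag_term k i = bracket (k - i) powr (2 * p) * (y (k - i))\<^sup>2 / weight m k i"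

lemma diag_term_nonneg: "1 \<le> k \<Longrightarrow> 0 \<le> diag_term k i"
  using weight_pos[of k m i] by (simp add: diag_term_def)

lemma diag_term_sum:
  assumes k: "1 \<le> k" and F: "finite F" "k \<notin> F"
  shows "(\<Sum>i\<in>F. diag_term k i) \<le> Q k"
proof -
  let ?e1 = "real_of_int k powr (max 1 (2 * p) - 2 * real m)" and ?e2 = "real_of_int k powr (2 * p - 2 * real m + 1)"
  define g where "g = (\<lambda>l. (if k < \<bar>l\<bar> then (y l)\<^sup>2 else 0) * (1 / dist1 (real_of_int (2 * k - l))))"
  have gs: "g summable_on UNIV" unfolding g_def by (rule ftail_summable)
  have g0: "0 \<le> g l" for l using dist1_pos[of "real_of_int (2 * k - l)"] by (simp add: g_def)
  have le: "diag_term k i \<le> 2 * 16 ^ m * (?e1 * (y (k - i))\<^sup>2 + ?e2 * g (k - i))" if "i \<in> F" for i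
  proof -
    have W: "0 < weight m k i" by (rule weight_pos[OF k])
    let ?b = "if k < \<bar>k - i\<bar> then ?e2 / dist1 (real_of_int (2 * k - (k - i))) else 0"
    have "i \<noteq> k" using that F by auto
    from pair_kernel_diag[OF m p k this]
    have "bracket (k - i) powr (2 * p) / weight m k i \<le> 2 * 16 ^ m * (?e1 + ?b)"
      using W by (simp only: pos_divide_le_eq)
    from mult_right_mono[OF this, of "(y (k - i))\<^sup>2"]
    have "diag_term k i \<le> 2 * 16 ^ m * (?e1 + ?b) * (y (k - i))\<^sup>2" by (simp add: diag_term_def)
    also have "\<dots> = 2 * 16 ^ m * (?e1 * (y (k - i))\<^sup>2 + ?e2 * g (k - i))"
      by (simp add: g_def distrib_right distrib_left)
    finally show ?thesis .
  qed
  have inj: "inj (\<lambda>i. k - i)" by (simp add: inj_on_def)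
  have s2: "(\<Sum>i\<in>F. g (k - i)) \<le> ftail k"
  proof -
    have "(\<Sum>i\<in>F. g (k - i)) = (\<Sum>l\<in>(\<lambda>i. k - i) ` F. g l)"
      by (rule sum.reindex_cong[symmetric, of "\<lambda>i. k - i"]) (auto simp: inj_on_def)
    also have "\<dots> \<le> ftail k" unfolding ftail_def g_def[symmetric]
      by (rule finite_sum_le_infsum[OF gs]) (use F g0 in auto)
    finally show ?thesis .
  qed
  have "(\<Sum>i\<in>F. diag_term k i) \<le> (\<Sum>i\<in>F. 2 * 16 ^ m * (?e1 * (y (k - i))\<^sup>2 + ?e2 * g (k - i)))"
    by (rule sum_mono[OF le])
  also have "\<dots> = 2 * 16 ^ m * (?e1 * (\<Sum>i\<in>F. (y (k - i))\<^sup>2) + ?e2 * (\<Sum>i\<in>F. g (k - i)))"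
    by (simp add: sum_distrib_left sum.distrib distrib_left)
  also have "\<dots> \<le> Q k" unfolding Q_def
    using y_sum_reindex[OF F(1) inj] s2 by (intro mult_left_mono add_mono) auto
  finally show ?thesis .
qed

lemma V_square_le: "cmod (V l) * cmod (V l) \<le> bracket l powr (2 * p) * (y l)\<^sup>2"
  and V_minus_le: "cmod (V l) \<le> bracket (- l) powr p * y (- l)"
proof -
  have "cmod (V l) * cmod (V l) \<le> (bracket l powr p * y l) * (bracket l powr p * y l)"
    using V_le[of l] by (intro mult_mono) (auto simp: y_nonneg)
  thus "cmod (V l) * cmod (V l) \<le> bracket l powr (2 * p) * (y l)\<^sup>2"
    unfolding bracket_powr_square[symmetric] by (simp add: power2_eq_square mult_ac)
  have "bracket (- l) = bracket l" by (simp add: bracket_def)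
  thus "cmod (V l) \<le> bracket (- l) powr p * y (- l)" using V_le[of l] y_even by simp
qed

lemma V_pair_square_le: "cmod (V l) * cmod (V (- l)) \<le> bracket l powr (2 * p) * (y l)\<^sup>2"
proof -
  have "cmod (V l) * cmod (V (- l)) \<le> (bracket l powr p * y l) * (bracket l powr p * y l)"
    using V_le[of l] V_minus_le[of "- l"] by (intro mult_mono) (auto simp: y_nonneg)
  thus ?thesis unfolding bracket_powr_square[symmetric] by (simp add: power2_eq_square mult_ac)
qed

lemma diag_term_sum_minus:
  assumes k: "1 \<le> k" and F: "finite F" "- k \<notin> F"
  shows "(\<Sum>i\<in>F. diag_term k (- i)) \<le> Q k"
proof -
  have "(\<Sum>i\<in>F. diag_term k (- i)) = (\<Sum>i\<in>uminus ` F. diag_term k i)"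
    by (rule sum.reindex_cong[symmetric, of uminus]) auto
  also have "\<dots> \<le> Q k" by (rule diag_term_sum[OF k]) (use F in auto)
  finally show ?thesis .
qed

text \<open>Only the columns \<open>k\<close> and \<open>- k\<close> contribute. The entries are
  kept abstract because the block with rows in the pair is treated through its transpose.\<close>

lemma pair_block_l2:
  assumes k: "1 \<le> k" and A: "\<And>i j. \<not> (i \<in> {i. odd i} - {k, - k} \<and> j \<in> {k, - k}) \<Longrightarrow> A i j = 0"
    and Ak: "\<And>i. (cmod (A i k))\<^sup>2 \<le> diag_term k i / c" "\<And>i. (cmod (A i (- k)))\<^sup>2 \<le> diag_term k (- i) / c" and c: "0 < c"
  shows "l2_bounded (sqrt (2 * Q k / c)) (\<lambda>(i, j). A i j)"
proof (rule l2_boundedI)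
  show "0 \<le> sqrt (2 * Q k / c)" using Q_nonneg[of k] c by simp
  fix F :: "(int \<times> int) set" assume F: "finite F"
  define F1 where "F1 = fst ` F - {k, - k}"
  have fin: "finite F1" using F by (simp add: F1_def)
  have kk: "k \<noteq> - k" using k by auto
  let ?h = "\<lambda>x. (cmod (case x of (i, j) \<Rightarrow> A i j))\<^sup>2"
  have "(\<Sum>x\<in>F. ?h x) = (\<Sum>x\<in>F \<inter> (F1 \<times> {k, - k}). ?h x)"
  proof (rule sum.mono_neutral_right[OF F])
    show "\<forall>x\<in>F - F \<inter> (F1 \<times> {k, - k}). ?h x = 0"
    proof
      fix x assume x: "x \<in> F - F \<inter> (F1 \<times> {k, - k})"
      obtain i j where ij: "x = (i, j)" by fastforce
      have "i \<in> fst ` F" using x ij by force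
      hence "A i j = 0" using x ij by (intro A) (auto simp: F1_def)
      thus "?h x = 0" by (simp add: ij)
    qed
  qed auto
  also have "\<dots> \<le> (\<Sum>x\<in>F1 \<times> {k, - k}. ?h x)" by (rule sum_mono2) (use fin in auto)
  also have "\<dots> = (\<Sum>i\<in>F1. \<Sum>j\<in>{k, - k}. (cmod (A i j))\<^sup>2)"
    by (simp only: sum.cartesian_product case_prod_unfold fst_conv snd_conv)
  also have "\<dots> = (\<Sum>i\<in>F1. (cmod (A i k))\<^sup>2 + (cmod (A i (- k)))\<^sup>2)"
    using kk by (intro sum.cong) auto
  also have "\<dots> \<le> (\<Sum>i\<in>F1. diag_term k i / c + diag_term k (- i) / c)"
    by (intro sum_mono add_mono Ak)
  also have "\<dots> = ((\<Sum>i\<in>F1. diag_term k i) + (\<Sum>i\<in>F1. diag_term k (- i))) / c"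
    by (simp add: sum.distrib sum_divide_distrib[symmetric] add_divide_distrib)
  also have "\<dots> \<le> (Q k + Q k) / c"
    using c by (intro divide_right_mono add_mono diag_term_sum diag_term_sum_minus k fin) (auto simp: F1_def)
  also have "\<dots> = (sqrt (2 * Q k / c))\<^sup>2" using Q_nonneg[of k] c by simp
  finally show "(\<Sum>x\<in>F. ?h x) \<le> (sqrt (2 * Q k / c))\<^sup>2" .
qed

lemma kmat_square_le:
  assumes k: "1 \<le> k"
  shows "(cmod (kmat m V k i k))\<^sup>2 \<le> diag_term k i / real_of_int k ^ (2 * m - 1)"
    and "(cmod (kmat m V k k i))\<^sup>2 \<le> diag_term k i / real_of_int k ^ (2 * m - 1)"
    and "(cmod (kmat m V k i (- k)))\<^sup>2 \<le> diag_term k (- i) / real_of_int k ^ (2 * m - 1)"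
    and "(cmod (kmat m V k (- k) i))\<^sup>2 \<le> diag_term k (- i) / real_of_int k ^ (2 * m - 1)"
proof -
  let ?c = "real_of_int k ^ (2 * m - 1)"
  have c: "0 < ?c" using k by simp
  have W: "0 < weight m k j" for j by (rule weight_pos[OF k])
  have wk: "weight m k k = ?c" "weight m k (- k) = ?c" using weight_diag[OF k, of m] k by simp_all
  have gen: "(cmod (kmat m V k a b))\<^sup>2 \<le> B / weight m k i / ?c"
    if "(cmod (V (a - b)))\<^sup>2 \<le> B" "weight m k a * weight m k b = weight m k i * ?c" for a b B i
  proof -
    have "(cmod (kmat m V k a b))\<^sup>2 \<le> (cmod (V (a - b)))\<^sup>2 / (weight m k a * weight m k b)"
      using W[of a] W[of b] by (auto simp: kmat_def norm_divide norm_mult power_divide power_mult_distrib less_imp_le)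
    also have "\<dots> \<le> B / (weight m k i * ?c)" unfolding that(2)
      using that(1) W[of i] c by (intro divide_right_mono) auto
    finally show ?thesis by simp
  qed
  have V1: "(cmod (V l))\<^sup>2 \<le> bracket l powr (2 * p) * (y l)\<^sup>2" for l
    using V_square_le[of l] by (simp add: power2_eq_square)
  have V2: "(cmod (V l))\<^sup>2 \<le> bracket (- l) powr (2 * p) * (y (- l))\<^sup>2" for l
    using V1[of l] by (simp add: bracket_def y_even)
  show "(cmod (kmat m V k i k))\<^sup>2 \<le> diag_term k i / ?c"
    using gen[OF V2, of i k i] wk by (simp add: diag_term_def)
  show "(cmod (kmat m V k k i))\<^sup>2 \<le> diag_term k i / ?c"
    using gen[OF V1, of k i i] wk by (simp add: diag_term_def)
  show "(cmod (kmat m V k i (- k)))\<^sup>2 \<le> diag_term k (- i) / ?c"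
    using gen[OF V1, of i "- k" i] wk by (simp add: diag_term_def add.commute)
  show "(cmod (kmat m V k (- k) i))\<^sup>2 \<le> diag_term k (- i) / ?c"
    using gen[OF V2, of "- k" i i] wk by (simp add: diag_term_def add.commute)
qed

text \<open>With this \<open>\<tau>\<close> the quantity
  \<open>k ^ (2 * m - 1) * \<tau>\<^sup>2\<close> in the effective entries equals
  \<open>2 * Q k\<close>, so the crude errors have the size of the bound for the diagonal
  second-order sums.\<close>

lemma pair_blocks_small:
  assumes k: "1 \<le> k"
  defines "\<tau> \<equiv> sqrt (2 * Q k / real_of_int k ^ (2 * m - 1))"
  shows "l2_bounded \<tau> (\<lambda>(i, j). if i \<in> {i. odd i} - {k, - k} \<and> j \<in> {k, - k} then kmat m V k i j else 0)"
    and "l2_bounded \<tau> (\<lambda>(i, j). if i \<in> {k, - k} \<and> j \<in> {i. odd i} - {k, - k} then kmat m V k i j else 0)"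
proof -
  have c: "0 < real_of_int k ^ (2 * m - 1)" using k by simp
  have nn: "0 \<le> diag_term k i / real_of_int k ^ (2 * m - 1)" for i using diag_term_nonneg[OF k, of i] c by simp
  show "l2_bounded \<tau> (\<lambda>(i, j). if i \<in> {i. odd i} - {k, - k} \<and> j \<in> {k, - k} then kmat m V k i j else 0)"
    unfolding \<tau>_def by (rule pair_block_l2[OF k _ _ _ c]) (use kmat_square_le[OF k] nn in auto)
  have "l2_bounded \<tau> (\<lambda>(j, i). if i \<in> {k, - k} \<and> j \<in> {i. odd i} - {k, - k} then kmat m V k i j else 0)"
    unfolding \<tau>_def by (rule pair_block_l2[OF k _ _ _ c]) (use kmat_square_le[OF k] nn in auto)
  moreover have "inj (\<lambda>(i::int, j::int). (j, i))" by (auto simp: inj_on_def)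
  ultimately have "l2_bounded \<tau> (\<lambda>x. case (case x of (i, j) \<Rightarrow> (j, i)) of (j, i) \<Rightarrow>
      if i \<in> {k, - k} \<and> j \<in> {i. odd i} - {k, - k} then kmat m V k i j else 0)" by (rule l2_bounded_reindex)
  thus "l2_bounded \<tau> (\<lambda>(i, j). if i \<in> {k, - k} \<and> j \<in> {i. odd i} - {k, - k} then kmat m V k i j else 0)"
    by (rule l2_bounded_mono) auto
qed

text \<open>By \<open>pair_gap\<close> the weight is a lower bound for the modulus of the
  denominator.\<close>

lemma second_order_le:
  assumes k: "odd k" "1 \<le> k" and B: "0 \<le> B"
    and le: "\<And>F. finite F \<Longrightarrow> F \<subseteq> {l. odd l} - {k, - k} \<Longrightarrow> (\<Sum>l\<in>F. cmod (V (i - l)) * cmod (V (l - j)) / weight m k l) \<le> B"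
  shows "cmod (second_order m V k i j) \<le> B"
  unfolding second_order_def
proof (rule cmod_infsum_le[OF B])
  fix F assume F: "finite F" "F \<subseteq> {l. odd l} - {k, - k}"
  have "cmod (V (i - l) * V (l - j) / (lam0 m l - lam0 m k)) \<le> cmod (V (i - l)) * cmod (V (l - j)) / weight m k l" if "l \<in> F" for l
  proof -
    have l: "odd l" "l \<noteq> k" "l \<noteq> - k" using that F by auto
    show ?thesis unfolding norm_divide norm_mult
      by (rule divide_left_mono[OF pair_gap(1)[OF m k l]])
        (use weight_pos[OF k(2), of m l] pair_gap(1)[OF m k l] in \<open>auto intro!: mult_pos_pos dest: less_le_trans\<close>)
  qed
  hence "(\<Sum>l\<in>F. cmod (V (i - l) * V (l - j) / (lam0 m l - lam0 m k)))
      \<le> (\<Sum>l\<in>F. cmod (V (i - l)) * cmod (V (l - j)) / weight m k l)" by (rule sum_mono)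
  also have "\<dots> \<le> B" by (rule le[OF F])
  finally show "(\<Sum>l\<in>F. cmod (V (i - l) * V (l - j) / (lam0 m l - lam0 m k))) \<le> B" .
qed

lemma second_order_diag:
  assumes k: "odd k" "1 \<le> k"
  shows "cmod (second_order m V k k k) \<le> Q k" "cmod (second_order m V k (- k) (- k)) \<le> Q k"
proof -
  have W: "0 < weight m k j" for j by (rule weight_pos[OF k(2)])
  show "cmod (second_order m V k k k) \<le> Q k"
  proof (rule second_order_le[OF k Q_nonneg])
    fix F assume F: "finite F" "F \<subseteq> {l. odd l} - {k, - k}"
    have "(\<Sum>l\<in>F. cmod (V (k - l)) * cmod (V (l - k)) / weight m k l) \<le> (\<Sum>l\<in>F. diag_term k l)"
      unfolding diag_term_def using V_pair_square_le[of "k - _"] W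
      by (intro sum_mono divide_right_mono) (auto simp: less_imp_le)
    also have "\<dots> \<le> Q k" by (rule diag_term_sum[OF k(2)]) (use F in auto)
    finally show "(\<Sum>l\<in>F. cmod (V (k - l)) * cmod (V (l - k)) / weight m k l) \<le> Q k" .
  qed
  show "cmod (second_order m V k (- k) (- k)) \<le> Q k"
  proof (rule second_order_le[OF k Q_nonneg])
    fix F assume F: "finite F" "F \<subseteq> {l. odd l} - {k, - k}"
    have "(\<Sum>l\<in>F. cmod (V (- k - l)) * cmod (V (l - - k)) / weight m k l) \<le> (\<Sum>l\<in>F. diag_term k (- l))"
    proof (rule sum_mono)
      fix l
      have "cmod (V (k + l)) * cmod (V (- (k + l))) \<le> bracket (k + l) powr (2 * p) * (y (k + l))\<^sup>2"
        by (rule V_pair_square_le)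
      hence "cmod (V (- k - l)) * cmod (V (l - - k)) \<le> bracket (k - - l) powr (2 * p) * (y (k - - l))\<^sup>2"
        by (simp add: mult.commute add.commute)
      thus "cmod (V (- k - l)) * cmod (V (l - - k)) / weight m k l \<le> diag_term k (- l)"
        unfolding diag_term_def weight_minus using W[of l] by (intro divide_right_mono) (auto simp: less_imp_le)
    qed
    also have "\<dots> \<le> Q k" by (rule diag_term_sum_minus[OF k(2)]) (use F in auto)
    finally show "(\<Sum>l\<in>F. cmod (V (- k - l)) * cmod (V (l - - k)) / weight m k l) \<le> Q k" .
  qed
qed

text \<open>The frequencies \<open>k - i\<close> and \<open>k + i\<close> add up to
  \<open>2 * k\<close>, so off-diagonal sums are convolutions evaluated at \<open>2 * k\<close>. For
  \<open>h > 1/2\<close> the factor with \<open>bracket l powr (- h)\<close> is summable by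
  Cauchy-Schwarz, and convolving it with \<open>y\<close> gives a square summable function of
  \<open>k\<close>.\<close>

definition g :: "real \<Rightarrow> int \<Rightarrow> real" where
  "g h k = (\<Sum>\<^sub>\<infinity>l. (y l * bracket l powr (- h)) * y (2 * k - l))"

definition B :: "real \<Rightarrow> int \<Rightarrow> real" where
  "B h k = 2 * 16 ^ m * 2 powr max 0 (p - 1 + h) *
    (real_of_int k powr (p + 1 - 2 * real m + max 0 (p - 1 + h)) * (2 * g h k) + real_of_int k powr (2 * p - 2 * real m) * Y\<^sup>2)"

lemma y_bracket_sum:
  assumes h: "1 / 2 < h" and F: "finite F"
  shows "(\<Sum>l\<in>F. y l * bracket l powr (- h)) \<le> Y * bracket_l2 h"
proof -
  have "(\<Sum>l\<in>F. y l * bracket l powr (- h)) = (\<Sum>l\<in>F. \<bar>cmod (of_real (y l))\<bar> * \<bar>cmod (of_real (bracket l powr (- h)))\<bar>)"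
    using y_nonneg by simp
  also have "\<dots> \<le> L2_set (\<lambda>l. cmod (of_real (y l))) F * L2_set (\<lambda>l. cmod (of_real (bracket l powr (- h)))) F"
    by (rule L2_set_mult_ineq)
  also have "\<dots> \<le> Y * bracket_l2 h"
    using y_l2 bracket_l2[OF h] F unfolding l2_bounded_def by (intro mult_mono) auto
  finally show ?thesis .
qed

lemma g_summable: "1 / 2 < h \<Longrightarrow> (\<lambda>l. (y l * bracket l powr (- h)) * y (2 * k - l)) summable_on UNIV"
  by (rule l2_bounded_convolution(2)[OF _ y_bracket_sum y_l2]) (use y_nonneg in auto)

lemma g_nonneg: "0 \<le> g h k"
  unfolding g_def by (rule infsum_nonneg) (use y_nonneg in auto)

lemma g_l2: "1 / 2 < h \<Longrightarrow> l2_bounded (Y * bracket_l2 h * Y) (\<lambda>k. of_real (g h k))"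
proof -
  assume h: "1 / 2 < h"
  have "l2_bounded (Y * bracket_l2 h * Y) (\<lambda>x. of_real (\<Sum>\<^sub>\<infinity>l. (y l * bracket l powr (- h)) * y (x - l)))"
    by (rule l2_bounded_convolution(1)[OF _ y_bracket_sum[OF h] y_l2]) (use y_nonneg in auto)
  from l2_bounded_reindex[OF this, of "\<lambda>k. 2 * k"] show ?thesis by (simp add: g_def inj_on_def)
qed

lemma B_nonneg: "0 \<le> B h k"
  unfolding B_def using g_nonneg by simp

lemma offdiag_sum:
  assumes h: "1 / 2 < h" and k: "1 \<le> k" and F: "finite F" "k \<notin> F" "- k \<notin> F"
  shows "(\<Sum>i\<in>F. (bracket (k - i) powr p * y (k - i)) * (bracket (k + i) powr p * y (k + i)) / weight m k i) \<le> B h k"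
proof -
  let ?G = "max 0 (p - 1 + h)"
  let ?e1 = "real_of_int k powr (p + 1 - 2 * real m + ?G)" and ?e2 = "real_of_int k powr (2 * p - 2 * real m)"
  define u where "u l = (y l * bracket l powr (- h)) * y (2 * k - l)" for l
  have u0: "0 \<le> u l" for l using y_nonneg by (simp add: u_def)
  have le: "(bracket (k - i) powr p * y (k - i)) * (bracket (k + i) powr p * y (k + i)) / weight m k i
    \<le> 2 * 16 ^ m * 2 powr ?G * (?e1 * (u (k - i) + u (k + i)) + ?e2 * ((y (k - i))\<^sup>2 / 2 + (y (k + i))\<^sup>2 / 2))"
    if "i \<in> F" for i
  proof -
    have W: "0 < weight m k i" by (rule weight_pos[OF k])
    let ?bb = "bracket (k - i) powr (- h) + bracket (k + i) powr (- h)"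
    have i: "i \<noteq> k" "i \<noteq> - k" using that F by auto
    have "bracket (k - i) powr p * bracket (k + i) powr p / weight m k i \<le> 2 * 16 ^ m * 2 powr ?G * (?e1 * ?bb + ?e2)"
      using pair_kernel_offdiag[OF m p k i, of h] h W by (simp only: pos_divide_le_eq)
    from mult_right_mono[OF this, of "y (k - i) * y (k + i)"]
    have "(bracket (k - i) powr p * y (k - i)) * (bracket (k + i) powr p * y (k + i)) / weight m k i
        \<le> 2 * 16 ^ m * 2 powr ?G * (?e1 * ?bb + ?e2) * (y (k - i) * y (k + i))"
      using y_nonneg by (simp add: mult_ac)
    also have "\<dots> = 2 * 16 ^ m * 2 powr ?G * (?e1 * (u (k - i) + u (k + i)) + ?e2 * (y (k - i) * y (k + i)))"
      by (simp add: u_def algebra_simps)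
    also have "\<dots> \<le> 2 * 16 ^ m * 2 powr ?G * (?e1 * (u (k - i) + u (k + i)) + ?e2 * ((y (k - i))\<^sup>2 / 2 + (y (k + i))\<^sup>2 / 2))"
      using sum_squares_bound[of "y (k - i)" "y (k + i)"] by (intro mult_left_mono add_left_mono) auto
    finally show ?thesis .
  qed
  have us: "(\<Sum>i\<in>F. u (h' i)) \<le> g h k" if "inj h'" for h' :: "int \<Rightarrow> int"
  proof -
    have "(\<Sum>i\<in>F. u (h' i)) = (\<Sum>l\<in>h' ` F. u l)"
      by (rule sum.reindex_cong[symmetric, of h']) (use that in \<open>auto intro: inj_on_subset\<close>)
    also have "\<dots> \<le> g h k" unfolding g_def u_def[symmetric]
      by (rule finite_sum_le_infsum) (use g_summable[OF h, of k] F u0 in \<open>auto simp: u_def[symmetric]\<close>)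
    finally show ?thesis .
  qed
  have inj: "inj (\<lambda>i. k - i)" "inj (\<lambda>i. k + i)" by (simp_all add: inj_on_def)
  have "(\<Sum>i\<in>F. (bracket (k - i) powr p * y (k - i)) * (bracket (k + i) powr p * y (k + i)) / weight m k i)
    \<le> (\<Sum>i\<in>F. 2 * 16 ^ m * 2 powr ?G * (?e1 * (u (k - i) + u (k + i)) + ?e2 * ((y (k - i))\<^sup>2 / 2 + (y (k + i))\<^sup>2 / 2)))"
    by (rule sum_mono[OF le])
  also have "\<dots> = 2 * 16 ^ m * 2 powr ?G * (?e1 * ((\<Sum>i\<in>F. u (k - i)) + (\<Sum>i\<in>F. u (k + i)))
      + ?e2 * ((\<Sum>i\<in>F. (y (k - i))\<^sup>2) / 2 + (\<Sum>i\<in>F. (y (k + i))\<^sup>2) / 2))"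
    by (simp only: sum_distrib_left[symmetric] sum.distrib sum_divide_distrib[symmetric])
  also have "\<dots> \<le> 2 * 16 ^ m * 2 powr ?G * (?e1 * (g h k + g h k) + ?e2 * (Y\<^sup>2 / 2 + Y\<^sup>2 / 2))"
    by (intro mult_left_mono add_mono divide_right_mono us inj y_sum_reindex F(1)) auto
  also have "\<dots> = B h k" by (simp add: B_def)
  finally show ?thesis .
qed

lemma second_order_offdiag:
  assumes h: "1 / 2 < h" and k: "odd k" "1 \<le> k"
  shows "cmod (second_order m V k k (- k)) \<le> B h k" "cmod (second_order m V k (- k) k) \<le> B h k"
proof -
  have W: "0 < weight m k j" for j by (rule weight_pos[OF k(2)])
  show "cmod (second_order m V k k (- k)) \<le> B h k"
  proof (rule second_order_le[OF k B_nonneg])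
    fix F assume F: "finite F" "F \<subseteq> {l. odd l} - {k, - k}"
    have "(\<Sum>l\<in>F. cmod (V (k - l)) * cmod (V (l - - k)) / weight m k l)
        \<le> (\<Sum>i\<in>F. (bracket (k - i) powr p * y (k - i)) * (bracket (k + i) powr p * y (k + i)) / weight m k i)"
    proof (intro sum_mono divide_right_mono mult_mono)
      fix l
      show "cmod (V (k - l)) \<le> bracket (k - l) powr p * y (k - l)" by (rule V_le)
      show "cmod (V (l - - k)) \<le> bracket (k + l) powr p * y (k + l)" using V_le[of "k + l"] by (simp add: add.commute)
    qed (use W y_nonneg in \<open>auto simp: less_imp_le\<close>)
    also have "\<dots> \<le> B h k" by (rule offdiag_sum[OF h k(2)]) (use F in auto)
    finally show "(\<Sum>l\<in>F. cmod (V (k - l)) * cmod (V (l - - k)) / weight m k l) \<le> B h k" .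
  qed
  show "cmod (second_order m V k (- k) k) \<le> B h k"
  proof (rule second_order_le[OF k B_nonneg])
    fix F assume F: "finite F" "F \<subseteq> {l. odd l} - {k, - k}"
    have "(\<Sum>l\<in>F. cmod (V (- k - l)) * cmod (V (l - k)) / weight m k l)
        \<le> (\<Sum>i\<in>F. (bracket (k + i) powr p * y (k + i)) * (bracket (k - i) powr p * y (k - i)) / weight m k i)"
    proof (intro sum_mono divide_right_mono mult_mono)
      fix l
      show "cmod (V (l - k)) \<le> bracket (k - l) powr p * y (k - l)" using V_minus_le[of "l - k"] by simp
      show "cmod (V (- k - l)) \<le> bracket (k + l) powr p * y (k + l)" using V_minus_le[of "- k - l"] by (simp add: add.commute)
    qed (use W y_nonneg in \<open>auto simp: less_imp_le\<close>)
    also have "\<dots> = (\<Sum>i\<in>F. (bracket (k - i) powr p * y (k - i)) * (bracket (k + i) powr p * y (k + i)) / weight m k i)"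
      by (simp only: mult.commute)
    also have "\<dots> \<le> B h k" by (rule offdiag_sum[OF h k(2)]) (use F in auto)
    finally show "(\<Sum>l\<in>F. cmod (V (- k - l)) * cmod (V (l - k)) / weight m k l) \<le> B h k" .
  qed
qed

end

text \<open>The substitution of \<open>- l\<close> for \<open>l\<close> exchanges the two factors of
  each summand; one estimate then serves both diagonal entries.\<close>

lemma second_order_reflect:
  "second_order m V k (- k) (- k) = second_order m V k k k"
proof -
  have bij: "bij_betw uminus ({l. odd l} - {k, - k}) ({l. odd l} - {k, - k})"
    by (rule bij_betwI[where g = uminus]) auto
  have "second_order m V k (- k) (- k)
      = (\<Sum>\<^sub>\<infinity>l\<in>{l. odd l} - {k, - k}. V (- k - - l) * V (- l - - k) / (lam0 m (- l) - lam0 m k))"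
    unfolding second_order_def by (rule infsum_reindex_bij_betw[OF bij, symmetric])
  also have "\<dots> = second_order m V k k k"
    unfolding second_order_def by (intro infsum_cong) (simp add: mult.commute)
  finally show ?thesis .
qed

section \<open>Cancellation in the borderline case\<close>

lemma infsum_odd_function:
  fixes f :: "int \<Rightarrow> complex"
  assumes "\<And>j. f (- j) = - f j"
  shows "(\<Sum>\<^sub>\<infinity>j. f j) = 0"
proof -
  have "(\<Sum>\<^sub>\<infinity>j. f j) = (\<Sum>\<^sub>\<infinity>j. f (- j))"
    by (rule infsum_reindex_bij_betw[symmetric]) (simp add: bij_uminus)
  also have "\<dots> = - (\<Sum>\<^sub>\<infinity>j. f j)" by (simp add: assms infsum_uminus)
  finally show ?thesis by (simp add: equal_neg_zero)
qed

context coeff_majorant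
begin

text \<open>
  For \<open>m = 1\<close> and \<open>p = 0\<close> the termwise bound \<open>Q\<close> is of the borderline order \<open>1 / k\<close>. The partial
  fraction \<open>1 / (j (j - 2 k)) = (1 / (j - 2 k) - 1 / j) / (2 k)\<close> gains what is missing, since the
  contributions of \<open>1 / j\<close> cancel by oddness.
\<close>

lemma second_order_diag_L2:
  assumes m1: "m = 1" and p0: "p = 0" and V_odd: "\<And>l. odd l \<Longrightarrow> V l = 0" and k: "odd k" "1 \<le> k"
  shows "cmod (second_order m V k k k) \<le> ffull k / real_of_int k"
proof -
  define c where "c j = V j * V (- j)" for j
  define z :: complex where "z = of_int (2 * k)"
  have z0: "z \<noteq> 0" using k by (simp add: z_def)
  have c_le: "cmod (c j) \<le> (y j)\<^sup>2" for j
    using V_pair_square_le[of j] by (simp add: c_def norm_mult p0)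
  have c_even: "c (- j) = c j" for j by (simp add: c_def mult.commute)
  have d: "0 < dist1 x" for x by (rule dist1_pos)
  define f1 f2 where "f1 j = c j / (of_int j - z)" and "f2 j = c j / of_int j" for j
  have inv_le: "cmod (x / of_int i) \<le> cmod x * (1 / dist1 (real_of_int i))" for x i
  proof (cases "i = 0")
    case False
    hence "dist1 (real_of_int i) = \<bar>real_of_int i\<bar>" by (simp add: dist1_def)
    thus ?thesis by (simp add: norm_divide)
  qed (use d[of 0] in simp)
  have f1_le: "cmod (f1 j) \<le> (y j)\<^sup>2 * (1 / dist1 (real_of_int (2 * k - j)))" for j
  proof -
    have "cmod (f1 j) = cmod (c j / of_int (j - 2 * k))" by (simp add: f1_def z_def)
    also have "\<dots> \<le> cmod (c j) * (1 / dist1 (real_of_int (j - 2 * k)))" by (rule inv_le)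
    also have "dist1 (real_of_int (j - 2 * k)) = dist1 (real_of_int (2 * k - j))" by (simp add: dist1_def abs_minus_commute)
    also have "cmod (c j) * (1 / dist1 (real_of_int (2 * k - j))) \<le> (y j)\<^sup>2 * (1 / dist1 (real_of_int (2 * k - j)))"
      using c_le d[of "real_of_int (2 * k - j)"] by (intro mult_right_mono) auto
    finally show ?thesis .
  qed
  have f2_le: "cmod (f2 j) \<le> (y j)\<^sup>2" for j
  proof -
    have "cmod (f2 j) \<le> cmod (c j) * (1 / dist1 (real_of_int j))" unfolding f2_def by (rule inv_le)
    also have "\<dots> \<le> cmod (c j) * 1" using dist1_ge(1)[of "real_of_int j"] by (intro mult_left_mono) auto
    finally show ?thesis using c_le[of j] by simp
  qed
  have ysq: "(\<lambda>l. (y l)\<^sup>2) summable_on UNIV"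
    by (rule nonneg_bdd_above_summable_on) (auto intro!: bdd_aboveI[of _ "Y\<^sup>2"] y_sum)
  have s1: "(\<lambda>j. cmod (f1 j)) summable_on UNIV"
    by (rule summable_on_comparison_test[OF ffull_summable[of k] f1_le]) simp
  have s2: "(\<lambda>j. cmod (f2 j)) summable_on UNIV"
    by (rule summable_on_comparison_test[OF ysq f2_le]) simp
  \<comment> \<open>Corrections at the poles: with \<open>x / 0 = 0\<close> the left side below
    vanishes at \<open>j = 0\<close> and at \<open>j = 2 * k\<close>, but there one of the two
    partial fractions survives and has to be cancelled.\<close>
  define e where "e j = (if j = 0 then c 0 / z else 0) + (if j = 2 * k then c (2 * k) / z else 0)" for j
  have es: "(e has_sum (c 0 / z + c (2 * k) / z)) UNIV"
  proof -
    have "(e has_sum (\<Sum>j\<in>{0, 2 * k}. e j)) UNIV"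
      by (rule has_sum_finite_neutralI[of "{0, 2 * k}"]) (auto simp: e_def)
    moreover have "(\<Sum>j\<in>{0, 2 * k}. e j) = c 0 / z + c (2 * k) / z" using k by (simp add: e_def)
    ultimately show ?thesis by simp
  qed
  have pf: "c j / (of_int j * (of_int j - z)) = 1 / z * (f1 j + (- f2 j + e j))" for j
  proof -
    consider "j = 0" | "j = 2 * k" | "j \<noteq> 0" "j \<noteq> 2 * k" by blast
    thus ?thesis
    proof cases
      case 1
      thus ?thesis using k z0 by (simp add: f1_def f2_def e_def)
    next
      case 2
      thus ?thesis using k z0 by (simp add: f1_def f2_def e_def z_def)
    next
      case 3
      have "(of_int j :: complex) - z \<noteq> 0"
      proof -
        have "(of_int j :: complex) - z = of_int (j - 2 * k)" by (simp add: z_def)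
        thus ?thesis using 3 by (simp only: of_int_eq_0_iff)
      qed
      thus ?thesis using 3 z0 by (simp add: f1_def f2_def e_def field_simps)
    qed
  qed
  define L where "L = {l. odd l} - {k, - k}"
  \<comment> \<open>After the substitution \<open>l = k - j\<close> the sum extends to all integers:
    odd \<open>j\<close> contribute nothing because \<open>V\<close> vanishes there, and
    \<open>0\<close> and \<open>2 * k\<close> nothing because the denominator is 0.\<close>
  have so: "second_order m V k k k = (\<Sum>\<^sub>\<infinity>j. 1 / of_real (pi\<^sup>2) * (c j / (of_int j * (of_int j - z))))"
  proof -
    have bij: "bij_betw (\<lambda>j. k - j) ({j. even j} - {0, 2 * k}) L"
      unfolding L_def using k by (intro bij_betwI[where g = "\<lambda>l. k - l"]) auto
    have "second_order m V k k k = (\<Sum>\<^sub>\<infinity>l\<in>L. V (k - l) * V (l - k) / (lam0 m l - lam0 m k))"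
      by (simp add: second_order_def L_def)
    also have "\<dots> = (\<Sum>\<^sub>\<infinity>j\<in>{j. even j} - {0, 2 * k}. V (k - (k - j)) * V ((k - j) - k) / (lam0 m (k - j) - lam0 m k))"
      by (rule infsum_reindex_bij_betw[OF bij, symmetric])
    also have "\<dots> = (\<Sum>\<^sub>\<infinity>j. 1 / of_real (pi\<^sup>2) * (c j / (of_int j * (of_int j - z))))"
    proof (rule infsum_cong_neutral)
      fix j assume "j \<in> UNIV - ({j. even j} - {0, 2 * k})"
      thus "1 / of_real (pi\<^sup>2) * (c j / (of_int j * (of_int j - z))) = 0"
        using V_odd[of j] by (auto simp: c_def z_def)
    next
      fix j
      have "lam0 m (k - j) - lam0 m k = of_real (pi\<^sup>2) * (of_int j * (of_int j - z))"
        by (simp add: lam0_def m1 z_def power2_eq_square algebra_simps)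
      thus "V (k - (k - j)) * V ((k - j) - k) / (lam0 m (k - j) - lam0 m k)
          = 1 / of_real (pi\<^sup>2) * (c j / (of_int j * (of_int j - z)))"
        by (simp add: c_def)
    qed auto
    finally show ?thesis .
  qed
  have f1s: "f1 summable_on UNIV" and f2s: "f2 summable_on UNIV"
    using s1 s2 by (auto intro: abs_summable_summable)
  have f2z: "infsum f2 UNIV = 0" by (rule infsum_odd_function) (simp add: f2_def c_even)
  have "second_order m V k k k = (\<Sum>\<^sub>\<infinity>j. 1 / (of_real (pi\<^sup>2) * z) * (f1 j + (- f2 j + e j)))"
    unfolding so pf by simp
  also have "\<dots> = 1 / (of_real (pi\<^sup>2) * z) * (\<Sum>\<^sub>\<infinity>j. f1 j + (- f2 j + e j))" by (rule infsum_cmult_right')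
  also have "(\<Sum>\<^sub>\<infinity>j. f1 j + (- f2 j + e j)) = infsum f1 UNIV + (- infsum f2 UNIV + infsum e UNIV)"
  proof -
    have n2: "(\<lambda>j. - f2 j) summable_on UNIV" using f2s by (simp add: summable_on_uminus)
    have e2: "e summable_on UNIV" using es by (rule has_sum_imp_summable)
    show ?thesis
      using infsum_add[OF f1s summable_on_add[OF n2 e2]] infsum_add[OF n2 e2] by (simp add: infsum_uminus)
  qed
  also have "\<dots> = infsum f1 UNIV + (c 0 / z + c (2 * k) / z)" using f2z infsumI[OF es] by simp
  finally have eq: "second_order m V k k k = 1 / (of_real (pi\<^sup>2) * z) * (infsum f1 UNIV + (c 0 / z + c (2 * k) / z))" .
  have single: "(y j)\<^sup>2 * (1 / dist1 (real_of_int (2 * k - j))) \<le> ffull k" for j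
    using finite_sum_le_infsum[OF ffull_summable[of k], of "{j}"] d unfolding ffull_def by (simp add: less_imp_le)
  have zc: "cmod z = 2 * real_of_int k" using k by (simp add: z_def norm_mult)
  have b1: "cmod (infsum f1 UNIV) \<le> ffull k"
  proof -
    have "cmod (infsum f1 UNIV) \<le> (\<Sum>\<^sub>\<infinity>j. cmod (f1 j))" by (rule norm_infsum_bound[OF s1])
    also have "\<dots> \<le> ffull k" unfolding ffull_def by (rule infsum_mono[OF s1 ffull_summable f1_le])
    finally show ?thesis .
  qed
  have b2: "cmod (c 0 / z) \<le> ffull k"
  proof -
    have "dist1 (real_of_int (2 * k - 0)) = 2 * real_of_int k" using k by (simp add: dist1_def)
    thus ?thesis using single[of 0] c_le[of 0] zc k divide_right_mono[OF c_le[of 0], of "2 * real_of_int k"]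
      by (simp add: norm_divide)
  qed
  have b3: "cmod (c (2 * k) / z) \<le> ffull k"
  proof -
    have "cmod (c (2 * k) / z) \<le> (y (2 * k))\<^sup>2 / (2 * real_of_int k)"
      using c_le[of "2 * k"] zc k by (simp add: norm_divide divide_right_mono)
    also have "\<dots> \<le> (y (2 * k))\<^sup>2 / 1" using k by (intro divide_left_mono) auto
    also have "\<dots> \<le> ffull k" using single[of "2 * k"] by (simp add: dist1_def)
    finally show ?thesis .
  qed
  have "cmod (infsum f1 UNIV + (c 0 / z + c (2 * k) / z)) \<le> 3 * ffull k"
    using norm_triangle_ineq[of "infsum f1 UNIV" "c 0 / z + c (2 * k) / z"] norm_triangle_ineq[of "c 0 / z" "c (2 * k) / z"]
      b1 b2 b3 by linarith
  hence "cmod (second_order m V k k k) \<le> 1 / (pi\<^sup>2 * (2 * real_of_int k)) * (3 * ffull k)"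
    unfolding eq norm_mult norm_divide using zc k by (intro mult_mono) (auto simp: norm_power)
  also have "\<dots> = 3 / (2 * pi\<^sup>2) * (ffull k / real_of_int k)" by simp
  also have "\<dots> \<le> 1 * (ffull k / real_of_int k)"
  proof (rule mult_right_mono)
    have "2\<^sup>2 \<le> pi\<^sup>2" using pi_ge_two by (intro power_mono) auto
    thus "3 / (2 * pi\<^sup>2) \<le> 1" by simp
    show "0 \<le> ffull k / real_of_int k" using ftail_nonneg[of k] ftail_le_ffull[of k] k by simp
  qed
  finally show ?thesis by simp
qed

end

text \<open>
  The sign of the root is chosen so that \<open>\<bar>D + r\<bar>\<^sup>2 \<le> \<bar>D\<^sup>2 - r\<^sup>2\<bar>\<close>, where \<open>D\<close> is half the difference of
  the two eigenvalues.
\<close>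

lemma root_choice:
  fixes a1 a2 b1 b2 e f v w :: complex and A b :: real
  assumes sum: "e + f = a1 + a2" and prod: "e * f = a1 * a2 - (v + b1) * (w + b2)"
    and A: "cmod a1 \<le> A" "cmod a2 \<le> A" and b: "cmod b1 \<le> b" "cmod b2 \<le> b"
  obtains r where "r\<^sup>2 = v * w"
    "(cmod (e + r))\<^sup>2 \<le> 4 * A\<^sup>2 + 2 * (cmod v + cmod w) * b + 2 * b\<^sup>2"
    "(cmod (f - r))\<^sup>2 \<le> 4 * A\<^sup>2 + 2 * (cmod v + cmod w) * b + 2 * b\<^sup>2"
proof -
  define D where "D = (e - f) / 2"
  define r0 where "r0 = csqrt (v * w)"
  define r where "r = (if cmod (D + r0) \<le> cmod (D - r0) then r0 else - r0)"
  have r2: "r\<^sup>2 = v * w" by (simp add: r_def r0_def)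
  have "cmod (D + r) \<le> cmod (D - r)" by (auto simp: r_def)
  hence "cmod (D + r) * cmod (D + r) \<le> cmod (D + r) * cmod (D - r)" by (intro mult_left_mono) auto
  also have "\<dots> = cmod (D\<^sup>2 - r\<^sup>2)" by (simp add: norm_mult[symmetric] power2_eq_square algebra_simps)
  finally have Dr: "(cmod (D + r))\<^sup>2 \<le> cmod (D\<^sup>2 - r\<^sup>2)" by (simp add: power2_eq_square)
  \<comment> \<open>The discriminant of the quadratic. Subtracting \<open>r\<^sup>2 = v * w\<close>
    from its quarter leaves only terms that contain \<open>a1 - a2\<close>, \<open>b1\<close> or
    \<open>b2\<close>.\<close>
  have "4 * D\<^sup>2 = (e + f)\<^sup>2 - 4 * (e * f)" by (simp add: D_def power2_eq_square field_simps)
  also have "\<dots> = (a1 - a2)\<^sup>2 + 4 * ((v + b1) * (w + b2))"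
    unfolding sum prod by (simp add: power2_eq_square algebra_simps)
  finally have "D\<^sup>2 - r\<^sup>2 = ((a1 - a2) / 2)\<^sup>2 + (v * b2 + (b1 * w + b1 * b2))"
    unfolding r2 by (simp add: power2_eq_square field_simps)
  hence "cmod (D\<^sup>2 - r\<^sup>2) \<le> cmod (((a1 - a2) / 2)\<^sup>2) + (cmod (v * b2) + (cmod (b1 * w) + cmod (b1 * b2)))"
    by (metis add_left_mono norm_triangle_mono norm_triangle_ineq order_refl)
  also have "cmod (((a1 - a2) / 2)\<^sup>2) \<le> A\<^sup>2"
  proof -
    have "cmod ((a1 - a2) / 2) \<le> A" using norm_triangle_ineq4[of a1 a2] A by (simp add: norm_divide)
    thus ?thesis unfolding norm_power by (intro power_mono) auto
  qed
  finally have "cmod (D\<^sup>2 - r\<^sup>2) \<le> A\<^sup>2 + (cmod (v * b2) + (cmod (b1 * w) + cmod (b1 * b2)))" by simp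
  moreover have "cmod (v * b2) \<le> cmod v * b" "cmod (b1 * w) \<le> cmod w * b" "cmod (b1 * b2) \<le> b\<^sup>2"
  proof -
    have "0 \<le> b" using b(1) norm_ge_zero[of b1] by linarith
    thus "cmod (v * b2) \<le> cmod v * b" "cmod (b1 * w) \<le> cmod w * b" "cmod (b1 * b2) \<le> b\<^sup>2"
      using b unfolding norm_mult power2_eq_square mult.commute[of "cmod b1" "cmod w"]
      by (auto intro!: mult_left_mono mult_mono)
  qed
  ultimately have Db: "(cmod (D + r))\<^sup>2 \<le> A\<^sup>2 + (cmod v + cmod w) * b + b\<^sup>2"
    using Dr by (simp add: distrib_right)
  have s: "cmod ((a1 + a2) / 2) \<le> A" using norm_triangle_ineq[of a1 a2] A by (simp add: norm_divide)
  have A0: "0 \<le> A" using A(1) norm_ge_zero[of a1] by linarith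
  have gen: "(cmod x)\<^sup>2 \<le> 4 * A\<^sup>2 + 2 * (cmod v + cmod w) * b + 2 * b\<^sup>2" if "cmod x \<le> A + cmod (D + r)" for x
  proof -
    have "(cmod x)\<^sup>2 \<le> (A + cmod (D + r))\<^sup>2" by (rule power_mono[OF that]) simp
    also have "\<dots> \<le> 2 * A\<^sup>2 + 2 * (cmod (D + r))\<^sup>2"
      using sum_squares_bound[of A "cmod (D + r)"] by (simp add: power2_sum)
    finally show ?thesis using Db by (simp add: distrib_right)
  qed
  have e: "e + r = (a1 + a2) / 2 + (D + r)" "f - r = (a1 + a2) / 2 - (D + r)"
    unfolding sum[symmetric] by (simp_all add: D_def field_simps)
  show ?thesis
  proof (rule that[OF r2]; rule gen)
    show "cmod (e + r) \<le> A + cmod (D + r)" unfolding e using norm_triangle_ineq[of "(a1 + a2) / 2" "D + r"] s by linarith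
    show "cmod (f - r) \<le> A + cmod (D + r)" unfolding e using norm_triangle_ineq4[of "(a1 + a2) / 2" "D + r"] s by linarith
  qed
qed

text \<open>Each \<open>x\<close> among \<open>e\<close> and \<open>f\<close> satisfies
  \<open>(x - a1) * (x - a2) = (v + b1) * (w + b2)\<close>, so one factor on the left has modulus at
  most \<open>X\<close>.\<close>

lemma eigenvalue_shift_bound:
  fixes a1 a2 b1 b2 e f v w :: complex and A X :: real
  assumes sum: "e + f = a1 + a2" and prod: "e * f = a1 * a2 - (v + b1) * (w + b2)"
    and A: "cmod a1 \<le> A" "cmod a2 \<le> A" and X: "cmod (v + b1) \<le> X" "cmod (w + b2) \<le> X"
  shows "cmod e \<le> A + X" "cmod f \<le> A + X"
proof -
  have X0: "0 \<le> X" using X(1) norm_ge_zero[of "v + b1"] by linarith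
  have gen: "cmod x \<le> A + X" if "(x - a1) * (x - a2) = (v + b1) * (w + b2)" for x
  proof (rule ccontr)
    assume "\<not> cmod x \<le> A + X"
    hence "X < cmod (x - a1)" "X < cmod (x - a2)"
      using norm_triangle_ineq2[of x a1] norm_triangle_ineq2[of x a2] A by linarith+
    hence "X * X < cmod (x - a1) * cmod (x - a2)" using X0 by (intro mult_strict_mono) auto
    also have "\<dots> = cmod (v + b1) * cmod (w + b2)" using arg_cong[OF that, of cmod] by (simp only: norm_mult)
    also have "\<dots> \<le> X * X" using X X0 by (intro mult_mono) auto
    finally show False by simp
  qed
  have P: "(v + b1) * (w + b2) = a1 * a2 - e * f" unfolding prod by simp
  have "(e - a1) * (e - a2) = e * e - (a1 + a2) * e + a1 * a2" by (simp add: algebra_simps)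
  also have "\<dots> = (v + b1) * (w + b2)" unfolding P sum[symmetric] by (simp add: algebra_simps)
  finally show "cmod e \<le> A + X" by (rule gen)
  have "(f - a1) * (f - a2) = f * f - (a1 + a2) * f + a1 * a2" by (simp add: algebra_simps)
  also have "\<dots> = (v + b1) * (w + b2)" unfolding P sum[symmetric] by (simp add: algebra_simps)
  finally show "cmod f \<le> A + X" by (rule gen)
qed

text \<open>Adding the coefficients at \<open>l\<close> and \<open>- l\<close> makes the family
  even, at the price of the factor 2 in the bound \<open>2 * R\<close>.\<close>

definition majorant :: "real \<Rightarrow> (int \<Rightarrow> complex) \<Rightarrow> int \<Rightarrow> real" where
  "majorant p V l = bracket l powr (- p) * (cmod (V l) + cmod (V (- l)))"

text \<open>The predicate \<open>P\<close> lets one estimate serve the whole family and its tails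
  \<open>L < \<bar>l\<bar>\<close>.\<close>

lemma majorant_l2:
  assumes "l2_bounded R (\<lambda>l. if P l then of_real (bracket l powr (- p)) * V l else 0)" and P: "\<And>l. P (- l) = P l"
  shows "l2_bounded (2 * R) (\<lambda>l. of_real (if P l then majorant p V l else 0))"
proof -
  have br: "bracket (- l) = bracket l" for l by (simp add: bracket_def)
  have cm: "l2_bounded R (\<lambda>l. of_real (cmod (if P l then of_real (bracket l powr (- p)) * V l else 0)))"
    by (rule l2_bounded_mono[OF assms(1)]) simp
  have "l2_bounded R (\<lambda>l. of_real (cmod (if P (- l) then of_real (bracket (- l) powr (- p)) * V (- l) else 0)))"
    by (rule l2_bounded_reindex[OF cm, of uminus]) (simp add: inj_on_def)
  from l2_bounded_add[OF cm this] show ?thesis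
    by (rule l2_bounded_le[OF l2_bounded_mono]) (auto simp: majorant_def br P norm_mult distrib_left simp flip: of_real_add)
qed

lemma coeff_majorantI:
  assumes "1 \<le> m" "0 \<le> p" "p \<le> real m" "l2_bounded R (\<lambda>l. of_real (bracket l powr (- p)) * V l)"
  shows "coeff_majorant m p V (majorant p V) (2 * R)"
proof
  have br: "bracket (- l) = bracket l" for l by (simp add: bracket_def)
  show "0 \<le> majorant p V l" for l by (simp add: majorant_def)
  show "majorant p V (- l) = majorant p V l" for l by (simp add: majorant_def br add.commute)
  show "cmod (V l) \<le> bracket l powr p * majorant p V l" for l
  proof -
    have "bracket l powr p * bracket l powr (- p) = 1" by (simp flip: powr_add)
    hence "bracket l powr p * majorant p V l = cmod (V l) + cmod (V (- l))"
      unfolding majorant_def mult.assoc[symmetric] by simp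
    thus ?thesis by simp
  qed
  show "l2_bounded (2 * R) (\<lambda>l. of_real (majorant p V l))"
    using majorant_l2[of R "\<lambda>l. True" p V] assms(4) by simp
qed (use assms in auto)

lemma (in coeff_majorant) pair_structure:
  fixes N :: nat and \<delta> :: "int \<Rightarrow> real"
  assumes N: "1 \<le> N" and K: "\<And>t. 2 * int N \<le> t \<Longrightarrow> l2_bounded (\<delta> t) (\<lambda>(i, j). kmat m V t i j)"
    and \<delta>: "\<And>t. 2 * int N \<le> t \<Longrightarrow> \<delta> t \<le> 1 / 8"
  shows "\<And>k. 1 \<le> k \<Longrightarrow> k \<le> 2 * N \<Longrightarrow>
      \<exists>j. odd j \<and> \<bar>j\<bar> < 2 * int N \<and> cmod (lam0 m j - eigval m V k) < weight m (2 * int N) j / 4"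
    and "\<And>n k. N < n \<Longrightarrow> k = 2 * int n - 1 \<Longrightarrow> \<exists>a1 a2 b1 b2 e f.
      eigval m V (2 * n - 1) = lam0 m k + V 0 + e \<and> eigval m V (2 * n) = lam0 m k + V 0 + f \<and>
      e + f = a1 + a2 \<and> e * f = a1 * a2 - (V (2 * k) + b1) * (V (- 2 * k) + b2) \<and>
      (\<forall>c\<in>{a1, a2, b1, b2}. cmod c \<le> 4 * Q k) \<and>
      cmod a1 \<le> cmod (second_order m V k k k) + 10 * \<delta> k * Q k \<and>
      cmod a2 \<le> cmod (second_order m V k k k) + 10 * \<delta> k * Q k \<and>
      cmod b1 \<le> cmod (second_order m V k k (- k)) + 10 * \<delta> k * Q k \<and>
      cmod b2 \<le> cmod (second_order m V k (- k) k) + 10 * \<delta> k * Q k"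
proof -
  define kk where "kk n = 2 * int n - 1" for n
  \<comment> \<open>Both arguments are valid coupling bounds. The second one determines the size of
    the errors; the minimum with the first is taken because the splitting demands
    \<open>\<tau> \<le> \<delta>\<close>.\<close>
  define \<tau> where "\<tau> n = min (\<delta> (kk n)) (sqrt (2 * Q (kk n) / real_of_int (kk n) ^ (2 * m - 1)))" for n
  have kN: "2 * int N \<le> kk n" "1 \<le> kk n" if "N < n" for n using that N by (auto simp: kk_def)
  have low: "l2_bounded (1 / 8) (\<lambda>(i, j). kmat m V (2 * int N) i j)"
    by (rule l2_bounded_le[OF K \<delta>]) auto
  have sub: "l2_bounded (\<delta> (kk n)) (\<lambda>(i, j). if P i j then kmat m V (kk n) i j else 0)" if "N < n" for n P
    by (rule l2_bounded_mono[OF K[OF kN(1)[OF that]]]) auto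
  have p1: "l2_bounded (\<delta> (kk n)) (\<lambda>(i, j). kmat m V (2 * int n - 1) i j)" if "N < n" for n
    using K[OF kN(1)[OF that]] by (simp only: kk_def)
  have p2: "\<delta> (kk n) \<le> 1 / 8" if "N < n" for n by (rule \<delta>[OF kN(1)[OF that]])
  have p3: "l2_bounded (\<tau> n) (\<lambda>(i, j). if i \<in> {i. odd i} - {k, - k} \<and> j \<in> {k, - k} then kmat m V k i j else 0)"
    and p4: "l2_bounded (\<tau> n) (\<lambda>(i, j). if i \<in> {k, - k} \<and> j \<in> {i. odd i} - {k, - k} then kmat m V k i j else 0)"
    if n: "N < n" and k: "k = 2 * int n - 1" for n k
  proof -
    have k': "kk n = k" by (simp add: kk_def k)
    show "l2_bounded (\<tau> n) (\<lambda>(i, j). if i \<in> {i. odd i} - {k, - k} \<and> j \<in> {k, - k} then kmat m V k i j else 0)"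
      using pair_blocks_small(1)[of k] sub[OF n, of "\<lambda>i j. i \<in> {i. odd i} - {k, - k} \<and> j \<in> {k, - k}"] kN(2)[OF n]
      unfolding \<tau>_def k' min_def by presburger
    show "l2_bounded (\<tau> n) (\<lambda>(i, j). if i \<in> {k, - k} \<and> j \<in> {i. odd i} - {k, - k} then kmat m V k i j else 0)"
      using pair_blocks_small(2)[of k] sub[OF n, of "\<lambda>i j. i \<in> {k, - k} \<and> j \<in> {i. odd i} - {k, - k}"] kN(2)[OF n]
      unfolding \<tau>_def k' min_def by presburger
  qed
  have p5: "\<tau> n \<le> \<delta> (kk n)" for n by (simp add: \<tau>_def)
  show "\<exists>j. odd j \<and> \<bar>j\<bar> < 2 * int N \<and> cmod (lam0 m j - eigval m V k) < weight m (2 * int N) j / 4"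
    if "1 \<le> k" "k \<le> 2 * N" for k
    by (rule spectral_structure(1)[OF m N low p1 p2 p3 p4 p5]) (use that in auto)
  fix n k assume n: "N < n" and k: "k = 2 * int n - 1"
  have k': "kk n = k" by (simp add: kk_def k)
  have k1: "1 \<le> k" using kN(2)[OF n] by (simp add: k')
  define c where "c = real_of_int k ^ (2 * m - 1)"
  have c: "0 < c" using k1 by (simp add: c_def)
  have d0: "0 \<le> \<delta> k" using l2_bounded_nonneg[OF K[OF kN(1)[OF n]]] by (simp add: k')
  have t0: "0 \<le> \<tau> n" using d0 c Q_nonneg[of k] by (simp add: \<tau>_def k' c_def)
  have tq: "c * (\<tau> n)\<^sup>2 \<le> 2 * Q k"
  proof -
    have "\<tau> n \<le> sqrt (2 * Q k / c)" by (simp add: \<tau>_def k' c_def)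
    hence "(\<tau> n)\<^sup>2 \<le> (sqrt (2 * Q k / c))\<^sup>2" using t0 by (intro power_mono) auto
    also have "\<dots> = 2 * Q k / c" using Q_nonneg[of k] c by simp
    finally show ?thesis using c by (simp add: field_simps)
  qed
  obtain a1 a2 b1 b2 e f where E: "effective_entries m V (\<delta> k) (\<tau> n) k a1 a2 b1 b2"
    and ev: "eigval m V (2 * n - 1) = lam0 m k + V 0 + e" "eigval m V (2 * n) = lam0 m k + V 0 + f"
      "e + f = a1 + a2" "e * f = a1 * a2 - (V (2 * k) + b1) * (V (- 2 * k) + b2)"
  proof -
    have "\<exists>a1 a2 b1 b2 e f.
      effective_entries m V (\<delta> (kk n)) (\<tau> n) k a1 a2 b1 b2 \<and>
      eigval m V (2 * n - 1) = lam0 m k + V 0 + e \<and> eigval m V (2 * n) = lam0 m k + V 0 + f \<and>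
      e + f = a1 + a2 \<and> e * f = a1 * a2 - (V (2 * k) + b1) * (V (- 2 * k) + b2)"
      by (rule spectral_structure(2)[OF m N low p1 p2 p3 p4 p5]) (use n k in auto)
    thus ?thesis using that unfolding k' by blast
  qed
  have crude: "\<forall>c\<in>{a1, a2, b1, b2}. cmod c \<le> 4 * Q k"
  proof
    fix x assume "x \<in> {a1, a2, b1, b2}"
    hence "cmod x \<le> c * (2 * (\<tau> n)\<^sup>2)" using E unfolding effective_entries_def c_def by blast
    also have "c * (2 * (\<tau> n)\<^sup>2) = 2 * (c * (\<tau> n)\<^sup>2)" by simp
    also have "2 * (c * (\<tau> n)\<^sup>2) \<le> 2 * (2 * Q k)" using tq by simp
    finally show "cmod x \<le> 4 * Q k" by simp
  qed
  have fine: "cmod x \<le> cmod s + 10 * \<delta> k * Q k" if "cmod (x + s) \<le> c * (5 * \<delta> k * (\<tau> n)\<^sup>2)" for x s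
  proof -
    have "c * (5 * \<delta> k * (\<tau> n)\<^sup>2) = 5 * \<delta> k * (c * (\<tau> n)\<^sup>2)" by simp
    also have "\<dots> \<le> 5 * \<delta> k * (2 * Q k)" using tq d0 by (intro mult_left_mono) auto
    finally have "cmod (x + s) \<le> 10 * \<delta> k * Q k" using that by simp
    thus ?thesis using norm_triangle_ineq4[of "x + s" s] by simp
  qed
  have "cmod a1 \<le> cmod (second_order m V k k k) + 10 * \<delta> k * Q k"
    "cmod a2 \<le> cmod (second_order m V k k k) + 10 * \<delta> k * Q k"
    "cmod b1 \<le> cmod (second_order m V k k (- k)) + 10 * \<delta> k * Q k"
    "cmod b2 \<le> cmod (second_order m V k (- k) k) + 10 * \<delta> k * Q k"
    using E unfolding effective_entries_def c_def[symmetric] second_order_reflect by (auto intro: fine)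
  with ev crude show "\<exists>a1 a2 b1 b2 e f.
      eigval m V (2 * n - 1) = lam0 m k + V 0 + e \<and> eigval m V (2 * n) = lam0 m k + V 0 + f \<and>
      e + f = a1 + a2 \<and> e * f = a1 * a2 - (V (2 * k) + b1) * (V (- 2 * k) + b2) \<and>
      (\<forall>c\<in>{a1, a2, b1, b2}. cmod c \<le> 4 * Q k) \<and>
      cmod a1 \<le> cmod (second_order m V k k k) + 10 * \<delta> k * Q k \<and>
      cmod a2 \<le> cmod (second_order m V k k k) + 10 * \<delta> k * Q k \<and>
      cmod b1 \<le> cmod (second_order m V k k (- k)) + 10 * \<delta> k * Q k \<and>
      cmod b2 \<le> cmod (second_order m V k (- k) k) + 10 * \<delta> k * Q k" by blast
qed

section \<open>The case of the most singular potentials\<close>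

lemma lam0_unperturbed:
  assumes "1 \<le> n"
  shows "lam0 m (2 * int n - 1) = unperturbed m n"
proof -
  have "\<bar>real_of_int (2 * int n - 1)\<bar> = 2 * real n - 1" using assms by simp
  thus ?thesis unfolding lam0_real unperturbed_def by (simp add: mult.commute)
qed

lemma hs_tail:
  assumes V: "V \<in> hs s" and \<theta>: "0 < \<theta>"
  shows "\<exists>L. \<forall>L'\<ge>L. l2_bounded \<theta> (\<lambda>l. if L' < \<bar>l\<bar> then of_real (bracket l powr s) * V l else 0)"
proof -
  define f where "f l = bracket l powr (2 * s) * (cmod (V l))\<^sup>2" for l
  have sm: "f summable_on UNIV" using V by (simp add: hs_def f_def[abs_def])
  have f0: "0 \<le> f l" for l by (simp add: f_def)
  obtain F0 where F0: "finite F0" "norm (sum f F0 - infsum f UNIV) \<le> \<theta>\<^sup>2"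
    using infsum_finite_approximation[OF sm, of "\<theta>\<^sup>2"] \<theta> by (auto simp: dist_norm)
  define L where "L = Max (insert 0 (abs ` F0))"
  have L: "\<bar>l\<bar> \<le> L" if "l \<in> F0" for l unfolding L_def using F0(1) that by (intro Max_ge) auto
  have "l2_bounded \<theta> (\<lambda>l. if L' < \<bar>l\<bar> then of_real (bracket l powr s) * V l else 0)" if L': "L \<le> L'" for L'
  proof (rule l2_boundedI)
    fix F :: "int set" assume F: "finite F"
    define G where "G = {l \<in> F. L' < \<bar>l\<bar>}"
    have G: "finite G" "G \<inter> F0 = {}" using F L L' by (force simp: G_def)+
    have "(\<Sum>l\<in>F. (cmod (if L' < \<bar>l\<bar> then of_real (bracket l powr s) * V l else 0))\<^sup>2) = (\<Sum>l\<in>F. if L' < \<bar>l\<bar> then f l else 0)"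
      by (intro sum.cong) (auto simp: f_def norm_mult power_mult_distrib bracket_powr_square)
    also have "\<dots> = sum f G" unfolding G_def by (rule sum.inter_filter[OF F, symmetric])
    also have "\<dots> = sum f (G \<union> F0) - sum f F0" by (subst sum.union_disjoint[OF G(1) F0(1) G(2)]) simp
    also have "sum f (G \<union> F0) \<le> infsum f UNIV" by (rule finite_sum_le_infsum[OF sm]) (use G F0 f0 in auto)
    finally show "(\<Sum>l\<in>F. (cmod (if L' < \<bar>l\<bar> then of_real (bracket l powr s) * V l else 0))\<^sup>2) \<le> \<theta>\<^sup>2"
      using F0(2) by (simp add: abs_le_iff)
  qed (use \<theta> in simp)
  thus ?thesis by blast
qed

lemma kmat_add: "kmat m (\<lambda>l. V1 l + V2 l) t i j = kmat m V1 t i j + kmat m V2 t i j"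
  by (simp add: kmat_def add_divide_distrib)

text \<open>For \<open>p = m = 1\<close> the matrix bound does not decay. The coefficients with
  \<open>\<bar>l\<bar> \<le> L\<close> are therefore estimated with \<open>p = 0\<close>, which
  costs a constant depending on \<open>L\<close> and gains a negative power of \<open>t\<close>,
  while the tail is estimated with \<open>p = m\<close> and is small by assumption. The threshold
  \<open>\<theta>0\<close> depends on \<open>m\<close> alone, and \<open>T\<close> on
  \<open>R\<close> and \<open>L\<close> as well.\<close>

lemma kmat_small:
  assumes m: "1 \<le> m"
  shows "\<exists>\<theta>0>0. \<forall>R L. \<exists>T\<ge>1. \<forall>W t. T \<le> t \<longrightarrow> l2_bounded R (\<lambda>l. of_real (bracket l powr (- real m)) * W l) \<longrightarrow>
    l2_bounded \<theta>0 (\<lambda>l. if L < \<bar>l\<bar> then of_real (bracket l powr (- real m)) * W l else 0) \<longrightarrow>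
    l2_bounded (1 / 8) (\<lambda>(i, j). kmat m W t i j)"
proof -
  obtain C0 where C0: "0 \<le> C0" and K0: "\<And>V Y t. 1 \<le> t \<Longrightarrow> l2_bounded Y (\<lambda>l. of_real (bracket l powr (- 0)) * V l) \<Longrightarrow>
    l2_bounded (C0 * Y * real_of_int t powr (0 - 2 * real m + 1)) (\<lambda>(i, j). kmat m V t i j)"
    using kmat_bound[OF m, of 0] by auto
  obtain Cm where Cm: "0 \<le> Cm" and Km: "\<And>V Y t. 1 \<le> t \<Longrightarrow> l2_bounded Y (\<lambda>l. of_real (bracket l powr (- real m)) * V l) \<Longrightarrow>
    l2_bounded (Cm * Y * real_of_int t powr (real m - 2 * real m + 1)) (\<lambda>(i, j). kmat m V t i j)"
    using kmat_bound[OF m, of "real m"] by auto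
  \<comment> \<open>Each of the two parts is granted 1/16; \<open>Cm + 1\<close> keeps the
    denominator positive.\<close>
  define \<theta>0 where "\<theta>0 = 1 / (16 * (Cm + 1))"
  have \<theta>0: "0 < \<theta>0" using Cm by (simp add: \<theta>0_def)
  have "\<exists>T\<ge>1. \<forall>W t. T \<le> t \<longrightarrow> l2_bounded R (\<lambda>l. of_real (bracket l powr (- real m)) * W l) \<longrightarrow>
    l2_bounded \<theta>0 (\<lambda>l. if L < \<bar>l\<bar> then of_real (bracket l powr (- real m)) * W l else 0) \<longrightarrow>
    l2_bounded (1 / 8) (\<lambda>(i, j). kmat m W t i j)" for R :: real and L :: int
  proof -
    define B where "B = (1 + \<bar>real_of_int L\<bar>) powr real m"
    have B: "0 \<le> B" by (simp add: B_def)
    define T where "T = max 1 \<lceil>16 * (C0 * (B * R))\<rceil>"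
    have "l2_bounded (1 / 8) (\<lambda>(i, j). kmat m W t i j)"
      if t: "T \<le> t" and W: "l2_bounded R (\<lambda>l. of_real (bracket l powr (- real m)) * W l)"
        and tail: "l2_bounded \<theta>0 (\<lambda>l. if L < \<bar>l\<bar> then of_real (bracket l powr (- real m)) * W l else 0)" for W t
    proof -
      have t1: "1 \<le> t" using t by (simp add: T_def)
      have tB: "16 * (C0 * (B * R)) \<le> real_of_int t" using t by (simp add: T_def ceiling_le_iff)
      define W1 W2 where "W1 l = (if L < \<bar>l\<bar> then 0 else W l)" and "W2 l = (if L < \<bar>l\<bar> then W l else 0)" for l
      have W1: "l2_bounded (B * R) (\<lambda>l. of_real (bracket l powr (- 0)) * W1 l)"
      proof -
        have "l2_bounded (cmod (of_real B) * R) (\<lambda>l. of_real B * (of_real (bracket l powr (- real m)) * W l))"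
          by (rule l2_bounded_cmult[OF W])
        hence "l2_bounded (B * R) (\<lambda>l. of_real B * (of_real (bracket l powr (- real m)) * W l))" using B by simp
        thus ?thesis
        proof (rule l2_bounded_mono)
          fix l
          show "cmod (of_real (bracket l powr (- 0)) * W1 l) \<le> cmod (of_real B * (of_real (bracket l powr (- real m)) * W l))"
          proof (cases "L < \<bar>l\<bar>")
            case False
            hence "bracket l \<le> 1 + \<bar>real_of_int L\<bar>" unfolding bracket_def by linarith
            hence "bracket l powr real m \<le> B" unfolding B_def by (intro powr_mono2) (auto simp: less_imp_le)
            hence "bracket l powr real m * bracket l powr (- real m) \<le> B * bracket l powr (- real m)"
              by (intro mult_right_mono) auto
            moreover have "bracket l powr real m * bracket l powr (- real m) = 1" by (simp flip: powr_add)
            ultimately have "1 * cmod (W l) \<le> (B * bracket l powr (- real m)) * cmod (W l)"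
              by (intro mult_right_mono) auto
            thus ?thesis using False B by (simp add: W1_def norm_mult mult.assoc)
          qed (simp add: W1_def)
        qed
      qed
      have W2: "l2_bounded \<theta>0 (\<lambda>l. of_real (bracket l powr (- real m)) * W2 l)"
        by (rule l2_bounded_mono[OF tail]) (simp add: W2_def)
      have "l2_bounded (C0 * (B * R) * real_of_int t powr (0 - 2 * real m + 1) + Cm * \<theta>0 * real_of_int t powr (real m - 2 * real m + 1))
          (\<lambda>x. (case x of (i, j) \<Rightarrow> kmat m W1 t i j) + (case x of (i, j) \<Rightarrow> kmat m W2 t i j))"
        by (rule l2_bounded_add[OF K0[OF t1 W1] Km[OF t1 W2]])
      moreover have "(\<lambda>x. (case x of (i, j) \<Rightarrow> kmat m W1 t i j) + (case x of (i, j) \<Rightarrow> kmat m W2 t i j)) = (\<lambda>(i, j). kmat m W t i j)"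
      proof -
        have "W = (\<lambda>l. W1 l + W2 l)" by (auto simp: W1_def W2_def)
        thus ?thesis using kmat_add[of m W1 W2 t] by (auto simp: case_prod_unfold)
      qed
      moreover have "C0 * (B * R) * real_of_int t powr (0 - 2 * real m + 1) \<le> 1 / 16"
      proof -
        have "real_of_int t powr (0 - 2 * real m + 1) \<le> real_of_int t powr (- 1)" using t1 m by (intro powr_mono) auto
        also have "\<dots> = 1 / real_of_int t" using t1 by (simp add: powr_minus_divide)
        finally have "C0 * (B * R) * real_of_int t powr (0 - 2 * real m + 1) \<le> C0 * (B * R) * (1 / real_of_int t)"
          using C0 B l2_bounded_nonneg[OF W] by (intro mult_left_mono) auto
        also have "\<dots> \<le> 1 / 16" using tB t1 by (simp add: divide_le_eq)
        finally show ?thesis .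
      qed
      moreover have "Cm * \<theta>0 * real_of_int t powr (real m - 2 * real m + 1) \<le> 1 / 16"
      proof -
        have "real_of_int t powr (real m - 2 * real m + 1) \<le> real_of_int t powr 0" using t1 m by (intro powr_mono) auto
        hence "Cm * \<theta>0 * real_of_int t powr (real m - 2 * real m + 1) \<le> Cm * \<theta>0 * 1"
          using Cm \<theta>0 t1 by (intro mult_left_mono) auto
        also have "\<dots> \<le> 1 / 16" using Cm by (simp add: \<theta>0_def divide_le_eq)
        finally show ?thesis .
      qed
      ultimately show ?thesis by (simp add: l2_bounded_le)
    qed
    thus ?thesis by (intro exI[of _ T]) (auto simp: T_def)
  qed
  thus ?thesis using \<theta>0 by blast
qed

lemma le_power_self: "1 \<le> n \<Longrightarrow> 1 \<le> m \<Longrightarrow> real n \<le> real n ^ m"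
  using power_increasing[of 1 m "real n"] by simp

text \<open>Serves both assertions for \<alpha> = 1: \<open>R\<close> contributes a constant, the
  tail bound \<open>\<theta>\<close> a multiple of \<open>n ^ m\<close>. The order of the
  quantifiers carries the uniformity: \<open>\<theta>0\<close> and \<open>c\<close> depend on
  \<open>m\<close> alone, and \<open>N\<close> on \<open>R\<close> and \<open>L\<close> but not on
  \<open>\<theta>\<close> or \<open>W\<close>.\<close>

theorem alpha_one_estimate:
  assumes m: "1 \<le> m"
  shows "\<exists>\<theta>0>0. \<exists>c\<ge>0. \<forall>R L. \<exists>N. \<forall>\<theta> W. \<theta> \<le> \<theta>0 \<longrightarrow>
    l2_bounded R (\<lambda>l. of_real (bracket l powr (- real m)) * W l) \<longrightarrow>
    l2_bounded \<theta> (\<lambda>l. if L < \<bar>l\<bar> then of_real (bracket l powr (- real m)) * W l else 0) \<longrightarrow>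
    (\<forall>n>N. \<forall>k\<in>{2 * n - 1, 2 * n}. cmod (eigval m W k - unperturbed m n)
       \<le> c * (R + R\<^sup>2) + c * (\<theta> + \<theta>\<^sup>2) * real n ^ m)"
proof -
  obtain \<theta>0 where \<theta>0: "0 < \<theta>0" and small: "\<And>R L. \<exists>T\<ge>1. \<forall>W t. T \<le> t \<longrightarrow>
    l2_bounded R (\<lambda>l. of_real (bracket l powr (- real m)) * W l) \<longrightarrow>
    l2_bounded \<theta>0 (\<lambda>l. if L < \<bar>l\<bar> then of_real (bracket l powr (- real m)) * W l else 0) \<longrightarrow>
    l2_bounded (1 / 8) (\<lambda>(i, j). kmat m W t i j)"
    using kmat_small[OF m] by blast
  define c16 where "c16 = 2 * (16::real) ^ m"
  have c16: "0 \<le> c16" by (simp add: c16_def)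
  define c where "c = 2 + 64 * c16 + 2 * 6 ^ m"
  have c: "0 \<le> c" "2 \<le> c" "32 * c16 \<le> c" "64 * c16 \<le> c" "2 * 6 ^ m \<le> c" using c16 by (auto simp: c_def)
  have "\<exists>N. \<forall>\<theta> W. \<theta> \<le> \<theta>0 \<longrightarrow>
    l2_bounded R (\<lambda>l. of_real (bracket l powr (- real m)) * W l) \<longrightarrow>
    l2_bounded \<theta> (\<lambda>l. if L < \<bar>l\<bar> then of_real (bracket l powr (- real m)) * W l else 0) \<longrightarrow>
    (\<forall>n>N. \<forall>k\<in>{2 * n - 1, 2 * n}. cmod (eigval m W k - unperturbed m n)
       \<le> c * (R + R\<^sup>2) + c * (\<theta> + \<theta>\<^sup>2) * real n ^ m)" for R :: real and L :: int
  proof -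
    obtain T where T: "1 \<le> T" "\<And>W t. T \<le> t \<Longrightarrow>
      l2_bounded R (\<lambda>l. of_real (bracket l powr (- real m)) * W l) \<Longrightarrow>
      l2_bounded \<theta>0 (\<lambda>l. if L < \<bar>l\<bar> then of_real (bracket l powr (- real m)) * W l else 0) \<Longrightarrow>
      l2_bounded (1 / 8) (\<lambda>(i, j). kmat m W t i j)"
      using small by blast
    \<comment> \<open>Taking \<open>N\<close> at least \<open>L\<close> makes every \<open>k\<close>
      in question exceed \<open>L\<close>, so that \<open>y (2 * k)\<close> and
      \<open>ftail k\<close> involve coefficients of the tail only.\<close>
    define N where "N = nat (max T \<bar>L\<bar>)"
    have N: "1 \<le> N" "T \<le> 2 * int N" "L \<le> int N" using T(1) by (auto simp: N_def)
    have "cmod (eigval m W j - unperturbed m n) \<le> c * (R + R\<^sup>2) + c * (\<theta> + \<theta>\<^sup>2) * real n ^ m"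
      if \<theta>: "\<theta> \<le> \<theta>0" and W: "l2_bounded R (\<lambda>l. of_real (bracket l powr (- real m)) * W l)"
        and tail: "l2_bounded \<theta> (\<lambda>l. if L < \<bar>l\<bar> then of_real (bracket l powr (- real m)) * W l else 0)"
        and n: "N < n" and j: "j \<in> {2 * n - 1, 2 * n}" for \<theta> W n j
    proof -
      define y where "y = majorant (real m) W"
      interpret coeff_majorant m "real m" W y "2 * R"
        unfolding y_def by (rule coeff_majorantI[OF m _ _ W]) auto
      define k where "k = 2 * int n - 1"
      have k: "1 \<le> k" "L < k" "real_of_int k \<le> 2 * real n" using n N by (auto simp: k_def)
      have R0: "0 \<le> R" by (rule l2_bounded_nonneg[OF W])
      have t0: "0 \<le> \<theta>" by (rule l2_bounded_nonneg[OF tail])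
      have tail0: "l2_bounded \<theta>0 (\<lambda>l. if L < \<bar>l\<bar> then of_real (bracket l powr (- real m)) * W l else 0)"
        by (rule l2_bounded_le[OF tail \<theta>])
      obtain a1 a2 b1 b2 e f where st:
        "eigval m W (2 * n - 1) = lam0 m k + W 0 + e" "eigval m W (2 * n) = lam0 m k + W 0 + f"
        "e + f = a1 + a2" "e * f = a1 * a2 - (W (2 * k) + b1) * (W (- 2 * k) + b2)"
        "\<forall>c\<in>{a1, a2, b1, b2}. cmod c \<le> 4 * Q k"
        using pair_structure(2)[OF N(1) T(2)[OF _ W tail0] _ n k_def] N(2) by auto
      have ytail: "l2_bounded (2 * \<theta>) (\<lambda>l. of_real (if L < \<bar>l\<bar> then y l else 0))"
        unfolding y_def by (rule majorant_l2[OF tail]) simp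
      have yk: "y (2 * k) \<le> 2 * \<theta>"
        using l2_bounded_pointwise[OF ytail, of "2 * k"] k y_nonneg[of "2 * k"] by simp
      have ft: "ftail k \<le> (2 * \<theta>)\<^sup>2"
      proof (rule ftail_le)
        fix F :: "int set" assume F: "finite F"
        have "(\<Sum>l\<in>F. if k < \<bar>l\<bar> then (y l)\<^sup>2 else 0) \<le> (\<Sum>l\<in>F. (cmod (of_real (if L < \<bar>l\<bar> then y l else 0)))\<^sup>2)"
          using k(2) by (intro sum_mono) auto
        also have "\<dots> \<le> (2 * \<theta>)\<^sup>2" by (rule l2_boundedD[OF ytail F])
        finally show "(\<Sum>l\<in>F. if k < \<bar>l\<bar> then (y l)\<^sup>2 else 0) \<le> (2 * \<theta>)\<^sup>2" .
      qed
      have Qk: "Q k \<le> c16 * (4 * R\<^sup>2 + 2 * real n * (4 * \<theta>\<^sup>2))"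
      proof -
        have e1: "max 1 (2 * real m) - 2 * real m = 0" using m by simp
        have "Q k = c16 * (4 * R\<^sup>2 + real_of_int k * ftail k)"
          using k by (simp add: Q_def c16_def e1 power_mult_distrib)
        also have "\<dots> \<le> c16 * (4 * R\<^sup>2 + 2 * real n * (4 * \<theta>\<^sup>2))"
          using k ft c16 ftail_nonneg[of k]
          by (intro mult_left_mono add_left_mono mult_mono) (auto simp: power_mult_distrib)
        finally show ?thesis .
      qed
      define v where "v = 6 ^ m * real n ^ m * (2 * \<theta>)"
      have v: "cmod (W (2 * k)) \<le> v" "cmod (W (- 2 * k)) \<le> v"
      proof -
        have "bracket (2 * k) \<le> 6 * real n" using k by (simp add: bracket_def)
        hence "bracket (2 * k) powr real m \<le> (6 * real n) powr real m" by (intro powr_mono2) (auto simp: less_imp_le)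
        also have "\<dots> = 6 ^ m * real n ^ m" using n by (simp add: powr_realpow power_mult_distrib)
        finally have "bracket (2 * k) powr real m * y (2 * k) \<le> v"
          unfolding v_def using yk y_nonneg by (intro mult_mono) auto
        thus "cmod (W (2 * k)) \<le> v" "cmod (W (- 2 * k)) \<le> v"
          using V_le[of "2 * k"] V_minus_le[of "- 2 * k"] by simp_all
      qed
      have W0: "cmod (W 0) \<le> 2 * R"
      proof -
        have "cmod (W 0) \<le> y 0" using V_le[of 0] by (simp add: bracket_def)
        also have "\<dots> \<le> 2 * R" using l2_bounded_pointwise[OF y_l2, of 0] y_nonneg[of 0] by simp
        finally show ?thesis .
      qed
      have "cmod e \<le> 4 * Q k + (v + 4 * Q k)" "cmod f \<le> 4 * Q k + (v + 4 * Q k)"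
      proof -
        have ab: "cmod a1 \<le> 4 * Q k" "cmod a2 \<le> 4 * Q k" "cmod b1 \<le> 4 * Q k" "cmod b2 \<le> 4 * Q k" using st(5) by auto
        have X: "cmod (W (2 * k) + b1) \<le> v + 4 * Q k" "cmod (W (- 2 * k) + b2) \<le> v + 4 * Q k"
          using norm_triangle_ineq[of "W (2 * k)" b1] norm_triangle_ineq[of "W (- 2 * k)" b2] v ab by linarith+
        show "cmod e \<le> 4 * Q k + (v + 4 * Q k)" "cmod f \<le> 4 * Q k + (v + 4 * Q k)"
          by (rule eigenvalue_shift_bound[OF st(3,4) ab(1,2) X])+
      qed
      moreover have "lam0 m k = unperturbed m n" unfolding k_def using n by (intro lam0_unperturbed) simp
      ultimately have "cmod (eigval m W j - unperturbed m n) \<le> 2 * R + (8 * Q k + v)"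
        using j st(1,2) norm_triangle_ineq[of "W 0" e] norm_triangle_ineq[of "W 0" f] W0 by auto
      also have "8 * Q k \<le> 32 * c16 * R\<^sup>2 + 64 * c16 * \<theta>\<^sup>2 * real n" using Qk by (simp add: algebra_simps)
      also have "64 * c16 * \<theta>\<^sup>2 * real n \<le> 64 * c16 * \<theta>\<^sup>2 * real n ^ m"
        using le_power_self[of n m] n m c16 by (intro mult_left_mono) auto
      also have "2 * R + (32 * c16 * R\<^sup>2 + 64 * c16 * \<theta>\<^sup>2 * real n ^ m + v)
          = (2 * R + 32 * c16 * R\<^sup>2) + (64 * c16 * \<theta>\<^sup>2 + 2 * 6 ^ m * \<theta>) * real n ^ m"
        by (simp add: v_def algebra_simps)
      also have "\<dots> \<le> (c * R + c * R\<^sup>2) + (c * \<theta>\<^sup>2 + c * \<theta>) * real n ^ m"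
        using c R0 t0 by (intro add_mono mult_right_mono) auto
      also have "\<dots> = c * (R + R\<^sup>2) + c * (\<theta> + \<theta>\<^sup>2) * real n ^ m" by (simp add: algebra_simps)
      finally show ?thesis by simp
    qed
    thus ?thesis by (intro exI[of _ N]) blast
  qed
  thus ?thesis using \<theta>0 c(1) by blast
qed

section \<open>Uniformity around a fixed potential\<close>

lemma hs_diff_l2:
  assumes "V \<in> hs s" "W \<in> hs s"
  shows "W - V \<in> hs s"
proof -
  have "l2_bounded (hs_norm s W + hs_norm s V) (\<lambda>k. of_real (bracket k powr s) * (W - V) k)"
    using l2_bounded_diff[OF hs_l2_bounded[OF assms(2)] hs_l2_bounded[OF assms(1)]] by (simp add: right_diff_distrib)
  thus ?thesis by (rule l2_bounded_hs(1))
qed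

text \<open>The radius is half of the threshold \<open>\<theta>0\<close>: the tail of
  \<open>V\<close> takes one half, the difference \<open>W - V\<close> the other.\<close>

theorem alpha_one_bounded:
  assumes m: "1 \<le> m" and V: "V \<in> H_plus (- real m)"
  shows "\<exists>\<epsilon>>0. \<exists>C N. \<forall>W \<in> H_plus (- real m). hs_norm (- real m) (W - V) \<le> \<epsilon> \<longrightarrow>
          (\<forall>n\<ge>N. n \<ge> 1 \<longrightarrow> (\<forall>k \<in> {2 * n - 1, 2 * n}.
             cmod (eigval m W k - unperturbed m n) \<le> C * real n ^ m))"
proof -
  let ?s = "- real m"
  obtain \<theta>0 c where \<theta>0: "0 < \<theta>0" and c: "0 \<le> c" and est: "\<And>R L. \<exists>N. \<forall>\<theta> W. \<theta> \<le> \<theta>0 \<longrightarrow>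
    l2_bounded R (\<lambda>l. of_real (bracket l powr ?s) * W l) \<longrightarrow>
    l2_bounded \<theta> (\<lambda>l. if L < \<bar>l\<bar> then of_real (bracket l powr ?s) * W l else 0) \<longrightarrow>
    (\<forall>n>N. \<forall>k\<in>{2 * n - 1, 2 * n}. cmod (eigval m W k - unperturbed m n)
       \<le> c * (R + R\<^sup>2) + c * (\<theta> + \<theta>\<^sup>2) * real n ^ m)"
    using alpha_one_estimate[OF m] by blast
  have Vh: "V \<in> hs ?s" using V by (simp add: H_plus_def)
  obtain L where L: "l2_bounded (\<theta>0 / 2) (\<lambda>l. if L < \<bar>l\<bar> then of_real (bracket l powr ?s) * V l else 0)"
    using hs_tail[OF Vh, of "\<theta>0 / 2"] \<theta>0 by auto
  define R where "R = hs_norm ?s V + \<theta>0 / 2"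
  obtain N where N: "\<And>\<theta> W n k. \<theta> \<le> \<theta>0 \<Longrightarrow>
    l2_bounded R (\<lambda>l. of_real (bracket l powr ?s) * W l) \<Longrightarrow>
    l2_bounded \<theta> (\<lambda>l. if L < \<bar>l\<bar> then of_real (bracket l powr ?s) * W l else 0) \<Longrightarrow>
    N < n \<Longrightarrow> k \<in> {2 * n - 1, 2 * n} \<Longrightarrow> cmod (eigval m W k - unperturbed m n)
       \<le> c * (R + R\<^sup>2) + c * (\<theta> + \<theta>\<^sup>2) * real n ^ m"
    using est[of R L] by blast
  define C where "C = c * (R + R\<^sup>2) + c * (\<theta>0 + \<theta>0\<^sup>2)"
  have "cmod (eigval m W k - unperturbed m n) \<le> C * real n ^ m"
    if W: "W \<in> H_plus ?s" "hs_norm ?s (W - V) \<le> \<theta>0 / 2" and n: "Suc N \<le> n" and k: "k \<in> {2 * n - 1, 2 * n}" for W n k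
  proof -
    have D: "l2_bounded (\<theta>0 / 2) (\<lambda>l. of_real (bracket l powr ?s) * (W - V) l)"
    proof (rule l2_bounded_le[OF hs_l2_bounded W(2)])
      have "W \<in> hs ?s" using W(1) unfolding H_plus_def by blast
      thus "W - V \<in> hs ?s" by (rule hs_diff_l2[OF Vh])
    qed
    have WR: "l2_bounded R (\<lambda>l. of_real (bracket l powr ?s) * W l)"
      using l2_bounded_add[OF hs_l2_bounded[OF Vh] D] by (simp add: R_def right_diff_distrib)
    have "l2_bounded (\<theta>0 / 2) (\<lambda>l. if L < \<bar>l\<bar> then of_real (bracket l powr ?s) * (W - V) l else 0)"
      by (rule l2_bounded_mono[OF D]) simp
    from l2_bounded_add[OF L this]
    have tail: "l2_bounded \<theta>0 (\<lambda>l. if L < \<bar>l\<bar> then of_real (bracket l powr ?s) * W l else 0)"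
      unfolding field_sum_of_halves by (rule l2_bounded_mono) (simp add: right_diff_distrib)
    have R0: "0 \<le> R" by (rule l2_bounded_nonneg[OF WR])
    have n1: "1 \<le> real n ^ m" using n by (intro one_le_power) simp
    have "cmod (eigval m W k - unperturbed m n) \<le> c * (R + R\<^sup>2) * 1 + c * (\<theta>0 + \<theta>0\<^sup>2) * real n ^ m"
      using N[OF order_refl WR tail _ k] n by simp
    also have "\<dots> \<le> c * (R + R\<^sup>2) * real n ^ m + c * (\<theta>0 + \<theta>0\<^sup>2) * real n ^ m"
      using n1 c R0 by (intro add_right_mono mult_left_mono) auto
    also have "\<dots> = C * real n ^ m" by (simp add: C_def algebra_simps)
    finally show ?thesis .
  qed
  note main = this
  show ?thesis
  proof (rule exI[of _ "\<theta>0 / 2"], rule conjI[rotated], rule exI[of _ C], rule exI[of _ "Suc N"], intro ballI allI impI)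
    fix W n k
    assume "W \<in> H_plus ?s" "hs_norm ?s (W - V) \<le> \<theta>0 / 2" "Suc N \<le> n" "1 \<le> n" "k \<in> {2 * n - 1, 2 * n}"
    thus "cmod (eigval m W k - unperturbed m n) \<le> C * real n ^ m" by (intro main)
  qed (use \<theta>0 in simp)
qed

text \<open>A difference bounded by \<open>R\<close> in the norm of index \<open>m\<close> has,
  beyond \<open>L\<close>, a norm of index \<open>- m\<close> of at most \<open>R / L\<close>,
  uniformly in \<open>W\<close>: the gain of regularity replaces closeness. One half of
  \<open>\<delta>\<close> is spent on the tail, the other on the constant term, which
  \<open>n ^ m\<close> eventually dominates.\<close>

theorem alpha_one_small:
  assumes m: "1 \<le> m" and V: "V \<in> H_plus (- real m)" and R: "0 < R" and \<delta>: "0 < \<delta>"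
  shows "\<exists>N. \<forall>W \<in> H_plus (- real m).
          W - V \<in> H_plus (real m) \<and> hs_norm (real m) (W - V) \<le> R \<longrightarrow>
          (\<forall>n\<ge>N. n \<ge> 1 \<longrightarrow> (\<forall>k \<in> {2 * n - 1, 2 * n}.
             cmod (eigval m W k - unperturbed m n) \<le> \<delta> * real n ^ m))"
proof -
  let ?s = "- real m"
  obtain \<theta>0 c where \<theta>0: "0 < \<theta>0" and c: "0 \<le> c" and est: "\<And>R L. \<exists>N. \<forall>\<theta> W. \<theta> \<le> \<theta>0 \<longrightarrow>
    l2_bounded R (\<lambda>l. of_real (bracket l powr ?s) * W l) \<longrightarrow>
    l2_bounded \<theta> (\<lambda>l. if L < \<bar>l\<bar> then of_real (bracket l powr ?s) * W l else 0) \<longrightarrow>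
    (\<forall>n>N. \<forall>k\<in>{2 * n - 1, 2 * n}. cmod (eigval m W k - unperturbed m n)
       \<le> c * (R + R\<^sup>2) + c * (\<theta> + \<theta>\<^sup>2) * real n ^ m)"
    using alpha_one_estimate[OF m] by blast
  \<comment> \<open>\<open>4 * c + 1\<close> also covers \<open>c = 0\<close>; the bound 1 serves to
    estimate \<open>\<theta>\<^sup>2\<close> by \<open>\<theta>\<close>.\<close>
  define \<theta> where "\<theta> = min \<theta>0 (min 1 (\<delta> / (4 * c + 1)))"
  have \<theta>: "0 < \<theta>" "\<theta> \<le> \<theta>0" "\<theta> \<le> 1" "\<theta> \<le> \<delta> / (4 * c + 1)" using \<theta>0 \<delta> c by (auto simp: \<theta>_def)
  have c\<theta>: "c * (\<theta> + \<theta>\<^sup>2) \<le> \<delta> / 2"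
  proof -
    have "\<theta>\<^sup>2 \<le> \<theta>" using \<theta>(1,3) by (simp add: power2_eq_square mult_left_le)
    hence "c * (\<theta> + \<theta>\<^sup>2) \<le> c * (2 * \<theta>)" using c by (intro mult_left_mono) auto
    also have "\<dots> \<le> (4 * c + 1) * \<theta> / 2" using \<theta>(1) by (simp add: algebra_simps)
    also have "\<dots> \<le> \<delta> / 2" using \<theta>(4) c by (simp add: le_divide_eq mult.commute)
    finally show ?thesis .
  qed
  have Vh: "V \<in> hs ?s" using V by (simp add: H_plus_def)
  obtain L1 where L1: "\<And>L. L1 \<le> L \<Longrightarrow> l2_bounded (\<theta> / 2) (\<lambda>l. if L < \<bar>l\<bar> then of_real (bracket l powr ?s) * V l else 0)"
    using hs_tail[OF Vh, of "\<theta> / 2"] \<theta>(1) by auto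
  \<comment> \<open>The last entry turns the tail bound \<open>R / L\<close> of the difference into
    \<open>\<theta> / 2\<close>.\<close>
  define L where "L = max L1 (max 1 \<lceil>2 * R / \<theta>\<rceil>)"
  have L: "L1 \<le> L" "1 \<le> L" "2 * R / \<theta> \<le> real_of_int L"
  proof -
    have "\<lceil>2 * R / \<theta>\<rceil> \<le> L" by (simp add: L_def)
    thus "2 * R / \<theta> \<le> real_of_int L" by (simp add: ceiling_le_iff)
  qed (auto simp: L_def)
  define R' where "R' = hs_norm ?s V + R"
  obtain N where N: "\<And>\<theta> W n k. \<theta> \<le> \<theta>0 \<Longrightarrow>
    l2_bounded R' (\<lambda>l. of_real (bracket l powr ?s) * W l) \<Longrightarrow>
    l2_bounded \<theta> (\<lambda>l. if L < \<bar>l\<bar> then of_real (bracket l powr ?s) * W l else 0) \<Longrightarrow>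
    N < n \<Longrightarrow> k \<in> {2 * n - 1, 2 * n} \<Longrightarrow> cmod (eigval m W k - unperturbed m n)
       \<le> c * (R' + R'\<^sup>2) + c * (\<theta> + \<theta>\<^sup>2) * real n ^ m"
    using est[of R' L] by blast
  obtain n0 where n0: "2 * (c * (R' + R'\<^sup>2)) / \<delta> \<le> real n0" using real_arch_simple by blast
  have "cmod (eigval m W k - unperturbed m n) \<le> \<delta> * real n ^ m"
    if W: "W - V \<in> H_plus (real m)" "hs_norm (real m) (W - V) \<le> R" and n: "max (Suc N) n0 \<le> n" and k: "k \<in> {2 * n - 1, 2 * n}" for W n k
  proof -
    have D: "l2_bounded R (\<lambda>l. of_real (bracket l powr real m) * (W - V) l)"
    proof (rule l2_bounded_le[OF hs_l2_bounded W(2)])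
      show "W - V \<in> hs (real m)" using W(1) unfolding H_plus_def by blast
    qed
    have D1: "l2_bounded R (\<lambda>l. of_real (bracket l powr ?s) * (W - V) l)"
    proof (rule l2_bounded_mono[OF D])
      fix l
      have "bracket l powr ?s \<le> bracket l powr real m" by (intro powr_mono) auto
      thus "cmod (of_real (bracket l powr ?s) * (W - V) l) \<le> cmod (of_real (bracket l powr real m) * (W - V) l)"
        by (simp add: norm_mult mult_right_mono)
    qed
    have WR: "l2_bounded R' (\<lambda>l. of_real (bracket l powr ?s) * W l)"
      using l2_bounded_add[OF hs_l2_bounded[OF Vh] D1] by (simp add: R'_def right_diff_distrib)
    have "l2_bounded (cmod (of_real (1 / real_of_int L)) * R) (\<lambda>l. of_real (1 / real_of_int L) * (of_real (bracket l powr real m) * (W - V) l))"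
      by (rule l2_bounded_cmult[OF D])
    hence "l2_bounded (\<theta> / 2) (\<lambda>l. of_real (1 / real_of_int L) * (of_real (bracket l powr real m) * (W - V) l))"
      by (rule l2_bounded_le) (use L \<theta>(1) R in \<open>simp add: norm_divide field_simps\<close>)
    hence D2: "l2_bounded (\<theta> / 2) (\<lambda>l. if L < \<bar>l\<bar> then of_real (bracket l powr ?s) * (W - V) l else 0)"
    proof (rule l2_bounded_mono)
      fix l
      show "cmod (if L < \<bar>l\<bar> then of_real (bracket l powr ?s) * (W - V) l else 0)
          \<le> cmod (of_real (1 / real_of_int L) * (of_real (bracket l powr real m) * (W - V) l))"
      proof (cases "L < \<bar>l\<bar>")
        case True
        have "bracket l powr ?s \<le> bracket l powr (real m - 1)" using m by (intro powr_mono) auto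
        also have "\<dots> = bracket l powr real m / bracket l" by (simp add: powr_diff less_imp_le)
        also have "\<dots> \<le> bracket l powr real m / real_of_int L"
        proof (rule divide_left_mono)
          show "real_of_int L \<le> bracket l" using True unfolding bracket_def by linarith
        qed (use L(2) in auto)
        finally have "bracket l powr ?s * cmod ((W - V) l) \<le> bracket l powr real m / real_of_int L * cmod ((W - V) l)"
          by (rule mult_right_mono) simp
        thus ?thesis using True L(2) by (simp add: norm_mult norm_divide)
      qed simp
    qed
    from l2_bounded_add[OF L1[OF L(1)] D2]
    have tail: "l2_bounded \<theta> (\<lambda>l. if L < \<bar>l\<bar> then of_real (bracket l powr ?s) * W l else 0)"
      unfolding field_sum_of_halves by (rule l2_bounded_mono) (simp add: right_diff_distrib)
    have "cmod (eigval m W k - unperturbed m n) \<le> c * (R' + R'\<^sup>2) + c * (\<theta> + \<theta>\<^sup>2) * real n ^ m"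
      using N[OF \<theta>(2) WR tail _ k] n by simp
    also have "\<dots> \<le> \<delta> / 2 * real n ^ m + \<delta> / 2 * real n ^ m"
    proof (intro add_mono mult_right_mono c\<theta>)
      have "2 * (c * (R' + R'\<^sup>2)) / \<delta> \<le> real n" using n0 n by simp
      also have "\<dots> \<le> real n ^ m" using n m by (intro le_power_self) auto
      finally show "c * (R' + R'\<^sup>2) \<le> \<delta> / 2 * real n ^ m" using \<delta> by (simp add: field_simps)
    qed auto
    finally show ?thesis by simp
  qed
  note main = this
  show ?thesis
  proof (rule exI[of _ "max (Suc N) n0"], intro ballI allI impI, elim conjE)
    fix W n k
    assume "W - V \<in> H_plus (real m)" "hs_norm (real m) (W - V) \<le> R" "max (Suc N) n0 \<le> n" "1 \<le> n" "k \<in> {2 * n - 1, 2 * n}"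
    thus "cmod (eigval m W k - unperturbed m n) \<le> \<delta> * real n ^ m" by (intro main)
  qed
qed

section \<open>Error sequences\<close>

text \<open>Comparable bases have comparable powers for exponents of either sign; both signs occur,
  as the order of the error space may be negative.\<close>

lemma powr_compare:
  fixes x z q :: real
  assumes "0 < x" "0 < z" "x \<le> 2 * z" "z \<le> 2 * x"
  shows "x powr q \<le> 2 powr \<bar>q\<bar> * z powr q"
proof (cases "0 \<le> q")
  case True
  have "x powr q \<le> (2 * z) powr q" using assms True by (intro powr_mono2) auto
  thus ?thesis using assms True by (simp add: powr_mult)
next
  case False
  have "x powr q \<le> (z / 2) powr q" using assms False by (intro powr_mono2') auto
  also have "\<dots> = z powr q / 2 powr q" using assms by (simp add: powr_divide)
  also have "\<dots> = 2 powr (- q) * z powr q" by (simp add: powr_minus_divide)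
  finally show ?thesis using False by simp
qed

context coeff_majorant
begin

text \<open>\<open>\<eta>\<close> is the decay demanded of the first term of \<open>Q\<close>. The
  second term needs only a nonpositive power of \<open>k\<close>, because its other factor is
  dominated by the square summable \<open>ffull\<close>.\<close>

lemma Q_weighted:
  assumes k: "1 \<le> k" and q: "q + (max 1 (2 * p) - 2 * real m) \<le> - \<eta>" "q + (2 * p - 2 * real m + 1) \<le> 0"
  shows "real_of_int k powr q * Q k \<le> 2 * 16 ^ m * (Y\<^sup>2 + 1) * (real_of_int k powr (- \<eta>) + ffull k)"
proof -
  let ?T = "real_of_int k"
  have T: "1 \<le> ?T" using k by simp
  have f0: "0 \<le> ffull k" using ftail_nonneg[of k] ftail_le_ffull[of k] by linarith
  have "?T powr q * Q k = 2 * 16 ^ m * (?T powr (q + (max 1 (2 * p) - 2 * real m)) * Y\<^sup>2 + ?T powr (q + (2 * p - 2 * real m + 1)) * ftail k)"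
    unfolding Q_def powr_add by (simp add: algebra_simps)
  also have "\<dots> \<le> 2 * 16 ^ m * (?T powr (- \<eta>) * Y\<^sup>2 + 1 * ffull k)"
  proof (intro mult_left_mono add_mono mult_mono)
    show "?T powr (q + (max 1 (2 * p) - 2 * real m)) \<le> ?T powr (- \<eta>)" using T q by (intro powr_mono) auto
    have "?T powr (q + (2 * p - 2 * real m + 1)) \<le> ?T powr 0" using T q by (intro powr_mono) auto
    thus "?T powr (q + (2 * p - 2 * real m + 1)) \<le> 1" using T by simp
  qed (use ftail_nonneg ftail_le_ffull in auto)
  also have "\<dots> \<le> 2 * 16 ^ m * ((Y\<^sup>2 + 1) * (?T powr (- \<eta>) + ffull k))"
    using f0 by (intro mult_left_mono) (auto simp: algebra_simps)
  finally show ?thesis by (simp only: mult.assoc)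
qed

lemma B_weighted:
  assumes k: "1 \<le> k" and q: "q + (p + 1 - 2 * real m + max 0 (p - 1 + h)) \<le> 0" "q + (2 * p - 2 * real m) \<le> - \<eta>"
  shows "real_of_int k powr q * B h k \<le> 2 * 16 ^ m * 2 powr max 0 (p - 1 + h) * (Y\<^sup>2 + 2) * (real_of_int k powr (- \<eta>) + g h k)"
proof -
  let ?T = "real_of_int k" and ?G = "max 0 (p - 1 + h)"
  have T: "1 \<le> ?T" using k by simp
  have g0: "0 \<le> g h k" by (rule g_nonneg)
  have "?T powr q * B h k = 2 * 16 ^ m * 2 powr ?G * (?T powr (q + (p + 1 - 2 * real m + ?G)) * (2 * g h k) + ?T powr (q + (2 * p - 2 * real m)) * Y\<^sup>2)"
    unfolding B_def powr_add[of _ q] by (simp add: algebra_simps)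
  also have "\<dots> \<le> 2 * 16 ^ m * 2 powr ?G * (1 * (2 * g h k) + ?T powr (- \<eta>) * Y\<^sup>2)"
  proof (intro mult_left_mono add_mono mult_right_mono)
    show "?T powr (q + (2 * p - 2 * real m)) \<le> ?T powr (- \<eta>)" using T q by (intro powr_mono) auto
    have "?T powr (q + (p + 1 - 2 * real m + ?G)) \<le> ?T powr 0" using T q by (intro powr_mono) auto
    thus "?T powr (q + (p + 1 - 2 * real m + ?G)) \<le> 1" using T by simp
  qed (use g0 in auto)
  also have "\<dots> \<le> 2 * 16 ^ m * 2 powr ?G * ((Y\<^sup>2 + 2) * (?T powr (- \<eta>) + g h k))"
    using g0 by (intro mult_left_mono) (auto simp: algebra_simps)
  finally show ?thesis by (simp only: mult.assoc)
qed

text \<open>The squares of the four sequences to which all errors are reduced; each has a finite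
  sum, bounded in terms of \<open>Y\<close>, \<open>\<eta>\<close> and \<open>h\<close>. The name is
  reused here for a new object.\<close>

definition X :: "real \<Rightarrow> real \<Rightarrow> int \<Rightarrow> real" where
  "X \<eta> h k = (real_of_int k powr (- \<eta>))\<^sup>2 + (ffull k)\<^sup>2 + (g h k)\<^sup>2 + (y (2 * k))\<^sup>2"

lemma X_sum:
  assumes F: "finite F" "\<And>k. k \<in> F \<Longrightarrow> 1 \<le> k" and \<eta>: "1 / 2 < \<eta>" and h: "1 / 2 < h"
  shows "(\<Sum>k\<in>F. X \<eta> h k) \<le> (2 powr \<bar>- \<eta>\<bar> * bracket_l2 \<eta>)\<^sup>2 + (Y\<^sup>2 * dist1_l2)\<^sup>2 + (Y * bracket_l2 h * Y)\<^sup>2 + Y\<^sup>2"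
proof -
  have "(\<Sum>k\<in>F. (real_of_int k powr (- \<eta>))\<^sup>2) \<le> (\<Sum>k\<in>F. (2 powr \<bar>- \<eta>\<bar> * bracket k powr (- \<eta>))\<^sup>2)"
  proof (intro sum_mono power_mono)
    fix k assume "k \<in> F"
    hence "1 \<le> k" by (rule F(2))
    thus "real_of_int k powr (- \<eta>) \<le> 2 powr \<bar>- \<eta>\<bar> * bracket k powr (- \<eta>)"
      by (intro powr_compare) (auto simp: bracket_def)
  qed auto
  also have "\<dots> = (2 powr \<bar>- \<eta>\<bar>)\<^sup>2 * (\<Sum>k\<in>F. (cmod (of_real (bracket k powr (- \<eta>))))\<^sup>2)"
    by (simp add: power_mult_distrib sum_distrib_left)
  also have "\<dots> \<le> (2 powr \<bar>- \<eta>\<bar>)\<^sup>2 * (bracket_l2 \<eta>)\<^sup>2"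
    by (intro mult_left_mono l2_boundedD[OF bracket_l2[OF \<eta>] F(1)]) simp
  finally have 1: "(\<Sum>k\<in>F. (real_of_int k powr (- \<eta>))\<^sup>2) \<le> (2 powr \<bar>- \<eta>\<bar> * bracket_l2 \<eta>)\<^sup>2"
    by (simp only: power_mult_distrib)
  have 2: "(\<Sum>k\<in>F. (ffull k)\<^sup>2) \<le> (Y\<^sup>2 * dist1_l2)\<^sup>2" using l2_boundedD[OF ffull_l2 F(1)] by simp
  have 3: "(\<Sum>k\<in>F. (g h k)\<^sup>2) \<le> (Y * bracket_l2 h * Y)\<^sup>2" using l2_boundedD[OF g_l2[OF h] F(1)] by simp
  have 4: "(\<Sum>k\<in>F. (y (2 * k))\<^sup>2) \<le> Y\<^sup>2" by (rule y_sum_reindex[OF F(1)]) (simp add: inj_on_def)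
  show ?thesis unfolding X_def sum.distrib using 1 2 3 4 by linarith
qed

text \<open>
  The inequalities \<open>E1\<close> to \<open>E8\<close> are those needed to bound \<open>k powr s * A\<close> and \<open>k powr s * b\<close>, and, for
  the mixed term with \<open>\<bar>V (\<plusminus>2 k)\<bar>\<close> of size \<open>k powr p\<close>, also \<open>k powr (2 * s + p) * b\<close>.
\<close>

lemma pair_error_weighted:
  fixes D C1 s \<eta> h :: real and A b :: real
  assumes k: "1 \<le> k" and D: "0 \<le> D" and C1: "0 \<le> C1"
    and E1: "s + (p - 2 * real m + 1) + (max 1 (2 * p) - 2 * real m) \<le> - \<eta>"
    and E2: "s + (p - 2 * real m + 1) + (2 * p - 2 * real m + 1) \<le> 0"
    and E3: "s + (p + 1 - 2 * real m + max 0 (p - 1 + h)) \<le> 0" and E4: "s + (2 * p - 2 * real m) \<le> - \<eta>"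
    and E5: "2 * s + p + (p + 1 - 2 * real m + max 0 (p - 1 + h)) \<le> 0" and E6: "2 * s + p + (2 * p - 2 * real m) \<le> - \<eta>"
    and E7: "2 * s + p + (p - 2 * real m + 1) + (max 1 (2 * p) - 2 * real m) \<le> - \<eta>"
    and E8: "2 * s + p + (p - 2 * real m + 1) + (2 * p - 2 * real m + 1) \<le> 0"
    and S: "real_of_int k powr s * S \<le> C1 * (real_of_int k powr (- \<eta>) + ffull k)" and S0: "0 \<le> S"
  defines "\<delta> \<equiv> D * real_of_int k powr (p - 2 * real m + 1)"
    and "KA \<equiv> C1 + 10 * D * (2 * 16 ^ m * (Y\<^sup>2 + 1))"
    and "Kb \<equiv> 2 * 16 ^ m * 2 powr max 0 (p - 1 + h) * (Y\<^sup>2 + 2) + 10 * D * (2 * 16 ^ m * (Y\<^sup>2 + 1))"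
  assumes A: "A = S + 10 * \<delta> * Q k" and b: "b = B h k + 10 * \<delta> * Q k"
  shows "real_of_int k powr (2 * s) * (4 * A\<^sup>2 + 2 * (cmod (V (2 * k)) + cmod (V (- 2 * k))) * b + 2 * b\<^sup>2)
    \<le> 3 * (4 * KA\<^sup>2 + 2 * Kb\<^sup>2 + 2 * 3 powr p * Kb) * X \<eta> h k"
proof -
  let ?T = "real_of_int k"
  define x where "x = ?T powr (- \<eta>) + ffull k + g h k"
  have T: "1 \<le> ?T" using k by simp
  have f0: "0 \<le> ffull k" using ftail_nonneg[of k] ftail_le_ffull[of k] by linarith
  have g0: "0 \<le> g h k" by (rule g_nonneg)
  have x0: "0 \<le> x" using f0 g0 by (simp add: x_def)
  have c0: "0 \<le> 2 * 16 ^ m * (Y\<^sup>2 + 1)" "0 \<le> 2 * 16 ^ m * 2 powr max 0 (p - 1 + h) * (Y\<^sup>2 + 2)" by auto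
  have KA0: "0 \<le> KA" and Kb0: "0 \<le> Kb" using C1 D c0 by (auto simp: KA_def Kb_def)
  have \<delta>0: "0 \<le> \<delta>" using D by (simp add: \<delta>_def)
  have A0: "0 \<le> A" and b0: "0 \<le> b" using S0 \<delta>0 Q_nonneg[of k] B_nonneg[of h k] by (auto simp: A b)
  have dQ: "?T powr q * (10 * \<delta> * Q k) \<le> 10 * D * (2 * 16 ^ m * (Y\<^sup>2 + 1)) * x"
    if q: "q + (p - 2 * real m + 1) + (max 1 (2 * p) - 2 * real m) \<le> - \<eta>" "q + (p - 2 * real m + 1) + (2 * p - 2 * real m + 1) \<le> 0" for q
  proof -
    have "?T powr q * (10 * \<delta> * Q k) = 10 * D * (?T powr (q + (p - 2 * real m + 1)) * Q k)"
      unfolding \<delta>_def powr_add[of _ q] by simp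
    also have "\<dots> \<le> 10 * D * (2 * 16 ^ m * (Y\<^sup>2 + 1) * (?T powr (- \<eta>) + ffull k))"
      using D by (intro mult_left_mono Q_weighted[OF k q]) auto
    also have "\<dots> \<le> 10 * D * (2 * 16 ^ m * (Y\<^sup>2 + 1) * x)"
      using D g0 c0 by (intro mult_left_mono) (auto simp: x_def)
    finally show ?thesis by (simp only: mult.assoc)
  qed
  have Bx: "?T powr q * B h k \<le> 2 * 16 ^ m * 2 powr max 0 (p - 1 + h) * (Y\<^sup>2 + 2) * x"
    if q: "q + (p + 1 - 2 * real m + max 0 (p - 1 + h)) \<le> 0" "q + (2 * p - 2 * real m) \<le> - \<eta>" for q
    by (rule order_trans[OF B_weighted[OF k q]], rule mult_left_mono) (use f0 in \<open>auto simp: x_def\<close>)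
  have Ax: "?T powr s * A \<le> KA * x"
  proof -
    have "?T powr s * S \<le> C1 * x" by (rule order_trans[OF S], rule mult_left_mono) (use C1 g0 in \<open>auto simp: x_def\<close>)
    thus ?thesis using dQ[OF E1 E2] by (simp add: A KA_def distrib_left distrib_right)
  qed
  have bx: "?T powr s * b \<le> Kb * x"
    using Bx[OF E3 E4] dQ[OF E1 E2] by (simp add: b Kb_def distrib_left distrib_right)
  \<comment> \<open>In the mixed term the whole weight \<open>2 * s + p\<close> falls on
    \<open>b\<close>: the modulus of \<open>V (2 k)\<close> is of order \<open>k powr p\<close>
    times \<open>y (2 * k)\<close>, and \<open>y (2 * k)\<close> brings no decay beyond square
    summability.\<close>
  have bx2: "?T powr (2 * s + p) * b \<le> Kb * x"
    using Bx[OF E5 E6] dQ[OF E7 E8] by (simp add: b Kb_def distrib_left distrib_right)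
  have T2: "?T powr (2 * s) = (?T powr s)\<^sup>2" by (simp add: power2_eq_square powr_add[symmetric])
  have v: "cmod (V (2 * k)) + cmod (V (- 2 * k)) \<le> 2 * (3 powr p * ?T powr p * y (2 * k))"
  proof -
    have "bracket (2 * k) \<le> 3 * ?T" using k by (simp add: bracket_def)
    hence "bracket (2 * k) powr p \<le> (3 * ?T) powr p" using p by (intro powr_mono2) (auto simp: less_imp_le)
    hence "bracket (2 * k) powr p * y (2 * k) \<le> 3 powr p * ?T powr p * y (2 * k)"
      using T y_nonneg by (intro mult_right_mono) (auto simp: powr_mult)
    thus ?thesis using V_le[of "2 * k"] V_minus_le[of "- 2 * k"] by simp
  qed
  have "?T powr (2 * s) * (4 * A\<^sup>2 + 2 * (cmod (V (2 * k)) + cmod (V (- 2 * k))) * b + 2 * b\<^sup>2)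
      \<le> ?T powr (2 * s) * (4 * A\<^sup>2 + 2 * (2 * (3 powr p * ?T powr p * y (2 * k))) * b + 2 * b\<^sup>2)"
    using v b0 by (intro mult_left_mono add_mono mult_right_mono) auto
  also have "\<dots> = 4 * (?T powr s * A)\<^sup>2 + 4 * 3 powr p * y (2 * k) * (?T powr (2 * s + p) * b) + 2 * (?T powr s * b)\<^sup>2"
    unfolding powr_add[of _ "2 * s"] T2 by (simp add: power_mult_distrib algebra_simps)
  also have "\<dots> \<le> 4 * (KA * x)\<^sup>2 + 4 * 3 powr p * y (2 * k) * (Kb * x) + 2 * (Kb * x)\<^sup>2"
    using Ax bx bx2 A0 b0 y_nonneg by (intro add_mono mult_left_mono power_mono) auto
  also have "4 * 3 powr p * y (2 * k) * (Kb * x) \<le> 2 * 3 powr p * Kb * (x\<^sup>2 + (y (2 * k))\<^sup>2)"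
  proof -
    have "2 * 3 powr p * Kb * (2 * x * y (2 * k)) \<le> 2 * 3 powr p * Kb * (x\<^sup>2 + (y (2 * k))\<^sup>2)"
      using Kb0 by (intro mult_left_mono sum_squares_bound) auto
    thus ?thesis by (simp add: mult_ac)
  qed
  also have "4 * (KA * x)\<^sup>2 + 2 * 3 powr p * Kb * (x\<^sup>2 + (y (2 * k))\<^sup>2) + 2 * (Kb * x)\<^sup>2
      = (4 * KA\<^sup>2 + 2 * Kb\<^sup>2 + 2 * 3 powr p * Kb) * x\<^sup>2 + 2 * 3 powr p * Kb * (y (2 * k))\<^sup>2"
    by (simp add: power_mult_distrib algebra_simps)
  also have "\<dots> \<le> (4 * KA\<^sup>2 + 2 * Kb\<^sup>2 + 2 * 3 powr p * Kb) * (3 * ((?T powr (- \<eta>))\<^sup>2 + (ffull k)\<^sup>2 + (g h k)\<^sup>2))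
      + (4 * KA\<^sup>2 + 2 * Kb\<^sup>2 + 2 * 3 powr p * Kb) * (3 * (y (2 * k))\<^sup>2)"
  proof (intro add_mono mult_mono)
    show "x\<^sup>2 \<le> 3 * ((?T powr (- \<eta>))\<^sup>2 + (ffull k)\<^sup>2 + (g h k)\<^sup>2)"
      using sum_squares_bound[of "?T powr (- \<eta>)" "ffull k"] sum_squares_bound[of "?T powr (- \<eta>)" "g h k"]
        sum_squares_bound[of "ffull k" "g h k"]
      by (simp add: x_def power2_sum algebra_simps)
  qed (use Kb0 KA0 in auto)
  also have "\<dots> = 3 * (4 * KA\<^sup>2 + 2 * Kb\<^sup>2 + 2 * 3 powr p * Kb) * X \<eta> h k"
    by (simp add: X_def algebra_simps)
  finally show ?thesis by simp
qed

end

text \<open>Up to \<open>N\<close> nothing is asymptotic, and the explicit bounds \<open>G\<close>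
  enter the constant as a finite sum. Beyond, \<open>x\<close> is sampled at the odd numbers
  \<open>2 * j - 1\<close>, which are comparable to \<open>bracket j\<close>.\<close>

lemma error_sequence_l2:
  fixes a :: "int \<Rightarrow> complex" and G :: "int \<Rightarrow> real" and x :: "int \<Rightarrow> real" and N :: nat
  assumes a0: "\<And>j. j \<le> 0 \<Longrightarrow> a j = 0"
    and low: "\<And>j. 1 \<le> j \<Longrightarrow> j \<le> int N \<Longrightarrow> cmod (a j) \<le> G j"
    and high: "\<And>j. int N < j \<Longrightarrow> real_of_int (2 * j - 1) powr (2 * s) * (cmod (a j))\<^sup>2 \<le> K * x (2 * j - 1)"
    and K: "0 \<le> K" and x: "\<And>F. finite F \<Longrightarrow> (\<And>k. k \<in> F \<Longrightarrow> 1 \<le> k) \<Longrightarrow> (\<Sum>k\<in>F. x k) \<le> S"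
  shows "l2_bounded (sqrt ((\<Sum>j\<in>{1..int N}. bracket j powr (2 * s) * (G j)\<^sup>2) + 2 powr \<bar>2 * s\<bar> * K * S)) (\<lambda>j. of_real (bracket j powr s) * a j)"
proof (rule l2_boundedI)
  let ?E = "\<Sum>j\<in>{1..int N}. bracket j powr (2 * s) * (G j)\<^sup>2"
  have S0: "0 \<le> S" using x[of "{}"] by simp
  have E0: "0 \<le> ?E" by (intro sum_nonneg) auto
  have tot0: "0 \<le> ?E + 2 powr \<bar>2 * s\<bar> * K * S" using E0 K S0 by simp
  thus "0 \<le> sqrt (?E + 2 powr \<bar>2 * s\<bar> * K * S)" by simp
  fix F :: "int set" assume F: "finite F"
  define t where "t j = (cmod (of_real (bracket j powr s) * a j))\<^sup>2" for j
  have t: "t j = bracket j powr (2 * s) * (cmod (a j))\<^sup>2" for j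
    by (simp add: t_def norm_mult power_mult_distrib bracket_powr_square)
  have t0: "t j = 0" if "\<not> 1 \<le> j" for j using a0[of j] that by (simp add: t)
  have "(\<Sum>j\<in>F. t j) = (\<Sum>j\<in>F \<inter> {1..}. t j)"
    by (rule sum.mono_neutral_right[OF F]) (use t0 in auto)
  also have "\<dots> = (\<Sum>j\<in>F \<inter> {1..int N}. t j) + (\<Sum>j\<in>F \<inter> {int N<..}. t j)"
    by (subst sum.union_disjoint[symmetric]) (use F in \<open>auto intro!: sum.cong\<close>)
  also have "(\<Sum>j\<in>F \<inter> {1..int N}. t j) \<le> (\<Sum>j\<in>F \<inter> {1..int N}. bracket j powr (2 * s) * (G j)\<^sup>2)"
    unfolding t by (intro sum_mono mult_left_mono power_mono low) auto
  also have "\<dots> \<le> ?E" by (rule sum_mono2) auto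
  also have "(\<Sum>j\<in>F \<inter> {int N<..}. t j) \<le> (\<Sum>j\<in>F \<inter> {int N<..}. 2 powr \<bar>2 * s\<bar> * K * x (2 * j - 1))"
  proof (rule sum_mono)
    fix j assume "j \<in> F \<inter> {int N<..}"
    hence j: "int N < j" "1 \<le> j" by auto
    have "bracket j powr (2 * s) \<le> 2 powr \<bar>2 * s\<bar> * real_of_int (2 * j - 1) powr (2 * s)"
      using j by (intro powr_compare) (auto simp: bracket_def)
    hence "t j \<le> 2 powr \<bar>2 * s\<bar> * real_of_int (2 * j - 1) powr (2 * s) * (cmod (a j))\<^sup>2"
      unfolding t by (rule mult_right_mono) simp
    also have "\<dots> = 2 powr \<bar>2 * s\<bar> * (real_of_int (2 * j - 1) powr (2 * s) * (cmod (a j))\<^sup>2)" by simp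
    also have "\<dots> \<le> 2 powr \<bar>2 * s\<bar> * (K * x (2 * j - 1))" by (intro mult_left_mono high j) simp
    finally show "t j \<le> 2 powr \<bar>2 * s\<bar> * K * x (2 * j - 1)" by simp
  qed
  also have "\<dots> = 2 powr \<bar>2 * s\<bar> * K * (\<Sum>j\<in>F \<inter> {int N<..}. x (2 * j - 1))" by (simp add: sum_distrib_left)
  also have "(\<Sum>j\<in>F \<inter> {int N<..}. x (2 * j - 1)) = (\<Sum>k\<in>(\<lambda>j. 2 * j - 1) ` (F \<inter> {int N<..}). x k)"
    by (rule sum.reindex_cong[symmetric, of "\<lambda>j. 2 * j - 1"]) (auto simp: inj_on_def)
  also have "2 powr \<bar>2 * s\<bar> * K * (\<Sum>k\<in>(\<lambda>j. 2 * j - 1) ` (F \<inter> {int N<..}). x k) \<le> 2 powr \<bar>2 * s\<bar> * K * S"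
    using K F by (intro mult_left_mono x) auto
  finally have "(\<Sum>j\<in>F. t j) \<le> ?E + 2 powr \<bar>2 * s\<bar> * K * S" by simp
  thus "(\<Sum>j\<in>F. (cmod (of_real (bracket j powr s) * a j))\<^sup>2) \<le> (sqrt (?E + 2 powr \<bar>2 * s\<bar> * K * S))\<^sup>2"
    using tot0 by (simp add: t_def)
qed

text \<open>The exponent inequalities are hypotheses so that one argument serves all ranges of
  \<alpha>; the diagonal second-order sum is left to an assumption because the case
  \<open>m = 1\<close>, \<open>p = 0\<close> bounds it by cancellation. \<open>\<eta>\<close> and
  \<open>h\<close> exceed 1/2 to make \<open>k powr (- \<eta>)\<close> and
  \<open>bracket l powr (- h)\<close> square summable.\<close>

theorem pm_formula_uniform:
  fixes m :: nat and p s \<eta> h R :: real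
  assumes m: "1 \<le> m" and p: "0 \<le> p" "p < real m" and \<eta>: "1 / 2 < \<eta>" and h: "1 / 2 < h"
    and E1: "s + (p - 2 * real m + 1) + (max 1 (2 * p) - 2 * real m) \<le> - \<eta>"
    and E2: "s + (p - 2 * real m + 1) + (2 * p - 2 * real m + 1) \<le> 0"
    and E3: "s + (p + 1 - 2 * real m + max 0 (p - 1 + h)) \<le> 0" and E4: "s + (2 * p - 2 * real m) \<le> - \<eta>"
    and E5: "2 * s + p + (p + 1 - 2 * real m + max 0 (p - 1 + h)) \<le> 0" and E6: "2 * s + p + (2 * p - 2 * real m) \<le> - \<eta>"
    and E7: "2 * s + p + (p - 2 * real m + 1) + (max 1 (2 * p) - 2 * real m) \<le> - \<eta>"
    and E8: "2 * s + p + (p - 2 * real m + 1) + (2 * p - 2 * real m + 1) \<le> 0"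
    and C1: "0 \<le> C1" and diag: "\<And>V y k. coeff_majorant m p V y (2 * R) \<Longrightarrow> (\<And>l. odd l \<Longrightarrow> V l = 0) \<Longrightarrow> odd k \<Longrightarrow> 1 \<le> k \<Longrightarrow>
      real_of_int k powr s * cmod (second_order m V k k k) \<le> C1 * (real_of_int k powr (- \<eta>) + coeff_majorant.ffull y k)"
  shows "\<exists>C. \<forall>U \<in> H_plus (- p). hs_norm (- p) U \<le> R \<longrightarrow> pm_formula m U s C"
proof (cases "R < 0")
  case True
  \<comment> \<open>Norms are nonnegative, so a negative radius admits no potential at all.\<close>
  have "\<not> hs_norm (- p) U \<le> R" for U
    unfolding hs_norm_def using True infsum_nonneg[of UNIV "\<lambda>k. bracket k powr (2 * - p) * (cmod (U k))\<^sup>2"]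
    by (auto simp: not_le intro: less_le_trans)
  thus ?thesis by blast
next
  case False
  hence R0: "0 \<le> R" by simp
  obtain CK where CK: "0 \<le> CK" and KB: "\<And>V Y t. 1 \<le> t \<Longrightarrow> l2_bounded Y (\<lambda>l. of_real (bracket l powr (- p)) * V l) \<Longrightarrow>
    l2_bounded (CK * Y * real_of_int t powr (p - 2 * real m + 1)) (\<lambda>(i, j). kmat m V t i j)"
    using kmat_bound[OF m p(1)] p(2) by auto
  define D where "D = CK * R"
  have D0: "0 \<le> D" using CK R0 by (simp add: D_def)
  define \<delta> where "\<delta> t = D * real_of_int t powr (p - 2 * real m + 1)" for t :: int
  have "1 \<le> real m" using m by simp
  hence neg: "p - 2 * real m + 1 < 0" using p by linarith
  obtain N :: nat where N: "1 \<le> N" and small: "\<And>t. 2 * int N \<le> t \<Longrightarrow> \<delta> t \<le> 1 / 8"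
  proof -
    have "((\<lambda>x. D * x powr (p - 2 * real m + 1)) \<longlongrightarrow> D * 0) at_top"
      by (intro tendsto_mult tendsto_const tendsto_neg_powr[OF neg] filterlim_ident)
    hence "\<forall>\<^sub>F x in at_top. D * x powr (p - 2 * real m + 1) < 1 / 8" by (rule order_tendstoD(2)) simp
    then obtain x0 where x0: "\<And>x. x0 \<le> x \<Longrightarrow> D * x powr (p - 2 * real m + 1) < 1 / 8"
      by (auto simp: eventually_at_top_linorder)
    define N where "N = nat (max 1 \<lceil>x0\<rceil>)"
    have "1 \<le> N" by (simp add: N_def)
    moreover have "\<delta> t \<le> 1 / 8" if "2 * int N \<le> t" for t
    proof -
      have "\<lceil>x0\<rceil> \<le> int N" unfolding N_def by linarith
      hence "\<lceil>x0\<rceil> \<le> t" using that by linarith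
      hence "x0 \<le> real_of_int t" by (simp add: ceiling_le_iff)
      thus ?thesis unfolding \<delta>_def using x0 by (auto intro: less_imp_le)
    qed
    ultimately show ?thesis by (rule that)
  qed
  define Y where "Y = 2 * R"
  define KA where "KA = C1 + 10 * D * (2 * 16 ^ m * (Y\<^sup>2 + 1))"
  define Kb where "Kb = 2 * 16 ^ m * 2 powr max 0 (p - 1 + h) * (Y\<^sup>2 + 2) + 10 * D * (2 * 16 ^ m * (Y\<^sup>2 + 1))"
  define K where "K = 3 * (4 * KA\<^sup>2 + 2 * Kb\<^sup>2 + 2 * 3 powr p * Kb)"
  have K0: "0 \<le> K" using D0 by (simp add: K_def Kb_def)
  define S where "S = (2 powr \<bar>- \<eta>\<bar> * bracket_l2 \<eta>)\<^sup>2 + (Y\<^sup>2 * dist1_l2)\<^sup>2 + (Y * bracket_l2 h * Y)\<^sup>2 + Y\<^sup>2"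
  define J0 where "J0 = {i. odd i \<and> \<bar>i\<bar> < 2 * int N}"
  \<comment> \<open>For \<open>n \<le> N\<close> the error is bounded by the sum of the sizes of all
    terms in the formula; the eigenvalue itself lies near one of the finitely many diagonal entries
    of the low block.\<close>
  define G where "G j = (\<Sum>i\<in>J0. cmod (lam0 m i) + weight m (2 * int N) i) + cmod (unperturbed m (nat j)) + Y
    + bracket (2 * (2 * j - 1)) powr p * Y" for j
  define C where "C = sqrt ((\<Sum>j\<in>{1..int N}. bracket j powr (2 * s) * (G j)\<^sup>2) + 2 powr \<bar>2 * s\<bar> * K * S)"
  have "pm_formula m U s C" if U: "U \<in> H_plus (- p)" "hs_norm (- p) U \<le> R" for U
  proof -
    have Uh: "U \<in> hs (- p)" and U_odd: "\<And>l. odd l \<Longrightarrow> U l = 0" using U(1) by (auto simp: H_plus_def)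
    have UR: "l2_bounded R (\<lambda>l. of_real (bracket l powr (- p)) * U l)"
      by (rule l2_bounded_le[OF hs_l2_bounded[OF Uh] U(2)])
    define y where "y = majorant p U"
    interpret coeff_majorant m p U y "2 * R"
      unfolding y_def by (rule coeff_majorantI[OF m p(1) _ UR]) (use p in simp)
    have Kt: "l2_bounded (\<delta> t) (\<lambda>(i, j). kmat m U t i j)" if "2 * int N \<le> t" for t
      using KB[OF _ UR, of t] that N by (simp add: \<delta>_def D_def)
    note st = pair_structure[OF N Kt small]
    have yY: "y l \<le> Y" for l using l2_bounded_pointwise[OF y_l2, of l] y_nonneg[of l] by (simp add: Y_def)
    have err: "\<exists>r a b. r\<^sup>2 = U (- 2 * (2 * int n - 1)) * U (2 * (2 * int n - 1)) \<and>
        eigval m U (2 * n - 1) = unperturbed m n + U 0 - r + a \<and> eigval m U (2 * n) = unperturbed m n + U 0 + r + b \<and>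
        (n \<le> N \<longrightarrow> cmod a \<le> G (int n) \<and> cmod b \<le> G (int n)) \<and>
        (N < n \<longrightarrow> real_of_int (2 * int n - 1) powr (2 * s) * (cmod a)\<^sup>2 \<le> K * X \<eta> h (2 * int n - 1) \<and>
           real_of_int (2 * int n - 1) powr (2 * s) * (cmod b)\<^sup>2 \<le> K * X \<eta> h (2 * int n - 1))" if n: "1 \<le> n" for n
    proof (cases "n \<le> N")
      case True
      define k where "k = 2 * int n - 1"
      define r where "r = csqrt (U (- 2 * k) * U (2 * k))"
      have r2: "r\<^sup>2 = U (- 2 * k) * U (2 * k)" by (simp add: r_def)
      have r: "cmod r \<le> bracket (2 * k) powr p * Y"
      proof -
        have v: "cmod (U (2 * k)) \<le> bracket (2 * k) powr p * Y" "cmod (U (- 2 * k)) \<le> bracket (2 * k) powr p * Y"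
          using order_trans[OF V_le[of "2 * k"] mult_left_mono[OF yY]] order_trans[OF V_minus_le[of "- 2 * k"] mult_left_mono[OF yY]]
          by auto
        have "(cmod r)\<^sup>2 = cmod (U (- 2 * k)) * cmod (U (2 * k))" unfolding norm_power[symmetric] r2 norm_mult ..
        also have "\<dots> \<le> (bracket (2 * k) powr p * Y)\<^sup>2" unfolding power2_eq_square using v R0 by (intro mult_mono) (auto simp: Y_def)
        finally show ?thesis by (rule power2_le_imp_le) (use R0 in \<open>simp add: Y_def\<close>)
      qed
      have U0: "cmod (U 0) \<le> Y" using order_trans[OF V_le[of 0] mult_left_mono[OF yY]] by (simp add: bracket_def)
      have ev: "cmod (eigval m U i) \<le> (\<Sum>i\<in>J0. cmod (lam0 m i) + weight m (2 * int N) i)" if i: "1 \<le> i" "i \<le> 2 * N" for i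
      proof -
        have W: "0 < weight m (2 * int N) j" for j by (rule weight_pos) (use N in simp)
        obtain j where j: "j \<in> J0" "cmod (lam0 m j - eigval m U i) < weight m (2 * int N) j / 4"
          using st(1)[OF _ _ i] by (auto simp: J0_def)
        have "cmod (eigval m U i) \<le> cmod (lam0 m j) + weight m (2 * int N) j"
          using j(2) norm_triangle_ineq4[of "lam0 m j" "lam0 m j - eigval m U i"] W[of j] by simp
        also have "\<dots> \<le> (\<Sum>i\<in>J0. cmod (lam0 m i) + weight m (2 * int N) i)"
          by (rule member_le_sum[OF j(1)]) (use W finite_low_block in \<open>auto simp: J0_def less_imp_le\<close>)
        finally show ?thesis .
      qed
      have rest: "cmod (eigval m U i - unperturbed m n - U 0 + x) \<le> G (int n)"
        if "1 \<le> i" "i \<le> 2 * N" "cmod x \<le> bracket (2 * k) powr p * Y" for i x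
      proof -
        have "cmod (eigval m U i - unperturbed m n - U 0 + x) \<le> cmod (eigval m U i) + cmod (unperturbed m n) + cmod (U 0) + cmod x"
          using norm_triangle_ineq[of "eigval m U i - unperturbed m n - U 0" x]
            norm_triangle_ineq4[of "eigval m U i - unperturbed m n" "U 0"] norm_triangle_ineq4[of "eigval m U i" "unperturbed m n"]
          by linarith
        also have "\<dots> \<le> G (int n)" unfolding G_def k_def[symmetric] using ev[OF that(1,2)] U0 that(3) by simp
        finally show ?thesis .
      qed
      have i: "1 \<le> 2 * n - 1" "2 * n - 1 \<le> 2 * N" "1 \<le> 2 * n" "2 * n \<le> 2 * N" using n True by auto
      show ?thesis
        by (rule exI[of _ r], rule exI[of _ "eigval m U (2 * n - 1) - unperturbed m n - U 0 + r"],
            rule exI[of _ "eigval m U (2 * n) - unperturbed m n - U 0 + - r"])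
          (use r2 rest[OF i(1,2) r] rest[OF i(3,4), of "- r"] r True in \<open>simp add: k_def\<close>)
    next
      case False
      hence nN: "N < n" by simp
      define k where "k = 2 * int n - 1"
      have k: "odd k" "1 \<le> k" using n by (auto simp: k_def)
      obtain a1 a2 b1 b2 e f where E:
        "eigval m U (2 * n - 1) = lam0 m k + U 0 + e" "eigval m U (2 * n) = lam0 m k + U 0 + f"
        "e + f = a1 + a2" "e * f = a1 * a2 - (U (2 * k) + b1) * (U (- 2 * k) + b2)"
        "cmod a1 \<le> cmod (second_order m U k k k) + 10 * \<delta> k * Q k"
        "cmod a2 \<le> cmod (second_order m U k k k) + 10 * \<delta> k * Q k"
        "cmod b1 \<le> cmod (second_order m U k k (- k)) + 10 * \<delta> k * Q k"
        "cmod b2 \<le> cmod (second_order m U k (- k) k) + 10 * \<delta> k * Q k"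
        using st(2)[OF _ _ nN k_def] by blast
      define A b where "A = cmod (second_order m U k k k) + 10 * \<delta> k * Q k" and "b = B h k + 10 * \<delta> k * Q k"
      have b12: "cmod b1 \<le> b" "cmod b2 \<le> b" using E(7,8) second_order_offdiag[OF h k] by (auto simp: b_def)
      obtain r where r: "r\<^sup>2 = U (2 * k) * U (- 2 * k)"
        "(cmod (e + r))\<^sup>2 \<le> 4 * A\<^sup>2 + 2 * (cmod (U (2 * k)) + cmod (U (- 2 * k))) * b + 2 * b\<^sup>2"
        "(cmod (f - r))\<^sup>2 \<le> 4 * A\<^sup>2 + 2 * (cmod (U (2 * k)) + cmod (U (- 2 * k))) * b + 2 * b\<^sup>2"
        by (rule root_choice[OF E(3,4) E(5,6)[folded A_def] b12])
      have main: "real_of_int k powr (2 * s) * (4 * A\<^sup>2 + 2 * (cmod (U (2 * k)) + cmod (U (- 2 * k))) * b + 2 * b\<^sup>2) \<le> K * X \<eta> h k"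
        unfolding K_def KA_def Kb_def Y_def
        by (rule pair_error_weighted[OF k(2) D0 C1 E1 E2 E3 E4 E5 E6 E7 E8 diag[OF coeff_majorant_axioms U_odd k]])
          (auto simp: A_def b_def \<delta>_def)
      have err: "real_of_int k powr (2 * s) * (cmod x)\<^sup>2 \<le> K * X \<eta> h k"
        if "(cmod x)\<^sup>2 \<le> 4 * A\<^sup>2 + 2 * (cmod (U (2 * k)) + cmod (U (- 2 * k))) * b + 2 * b\<^sup>2" for x
        by (rule order_trans[OF mult_left_mono[OF that] main]) simp
      have lam: "lam0 m k = unperturbed m n" unfolding k_def by (rule lam0_unperturbed[OF n])
      show ?thesis
        unfolding k_def[symmetric]
      proof (rule exI[of _ r], rule exI[of _ "e + r"], rule exI[of _ "f - r"], intro conjI impI)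
        show "r\<^sup>2 = U (- 2 * k) * U (2 * k)" using r(1) by (simp only: mult.commute)
        show "eigval m U (2 * n - 1) = unperturbed m n + U 0 - r + (e + r)"
          "eigval m U (2 * n) = unperturbed m n + U 0 + r + (f - r)" using E(1,2) lam by simp_all
      qed (use nN err[OF r(2)] err[OF r(3)] in auto)
    qed
    then obtain r a b where rab: "\<And>n. 1 \<le> n \<Longrightarrow> (r n)\<^sup>2 = U (- 2 * (2 * int n - 1)) * U (2 * (2 * int n - 1)) \<and>
        eigval m U (2 * n - 1) = unperturbed m n + U 0 - r n + a n \<and> eigval m U (2 * n) = unperturbed m n + U 0 + r n + b n \<and>
        (n \<le> N \<longrightarrow> cmod (a n) \<le> G (int n) \<and> cmod (b n) \<le> G (int n)) \<and>
        (N < n \<longrightarrow> real_of_int (2 * int n - 1) powr (2 * s) * (cmod (a n))\<^sup>2 \<le> K * X \<eta> h (2 * int n - 1) \<and>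
           real_of_int (2 * int n - 1) powr (2 * s) * (cmod (b n))\<^sup>2 \<le> K * X \<eta> h (2 * int n - 1))"
      by metis
    define a' b' where "a' j = (if j \<le> 0 then 0 else a (nat j))" and "b' j = (if j \<le> 0 then 0 else b (nat j))" for j :: int
    have X: "(\<Sum>k\<in>F. X \<eta> h k) \<le> S" if "finite F" "\<And>k. k \<in> F \<Longrightarrow> 1 \<le> k" for F
      using X_sum[OF that \<eta> h] by (simp add: S_def Y_def)
    have la: "l2_bounded C (\<lambda>j. of_real (bracket j powr s) * a' j)"
      unfolding C_def
    proof (rule error_sequence_l2[where x = "X \<eta> h", OF _ _ _ K0 X])
      show "cmod (a' j) \<le> G j" if "1 \<le> j" "j \<le> int N" for j using rab[of "nat j"] that by (simp add: a'_def)
      show "real_of_int (2 * j - 1) powr (2 * s) * (cmod (a' j))\<^sup>2 \<le> K * X \<eta> h (2 * j - 1)" if "int N < j" for j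
        using rab[of "nat j"] that by (simp add: a'_def)
    qed (auto simp: a'_def)
    have lb: "l2_bounded C (\<lambda>j. of_real (bracket j powr s) * b' j)"
      unfolding C_def
    proof (rule error_sequence_l2[where x = "X \<eta> h", OF _ _ _ K0 X])
      show "cmod (b' j) \<le> G j" if "1 \<le> j" "j \<le> int N" for j using rab[of "nat j"] that by (simp add: b'_def)
      show "real_of_int (2 * j - 1) powr (2 * s) * (cmod (b' j))\<^sup>2 \<le> K * X \<eta> h (2 * j - 1)" if "int N < j" for j
        using rab[of "nat j"] that by (simp add: b'_def)
    qed (auto simp: b'_def)
    show ?thesis unfolding pm_formula_def
    proof (rule exI[of _ r], rule exI[of _ a'], rule exI[of _ b'], intro conjI allI impI)
      show "a' \<in> hs s" "hs_norm s a' \<le> C" by (rule l2_bounded_hs[OF la])+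
      show "b' \<in> hs s" "hs_norm s b' \<le> C" by (rule l2_bounded_hs[OF lb])+
      fix n :: nat assume n: "1 \<le> n"
      note rn = rab[OF n]
      show "(r n)\<^sup>2 = U (- 2 * (2 * int n - 1)) * U (2 * (2 * int n - 1))" using rn by blast
      show "eigval m U (2 * n - 1) = unperturbed m n + U 0 - r n + a' (int n)" using rn n by (simp add: a'_def)
      show "eigval m U (2 * n) = unperturbed m n + U 0 + r n + b' (int n)" using rn n by (simp add: b'_def)
    qed (auto simp: a'_def b'_def)
  qed
  thus ?thesis by blast
qed

section \<open>Choice of the exponents\<close>

context coeff_majorant
begin

lemma diag_weighted:
  assumes k: "odd k" "1 \<le> k"
    and q: "q + (max 1 (2 * p) - 2 * real m) \<le> - \<eta>" "q + (2 * p - 2 * real m + 1) \<le> 0"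
  shows "real_of_int k powr q * cmod (second_order m V k k k)
    \<le> 2 * 16 ^ m * (Y\<^sup>2 + 1) * (real_of_int k powr (- \<eta>) + ffull k)"
  by (rule order_trans[OF mult_left_mono[OF second_order_diag(1)[OF k]] Q_weighted[OF k(2) q]]) simp

text \<open>The counterpart of \<open>diag_weighted\<close> for the exponent
  \<open>m / 2 - p = 1/2\<close> of the borderline case, where the first condition there would only
  allow \<open>\<eta> \<le> 1/2\<close>.\<close>

lemma diag_weighted_L2:
  assumes "m = 1" "p = 0" "\<And>l. odd l \<Longrightarrow> V l = 0" and k: "odd k" "1 \<le> k"
  shows "real_of_int k powr (1 / 2) * cmod (second_order m V k k k) \<le> 1 * (real_of_int k powr (- 1) + ffull k)"
proof -
  let ?T = "real_of_int k"
  have T: "1 \<le> ?T" using k by simp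
  have f0: "0 \<le> ffull k" using ftail_nonneg[of k] ftail_le_ffull[of k] by linarith
  have "?T powr (1 / 2) \<le> ?T powr 1" using T by (intro powr_mono) auto
  hence "?T powr (1 / 2) * cmod (second_order m V k k k) \<le> ?T * (ffull k / ?T)"
    using T by (intro mult_mono second_order_diag_L2[OF assms]) auto
  also have "\<dots> \<le> 1 * (?T powr (- 1) + ffull k)" using T by simp
  finally show ?thesis .
qed

end

text \<open>The loss \<open>\<epsilon>\<close> buys values of \<open>h\<close> and
  \<open>\<eta>\<close> above 1/2: for \<open>p = 1/2\<close> the conditions \<open>E5\<close> and
  \<open>E6\<close> of the mixed term, taken with \<open>s = m - 2 * p\<close>, would allow at most
  1/2.\<close>

theorem pm_formula_large_alpha:
  assumes m: "1 \<le> m" and p: "real m / 2 \<le> p" "p < real m" and \<epsilon>: "0 < \<epsilon>"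
  shows "\<exists>C. \<forall>U \<in> H_plus (- p). hs_norm (- p) U \<le> R \<longrightarrow> pm_formula m U (real m - 2 * p - \<epsilon>) C"
proof -
  define \<eta> where "\<eta> = min 1 (1 / 2 + \<epsilon>)"
  have \<eta>: "1 / 2 < \<eta>" "\<eta> \<le> 1" "\<eta> \<le> 1 / 2 + \<epsilon>" using \<epsilon> by (auto simp: \<eta>_def)
  have M: "1 \<le> real m" using m by simp
  have max1: "max 1 (2 * p) = 2 * p" using M p(1) by linarith
  show ?thesis
  proof (rule pm_formula_uniform[where h = "1 / 2 + \<epsilon>" and \<eta> = \<eta> and ?C1.0 = "2 * 16 ^ m * ((2 * R)\<^sup>2 + 1)"])
    fix V :: "int \<Rightarrow> complex" and y :: "int \<Rightarrow> real" and k :: int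
    assume a: "coeff_majorant m p V y (2 * R)" and k: "odd k" "1 \<le> k"
    show "real_of_int k powr (real m - 2 * p - \<epsilon>) * cmod (second_order m V k k k)
      \<le> 2 * 16 ^ m * ((2 * R)\<^sup>2 + 1) * (real_of_int k powr (- \<eta>) + coeff_majorant.ffull y k)"
      by (rule coeff_majorant.diag_weighted[OF a k]) (use max1 \<eta> p M \<epsilon> in linarith)+
  qed ((use m p M \<eta> \<epsilon> max1 in linarith) | simp)+
qed

text \<open>\<open>h\<close> exceeds 1/2 precisely because \<open>p < m / 2\<close>. The diagonal
  sum demands \<open>\<eta> \<le> 3 * m / 2 + p - 1\<close>, which leaves room above 1/2 except for
  \<open>m = 1\<close>, \<open>p = 0\<close>; that case is treated apart.\<close>

theorem pm_formula_small_alpha: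
  assumes m: "1 \<le> m" and p: "0 \<le> p" "p < real m / 2"
  shows "\<exists>C. \<forall>U \<in> H_plus (- p). hs_norm (- p) U \<le> R \<longrightarrow> pm_formula m U (real m / 2 - p) C"
proof -
  let ?h = "1 / 2 + real m / 2 - p"
  have M: "1 \<le> real m" using m by simp
  have maxh: "max 0 (p - 1 + ?h) = (real m - 1) / 2" using M by (simp add: max_def field_simps)
  show ?thesis
  proof (cases "m = 1 \<and> p = 0")
    case True
    hence mp: "m = 1" "p = 0" by auto
    show ?thesis
    proof (rule pm_formula_uniform[where h = 1 and \<eta> = 1 and ?C1.0 = 1])
      fix V :: "int \<Rightarrow> complex" and y :: "int \<Rightarrow> real" and k :: int
    assume a: "coeff_majorant m p V y (2 * R)" and V: "\<And>l. odd l \<Longrightarrow> V l = 0" and k: "odd k" "1 \<le> k"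
      have half: "real m / 2 - p = 1 / 2" using mp by simp
      show "real_of_int k powr (real m / 2 - p) * cmod (second_order m V k k k)
        \<le> 1 * (real_of_int k powr (- 1) + coeff_majorant.ffull y k)"
        unfolding half by (rule coeff_majorant.diag_weighted_L2[OF a mp V k])
    qed (simp_all add: mp)
  next
    case False
    hence mp: "2 \<le> real m \<or> 0 < p" using m p by auto
    define \<eta> where "\<eta> = min 1 (min (real m - p) (3 * real m / 2 + p - 1))"
    have \<eta>: "1 / 2 < \<eta>" unfolding \<eta>_def using mp p M by linarith
    have \<eta>': "\<eta> \<le> 1" "\<eta> \<le> real m - p" "\<eta> \<le> 3 * real m / 2 + p - 1" by (auto simp: \<eta>_def)
    show ?thesis
    proof (rule pm_formula_uniform[where h = ?h and \<eta> = \<eta> and ?C1.0 = "2 * 16 ^ m * ((2 * R)\<^sup>2 + 1)"])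
      fix V :: "int \<Rightarrow> complex" and y :: "int \<Rightarrow> real" and k :: int
    assume a: "coeff_majorant m p V y (2 * R)" and k: "odd k" "1 \<le> k"
      show "real_of_int k powr (real m / 2 - p) * cmod (second_order m V k k k)
        \<le> 2 * 16 ^ m * ((2 * R)\<^sup>2 + 1) * (real_of_int k powr (- \<eta>) + coeff_majorant.ffull y k)"
        by (rule coeff_majorant.diag_weighted[OF a k]) (use \<eta>' p M in linarith)+
    qed ((use m p M \<eta> \<eta>' maxh in linarith) | simp)+
  qed
qed

theorem theorem1p1:
  fixes m :: nat and \<alpha> R :: real and V :: "int \<Rightarrow> complex"
  assumes "m \<ge> 1" and "0 \<le> \<alpha>" and "\<alpha> \<le> 1"
    and "V \<in> H_plus (- (real m * \<alpha>))" and "R > 0"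
  shows
    "(\<alpha> = 1 \<longrightarrow>
       (\<exists>\<epsilon>>0. \<exists>C N. \<forall>W \<in> H_plus (- real m). hs_norm (- real m) (W - V) \<le> \<epsilon> \<longrightarrow>
          (\<forall>n\<ge>N. n \<ge> 1 \<longrightarrow> (\<forall>k \<in> {2 * n - 1, 2 * n}.
             cmod (eigval m W k - unperturbed m n) \<le> C * real n ^ m)))
       \<and>
       (\<forall>\<delta>>0. \<exists>N. \<forall>W \<in> H_plus (- real m).
          W - V \<in> H_plus (real m) \<and> hs_norm (real m) (W - V) \<le> R \<longrightarrow>
          (\<forall>n\<ge>N. n \<ge> 1 \<longrightarrow> (\<forall>k \<in> {2 * n - 1, 2 * n}.
             cmod (eigval m W k - unperturbed m n) \<le> \<delta> * real n ^ m))))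
     \<and>
     (1 / 2 \<le> \<alpha> \<and> \<alpha> < 1 \<longrightarrow>
       (\<forall>\<epsilon>>0. \<exists>C. \<forall>U \<in> H_plus (- (real m * \<alpha>)). hs_norm (- (real m * \<alpha>)) U \<le> R \<longrightarrow>
          pm_formula m U (real m * (1 - 2 * \<alpha>) - \<epsilon>) C))
     \<and>
     (\<alpha> < 1 / 2 \<longrightarrow>
       (\<exists>C. \<forall>U \<in> H_plus (- (real m * \<alpha>)). hs_norm (- (real m * \<alpha>)) U \<le> R \<longrightarrow>
          pm_formula m U (real m * (1 / 2 - \<alpha>)) C))"
proof (intro conjI impI allI)
  have M: "0 < real m" using assms(1) by simp
  {
    assume "\<alpha> = 1"
    hence V: "V \<in> H_plus (- real m)" using assms(4) by simp
    show "\<exists>\<epsilon>>0. \<exists>C N. \<forall>W \<in> H_plus (- real m). hs_norm (- real m) (W - V) \<le> \<epsilon> \<longrightarrow>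
          (\<forall>n\<ge>N. n \<ge> 1 \<longrightarrow> (\<forall>k \<in> {2 * n - 1, 2 * n}.
             cmod (eigval m W k - unperturbed m n) \<le> C * real n ^ m))"
      by (rule alpha_one_bounded[OF assms(1) V])
    fix \<delta> :: real assume "0 < \<delta>"
    thus "\<exists>N. \<forall>W \<in> H_plus (- real m).
          W - V \<in> H_plus (real m) \<and> hs_norm (real m) (W - V) \<le> R \<longrightarrow>
          (\<forall>n\<ge>N. n \<ge> 1 \<longrightarrow> (\<forall>k \<in> {2 * n - 1, 2 * n}.
             cmod (eigval m W k - unperturbed m n) \<le> \<delta> * real n ^ m))"
      by (rule alpha_one_small[OF assms(1) V assms(5)])
  next
    fix \<epsilon> :: real
    assume "1 / 2 \<le> \<alpha> \<and> \<alpha> < 1" and \<epsilon>: "0 < \<epsilon>"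
    hence "real m / 2 \<le> real m * \<alpha>" "real m * \<alpha> < real m" using M by auto
    from pm_formula_large_alpha[OF assms(1) this \<epsilon>]
    show "\<exists>C. \<forall>U \<in> H_plus (- (real m * \<alpha>)). hs_norm (- (real m * \<alpha>)) U \<le> R \<longrightarrow>
          pm_formula m U (real m * (1 - 2 * \<alpha>) - \<epsilon>) C"
      by (simp add: algebra_simps)
  next
    assume "\<alpha> < 1 / 2"
    hence "0 \<le> real m * \<alpha>" "real m * \<alpha> < real m / 2" using M assms(2) by auto
    from pm_formula_small_alpha[OF assms(1) this]
    show "\<exists>C. \<forall>U \<in> H_plus (- (real m * \<alpha>)). hs_norm (- (real m * \<alpha>)) U \<le> R \<longrightarrow>
          pm_formula m U (real m * (1 / 2 - \<alpha>)) C"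
      by (simp add: algebra_simps)
  }
qed

end
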